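(* Let $\mathcal I$ be a normed ideal of $\mathcal B(\mathcal H)$ endowed with a positive $\|\cdot\|_{\mathcal I}$-bounded trace $\tau_{\mathcal I}$. Let $\mathbf A_n=(A_1,\ldots,A_n)$ and $\mathbf B_n=(B_1,\ldots,B_n)$ be $n$-tuples of pairwise commuting contractions on $\mathcal H$ such that $V_j=B_j-A_j\in\mathcal I$ for $1\le j\le n$, and $[V_i,V_j]=0$ for $1\le i\ne j\le n$. Suppose $\{\mathbf A_n,\mathbf B_n\}\in\mathcal N_n$, that is, for every $t\in[0,1]$ the tuple $(A_1+tV_1,\ldots,A_n+tV_n)$ consists of pairwise commuting contractions and admits a commuting contractive normal dilation. Then, with $\Omega=\mathbb T$, there exist finite (countably additive, complex) measures $\mu_1,\ldots,\mu_n$ on $\Omega^n$ such that for every $1\le j\le n$, $$\|\mu_j\|\le\min\big\{\|\tau_{\mathcal I}\|_{\mathcal I^*}\cdot\|V_j\|_{\mathcal I},\ \tau_{\mathcal I}\big(|\mathrm{Re}(V_j)|+|\mathrm{Im}(V_j)|\big)\big\},\qquad (1)$$ $$\mu_j(\Omega^n)=\tau_{\mathcal I}(V_j),\qquad (2)$$ and $$\tau_{\mathcal I}\big(f(\mathbf B_n)-f(\mathbf A_n)\big)=\sum_{j=1}^n\int_{\Omega^n}\frac{\partial f}{\partial z_j}(z_1,\ldots,z_n)\,d\mu_j(z_1,\ldots,z_n)\qquad (3)$$ for every $f\in\mathcal A(\mathbb D^n_{1+\epsilon})$, $\epsilon>0$. Moreover, for every $1\le j\le n$ and every $g\in\mathcal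 A(\mathbb D_{1+\epsilon})$, $\epsilon>0$, $$\int_{\Omega^n}g(z_j)\,d\mu_j(z_1,\ldots,z_n)=\int_\Omega g(z)\,d\mu_{A_j,B_j}(z),\qquad (4)$$ where $\mu_{A_j,B_j}$ is the one-variable measure for the pair $(A_j,B_j)$ described in the context. If, in addition, $\mathbf A_n$ and $\mathbf B_n$ are tuples of self-adjoint contractions, then there exist real-valued finite measures $\mu_j$, $1\le j\le n$, such that (1)–(4) hold with $\Omega=[-1,1]$ for $f\in\mathcal A((-1-\epsilon,1+\epsilon)^n)$ and $g\in\mathcal A((-1-\epsilon,1+\epsilon))$, $\epsilon>0$.
   Context: $\mathcal H$ is a separable Hilbert space, $\mathcal B(\mathcal H)$ the bounded linear operators on it. A contraction is an operator of norm $\le 1$. $\mathbb T$ is the unit circle. $\mathrm{Re}(V)=(V+V^* )/2$, $\mathrm{Im}(V)=(V-V^* )/(2\mathrm i)$; $\|\mu\|$ is the total variation of a measure $\mu$. Function spaces. $\mathbb D^n_{1+\epsilon}=\{(z_1,\ldots,z_n)\in\mathbb C^n:|z_j|<1+\epsilon,\ 1\le j\le n\}$, and $\mathcal A(\mathbb D^n_{1+\epsilon})$ is the space of functions holomorphic on $\mathbb D^n_{1+\epsilon}$, given by an absolutely convergent series $f(z_1,\ldots,z_n)=\sum_{k_1,\ldots,k_n\ge0}c_{k_1,\ldots,k_n}z_1^{k_1}\cdots z_n^{k_n}$. $\mathcal A((-1-\epsilon,1+\epsilon)^n)$ is the space of functions on $(-1-\epsilon,1+\epsilon)^n$ representable there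 by such a Taylor series. For a tuple of contractions, $f(A_1,\ldots,A_n)=\sum c_{k_1,\ldots,k_n}A_1^{k_1}\cdots A_n^{k_n}$. Dilation. A tuple $\mathbf X_n=(X_1,\ldots,X_n)$ of commuting contractions on $\mathcal H$ admits a commuting contractive normal dilation if there are a Hilbert space $\mathcal K\supset\mathcal H$ and a tuple $(U_1,\ldots,U_n)$ of commuting normal contractions on $\mathcal K$ such that $X_{j_1}\cdots X_{j_l}=P_{\mathcal H}U_{j_1}\cdots U_{j_l}|_{\mathcal H}$ for all $l\in\mathbb N$ and $1\le j_1,\ldots,j_l\le n$, where $P_{\mathcal H}$ is the orthogonal projection of $\mathcal K$ onto $\mathcal H$. Normed ideal. An ideal $\mathcal I$ of $\mathcal B(\mathcal H)$ is a normed ideal if it is equipped with an ideal norm $\|\cdot\|_{\mathcal I}$, i.e. a norm such that (i) $A\in\mathcal B(\mathcal H)$, $B\in\mathcal I$, $0\le A\le B$ implies $\|A\|_{\mathcal I}\le\|B\|_{\mathcal I}$; (ii) there is $K>0$ with $\|B\|\le K\|B\|_{\mathcal I}$ for all $B\in\mathcal I$; (iii) $\|ABC\|_{\mathcal I}\le\|A\|\|B\|_{\mathcal I}\|C\|$ for $A,C\in\mathcal B(\mathcal H)$, $B\in\mathcal I$. A trace $\tau_{\mathcal I}$ on $\mathcal I$ is $\|\cdot\|_{\mathcal I}$-bounded if there is $M>0$ with $|\tau_{\mathcal I}(A)|\le M\|A\|_{\mathcal I}$ for all $A\in\mathcal I$; the infimum of such $M$ is $\|\tau_{\mathcal I}\|_{\mathcal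 I^*}$. One-variable measure. For contractions $H_0$, $H$ with $V=H-H_0\in\mathcal I$, it is known that there is a finite complex measure $\mu_{H_0,H}$ on $\mathbb T$ with $\|\mu_{H_0,H}\|\le\min\{\|\tau_{\mathcal I}\|_{\mathcal I^*}\|V\|_{\mathcal I},\ \tau_{\mathcal I}(|\mathrm{Re}(V)|)+\tau_{\mathcal I}(|\mathrm{Im}(V)|)\}$ and $\tau_{\mathcal I}(h(H)-h(H_0))=\int_{\mathbb T}h'(\lambda)\,d\mu_{H_0,H}(\lambda)$ for every $h$ analytic on a disc of radius $1+\epsilon$, $\epsilon>0$, centered at $0$. If $H_0$ and $V$ are self-adjoint, $\mu_{H_0,H}$ denotes instead, in the case $\Omega=[-1,1]$, the unique real-valued measure on $\mathrm{conv}(\sigma(H_0)\cup\sigma(H))\subset[-1,1]$ (extended by zero to $[-1,1]$) satisfying the same trace formula, with integral over this set, for $h$ real-analytic on it.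
   Formalization: If the ideal is not complete, f(B)-f(A) may lie outside it and (3) is undefined; there (3) is asserted only for f whose expansion of f(B)-f(A) converges in the ideal norm. One Hilbert space K serves all t, no loss: each dilation can be cut to a separable one and extended by zero. *)

theory Defs
  imports "HOL-Analysis.Analysis" "HOL-Computational_Algebra.Polynomial"
begin

section \<open>Complex Hilbert spaces and bounded operators\<close>

class complex_vector = real_vector +
  fixes scaleC :: "complex \<Rightarrow> 'a \<Rightarrow> 'a" (infixr "*\<^sub>C" 75)
  assumes scaleC_add_right: "c *\<^sub>C (x + y) = c *\<^sub>C x + c *\<^sub>C y"
    and scaleC_add_left: "(c + d) *\<^sub>C x = c *\<^sub>C x + d *\<^sub>C x"
    and scaleC_scaleC: "c *\<^sub>C d *\<^sub>C x = (c * d) *\<^sub>C x"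
    and scaleC_of_real: "of_real r *\<^sub>C x = r *\<^sub>R x"

text \<open>The inner product is linear in the first argument.  The law \<open>cinner_self\<close> makes it positive
  definite and says that the norm is the one it induces.\<close>

class hilbert_space = complex_vector + banach +
  fixes cinner :: "'a \<Rightarrow> 'a \<Rightarrow> complex"
  assumes cinner_commute: "cinner x y = cnj (cinner y x)"
    and cinner_add_left: "cinner (x + y) z = cinner x z + cinner y z"
    and cinner_scaleC_left: "cinner (c *\<^sub>C x) y = c * cinner x y"
    and cinner_self: "cinner x x = of_real ((norm x)\<^sup>2)"

lemma norm_scaleC: "norm (c *\<^sub>C (x :: 'a::hilbert_space)) = cmod c * norm x"
proof -
  have "cinner (c *\<^sub>C x) (c *\<^sub>C x) = c * cnj c * cinner x x"
    by (metis cinner_commute cinner_scaleC_left complex_cnj_mult mult.assoc)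
  then have "complex_of_real ((norm (c *\<^sub>C x))\<^sup>2) = of_real ((cmod c * norm x)\<^sup>2)"
    unfolding cinner_self by (simp add: complex_norm_square[symmetric] power_mult_distrib)
  then have "(norm (c *\<^sub>C x))\<^sup>2 = (cmod c * norm x)\<^sup>2"
    using of_real_eq_iff by blast
  then show ?thesis
    by (rule power2_eq_imp_eq) auto
qed

lemma bounded_linear_scaleC: "bounded_linear (\<lambda>x :: 'a::hilbert_space. c *\<^sub>C x)"
proof
  fix x y :: 'a and r :: real
  show "c *\<^sub>C (x + y) = c *\<^sub>C x + c *\<^sub>C y" by (rule scaleC_add_right)
  show "c *\<^sub>C r *\<^sub>R x = r *\<^sub>R c *\<^sub>C x"
    by (simp flip: scaleC_of_real add: scaleC_scaleC mult.commute)
  show "\<exists>K. \<forall>x :: 'a. norm (c *\<^sub>C x) \<le> norm x * K"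
    by (auto simp: norm_scaleC intro!: exI[of _ "cmod c"])
qed

text \<open>\<open>'a bop\<close> is the algebra of bounded complex-linear operators on \<open>'a\<close>.  It is not an instance of
  \<open>ring_1\<close>, since the zero Hilbert space is admitted.\<close>

typedef (overloaded) 'a bop =
  "{f :: 'a::hilbert_space \<Rightarrow> 'a. bounded_linear f \<and> (\<forall>c x. f (c *\<^sub>C x) = c *\<^sub>C f x)}"
  morphisms app Abs_bop
proof -
  have "c *\<^sub>C (0::'a) = 0" for c
    using norm_scaleC[of c "0::'a"] by simp
  then show ?thesis by (intro exI[of _ "\<lambda>x. 0"]) simp
qed

setup_lifting type_definition_bop

lemma bop_eqI: "(\<And>x. app A x = app B x) \<Longrightarrow> A = B"
  by transfer auto

instantiation bop :: (hilbert_space) "{real_normed_algebra, monoid_mult, complex_vector}"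
begin

lift_definition norm_bop :: "'a bop \<Rightarrow> real" is onorm .

lift_definition zero_bop :: "'a bop" is "\<lambda>x. 0"
  using norm_scaleC[of _ "0::'a"] by simp

lift_definition one_bop :: "'a bop" is "\<lambda>x. x"
  by (simp add: bounded_linear_ident)

lift_definition plus_bop :: "'a bop \<Rightarrow> 'a bop \<Rightarrow> 'a bop" is "\<lambda>f g x. f x + g x"
  by (simp add: bounded_linear_add scaleC_add_right)

lift_definition scaleC_bop :: "complex \<Rightarrow> 'a bop \<Rightarrow> 'a bop" is "\<lambda>c f x. c *\<^sub>C f x"
  by (auto intro: bounded_linear_compose[OF bounded_linear_scaleC]
      simp: scaleC_scaleC mult.commute)

lift_definition scaleR_bop :: "real \<Rightarrow> 'a bop \<Rightarrow> 'a bop" is "\<lambda>r f x. r *\<^sub>R f x"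
proof safe
  fix r and f :: "'a \<Rightarrow> 'a" and c x
  assume f: "bounded_linear f" "\<forall>c x. f (c *\<^sub>C x) = c *\<^sub>C f x"
  show "bounded_linear (\<lambda>x. r *\<^sub>R f x)"
    using f by (intro bounded_linear_compose[OF bounded_linear_scaleR_right])
  show "r *\<^sub>R f (c *\<^sub>C x) = c *\<^sub>C r *\<^sub>R f x"
    using f by (simp add: scaleC_scaleC mult.commute flip: scaleC_of_real)
qed

lift_definition uminus_bop :: "'a bop \<Rightarrow> 'a bop" is "\<lambda>f x. - f x"
proof safe
  fix f :: "'a \<Rightarrow> 'a" and c x
  assume f: "bounded_linear f" "\<forall>c x. f (c *\<^sub>C x) = c *\<^sub>C f x"
  show "bounded_linear (\<lambda>x. - f x)" using f by (intro bounded_linear_minus)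
  show "- f (c *\<^sub>C x) = c *\<^sub>C - f x" 
    using f by (simp add: linear_neg[OF bounded_linear.linear[OF bounded_linear_scaleC]])
qed

lift_definition minus_bop :: "'a bop \<Rightarrow> 'a bop \<Rightarrow> 'a bop" is "\<lambda>f g x. f x - g x"
proof safe
  fix f g :: "'a \<Rightarrow> 'a" and c x
  assume f: "bounded_linear f" "\<forall>c x. f (c *\<^sub>C x) = c *\<^sub>C f x"
    and g: "bounded_linear g" "\<forall>c x. g (c *\<^sub>C x) = c *\<^sub>C g x"
  show "bounded_linear (\<lambda>x. f x - g x)" using f g by (intro bounded_linear_sub)
  show "f (c *\<^sub>C x) - g (c *\<^sub>C x) = c *\<^sub>C (f x - g x)" 
    using f g by (simp add: linear_diff[OF bounded_linear.linear[OF bounded_linear_scaleC]])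
qed

lift_definition times_bop :: "'a bop \<Rightarrow> 'a bop \<Rightarrow> 'a bop" is "\<lambda>f g x. f (g x)"
  by (simp add: bounded_linear_compose)

definition dist_bop :: "'a bop \<Rightarrow> 'a bop \<Rightarrow> real"
  where "dist_bop a b = norm (a - b)"

definition [code del]:
  "(uniformity :: ('a bop \<times> 'a bop) filter) = (INF e\<in>{0 <..}. principal {(x, y). dist x y < e})"

definition open_bop :: "'a bop set \<Rightarrow> bool"
  where [code del]: "open_bop S = (\<forall>x\<in>S. \<forall>\<^sub>F (x', y) in uniformity. x' = x \<longrightarrow> y \<in> S)"

definition sgn_bop :: "'a bop \<Rightarrow> 'a bop"
  where "sgn_bop x = scaleR (inverse (norm x)) x"

instance
proof
  fix a b c :: "'a bop" and r s :: real and z w :: complex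
  show "a + b + c = a + (b + c)" "a + b = b + a" "0 + a = a" "- a + a = 0" "a - b = a + - b"
    by (transfer, auto simp: fun_eq_iff algebra_simps)+
  show "r *\<^sub>R (a + b) = r *\<^sub>R a + r *\<^sub>R b" "(r + s) *\<^sub>R a = r *\<^sub>R a + s *\<^sub>R a"
    "r *\<^sub>R s *\<^sub>R a = (r * s) *\<^sub>R a" "1 *\<^sub>R a = a"
    by (transfer, auto simp: fun_eq_iff algebra_simps)+
  show "z *\<^sub>C (a + b) = z *\<^sub>C a + z *\<^sub>C b" "(z + w) *\<^sub>C a = z *\<^sub>C a + w *\<^sub>C a"
    "z *\<^sub>C w *\<^sub>C a = (z * w) *\<^sub>C a" "of_real r *\<^sub>C a = r *\<^sub>R a"
    by (transfer, auto simp: fun_eq_iff scaleC_add_right scaleC_add_left scaleC_scaleC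
        scaleC_of_real)+
  show "a * b * c = a * (b * c)" "1 * a = a" "a * 1 = a" "(a + b) * c = a * c + b * c"
    by (transfer, auto simp: fun_eq_iff)+
  show "a * (b + c) = a * b + a * c"
    by transfer (auto simp: fun_eq_iff linear_add bounded_linear.linear)
  show "r *\<^sub>R a * b = r *\<^sub>R (a * b)"
    by transfer (auto simp: fun_eq_iff)
  show "a * r *\<^sub>R b = r *\<^sub>R (a * b)"
    by transfer (auto simp: fun_eq_iff linear_scale bounded_linear.linear)
  show "dist a b = norm (a - b)" "sgn a = inverse (norm a) *\<^sub>R a"
    by (simp_all add: dist_bop_def sgn_bop_def)
  show "(uniformity :: ('a bop \<times> 'a bop) filter) = (INF e\<in>{0 <..}. principal {(x, y). dist x y < e})"
    by (rule uniformity_bop_def)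
  show "open S = (\<forall>x\<in>S. \<forall>\<^sub>F (x', y) in uniformity. x' = x \<longrightarrow> y \<in> S)" for S :: "'a bop set"
    by (rule open_bop_def)
  show "norm a = 0 \<longleftrightarrow> a = 0"
    by transfer (auto simp: onorm_eq_0)
  show "norm (a + b) \<le> norm a + norm b"
    by transfer (auto intro: onorm_triangle)
  show "norm (r *\<^sub>R a) = \<bar>r\<bar> * norm a"
    by transfer (auto simp: onorm_scaleR)
  show "norm (a * b) \<le> norm a * norm b"
    by transfer (use onorm_compose in \<open>auto simp: o_def\<close>)
qed

end

instance bop :: (hilbert_space) banach
proof
  fix X :: "nat \<Rightarrow> 'a bop"
  assume "Cauchy X"
  define Y where "Y n = Blinfun (app (X n))" for n
  have bl: "bounded_linear (app T)" for T :: "'a bop"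
    using app[of T] by simp
  have Y: "blinfun_apply (Y n) = app (X n)" for n
    by (simp add: Y_def bounded_linear_Blinfun_apply bl)
  have norm_Y: "norm (Y m - Y n) = norm (X m - X n)" for m n
    by (simp add: norm_blinfun.rep_eq norm_bop.rep_eq minus_blinfun.rep_eq minus_bop.rep_eq Y)
  have "Cauchy Y"
    using \<open>Cauchy X\<close> by (simp add: Cauchy_def dist_norm norm_Y)
  then obtain L where L: "Y \<longlonglongrightarrow> L"
    by (auto simp: Cauchy_convergent_iff convergent_def)
  have lim: "(\<lambda>n. app (X n) x) \<longlonglongrightarrow> blinfun_apply L x" for x
    using blinfun.tendsto[OF L tendsto_const[of x]] by (simp add: Y)
  have "blinfun_apply L (c *\<^sub>C x) = c *\<^sub>C blinfun_apply L x" for c x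
  proof (rule LIMSEQ_unique[OF lim])
    have "app (X n) (c *\<^sub>C x) = c *\<^sub>C app (X n) x" for n
      using app[of "X n"] by simp
    then show "(\<lambda>n. app (X n) (c *\<^sub>C x)) \<longlonglongrightarrow> c *\<^sub>C blinfun_apply L x"
      using bounded_linear.tendsto[OF bounded_linear_scaleC lim] by simp
  qed
  then have T: "app (Abs_bop (blinfun_apply L)) = blinfun_apply L"
    by (intro Abs_bop_inverse) (simp add: blinfun.bounded_linear_right)
  have "norm (X n - Abs_bop (blinfun_apply L)) = norm (Y n - L)" for n
    by (simp add: norm_blinfun.rep_eq norm_bop.rep_eq minus_blinfun.rep_eq minus_bop.rep_eq Y T)
  then have "X \<longlonglongrightarrow> Abs_bop (blinfun_apply L)"
    using L by (simp add: LIMSEQ_iff)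
  then show "convergent X"
    by (auto simp: convergent_def)
qed

text \<open>The adjoint; by the Riesz theorem exactly one operator satisfies the condition.\<close>

definition adj :: "'a::hilbert_space bop \<Rightarrow> 'a bop" where
  "adj A = (THE B. \<forall>x y. cinner (app A x) y = cinner x (app B y))"

definition self_adjoint :: "'a::hilbert_space bop \<Rightarrow> bool" where
  "self_adjoint A \<longleftrightarrow> adj A = A"

definition normal_op :: "'a::hilbert_space bop \<Rightarrow> bool" where
  "normal_op A \<longleftrightarrow> adj A * A = A * adj A"

definition contraction :: "'a::hilbert_space bop \<Rightarrow> bool" where
  "contraction A \<longleftrightarrow> norm A \<le> 1"

definition positive_op :: "'a::hilbert_space bop \<Rightarrow> bool" where
  "positive_op A \<longleftrightarrow> (\<forall>x. cinner (app A x) x \<in> \<real>\<^sub>\<ge>\<^sub>0)"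

text \<open>The modulus is the unique positive square root of \<open>adj A * A\<close>.\<close>

definition abs_op :: "'a::hilbert_space bop \<Rightarrow> 'a bop" where
  "abs_op A = (THE P. positive_op P \<and> P * P = adj A * A)"

definition Re_op :: "'a::hilbert_space bop \<Rightarrow> 'a bop" where
  "Re_op A = (1 / 2) *\<^sub>C (A + adj A)"

definition Im_op :: "'a::hilbert_space bop \<Rightarrow> 'a bop" where
  "Im_op A = (1 / (2 * \<i>)) *\<^sub>C (A - adj A)"

definition spectrum_op :: "'a::hilbert_space bop \<Rightarrow> complex set" where
  "spectrum_op A = {z. \<not> (\<exists>B. (A - z *\<^sub>C 1) * B = 1 \<and> B * (A - z *\<^sub>C 1) = 1)}"

definition commuting :: "('n \<Rightarrow> 'a::hilbert_space bop) \<Rightarrow> bool" where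
  "commuting X \<longleftrightarrow> (\<forall>i j. X i * X j = X j * X i)"


section \<open>Normal dilations\<close>

definition isometric_embedding :: "('a::hilbert_space \<Rightarrow> 'b::hilbert_space) \<Rightarrow> bool" where
  "isometric_embedding J \<longleftrightarrow>
     (\<forall>x y. J (x + y) = J x + J y) \<and> (\<forall>c x. J (c *\<^sub>C x) = c *\<^sub>C J x) \<and> (\<forall>x. norm (J x) = norm x)"

definition orth_proj :: "'a::hilbert_space set \<Rightarrow> 'a \<Rightarrow> 'a" where
  "orth_proj S v = (THE p. p \<in> S \<and> (\<forall>s\<in>S. cinner (v - p) s = 0))"

text \<open>The larger Hilbert space is (a closed subspace of) the type \<open>'b\<close>, into which the given space is
  embedded by \<open>J\<close>.  Nothing is lost by taking the whole type: operators on a closed subspace are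
  extended by zero to its orthogonal complement.  In particular, one sufficiently large type
  accommodates any family of dilation spaces.\<close>

definition admits_normal_dilation ::
    "'b::hilbert_space itself \<Rightarrow> ('n \<Rightarrow> 'a::hilbert_space bop) \<Rightarrow> bool" where
  "admits_normal_dilation _ X \<longleftrightarrow>
     (\<exists>(J :: 'a \<Rightarrow> 'b) (U :: 'n \<Rightarrow> 'b bop).
        isometric_embedding J \<and> commuting U \<and> (\<forall>i. normal_op (U i) \<and> contraction (U i)) \<and>
        (\<forall>js x. J (app (prod_list (map X js)) x) =
                orth_proj (range J) (app (prod_list (map U js)) (J x))))"

definition dilatable_segment ::
    "'b::hilbert_space itself \<Rightarrow> ('n \<Rightarrow> 'a::hilbert_space bop) \<Rightarrow> ('n \<Rightarrow> 'a bop) \<Rightarrow> bool" where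
  "dilatable_segment K A B \<longleftrightarrow>
     (\<forall>t\<in>{0..1}. let X = (\<lambda>j. A j + t *\<^sub>R (B j - A j)) in
        commuting X \<and> (\<forall>j. contraction (X j)) \<and> admits_normal_dilation K X)"


section \<open>Normed ideals and traces\<close>

definition op_ideal :: "'a::hilbert_space bop set \<Rightarrow> bool" where
  "op_ideal I \<longleftrightarrow> 0 \<in> I \<and> (\<forall>X\<in>I. \<forall>Y\<in>I. X + Y \<in> I) \<and> (\<forall>X\<in>I. \<forall>A. A * X \<in> I \<and> X * A \<in> I)"

text \<open>Membership \<open>A \<in> I\<close> in the monotonicity axiom is automatic for an ideal of bounded operators;
  it is displayed because the norm is only meaningful on \<open>I\<close>.\<close>

definition normed_ideal :: "'a::hilbert_space bop set \<Rightarrow> ('a bop \<Rightarrow> real) \<Rightarrow> bool" where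
  "normed_ideal I nrm \<longleftrightarrow> op_ideal I \<and>
     (\<forall>X\<in>I. 0 \<le> nrm X \<and> (nrm X = 0 \<longleftrightarrow> X = 0)) \<and>
     (\<forall>X\<in>I. \<forall>c. nrm (c *\<^sub>C X) = cmod c * nrm X) \<and>
     (\<forall>X\<in>I. \<forall>Y\<in>I. nrm (X + Y) \<le> nrm X + nrm Y) \<and>
     (\<forall>A. \<forall>B\<in>I. positive_op A \<and> positive_op (B - A) \<longrightarrow> A \<in> I \<and> nrm A \<le> nrm B) \<and>
     (\<exists>K>0. \<forall>B\<in>I. norm B \<le> K * nrm B) \<and>
     (\<forall>A C. \<forall>B\<in>I. nrm (A * B * C) \<le> norm A * nrm B * norm C)"

definition trace_on :: "'a::hilbert_space bop set \<Rightarrow> ('a bop \<Rightarrow> complex) \<Rightarrow> bool" where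
  "trace_on I \<tau> \<longleftrightarrow>
     (\<forall>X\<in>I. \<forall>Y\<in>I. \<tau> (X + Y) = \<tau> X + \<tau> Y) \<and> (\<forall>X\<in>I. \<forall>c. \<tau> (c *\<^sub>C X) = c * \<tau> X) \<and>
     (\<forall>X\<in>I. \<forall>A. \<tau> (A * X) = \<tau> (X * A))"

definition positive_on :: "'a::hilbert_space bop set \<Rightarrow> ('a bop \<Rightarrow> complex) \<Rightarrow> bool" where
  "positive_on I \<tau> \<longleftrightarrow> (\<forall>X\<in>I. positive_op X \<longrightarrow> \<tau> X \<in> \<real>\<^sub>\<ge>\<^sub>0)"

definition bounded_by ::
    "'a::hilbert_space bop set \<Rightarrow> ('a bop \<Rightarrow> real) \<Rightarrow> ('a bop \<Rightarrow> complex) \<Rightarrow> real \<Rightarrow> bool" where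
  "bounded_by I nrm \<tau> M \<longleftrightarrow> M > 0 \<and> (\<forall>X\<in>I. cmod (\<tau> X) \<le> M * nrm X)"

definition dual_norm ::
    "'a::hilbert_space bop set \<Rightarrow> ('a bop \<Rightarrow> real) \<Rightarrow> ('a bop \<Rightarrow> complex) \<Rightarrow> real" where
  "dual_norm I nrm \<tau> = Inf {M. bounded_by I nrm \<tau> M}"

definition complete_ideal :: "'a::hilbert_space bop set \<Rightarrow> ('a bop \<Rightarrow> real) \<Rightarrow> bool" where
  "complete_ideal I nrm \<longleftrightarrow>
     (\<forall>X :: nat \<Rightarrow> 'a bop.
        (\<forall>m. X m \<in> I) \<and> (\<forall>e>0. \<exists>N. \<forall>p\<ge>N. \<forall>q\<ge>N. nrm (X p - X q) < e) \<longrightarrow>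
        (\<exists>T\<in>I. (\<lambda>m. nrm (X m - T)) \<longlonglongrightarrow> 0))"

text \<open>A trace lives on \<open>I\<close> only.  A difference \<open>f(B) - f(A)\<close> is a norm limit of polynomial expressions
  lying in \<open>I\<close>; it belongs to \<open>I\<close> whenever the ideal is complete (no condition is then imposed), but
  not in general: with the finite-rank operators under the trace norm, \<open>exp B - exp A\<close> usually has
  infinite rank, so its trace is undefined.  For an incomplete ideal we therefore ask that the terms
  \<open>D k\<close> of the Taylor expansion of the difference sum up in the norm of \<open>I\<close>, as they do for every
  polynomial.\<close>

definition trace_applicable ::
    "'a::hilbert_space bop set \<Rightarrow> ('a bop \<Rightarrow> real) \<Rightarrow> ('k \<Rightarrow> 'a bop) \<Rightarrow> bool" where
  "trace_applicable I nrm D \<longleftrightarrow> complete_ideal I nrm \<or>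
     (\<exists>T\<in>I. ((\<lambda>F. nrm (T - (\<Sum>k\<in>F. D k))) \<longlongrightarrow> 0) (finite_subsets_at_top UNIV))"


section \<open>Complex measures\<close>

text \<open>A finite complex measure on the \<open>\<sigma>\<close>-algebra of \<open>M\<close> is a countably additive set function; the
  measure carried by \<open>M\<close> itself and the values of \<open>\<mu>\<close> off \<open>sets M\<close> are irrelevant.\<close>

definition complex_measure :: "'a measure \<Rightarrow> ('a set \<Rightarrow> complex) \<Rightarrow> bool" where
  "complex_measure M \<mu> \<longleftrightarrow> \<mu> {} = 0 \<and>
     (\<forall>E :: nat \<Rightarrow> 'a set. range E \<subseteq> sets M \<and> disjoint_family E \<longrightarrow>
        (\<lambda>i. \<mu> (E i)) sums \<mu> (\<Union>i. E i))"

definition real_valued_on :: "'a measure \<Rightarrow> ('a set \<Rightarrow> complex) \<Rightarrow> bool" where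
  "real_valued_on M \<mu> \<longleftrightarrow> (\<forall>E\<in>sets M. \<mu> E \<in> \<real>)"

definition total_variation :: "'a measure \<Rightarrow> ('a set \<Rightarrow> complex) \<Rightarrow> ennreal" where
  "total_variation M \<mu> =
     (SUP P\<in>{P. finite P \<and> P \<subseteq> sets M \<and> partition_on (space M) P}. \<Sum>E\<in>P. ennreal (cmod (\<mu> E)))"

text \<open>The positive part of a signed measure in its Jordan decomposition
  (\<open>ennreal\<close> truncates negative numbers to 0).\<close>

definition positive_part :: "'a measure \<Rightarrow> ('a set \<Rightarrow> real) \<Rightarrow> 'a measure" where
  "positive_part M \<nu> =
     measure_of (space M) (sets M) (\<lambda>E. SUP F\<in>{F \<in> sets M. F \<subseteq> E}. ennreal (\<nu> F))"

definition cm_integral :: "'a measure \<Rightarrow> ('a set \<Rightarrow> complex) \<Rightarrow> ('a \<Rightarrow> complex) \<Rightarrow> complex" where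
  "cm_integral M \<mu> f =
     (\<integral>x. f x \<partial>positive_part M (\<lambda>E. Re (\<mu> E))) - (\<integral>x. f x \<partial>positive_part M (\<lambda>E. - Re (\<mu> E)))
     + \<i> * ((\<integral>x. f x \<partial>positive_part M (\<lambda>E. Im (\<mu> E))) - (\<integral>x. f x \<partial>positive_part M (\<lambda>E. - Im (\<mu> E))))"

definition borel_on :: "'a::topological_space set \<Rightarrow> 'a measure" where
  "borel_on S = restrict_space borel S"

definition vec_power :: "'a set \<Rightarrow> ('a ^ 'n) set" where
  "vec_power S = {z. \<forall>i. z $ i \<in> S}"


section \<open>Power series and functional calculus\<close>

text \<open>\<open>f\<close> is the sum of the absolutely convergent Taylor series with coefficients \<open>c\<close> on the open
  polydisc (resp. real cube, disc, interval) of radius \<open>r\<close>.\<close>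

definition taylor_polydisc ::
    "real \<Rightarrow> (('n \<Rightarrow> nat) \<Rightarrow> complex) \<Rightarrow> (complex ^ 'n::finite \<Rightarrow> complex) \<Rightarrow> bool" where
  "taylor_polydisc r c f \<longleftrightarrow>
     (\<forall>z. (\<forall>i. cmod (z $ i) < r) \<longrightarrow>
        (\<lambda>k. norm (c k * (\<Prod>i\<in>UNIV. z $ i ^ k i))) summable_on UNIV \<and>
        f z = (\<Sum>\<^sub>\<infinity>k. c k * (\<Prod>i\<in>UNIV. z $ i ^ k i)))"

definition taylor_cube ::
    "real \<Rightarrow> (('n \<Rightarrow> nat) \<Rightarrow> complex) \<Rightarrow> (real ^ 'n::finite \<Rightarrow> complex) \<Rightarrow> bool" where
  "taylor_cube r c f \<longleftrightarrow>
     (\<forall>x. (\<forall>i. \<bar>x $ i\<bar> < r) \<longrightarrow>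
        (\<lambda>k. norm (c k * of_real (\<Prod>i\<in>UNIV. x $ i ^ k i))) summable_on UNIV \<and>
        f x = (\<Sum>\<^sub>\<infinity>k. c k * of_real (\<Prod>i\<in>UNIV. x $ i ^ k i)))"

definition taylor_disc :: "real \<Rightarrow> (nat \<Rightarrow> complex) \<Rightarrow> (complex \<Rightarrow> complex) \<Rightarrow> bool" where
  "taylor_disc r a h \<longleftrightarrow>
     (\<forall>z. cmod z < r \<longrightarrow>
        (\<lambda>k. norm (a k * z ^ k)) summable_on UNIV \<and> h z = (\<Sum>\<^sub>\<infinity>k. a k * z ^ k))"

definition taylor_interval :: "real \<Rightarrow> (nat \<Rightarrow> complex) \<Rightarrow> (real \<Rightarrow> complex) \<Rightarrow> bool" where
  "taylor_interval r a h \<longleftrightarrow>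
     (\<forall>x. \<bar>x\<bar> < r \<longrightarrow>
        (\<lambda>k. norm (a k * of_real (x ^ k))) summable_on UNIV \<and> h x = (\<Sum>\<^sub>\<infinity>k. a k * of_real (x ^ k)))"

definition vec_upd :: "'a ^ 'n \<Rightarrow> 'n \<Rightarrow> 'a \<Rightarrow> 'a ^ 'n" where
  "vec_upd z j w = (\<chi> i. if i = j then w else z $ i)"

definition cpartial :: "'n \<Rightarrow> (complex ^ 'n \<Rightarrow> complex) \<Rightarrow> complex ^ 'n \<Rightarrow> complex" where
  "cpartial j f z = deriv (\<lambda>w. f (vec_upd z j w)) (z $ j)"

definition rpartial :: "'n \<Rightarrow> (real ^ 'n \<Rightarrow> complex) \<Rightarrow> real ^ 'n \<Rightarrow> complex" where
  "rpartial j f x = vector_derivative (\<lambda>t. f (vec_upd x j t)) (at (x $ j))"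

text \<open>The ordered product of the powers \<open>A i ^ k i\<close>.  The linear order on the index type replaces the
  numbering of the variables.\<close>

definition op_monomial ::
    "('n::{finite,linorder} \<Rightarrow> 'a::hilbert_space bop) \<Rightarrow> ('n \<Rightarrow> nat) \<Rightarrow> 'a bop" where
  "op_monomial A k = prod_list (map (\<lambda>i. A i ^ k i) (sorted_list_of_set UNIV))"

definition op_series :: "('k \<Rightarrow> complex) \<Rightarrow> ('k \<Rightarrow> 'a::hilbert_space bop) \<Rightarrow> 'a bop" where
  "op_series c W = (\<Sum>\<^sub>\<infinity>k. c k *\<^sub>C W k)"

definition op_poly :: "complex poly \<Rightarrow> 'a::hilbert_space bop \<Rightarrow> 'a bop" where
  "op_poly p H = (\<Sum>k\<le>degree p. coeff p k *\<^sub>C H ^ k)"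

text \<open>The continuous functional calculus of a self-adjoint \<open>H\<close> whose spectrum is contained in the
  compact set \<open>S\<close>, for \<open>h\<close> continuous on \<open>S\<close>: the common limit of \<open>p\<^sub>m(H)\<close> over all sequences of
  polynomials converging to \<open>h\<close> uniformly on \<open>S\<close>.\<close>

definition fun_calculus :: "real set \<Rightarrow> (real \<Rightarrow> complex) \<Rightarrow> 'a::hilbert_space bop \<Rightarrow> 'a bop" where
  "fun_calculus S h H =
     (THE T. \<forall>p. uniform_limit S (\<lambda>m x. poly (p m) (of_real x)) h sequentially \<longrightarrow>
                 (\<lambda>m. op_poly (p m) H) \<longlonglongrightarrow> T)"

definition real_analytic_on :: "(real \<Rightarrow> complex) \<Rightarrow> real set \<Rightarrow> bool" where
  "real_analytic_on h S \<longleftrightarrow>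
     (\<forall>x0\<in>S. \<exists>r>0. \<exists>a. \<forall>x. \<bar>x - x0\<bar> < r \<longrightarrow> (\<lambda>k. a k * of_real ((x - x0) ^ k)) sums h x)"


section \<open>One-variable spectral shift measures\<close>

definition one_var_measure_circle ::
    "'a::hilbert_space bop set \<Rightarrow> ('a bop \<Rightarrow> real) \<Rightarrow> ('a bop \<Rightarrow> complex) \<Rightarrow> 'a bop \<Rightarrow> 'a bop \<Rightarrow>
     (complex set \<Rightarrow> complex) \<Rightarrow> bool" where
  "one_var_measure_circle I nrm \<tau> H0 H \<nu> \<longleftrightarrow>
     complex_measure (borel_on (sphere 0 1)) \<nu> \<and>
     total_variation (borel_on (sphere 0 1)) \<nu> \<le>
       ennreal (min (dual_norm I nrm \<tau> * nrm (H - H0))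
                    (Re (\<tau> (abs_op (Re_op (H - H0)))) + Re (\<tau> (abs_op (Im_op (H - H0)))))) \<and>
     (\<forall>\<epsilon>>0. \<forall>a h. taylor_disc (1 + \<epsilon>) a h \<and>
        trace_applicable I nrm (\<lambda>k. a k *\<^sub>C (H ^ k - H0 ^ k)) \<longrightarrow>
        \<tau> (op_series a (\<lambda>k. H ^ k) - op_series a (\<lambda>k. H0 ^ k)) =
          cm_integral (borel_on (sphere 0 1)) \<nu> (deriv h))"

definition spectral_hull :: "'a::hilbert_space bop \<Rightarrow> 'a bop \<Rightarrow> real set" where
  "spectral_hull H0 H = convex hull {x. complex_of_real x \<in> spectrum_op H0 \<union> spectrum_op H}"

text \<open>For an incomplete ideal only polynomials are used, for which \<open>h(H) - h(H0)\<close> is in \<open>I\<close>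
  (compare \<open>trace_applicable\<close>); the measure is already determined by them.\<close>

definition one_var_measure_interval ::
    "'a::hilbert_space bop set \<Rightarrow> ('a bop \<Rightarrow> real) \<Rightarrow> ('a bop \<Rightarrow> complex) \<Rightarrow> 'a bop \<Rightarrow> 'a bop \<Rightarrow>
     (real set \<Rightarrow> complex) \<Rightarrow> bool" where
  "one_var_measure_interval I nrm \<tau> H0 H \<nu> \<longleftrightarrow> (let S = spectral_hull H0 H in
     complex_measure (borel_on S) \<nu> \<and> real_valued_on (borel_on S) \<nu> \<and>
     (\<forall>h. real_analytic_on h S \<and>
        (complete_ideal I nrm \<or> (\<exists>p. \<forall>x. h x = poly p (of_real x))) \<longrightarrow>
        \<tau> (fun_calculus S h H - fun_calculus S h H0) =
          cm_integral (borel_on S) \<nu> (\<lambda>x. vector_derivative h (at x))))"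

definition extend_by_zero :: "'a set \<Rightarrow> ('a set \<Rightarrow> complex) \<Rightarrow> 'a set \<Rightarrow> complex" where
  "extend_by_zero S \<nu> = (\<lambda>E. \<nu> (E \<inter> S))"

end

theory Submission
  imports Defs "HOL-Complex_Analysis.Cauchy_Integral_Formula"
begin

text \<open>Write \<open>V j = B j - A j\<close> and \<open>X t = A + t V\<close> for \<open>t\<close> in \<open>[0, 1]\<close>.  The measure \<open>\<mu> j\<close> represents the
  functional that sends a polynomial \<open>g\<close> to \<open>\<phi>\<^sub>j(g)\<close>, the integral of \<open>\<tau> (g (X t) * V j)\<close> over \<open>t\<close> from
  \<open>0\<close> to \<open>1\<close>.

  The trace formula holds for monomials with \<open>\<phi>\<^sub>j\<close> in place of \<open>\<mu> j\<close> (\<open>trace_monomial_diff\<close>).  Differentiating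
  a word in the \<open>X t j\<close> produces the sum over its positions of the words with \<open>V j\<close> inserted there; the
  trace is cyclic and the \<open>X t j\<close> commute, so under the trace the insertions of the same \<open>V j\<close> all agree
  and add up to the partial derivative.  Integrate over \<open>t\<close>.

  The functional is bounded: \<open>\<bar>\<phi>\<^sub>j(g)\<bar> \<le> mass (V j) * sup \<bar>g\<bar>\<close>, where \<open>mass (V j)\<close> is the bound required
  of the total variation and the supremum is over the torus.  One ingredient is
  \<open>\<bar>\<tau> (T * W)\<bar> \<le> \<parallel>T\<parallel> * mass W\<close> (\<open>trace_mult_mass\<close>), which rests on the polar decomposition of the real and
  imaginary parts of \<open>W\<close> and the Cauchy-Schwarz inequality for the form \<open>\<tau> (X P Y\<^sup>*)\<close> with \<open>P \<ge> 0\<close>.  The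
  other is a von Neumann inequality \<open>\<parallel>g (X t)\<parallel> \<le> sup \<bar>g\<bar>\<close>
  (\<open>von_Neumann_inequality_dilatable\<close>): a dilation reduces it to commuting normal contractions, for which the
  operator \<open>g (U)\<close> is normal by Fuglede's theorem, hence \<open>\<parallel>g (U)\<^bsup>m\<^esup>\<parallel> = \<parallel>g (U)\<parallel>\<^bsup>m\<^esup>\<close> for powers of \<open>2\<close>, while
  a bound through the Fourier coefficients of \<open>g\<^bsup>m\<^esup>\<close> loses only a factor polynomial in \<open>m\<close>.
  For self-adjoint operators the supremum over the cube is enough, because they are the real parts of the
  commuting unitaries \<open>A + \<i> (1 - A\<^sup>2)\<^bsup>1/2\<^esup>\<close> (\<open>von_Neumann_inequality_selfadjoint\<close>).

  A complex measure of total variation at most the norm of the functional is provided by a Riesz theorem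
  on compact sets (\<open>Riesz_complex_measure\<close>), proved by a Hahn-Banach extension to bounded
  sequences and the fact that a nonnegative finitely additive set function on Cantor space agrees with a
  measure on the cylinders.

  The formula passes from monomials to power series by absolute convergence: the coefficients with the
  degree as a weight are summable, and the norm in the ideal of \<open>op_monomial B k - op_monomial A k\<close> is
  bounded by the degree up to a constant.  For the comparison with the one-variable measures it suffices,
  by the same convergence, to integrate the powers \<open>z\<^bsup>m - 1\<^esup>\<close> of one variable; both sides are then
  \<open>\<tau> (B j ^ m - A j ^ m) / m\<close>.  In the self-adjoint case the moments \<open>\<phi>\<^sub>j\<close> of the monomials are real, so
  that the measures on the cube may be replaced by their real parts.\<close>

section \<open>Geometry of complex Hilbert spaces\<close>

lemma scaleC_zero_right [simp]: "c *\<^sub>C (0::'a::complex_vector) = 0"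
  using scaleC_add_right[of c 0 "0::'a"] by simp

lemma scaleC_zero_left [simp]: "0 *\<^sub>C (x::'a::complex_vector) = 0"
  using scaleC_add_left[of 0 0 x] by simp

lemma scaleC_one [simp]: "1 *\<^sub>C (x::'a::complex_vector) = x"
  using scaleC_of_real[of 1 x] by simp

lemma scaleR_eq_scaleC: "r *\<^sub>R (x::'a::complex_vector) = of_real r *\<^sub>C x"
  by (simp add: scaleC_of_real)

lemma scaleC_minus1: "(- 1) *\<^sub>C (x::'a::complex_vector) = - x"
  using scaleC_add_left[of "-1" 1 x] by (simp add: eq_neg_iff_add_eq_0)

lemma scaleC_minus_left: "(- c) *\<^sub>C (x::'a::complex_vector) = - (c *\<^sub>C x)"
  by (metis mult_minus1 scaleC_minus1 scaleC_scaleC)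

lemma scaleC_minus_right: "c *\<^sub>C (- (x::'a::complex_vector)) = - (c *\<^sub>C x)"
  using scaleC_add_right[of c x "-x"] by (simp add: eq_neg_iff_add_eq_0 add.commute)

lemma scaleC_diff_right: "c *\<^sub>C ((x::'a::complex_vector) - y) = c *\<^sub>C x - c *\<^sub>C y"
  using scaleC_add_right[of c x "-y"] by (simp add: scaleC_minus_right)

lemma scaleC_sum_right: "c *\<^sub>C sum f S = (\<Sum>k\<in>S. c *\<^sub>C (f k::'a::complex_vector))"
  by (induction S rule: infinite_finite_induct) (auto simp: scaleC_add_right)

lemma cinner_add_right: "cinner x (y + z) = cinner x y + cinner x z"
  by (metis cinner_add_left cinner_commute complex_cnj_add)

lemma cinner_scaleC_right: "cinner x (c *\<^sub>C y) = cnj c * cinner x y"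
  by (metis cinner_commute cinner_scaleC_left complex_cnj_mult)

lemma cinner_zero_left [simp]: "cinner 0 (x::'a::hilbert_space) = 0"
  using cinner_scaleC_left[of 0 0 x] by simp

lemma cinner_zero_right [simp]: "cinner (x::'a::hilbert_space) 0 = 0"
  using cinner_scaleC_right[of x 0 0] by simp

lemma cinner_minus_left: "cinner (- x) y = - cinner x y"
  using cinner_scaleC_left[of "-1" x y] by (simp add: scaleC_minus1)

lemma cinner_minus_right: "cinner x (- y) = - cinner x y"
  using cinner_scaleC_right[of x "-1" y] by (simp add: scaleC_minus1)

lemma cinner_diff_left: "cinner (x - y) z = cinner x z - cinner y z"
  using cinner_add_left[of x "-y" z] by (simp add: cinner_minus_left)

lemma cinner_diff_right: "cinner x (y - z) = cinner x y - cinner x z"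
  using cinner_add_right[of x y "-z"] by (simp add: cinner_minus_right)

lemma cinner_scaleR_left: "cinner (r *\<^sub>R x) y = of_real r * cinner x y"
  by (simp add: scaleR_eq_scaleC cinner_scaleC_left)

lemma cinner_scaleR_right: "cinner x (r *\<^sub>R y) = of_real r * cinner x y"
  by (simp add: scaleR_eq_scaleC cinner_scaleC_right)

lemmas cinner_simps = cinner_add_left cinner_add_right cinner_diff_left cinner_diff_right
  cinner_minus_left cinner_minus_right cinner_scaleC_left cinner_scaleC_right
  cinner_scaleR_left cinner_scaleR_right

lemma norm_power2_cinner: "(norm x)\<^sup>2 = Re (cinner x x)"
  by (simp add: cinner_self)

lemma cinner_eqI: "(\<And>z. cinner x z = cinner y z) \<Longrightarrow> x = y"
proof -
  assume *: "\<And>z. cinner x z = cinner y z"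
  have "cinner (x - y) (x - y) = 0" by (simp add: cinner_diff_left * cinner_diff_right)
  then show ?thesis by (simp add: cinner_self)
qed

text \<open>Polarization: realness at \<open>x + y\<close> matches the imaginary parts, realness at \<open>x + \<i> y\<close> the real ones.\<close>

lemma sesquilinear_real_diagonal_hermitian:
  fixes s :: "'v::complex_vector \<Rightarrow> 'v \<Rightarrow> complex"
  assumes add: "\<And>x y z. s (x + y) z = s x z + s y z" "\<And>x y z. s x (y + z) = s x y + s x z"
    and scale: "\<And>c x y. s (c *\<^sub>C x) y = c * s x y" "\<And>c x y. s x (c *\<^sub>C y) = cnj c * s x y"
    and real: "\<And>x. Im (s x x) = 0"
  shows "s x y = cnj (s y x)"
proof -
  have "Im (s (x + y) (x + y)) = Im (s x y) + Im (s y x)" by (simp add: add real)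
  moreover have "Im (s (x + \<i> *\<^sub>C y) (x + \<i> *\<^sub>C y)) = Re (s y x) - Re (s x y)"
    by (simp add: add scale real)
  ultimately show ?thesis by (simp add: real complex_eq_iff)
qed

text \<open>The form need not come from an inner product: it is used for \<open>\<langle>P x, y\<rangle>\<close> with \<open>P \<ge> 0\<close> and for
  \<open>\<tau> (X P Y\<^sup>*)\<close> with a positive trace.\<close>

lemma semidefinite_Cauchy_Schwarz:
  fixes s :: "'v::complex_vector \<Rightarrow> 'v \<Rightarrow> complex"
  assumes add: "\<And>x y z. s (x + y) z = s x z + s y z"
    and scale: "\<And>c x y. s (c *\<^sub>C x) y = c * s x y"
    and herm: "\<And>x y. s x y = cnj (s y x)"
    and pos: "\<And>x. 0 \<le> Re (s x x)"
  shows "(cmod (s x y))\<^sup>2 \<le> Re (s x x) * Re (s y y)"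
proof -
  have addr: "s z (x + y) = s z x + s z y" for x y z
    by (metis add herm complex_cnj_add)
  have scaler: "s x (c *\<^sub>C y) = cnj c * s x y" for c x y
    by (metis scale herm complex_cnj_mult)
  define m where "m = cmod (s x y)"
  obtain u where u: "cmod u = 1" "cnj u * s x y = of_real m"
  proof (cases "s x y = 0")
    case True then show ?thesis using that[of 1] by (simp add: m_def)
  next
    case False
    moreover have "cnj (s x y) * s x y = of_real m * of_real m"
      by (simp add: m_def mult.commute[of "cnj _"] complex_norm_square[symmetric] power2_eq_square)
    ultimately show ?thesis using that[of "s x y / of_real m"]
      by (simp add: m_def norm_divide)
  qed
  have uu: "u * cnj u = 1" using u(1) by (metis complex_norm_square of_real_1 power_one)
  have u2: "u * s y x = of_real m"
    by (metis u(2) herm complex_cnj_mult complex_cnj_cnj complex_cnj_complex_of_real)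
  have im: "Im (s y y) = 0" for y using herm[of y y] by (metis cnj.simps(2) equal_neg_zero)
  \<comment> \<open>the usual quadratic \<open>s (x - t u y) (x - t u y)\<close>, with the phase \<open>u\<close> chosen to make the linear term real\<close>
  have q: "0 \<le> Re (s x x) - 2 * t * m + t\<^sup>2 * Re (s y y)" for t :: real
  proof -
    let ?z = "x + (- (of_real t * u)) *\<^sub>C y"
    have "s ?z ?z = s x x - of_real t * (cnj u * s x y) - of_real t * (u * s y x)
        + of_real (t\<^sup>2) * (u * cnj u) * s y y"
      by (simp add: add addr scale scaler algebra_simps power2_eq_square)
    also have "\<dots> = s x x - 2 * of_real t * of_real m + of_real (t\<^sup>2) * s y y"
      using u u2 uu by simp
    finally have "Re (s ?z ?z) = Re (s x x) - 2 * t * m + t\<^sup>2 * Re (s y y)" by (simp del: of_real_power)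
    then show ?thesis using pos[of ?z] by simp
  qed
  show ?thesis
  proof (cases "Re (s y y) = 0")
    case True
    have "m = 0"
    proof (rule ccontr)
      assume "m \<noteq> 0"
      then show False using q[of "(Re (s x x) + 1) / (2 * m)"] True by simp
    qed
    then show ?thesis using True by (simp add: m_def)
  next
    case False
    then have p: "Re (s y y) > 0" using pos[of y] by linarith
    have "0 \<le> Re (s x x) - m\<^sup>2 / Re (s y y)"
      using q[of "m / Re (s y y)"] p by (simp add: power2_eq_square field_simps)
    then show ?thesis using p by (simp add: m_def field_simps)
  qed
qed

lemma cinner_Cauchy_Schwarz: "cmod (cinner x y) \<le> norm x * norm y"
proof -
  have "(cmod (cinner x y))\<^sup>2 \<le> Re (cinner x x) * Re (cinner y y)"
    by (rule semidefinite_Cauchy_Schwarz) (auto simp: cinner_simps cinner_self intro: cinner_commute)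
  also have "\<dots> = (norm x * norm y)\<^sup>2" by (simp add: cinner_self power_mult_distrib)
  finally show ?thesis by (rule power2_le_imp_le) simp
qed

lemma bounded_bilinear_cinner: "bounded_bilinear (cinner :: 'a::hilbert_space \<Rightarrow> 'a \<Rightarrow> complex)"
proof
  show "\<exists>K. \<forall>a b :: 'a. norm (cinner a b) \<le> norm a * norm b * K"
    by (rule exI[of _ 1]) (simp add: cinner_Cauchy_Schwarz)
qed (auto simp: cinner_simps scaleR_conv_of_real)

lemmas cinner_sum_left = bounded_bilinear.sum_left[OF bounded_bilinear_cinner]

lemma norm_le_if_cinner_le:
  assumes "\<And>y. cmod (cinner x y) \<le> b * norm y" "0 \<le> b"
  shows "norm x \<le> b"
proof (cases "norm x = 0")
  case True
  then show ?thesis using assms(2) by simp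
next
  case False
  have "norm x * norm x \<le> b * norm x"
    using assms(1)[of x] by (simp add: cinner_self power2_eq_square norm_mult)
  then show ?thesis using False by simp
qed

lemma parallelogram: "(norm (x + y))\<^sup>2 + (norm (x - y))\<^sup>2 = 2 * (norm x)\<^sup>2 + 2 * (norm (y::'a::hilbert_space))\<^sup>2"
  unfolding norm_power2_cinner by (simp add: cinner_simps)

text \<open>By the parallelogram law a minimizing sequence for the distance from \<open>v\<close> to \<open>S\<close> is Cauchy,
  because the midpoints of its members lie in \<open>S\<close>.  At the minimizer \<open>p\<close>, moving in the direction of
  a non-orthogonal element of \<open>S\<close> would decrease the distance.\<close>

theorem projection_theorem:
  fixes S :: "'a::hilbert_space set"
  assumes S: "closed S" "0 \<in> S" "\<And>x y. x \<in> S \<Longrightarrow> y \<in> S \<Longrightarrow> x + y \<in> S" "\<And>c x. x \<in> S \<Longrightarrow> c *\<^sub>C x \<in> S"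
  shows "\<exists>p\<in>S. \<forall>s\<in>S. cinner (v - p) s = 0"
proof -
  define d where "d = (INF s\<in>S. (norm (v - s))\<^sup>2)"
  have bdd: "bdd_below ((\<lambda>s. (norm (v - s))\<^sup>2) ` S)" by (rule bdd_belowI[of _ 0]) auto
  have dle: "d \<le> (norm (v - s))\<^sup>2" if "s \<in> S" for s
    unfolding d_def by (rule cINF_lower[OF bdd that])
  have "\<exists>s\<in>S. (norm (v - s))\<^sup>2 < d + 1 / Suc n" for n
    using cINF_less_iff[OF _ bdd, of "d + 1 / Suc n"] S(2) unfolding d_def by fastforce
  then obtain s where s: "\<And>n. s n \<in> S" "\<And>n. (norm (v - s n))\<^sup>2 < d + 1 / Suc n" by metis
  have diff: "(norm (s m - s n))\<^sup>2 \<le> 2 / Suc m + 2 / Suc n" for m n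
  proof -
    have mid: "(1/2) *\<^sub>R (s m + s n) \<in> S"
      using S(3,4) s(1) by (simp add: scaleR_eq_scaleC del: scaleR_add_right)
    have eq: "(v - s n) + (v - s m) = 2 *\<^sub>R (v - (1/2) *\<^sub>R (s m + s n))"
      by (simp add: scaleR_2 algebra_simps)
    have "(norm ((v - s n) + (v - s m)))\<^sup>2 = 4 * (norm (v - (1/2) *\<^sub>R (s m + s n)))\<^sup>2"
      unfolding eq norm_scaleR by (simp add: power_mult_distrib)
    then have "(norm ((v - s n) + (v - s m)))\<^sup>2 \<ge> 4 * d" using dle[OF mid] by simp
    moreover have "(v - s n) - (v - s m) = s m - s n" by simp
    ultimately show ?thesis
      using parallelogram[of "v - s n" "v - s m"] s(2)[of n] s(2)[of m] by simp
  qed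
  have "Cauchy s"
  proof (rule CauchyI)
    fix e :: real assume e: "0 < e"
    obtain N where N: "4 / e\<^sup>2 < real N" using reals_Archimedean2 by blast
    have Npos: "4 / real (Suc N) < e\<^sup>2"
      using N e by (simp add: field_simps) (smt (verit) zero_less_power2)
    have "norm (s m - s n) < e" if "N \<le> m" "N \<le> n" for m n
    proof -
      have "2 / real (Suc m) \<le> 2 / real (Suc N)" "2 / real (Suc n) \<le> 2 / real (Suc N)"
        using that by (auto intro!: divide_left_mono)
      then have "(norm (s m - s n))\<^sup>2 < e\<^sup>2" using diff[of m n] Npos by simp
      then show ?thesis using e by (meson less_imp_le power_less_imp_less_base)
    qed
    then show "\<exists>M. \<forall>m\<ge>M. \<forall>n\<ge>M. norm (s m - s n) < e" by blast
  qed
  then obtain p where p: "s \<longlonglongrightarrow> p" by (auto simp: Cauchy_convergent_iff convergent_def)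
  have pS: "p \<in> S" using closed_sequentially[OF S(1) _ p] s(1) by blast
  have np: "(norm (v - p))\<^sup>2 \<le> d"
  proof (rule LIMSEQ_le)
    show "(\<lambda>n. (norm (v - s n))\<^sup>2) \<longlonglongrightarrow> (norm (v - p))\<^sup>2" by (intro tendsto_intros p)
    show "(\<lambda>n. d + 1 / real (Suc n)) \<longlonglongrightarrow> d"
      using tendsto_add[OF tendsto_const LIMSEQ_inverse_real_of_nat, of d] by (simp add: inverse_eq_divide)
  qed (use s(2) less_imp_le in blast)
  have "cinner (v - p) t = 0" if t: "t \<in> S" for t
  proof (rule ccontr)
    define c where "c = cinner (v - p) t"
    assume "cinner (v - p) t \<noteq> 0"
    then have c0: "(cmod c)\<^sup>2 > 0" by (simp add: c_def)
    have ineq: "2 * r * (cmod c)\<^sup>2 \<le> r\<^sup>2 * (cmod c)\<^sup>2 * (norm t)\<^sup>2" for r :: real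
    proof -
      have mem: "p + (of_real r * c) *\<^sub>C t \<in> S" using S(3,4) pS t by blast
      have ct: "cinner t (v - p) = cnj c" using cinner_commute[of t "v - p"] by (simp add: c_def)
      have "cinner (v - (p + (of_real r * c) *\<^sub>C t)) (v - (p + (of_real r * c) *\<^sub>C t))
         = cinner ((v - p) - (of_real r * c) *\<^sub>C t) ((v - p) - (of_real r * c) *\<^sub>C t)"
        by (simp add: algebra_simps)
      also have "\<dots> = cinner (v - p) (v - p) - of_real r * (cnj c * c) - of_real r * (c * cnj c)
          + of_real r ^ 2 * (c * cnj c) * cinner t t"
        unfolding cinner_diff_left[of "v - p"] cinner_diff_right[of _ "v - p"]
        by (simp add: cinner_scaleC_left cinner_scaleC_right ct c_def[symmetric] algebra_simps power2_eq_square)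
      also have "\<dots> = of_real ((norm (v - p))\<^sup>2 - 2 * r * (cmod c)\<^sup>2 + r\<^sup>2 * (cmod c)\<^sup>2 * (norm t)\<^sup>2)"
        by (simp add: cinner_self complex_norm_square[symmetric] mult.commute[of "cnj c"] algebra_simps)
      finally have "(norm (v - (p + (of_real r * c) *\<^sub>C t)))\<^sup>2
          = (norm (v - p))\<^sup>2 - 2 * r * (cmod c)\<^sup>2 + r\<^sup>2 * (cmod c)\<^sup>2 * (norm t)\<^sup>2"
        unfolding cinner_self of_real_eq_iff .
      then show ?thesis using dle[OF mem] np by linarith
    qed
    have "2 \<le> r * (norm t)\<^sup>2" if "r > 0" for r
    proof -
      have "(r * (cmod c)\<^sup>2) * 2 \<le> (r * (cmod c)\<^sup>2) * (r * (norm t)\<^sup>2)"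
        using ineq[of r] by (simp add: power2_eq_square mult_ac)
      then show ?thesis using that c0 by (subst (asm) mult_le_cancel_left_pos) auto
    qed
    from this[of "1 / ((norm t)\<^sup>2 + 1)"] show False
      by (simp add: divide_simps add_pos_nonneg) (smt (verit) zero_le_power2)
  qed
  then show ?thesis using pS by blast
qed

text \<open>A vector \<open>w\<close> orthogonal to the kernel spans a complement of it, so \<open>f\<close> is a multiple of the inner
  product with \<open>w\<close>.\<close>

theorem riesz_representation:
  fixes f :: "'a::hilbert_space \<Rightarrow> complex"
  assumes f: "\<And>x y. f (x + y) = f x + f y" "\<And>c x. f (c *\<^sub>C x) = c * f x" "\<And>x. cmod (f x) \<le> K * norm x"
  shows "\<exists>y. \<forall>x. f x = cinner x y"
proof (cases "\<forall>x. f x = 0")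
  case True
  then show ?thesis by (intro exI[of _ 0]) simp
next
  case False
  then obtain v where v: "f v \<noteq> 0" by blast
  have bl: "bounded_linear f"
    using f by (intro bounded_linear_intro[of f K])
      (auto simp: scaleR_eq_scaleC scaleR_conv_of_real mult.commute)
  have f0: "f 0 = 0" using f(2)[of 0 0] by simp
  have fd: "f (x - y) = f x - f y" for x y
    by (metis bl bounded_linear.linear linear_diff)
  obtain p where p: "f p = 0" "\<And>s. f s = 0 \<Longrightarrow> cinner (v - p) s = 0"
    using projection_theorem[of "{x. f x = 0}" v]
      closed_Collect_eq[OF linear_continuous_on[OF bl, of UNIV] continuous_on_const[of UNIV 0]] f f0
    by auto
  define w where "w = v - p"
  have fw: "f w \<noteq> 0" using p(1) v by (simp add: w_def fd)
  have nw: "w \<noteq> 0" using fw f0 by auto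
  have cw: "cinner w w \<noteq> 0" using nw by (simp add: cinner_self)
  have "f x = cinner x ((cnj (f w) / cinner w w) *\<^sub>C w)" for x
  proof -
    have "f (x - (f x / f w) *\<^sub>C w) = 0" using fw by (simp add: fd f)
    then have "cinner w (x - (f x / f w) *\<^sub>C w) = 0" using p(2) w_def by blast
    then have "cinner (x - (f x / f w) *\<^sub>C w) w = 0" by (metis cinner_commute complex_cnj_zero)
    then have "cinner x w = (f x / f w) * cinner w w" by (simp add: cinner_simps)
    then show ?thesis using fw cw by (simp add: cinner_scaleC_right cinner_self)
  qed
  then show ?thesis by blast
qed

section \<open>Bounded operators\<close>

lemma bounded_linear_app: "bounded_linear (app A)"
  using app[of A] by simp

lemma app_scaleC_arg: "app A (c *\<^sub>C x) = c *\<^sub>C app A x"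
  using app[of A] by simp

lemma app_plus: "app (A + B) x = app A x + app B x" by transfer simp
lemma app_minus: "app (A - B) x = app A x - app B x" by transfer simp
lemma app_uminus: "app (- A) x = - app A x" by transfer simp
lemma app_times: "app (A * B) x = app A (app B x)" by transfer simp
lemma app_scaleC: "app (c *\<^sub>C A) x = c *\<^sub>C app A x" by transfer simp
lemma app_scaleR: "app (r *\<^sub>R A) x = r *\<^sub>R app A x" by transfer simp
lemma app_one: "app 1 x = x" by transfer simp
lemma app_zero: "app 0 x = 0" by transfer simp
lemma app_add_arg: "app A (x + y) = app A x + app A y"
  by (simp add: linear_add[OF bounded_linear.linear[OF bounded_linear_app]])
lemma app_diff_arg: "app A (x - y) = app A x - app A y"
  by (simp add: linear_diff[OF bounded_linear.linear[OF bounded_linear_app]])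
lemma app_zero_arg: "app A 0 = 0"
  by (simp add: linear_0[OF bounded_linear.linear[OF bounded_linear_app]])

lemmas app_simps = app_plus app_minus app_uminus app_times app_scaleC app_scaleR app_one app_zero
  app_add_arg app_diff_arg app_zero_arg app_scaleC_arg

lemma app_sum: "app (sum F S) x = (\<Sum>k\<in>S. app (F k) x)"
  by (induction S rule: infinite_finite_induct) (auto simp: app_simps)

lemma norm_app_le: "norm (app A x) \<le> norm A * norm x"
  unfolding norm_bop.rep_eq by (rule onorm[OF bounded_linear_app])

lemma norm_bop_le: "0 \<le> b \<Longrightarrow> (\<And>x. norm (app A x) \<le> b * norm x) \<Longrightarrow> norm A \<le> b"
  unfolding norm_bop.rep_eq by (rule onorm_bound)

lemma norm_one_bop_le: "norm (1 :: 'a::hilbert_space bop) \<le> 1"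
  by (rule norm_bop_le) (auto simp: app_one)

lemma norm_scaleC_bop: "norm (c *\<^sub>C (A :: 'a::hilbert_space bop)) = cmod c * norm A"
proof (rule antisym)
  show *: "norm (c *\<^sub>C (A :: 'a::hilbert_space bop)) \<le> cmod c * norm A" for c A
    by (rule norm_bop_le)
      (auto simp: app_scaleC norm_scaleC mult.assoc intro!: mult_left_mono norm_app_le)
  show "cmod c * norm A \<le> norm (c *\<^sub>C A)"
  proof (cases "c = 0")
    case False
    have "norm (inverse c *\<^sub>C c *\<^sub>C A) \<le> cmod (inverse c) * norm (c *\<^sub>C A)" by (rule *)
    then show ?thesis using False by (simp add: scaleC_scaleC norm_inverse norm_divide field_simps)
  qed simp
qed

lemma norm_power_bop_le: "norm ((A :: 'a::hilbert_space bop) ^ n) \<le> norm A ^ n"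
proof (induction n)
  case (Suc n)
  have "norm (A ^ Suc n) \<le> norm A * norm (A ^ n)" by (simp add: norm_mult_ineq)
  also have "\<dots> \<le> norm A * norm A ^ n" by (intro mult_left_mono Suc) simp
  finally show ?case by simp
qed (simp add: norm_one_bop_le)

lemma scaleC_mult_left: "(c *\<^sub>C A) * B = c *\<^sub>C (A * (B :: 'a::hilbert_space bop))"
  by (rule bop_eqI) (simp add: app_simps)

lemma scaleC_mult_right: "A * (c *\<^sub>C B) = c *\<^sub>C (A * (B :: 'a::hilbert_space bop))"
  by (rule bop_eqI) (simp add: app_simps)

lemma bop_ex:
  fixes f :: "'a::hilbert_space \<Rightarrow> 'a"
  assumes "\<And>x y. f (x + y) = f x + f y" "\<And>c x. f (c *\<^sub>C x) = c *\<^sub>C f x"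
    "\<And>x. norm (f x) \<le> K * norm x"
  obtains A where "app A = f"
proof -
  have "bounded_linear f"
    using assms by (intro bounded_linear_intro[of f K]) (auto simp: scaleR_eq_scaleC mult.commute)
  then show ?thesis using that[of "Abs_bop f"] assms by (simp add: Abs_bop_inverse)
qed

section \<open>Adjoints\<close>

lemma cinner_eqI2: "(\<And>z. cinner z x = cinner z y) \<Longrightarrow> x = y"
  by (metis cinner_commute cinner_eqI)

lemma adjoint_exists: "\<exists>B. \<forall>x y. cinner (app A x) y = cinner x (app B y)"
proof -
  have "\<exists>z. \<forall>x. cinner (app A x) y = cinner x z" for y
  proof (rule riesz_representation)
    fix x
    have "cmod (cinner (app A x) y) \<le> norm (app A x) * norm y" by (rule cinner_Cauchy_Schwarz)
    also have "\<dots> \<le> norm A * norm x * norm y" by (intro mult_right_mono norm_app_le) simp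
    finally show "cmod (cinner (app A x) y) \<le> (norm A * norm y) * norm x" by (simp add: mult_ac)
  qed (auto simp: app_simps cinner_simps)
  then obtain f where f: "\<And>x y. cinner (app A x) y = cinner x (f y)" by metis
  have "norm (f y) \<le> norm A * norm y" for y
  proof (rule norm_le_if_cinner_le)
    fix x
    have "cmod (cinner (f y) x) = cmod (cinner (app A x) y)"
      by (metis f cinner_commute complex_mod_cnj)
    also have "\<dots> \<le> norm (app A x) * norm y" by (rule cinner_Cauchy_Schwarz)
    also have "\<dots> \<le> norm A * norm x * norm y" by (intro mult_right_mono norm_app_le) simp
    finally show "cmod (cinner (f y) x) \<le> norm A * norm y * norm x" by (simp add: mult_ac)
  qed simp
  moreover have "f (x + y) = f x + f y" for x y
    by (rule cinner_eqI2) (simp add: f[symmetric] cinner_add_right)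
  moreover have "f (c *\<^sub>C x) = c *\<^sub>C f x" for c x
    by (rule cinner_eqI2) (simp add: f[symmetric] cinner_scaleC_right)
  ultimately obtain B where "app B = f" using bop_ex[of f] by metis
  then show ?thesis using f by metis
qed

lemma adj_eqI: "(\<And>x y. cinner (app A x) y = cinner x (app B y)) \<Longrightarrow> adj A = B"
proof -
  assume *: "\<And>x y. cinner (app A x) y = cinner x (app B y)"
  show ?thesis
    unfolding adj_def
  proof (rule the_equality)
    show "C = B" if C: "\<forall>x y. cinner (app A x) y = cinner x (app C y)" for C
    proof (rule bop_eqI)
      show "app C x = app B x" for x by (rule cinner_eqI2) (metis C *)
    qed
  qed (use * in blast)
qed

lemma cinner_adj_right: "cinner x (app (adj A) y) = cinner (app A x) y"
  using adjoint_exists[of A] adj_eqI by metis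

lemma cinner_adj_left: "cinner (app (adj A) x) y = cinner x (app A y)"
  by (metis cinner_adj_right cinner_commute)

lemma adj_adj [simp]: "adj (adj A) = A"
  by (rule adj_eqI) (simp add: cinner_adj_left)

lemma adj_plus: "adj (A + B) = adj A + adj B"
  by (rule adj_eqI) (simp add: cinner_adj_right app_simps cinner_simps)

lemma adj_minus: "adj (A - B) = adj A - adj B"
  by (rule adj_eqI) (simp add: cinner_adj_right app_simps cinner_simps)

lemma adj_mult: "adj (A * B) = adj B * adj A"
  by (rule adj_eqI) (simp add: cinner_adj_right app_simps)

lemma adj_scaleC: "adj (c *\<^sub>C A) = cnj c *\<^sub>C adj A"
  by (rule adj_eqI) (simp add: cinner_adj_right app_simps cinner_simps)

lemma adj_scaleR: "adj (r *\<^sub>R A) = r *\<^sub>R adj A"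
  by (simp add: scaleR_eq_scaleC adj_scaleC)

lemma adj_one [simp]: "adj 1 = 1"
  by (rule adj_eqI) (simp add: app_simps)

lemma adj_zero [simp]: "adj 0 = 0"
  by (rule adj_eqI) (simp add: app_simps)

lemma adj_uminus: "adj (- A) = - adj A"
  using adj_minus[of 0 A] by simp

lemma adj_power: "adj (A ^ n) = adj A ^ n"
  by (induction n) (auto simp: adj_mult power_commutes)

lemmas adj_simps = adj_plus adj_minus adj_mult adj_scaleC adj_scaleR adj_uminus adj_power

lemma norm_adj [simp]: "norm (adj A) = norm A"
proof -
  have *: "norm (adj A) \<le> norm A" for A :: "'a bop"
  proof (rule norm_bop_le)
    fix x
    show "norm (app (adj A) x) \<le> norm A * norm x"
    proof (rule norm_le_if_cinner_le)
      fix y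
      have "cmod (cinner (app (adj A) x) y) \<le> norm x * norm (app A y)"
        unfolding cinner_adj_left by (rule cinner_Cauchy_Schwarz)
      also have "\<dots> \<le> norm x * (norm A * norm y)" by (intro mult_left_mono norm_app_le) simp
      finally show "cmod (cinner (app (adj A) x) y) \<le> norm A * norm x * norm y" by (simp add: mult_ac)
    qed simp
  qed simp
  show ?thesis using *[of A] *[of "adj A"] by simp
qed

lemma bounded_linear_adj: "bounded_linear (adj :: 'a::hilbert_space bop \<Rightarrow> 'a bop)"
  by (rule bounded_linear_intro[of _ 1]) (auto simp: adj_simps)

lemmas tendsto_adj [tendsto_intros] = bounded_linear.tendsto[OF bounded_linear_adj]

lemma norm_power2_app: "(norm (app A x))\<^sup>2 = Re (cinner (app (adj A * A) x) x)"
  by (simp add: norm_power2_cinner app_times cinner_adj_left)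

text \<open>The C*-identity.\<close>

lemma norm_adj_mult: "norm (adj A * A) = (norm A)\<^sup>2"
proof (rule antisym)
  show "norm (adj A * A) \<le> (norm A)\<^sup>2"
    using norm_mult_ineq[of "adj A" A] by (simp add: power2_eq_square)
  have "norm A \<le> sqrt (norm (adj A * A))"
  proof (rule norm_bop_le)
    fix x
    have "(norm (app A x))\<^sup>2 \<le> cmod (cinner (app (adj A * A) x) x)"
      unfolding norm_power2_app by (rule complex_Re_le_cmod)
    also have "\<dots> \<le> norm (app (adj A * A) x) * norm x" by (rule cinner_Cauchy_Schwarz)
    also have "\<dots> \<le> norm (adj A * A) * norm x * norm x" by (intro mult_right_mono norm_app_le) simp
    also have "\<dots> = (sqrt (norm (adj A * A)) * norm x)\<^sup>2" by (simp add: power_mult_distrib power2_eq_square)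
    finally show "norm (app A x) \<le> sqrt (norm (adj A * A)) * norm x"
      by (rule power2_le_imp_le) simp
  qed simp
  then show "(norm A)\<^sup>2 \<le> norm (adj A * A)"
    by (metis norm_ge_zero power_mono real_sqrt_pow2)
qed

section \<open>Positive operators, square roots and the polar decomposition\<close>

text \<open>Over the complex numbers a form that is real on the diagonal is hermitian, so self-adjointness is
  a consequence of positivity.\<close>

lemma positive_op_iff: "positive_op A \<longleftrightarrow> adj A = A \<and> (\<forall>x. 0 \<le> Re (cinner (app A x) x))"
proof
  assume A: "positive_op A"
  then have im: "Im (cinner (app A x) x) = 0" and re: "0 \<le> Re (cinner (app A x) x)" for x
    by (auto simp: positive_op_def complex_nonneg_Reals_iff)
  have "cinner (app A x) y = cnj (cinner (app A y) x)" for x y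
    by (rule sesquilinear_real_diagonal_hermitian) (auto simp: app_simps cinner_simps im)
  then have "cinner (app A x) y = cinner x (app A y)" for x y by (metis cinner_commute)
  then show "adj A = A \<and> (\<forall>x. 0 \<le> Re (cinner (app A x) x))" using re by (auto intro: adj_eqI)
next
  assume A: "adj A = A \<and> (\<forall>x. 0 \<le> Re (cinner (app A x) x))"
  then have "Im (cinner (app A x) x) = 0" for x
    by (metis cinner_adj_right cinner_commute cnj.simps(2) equal_neg_zero)
  then show "positive_op A" using A by (simp add: positive_op_def complex_nonneg_Reals_iff)
qed

lemma positive_opD: "positive_op A \<Longrightarrow> adj A = A" "positive_op A \<Longrightarrow> 0 \<le> Re (cinner (app A x) x)"
  by (auto simp: positive_op_iff)

lemma positive_op_zero: "positive_op 0"
  by (simp add: positive_op_iff app_simps)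

lemma positive_op_scaleR: "positive_op A \<Longrightarrow> 0 \<le> r \<Longrightarrow> positive_op (r *\<^sub>R A)"
  by (simp add: positive_op_iff app_simps cinner_simps adj_simps)

lemma positive_op_conj: "positive_op P \<Longrightarrow> positive_op (adj A * P * A)"
  by (simp add: positive_op_iff app_simps cinner_adj_left adj_simps mult.assoc)

lemma positive_op_one: "positive_op 1"
  by (simp add: positive_op_iff app_simps cinner_self)

lemma positive_op_adj_mult: "positive_op (adj A * A)"
  using positive_op_conj[OF positive_op_one, of A] by simp

lemma positive_op_Cauchy_Schwarz:
  assumes "positive_op P"
  shows "(cmod (cinner (app P x) y))\<^sup>2 \<le> Re (cinner (app P x) x) * Re (cinner (app P y) y)"
proof (rule semidefinite_Cauchy_Schwarz[where s = "\<lambda>x y. cinner (app P x) y"])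
  show "cinner (app P x) y = cnj (cinner (app P y) x)" for x y
    by (metis assms cinner_adj_right cinner_commute positive_opD(1))
qed (use assms in \<open>auto simp: app_simps cinner_simps positive_opD\<close>)

lemma positive_op_app_eq_0:
  assumes "positive_op P" "Re (cinner (app P x) x) = 0"
  shows "app P x = 0"
proof -
  have "(cmod (cinner (app P x) (app P x)))\<^sup>2 \<le> 0"
    using positive_op_Cauchy_Schwarz[OF assms(1), of x "app P x"] assms(2) by simp
  then show ?thesis by (simp add: cinner_self)
qed

lemma positive_op_norm_le:
  assumes P: "positive_op P" and b: "\<And>x. Re (cinner (app P x) x) \<le> b * (norm x)\<^sup>2" "0 \<le> b"
  shows "norm P \<le> b"
proof (rule norm_bop_le[OF b(2)])
  fix x
  show "norm (app P x) \<le> b * norm x"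
  proof (rule norm_le_if_cinner_le)
    fix y
    have "(cmod (cinner (app P x) y))\<^sup>2 \<le> Re (cinner (app P x) x) * Re (cinner (app P y) y)"
      by (rule positive_op_Cauchy_Schwarz[OF P])
    also have "\<dots> \<le> (b * (norm x)\<^sup>2) * (b * (norm y)\<^sup>2)"
      by (intro mult_mono b positive_opD P mult_nonneg_nonneg) auto
    also have "\<dots> = (b * norm x * norm y)\<^sup>2" by (simp add: power_mult_distrib power2_eq_square mult_ac)
    finally show "cmod (cinner (app P x) y) \<le> b * norm x * norm y"
      by (rule power2_le_imp_le) (simp add: b)
  qed (simp add: b)
qed

lemma Re_cinner_app_le: "Re (cinner (app A x) x) \<le> norm A * (norm x)\<^sup>2"
proof -
  have "Re (cinner (app A x) x) \<le> norm (app A x) * norm x"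
    using complex_Re_le_cmod cinner_Cauchy_Schwarz order_trans by blast
  also have "\<dots> \<le> norm A * norm x * norm x" by (intro mult_right_mono norm_app_le) simp
  finally show ?thesis by (simp add: power2_eq_square mult_ac)
qed

text \<open>With \<open>X = 1 - P\<close>, the recursion \<open>Y\<^sub>n\<^sub>+\<^sub>1 = (X + Y\<^sub>n\<^sup>2) / 2\<close> produces polynomials in \<open>X\<close> with
  nonnegative coefficients.  Its increments are dominated by those of the same recursion for the
  scalar \<open>1\<close>, whence convergence in norm; the limit satisfies \<open>(1 - Y)\<^sup>2 = P\<close>.\<close>

lemma sqrt_contraction:
  assumes P: "positive_op P" "positive_op (1 - P)"
  shows "\<exists>R. positive_op R \<and> R * R = P \<and> (\<forall>C. C * P = P * C \<longrightarrow> C * R = R * C)"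
proof -
  define X where "X = 1 - P"
  have nX: "norm X \<le> 1"
    unfolding X_def
  proof (rule positive_op_norm_le[OF P(2)])
    show "Re (cinner (app (1 - P) x) x) \<le> 1 * (norm x)\<^sup>2" for x
      using positive_opD(2)[OF P(1), of x] by (simp add: app_simps cinner_simps cinner_self)
  qed simp
  have aX: "adj X = X" using positive_opD(1)[OF P(2)] by (simp add: X_def)
  define Y where "Y = rec_nat 0 (\<lambda>_ Z. (1/2) *\<^sub>R (X + Z * Z))"
  define y where "y = rec_nat (0::real) (\<lambda>_ z. (1 + z * z) / 2)"
  have Y: "Y 0 = 0" "Y (Suc n) = (1/2) *\<^sub>R (X + Y n * Y n)" for n by (simp_all add: Y_def)
  have y: "y 0 = 0" "y (Suc n) = (1 + y n * y n) / 2" for n by (simp_all add: y_def)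
  have y01: "0 \<le> y n \<and> y n \<le> 1" for n
  proof (induction n)
    case (Suc n)
    then have "y n * y n \<le> 1" by (simp add: mult_le_one)
    then show ?case using Suc by (simp add: y)
  qed (simp add: y)
  have comm: "C * Y n = Y n * C" if "C * X = X * C" for C n
  proof (induction n)
    case (Suc n)
    have "C * (Y n * Y n) = (Y n * Y n) * C" by (metis Suc mult.assoc)
    then show ?case using that by (simp add: Y distrib_left distrib_right)
  qed (simp add: Y)
  have commYY: "Y m * Y n = Y n * Y m" for m n by (rule comm) (metis comm)
  have bound: "norm (Y n) \<le> y n" for n
  proof (induction n)
    case (Suc n)
    have "norm (X + Y n * Y n) \<le> norm X + norm (Y n) * norm (Y n)"
      by (meson add_left_mono norm_mult_ineq norm_triangle_le order_trans order_refl norm_triangle_ineq)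
    also have "\<dots> \<le> 1 + y n * y n" by (intro add_mono nX mult_mono Suc) (use y01 in auto)
    finally show ?case by (simp add: Y y)
  qed (simp add: Y y)
  have incr: "norm (Y (Suc n) - Y n) \<le> y (Suc n) - y n" for n
  proof (induction n)
    case 0
    then show ?case using nX by (simp add: Y y)
  next
    case (Suc n)
    have "Y (Suc (Suc n)) - Y (Suc n) = (1/2) *\<^sub>R (Y (Suc n) * Y (Suc n) - Y n * Y n)"
      unfolding Y(2)[of "Suc n"] Y(2)[of n] scaleR_diff_right[symmetric] by simp
    also have "Y (Suc n) * Y (Suc n) - Y n * Y n = (Y (Suc n) - Y n) * (Y (Suc n) + Y n)"
      using commYY[of n "Suc n"] by (simp add: algebra_simps)
    finally have "norm (Y (Suc (Suc n)) - Y (Suc n)) \<le> (1/2) * (norm (Y (Suc n) - Y n) * norm (Y (Suc n) + Y n))"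
      by (simp add: norm_mult_ineq)
    also have "\<dots> \<le> (1/2) * ((y (Suc n) - y n) * (y (Suc n) + y n))"
      using bound[of n] bound[of "Suc n"] order_trans[OF norm_ge_zero Suc] norm_triangle_ineq[of "Y (Suc n)" "Y n"] Suc
      by (intro mult_left_mono mult_mono) auto
    also have "\<dots> = y (Suc (Suc n)) - y (Suc n)"
      by (simp add: y(2)[of "Suc n"] y(2)[of n] algebra_simps)
    finally show ?case .
  qed
  have "summable (\<lambda>n. y (Suc n) - y n)"
  proof -
    have "y n \<le> y (Suc n)" for n using order_trans[OF norm_ge_zero incr[of n]] by simp
    then have "incseq y" by (rule incseq_SucI)
    then obtain l where "y \<longlonglongrightarrow> l" using incseq_convergent[of y 1] y01 by blast
    then show ?thesis by (rule telescope_summable)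
  qed
  then have "summable (\<lambda>n. norm (Y (Suc n) - Y n))"
    by (rule summable_comparison_test'[where N = 0]) (use incr in auto)
  then have "summable (\<lambda>n. Y (Suc n) - Y n)" by (rule summable_norm_cancel)
  then have "convergent (\<lambda>m. \<Sum>n<m. Y (Suc n) - Y n)" by (simp add: summable_iff_convergent)
  then obtain Z where Z: "Y \<longlonglongrightarrow> Z"
    by (auto simp: sum_lessThan_telescope Y(1) convergent_def)
  have Zeq: "Z = (1/2) *\<^sub>R (X + Z * Z)"
  proof (rule LIMSEQ_unique)
    show "(\<lambda>n. Y (Suc n)) \<longlonglongrightarrow> Z" using Z by (rule LIMSEQ_Suc)
    show "(\<lambda>n. Y (Suc n)) \<longlonglongrightarrow> (1/2) *\<^sub>R (X + Z * Z)" unfolding Y by (intro tendsto_intros Z)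
  qed
  have "2 *\<^sub>R Z = 2 *\<^sub>R ((1/2) *\<^sub>R (X + Z * Z))" using Zeq by (rule arg_cong)
  also have "\<dots> = X + Z * Z" by simp
  finally have Z2: "2 *\<^sub>R Z = X + Z * Z" .
  have "(1 - Z) * (1 - Z) = 1 - 2 *\<^sub>R Z + Z * Z" by (simp add: algebra_simps scaleR_2)
  then have RR: "(1 - Z) * (1 - Z) = P" unfolding Z2 by (simp add: X_def)
  have aY: "adj (Y n) = Y n" for n by (induction n) (simp_all add: Y adj_simps aX)
  have aZ: "adj Z = Z" using LIMSEQ_unique[OF tendsto_adj[OF Z]] Z by (simp add: aY)
  have nZ: "norm Z \<le> 1"
    by (rule LIMSEQ_le_const2[OF tendsto_norm[OF Z]]) (use bound y01 order_trans in blast)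
  have pos: "positive_op (1 - Z)"
  proof -
    have "Re (cinner (app Z x) x) \<le> (norm x)\<^sup>2" for x
      using Re_cinner_app_le[of Z x] mult_right_mono[OF nZ, of "(norm x)\<^sup>2"] by simp
    then show ?thesis by (simp add: positive_op_iff adj_simps aZ app_simps cinner_simps cinner_self)
  qed
  have "C * (1 - Z) = (1 - Z) * C" if "C * P = P * C" for C
  proof -
    have CX: "C * X = X * C" using that by (simp add: X_def algebra_simps)
    have "C * Z = Z * C"
      using LIMSEQ_unique[OF tendsto_mult[OF tendsto_const Z, of C]] tendsto_mult[OF Z tendsto_const, of C]
      by (simp add: comm[OF CX])
    then show ?thesis by (simp add: algebra_simps)
  qed
  then show ?thesis using RR pos by blast
qed

lemma positive_op_sqrt_exists:
  assumes P: "positive_op P"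
  shows "\<exists>R. positive_op R \<and> R * R = P \<and> (\<forall>C. C * P = P * C \<longrightarrow> C * R = R * C)"
proof (cases "P = 0")
  case True
  then show ?thesis by (intro exI[of _ 0]) (simp add: positive_op_zero)
next
  case False
  define c where "c = norm P"
  have c: "c > 0" using False by (simp add: c_def)
  define Q where "Q = (1 / c) *\<^sub>R P"
  have Q: "positive_op Q" unfolding Q_def by (rule positive_op_scaleR[OF P]) (use c in simp)
  have nQ: "norm Q = 1" using c by (simp add: Q_def c_def)
  have "Re (cinner (app Q x) x) \<le> (norm x)\<^sup>2" for x
    using Re_cinner_app_le[of Q x] nQ by simp
  then have "positive_op (1 - Q)"
    using positive_opD(1)[OF Q] by (simp add: positive_op_iff adj_simps app_simps cinner_simps cinner_self)
  then obtain R where R: "positive_op R" "R * R = Q" "\<And>C. C * Q = Q * C \<Longrightarrow> C * R = R * C"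
    using sqrt_contraction[OF Q] by blast
  have "(sqrt c *\<^sub>R R) * (sqrt c *\<^sub>R R) = P"
    using R(2) c by (simp add: Q_def)
  moreover have "positive_op (sqrt c *\<^sub>R R)" by (rule positive_op_scaleR[OF R(1)]) (use c in simp)
  moreover have "C * (sqrt c *\<^sub>R R) = (sqrt c *\<^sub>R R) * C" if "C * P = P * C" for C
    using R(3)[of C] that by (simp add: Q_def)
  ultimately show ?thesis by blast
qed

text \<open>Every positive root \<open>Q\<close> equals the root \<open>T\<close> constructed above, with which it commutes: for
  \<open>y = (Q - T) x\<close> one has \<open>(Q + T) y = (Q\<^sup>2 - T\<^sup>2) x = 0\<close>, so both \<open>Q y\<close> and \<open>T y\<close> vanish by
  positivity, and \<open>\<parallel>y\<parallel>\<^sup>2 = \<langle>(Q - T) y, x\<rangle> = 0\<close>.\<close>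

lemma positive_op_sqrt_unique:
  assumes S: "positive_op S" "positive_op R" "S * S = R * R"
  shows "S = R"
proof -
  have "positive_op (S * S)" using positive_op_adj_mult[of S] positive_opD(1)[OF S(1)] by simp
  from positive_op_sqrt_exists[OF this]
  obtain T where T: "positive_op T" "T * T = S * S" "\<And>C. C * (S * S) = (S * S) * C \<Longrightarrow> C * T = T * C"
    by blast
  have *: "Q = T" if Q: "positive_op Q" "Q * Q = S * S" for Q
  proof -
    have QT: "Q * T = T * Q" by (rule T(3)) (metis Q(2) mult.assoc)
    have "app (Q - T) x = 0" for x
    proof -
      define y where "y = app (Q - T) x"
      have "(Q + T) * (Q - T) = 0" using QT Q(2) T(2) by (simp add: algebra_simps)
      then have "app (Q + T) y = 0" unfolding y_def app_times[symmetric] by (simp add: app_simps)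
      then have "app Q y + app T y = 0" by (simp add: app_plus)
      then have "Re (cinner (app Q y) y) + Re (cinner (app T y) y) = 0"
        by (metis cinner_add_left cinner_zero_left plus_complex.sel(1) zero_complex.sel(1))
      then have "Re (cinner (app Q y) y) = 0" "Re (cinner (app T y) y) = 0"
        using positive_opD(2)[OF Q(1), of y] positive_opD(2)[OF T(1), of y] by linarith+
      then have "app Q y = 0" "app T y = 0"
        using positive_op_app_eq_0 Q(1) T(1) by blast+
      then have "app (Q - T) y = 0" by (simp add: app_minus)
      moreover have "cinner y y = cinner (app (Q - T) y) x"
        using positive_opD(1)[OF Q(1)] positive_opD(1)[OF T(1)]
        by (metis adj_minus cinner_adj_left y_def)
      ultimately have "cinner y y = 0" by simp
      then show ?thesis by (simp add: y_def cinner_self)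
    qed
    then show ?thesis by (auto intro!: bop_eqI simp: app_minus)
  qed
  show ?thesis using *[OF S(1)] *[OF S(2)] S(3) by simp
qed

lemma abs_op_works: "positive_op (abs_op A) \<and> abs_op A * abs_op A = adj A * A"
  unfolding abs_op_def
proof (rule theI')
  show "\<exists>!P. positive_op P \<and> P * P = adj A * A"
  proof -
    obtain R where R: "positive_op R" "R * R = adj A * A"
      using positive_op_sqrt_exists[OF positive_op_adj_mult[of A]] by blast
    show ?thesis
    proof (rule ex1I[of _ R])
      show "P = R" if "positive_op P \<and> P * P = adj A * A" for P
        by (rule positive_op_sqrt_unique) (use that R in auto)
    qed (use R in blast)
  qed
qed

lemma norm_app_abs_op: "norm (app (abs_op A) x) = norm (app A x)"
proof -
  have "(norm (app (abs_op A) x))\<^sup>2 = (norm (app A x))\<^sup>2"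
    using abs_op_works[of A] by (simp add: norm_power2_app positive_opD(1))
  then show ?thesis by (metis norm_ge_zero power2_eq_imp_eq)
qed

text \<open>Since \<open>\<parallel>abs_op A x\<parallel> = \<parallel>A x\<parallel>\<close>, the assignment \<open>abs_op A x \<mapsto> A x\<close> is a well-defined isometry.
  It extends to the closure \<open>S\<close> of the range of \<open>abs_op A\<close> by uniform continuity, and to the whole
  space through the orthogonal projection \<open>q\<close> onto \<open>S\<close>.\<close>

theorem polar_decomposition:
  obtains U where "A = U * abs_op A" "abs_op A = adj U * A" "norm U \<le> 1"
proof -
  define P where "P = abs_op A"
  have nP: "norm (app P x) = norm (app A x)" for x by (simp add: P_def norm_app_abs_op)
  define S where "S = closure (range (app P))"
  define f0 where "f0 = (\<lambda>y. app A (SOME x. app P x = y))"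
  have f0: "f0 (app P x) = app A x" for x
  proof -
    have "app P (SOME z. app P z = app P x) = app P x" by (rule someI) simp
    then have "norm (app P ((SOME z. app P z = app P x) - x)) = 0" by (simp add: app_diff_arg)
    then show ?thesis unfolding nP f0_def by (simp add: app_diff_arg)
  qed
  have "uniformly_continuous_on (range (app P)) f0"
    unfolding uniformly_continuous_on_def
    by (auto simp: f0 dist_norm nP simp flip: app_diff_arg)
  then obtain f where f: "uniformly_continuous_on S f" "\<And>x. x \<in> range (app P) \<Longrightarrow> f0 x = f x"
    using uniformly_continuous_on_extension_on_closure unfolding S_def by metis
  have fP: "f (app P x) = app A x" for x using f(2)[of "app P x"] f0[of x] by simp
  have seq: "\<exists>u. (\<lambda>n. app P (u n)) \<longlonglongrightarrow> y \<and> (\<lambda>n. app A (u n)) \<longlonglongrightarrow> f y" if "y \<in> S" for y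
  proof -
    obtain v where v: "\<And>n. v n \<in> range (app P)" "v \<longlonglongrightarrow> y"
      using \<open>y \<in> S\<close> unfolding S_def closure_sequential by blast
    then have "\<exists>x. v n = app P x" for n by blast
    then obtain u where u: "\<And>n. v n = app P (u n)" by metis
    then have veq: "v = (\<lambda>n. app P (u n))" by auto
    have "v n \<in> S" for n unfolding S_def using v(1) closure_subset by blast
    then have "(\<lambda>n. f (v n)) \<longlonglongrightarrow> f y"
      using continuous_on_tendsto_compose[OF uniformly_continuous_imp_continuous[OF f(1)] v(2) that] by simp
    then show ?thesis using v(2) by (intro exI[of _ u]) (simp add: veq fP)
  qed
  have lim: "f y = z \<and> y \<in> S" if "(\<lambda>n. app P (u n)) \<longlonglongrightarrow> y" "(\<lambda>n. app A (u n)) \<longlonglongrightarrow> z" for u y z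
  proof -
    have yS: "y \<in> S" unfolding S_def closure_sequential by (intro exI[of _ "\<lambda>n. app P (u n)"]) (use that(1) in simp)
    have "(\<lambda>n. f (app P (u n))) \<longlonglongrightarrow> f y"
      by (rule continuous_on_tendsto_compose[OF uniformly_continuous_imp_continuous[OF f(1)] that(1) yS])
        (auto simp: S_def intro!: always_eventually subsetD[OF closure_subset])
    then show ?thesis using that(2) LIMSEQ_unique yS by (auto simp: fP)
  qed
  have Sadd: "f (x + y) = f x + f y \<and> x + y \<in> S" if xy: "x \<in> S" "y \<in> S" for x y
  proof -
    obtain u where u: "(\<lambda>n. app P (u n)) \<longlonglongrightarrow> x" "(\<lambda>n. app A (u n)) \<longlonglongrightarrow> f x"
      using seq[OF xy(1)] by blast
    obtain v where v: "(\<lambda>n. app P (v n)) \<longlonglongrightarrow> y" "(\<lambda>n. app A (v n)) \<longlonglongrightarrow> f y"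
      using seq[OF xy(2)] by blast
    show ?thesis
      by (rule lim[of "\<lambda>n. u n + v n"]) (simp_all add: app_add_arg tendsto_add u v)
  qed
  have Sscale: "f (c *\<^sub>C x) = c *\<^sub>C f x \<and> c *\<^sub>C x \<in> S" if xS: "x \<in> S" for c x
  proof -
    obtain u where u: "(\<lambda>n. app P (u n)) \<longlonglongrightarrow> x" "(\<lambda>n. app A (u n)) \<longlonglongrightarrow> f x" using seq[OF xS] by blast
    show ?thesis
      by (rule lim[of "\<lambda>n. c *\<^sub>C u n"])
        (simp_all add: app_scaleC_arg bounded_linear.tendsto[OF bounded_linear_scaleC] u)
  qed
  have Snorm: "norm (f x) = norm x" if xS: "x \<in> S" for x
  proof -
    obtain u where u: "(\<lambda>n. app P (u n)) \<longlonglongrightarrow> x" "(\<lambda>n. app A (u n)) \<longlonglongrightarrow> f x" using seq[OF xS] by blast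
    then show ?thesis using LIMSEQ_unique[OF tendsto_norm[OF u(1)]] tendsto_norm[OF u(2)] by (simp add: nP)
  qed
  have S0: "0 \<in> S" using lim[of "\<lambda>_. 0" 0 0] by (simp add: app_simps)
  have "\<exists>p\<in>S. \<forall>s\<in>S. cinner (v - p) s = 0" for v
    by (rule projection_theorem) (auto simp: Sadd Sscale S0 S_def[symmetric] closed_closure[of "range (app P)", folded S_def])
  then obtain q where q: "\<And>v. q v \<in> S" "\<And>v s. s \<in> S \<Longrightarrow> cinner (v - q v) s = 0" by metis
  have quniq: "q v = p" if "p \<in> S" "\<And>s. s \<in> S \<Longrightarrow> cinner (v - p) s = 0" for v p
  proof -
    have mem: "q v - p \<in> S" using Sadd[OF q(1), of "(-1) *\<^sub>C p"] Sscale[OF that(1), of "-1"] by (simp add: scaleC_minus1)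
    have "cinner (q v - p) (q v - p) = cinner (v - p) (q v - p) - cinner (v - q v) (q v - p)"
      by (simp flip: cinner_diff_left)
    then have "cinner (q v - p) (q v - p) = 0" using that(2)[OF mem] q(2)[OF mem] by simp
    then show ?thesis by (simp add: cinner_self)
  qed
  have qadd: "q (x + y) = q x + q y" for x y
  proof (rule quniq)
    show "cinner (x + y - (q x + q y)) s = 0" if "s \<in> S" for s
      using q(2)[OF that, of x] q(2)[OF that, of y] by (simp add: cinner_simps)
  qed (simp add: Sadd q)
  have qscale: "q (c *\<^sub>C x) = c *\<^sub>C q x" for c x
  proof (rule quniq)
    show "cinner (c *\<^sub>C x - c *\<^sub>C q x) s = 0" if "s \<in> S" for s
      using q(2)[OF that, of x] by (simp add: cinner_simps)
  qed (simp add: Sscale q)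
  have qnorm: "norm (q x) \<le> norm x" for x
  proof -
    have "cinner x (q x) = cinner (q x) (q x)" using q(2)[OF q(1), of x x] by (simp add: cinner_simps)
    then have "norm (q x) * norm (q x) \<le> norm x * norm (q x)"
      using cinner_Cauchy_Schwarz[of x "q x"] by (simp add: cinner_self power2_eq_square norm_mult)
    then show ?thesis by (cases "norm (q x) = 0") auto
  qed
  have qid: "q x = x" if "x \<in> S" for x by (rule quniq) (use that in auto)
  have PS: "app P x \<in> S" for x using lim[of "\<lambda>_. x" "app P x" "app A x"] by simp
  obtain U where U: "app U = (\<lambda>x. f (q x))"
    by (rule bop_ex[of "\<lambda>x. f (q x)" 1]) (auto simp: qadd qscale Sadd Sscale q Snorm qnorm)
  have AU: "A = U * P" by (rule bop_eqI) (simp add: app_times U qid PS fP)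
  have nU: "norm U \<le> 1" by (rule norm_bop_le) (auto simp: U Snorm q qnorm)
  have ad: "P = adj U * A"
  proof (rule bop_eqI)
    fix x
    have iso: "cinner (f y) (f z) = cinner y z" if yz: "y \<in> S" "z \<in> S" for y z
    proof -
      have re: "Re (cinner (f y) (f z)) = Re (cinner y z)" if "y \<in> S" "z \<in> S" for y z
      proof -
        have "norm (f (y + z)) = norm (y + z)" using Sadd[OF that] Snorm by blast
        then have "(norm (f y + f z))\<^sup>2 = (norm (y + z))\<^sup>2" using Sadd[OF that] by simp
        moreover have "(norm (f y))\<^sup>2 = (norm y)\<^sup>2" "(norm (f z))\<^sup>2 = (norm z)\<^sup>2"
          using Snorm that by auto
        moreover have "Re (cinner a b) = Re (cinner b a)" for a b :: 'a
          by (metis cinner_commute cnj.simps(1))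
        ultimately show ?thesis unfolding norm_power2_cinner by (simp add: cinner_simps)
      qed
      have "Re (cinner (f (\<i> *\<^sub>C y)) (f z)) = Re (cinner (\<i> *\<^sub>C y) z)"
        using re Sscale yz by blast
      then have "Im (cinner (f y) (f z)) = Im (cinner y z)"
        using Sscale[OF yz(1), of \<i>] by (simp add: cinner_scaleC_left)
      with re[OF yz] show ?thesis by (simp add: complex_eq_iff)
    qed
    show "app P x = app (adj U * A) x"
    proof (rule cinner_eqI)
      fix z
      have "cinner (app (adj U * A) x) z = cinner (f (app P x)) (f (q z))"
        by (simp add: app_times cinner_adj_left U fP)
      also have "\<dots> = cinner (app P x) (q z)" by (rule iso) (auto simp: PS q)
      also have "\<dots> = cinner (app P x) z"
      proof -
        have "cinner (z - q z) (app P x) = 0" by (rule q(2)[OF PS])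
        then have "cinner (app P x) (z - q z) = 0" by (metis cinner_commute complex_cnj_zero)
        then show ?thesis by (simp add: cinner_simps)
      qed
      finally show "cinner (app P x) z = cinner (app (adj U * A) x) z" by simp
    qed
  qed
  show ?thesis by (rule that[OF AU[unfolded P_def] ad[unfolded P_def] nU])
qed

section \<open>Exponentials and Fuglede's theorem\<close>

text \<open>On the zero space \<open>1 = 0\<close>, so the operators do not form a \<open>real_normed_algebra_1\<close>, the class to
  which \<open>exp\<close> belongs; the series is the same.\<close>

definition bexp :: "'a::hilbert_space bop \<Rightarrow> 'a bop" where
  "bexp S = (\<Sum>n. S ^ n /\<^sub>R fact n)"

lemma summable_norm_bexp: "summable (\<lambda>n. norm ((S :: 'a::hilbert_space bop) ^ n /\<^sub>R fact n))"
proof (rule summable_comparison_test'[where N = 0])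
  show "summable (\<lambda>n. inverse (fact n) * norm S ^ n)" by (rule summable_exp)
  show "norm (norm (S ^ n /\<^sub>R fact n)) \<le> inverse (fact n) * norm S ^ n" for n
    by (simp add: divide_inverse_commute mult_left_mono norm_power_bop_le)
qed

lemma bexp_sums: "(\<lambda>n. (S :: 'a::hilbert_space bop) ^ n /\<^sub>R fact n) sums bexp S"
  unfolding bexp_def by (rule summable_sums[OF summable_norm_cancel[OF summable_norm_bexp]])

lemma bexp_series_add:
  fixes x y :: "'a::hilbert_space bop"
  assumes comm: "x * y = y * x"
  shows "(x + y) ^ n /\<^sub>R fact n = (\<Sum>i\<le>n. (x ^ i /\<^sub>R fact i) * (y ^ (n - i) /\<^sub>R fact (n - i)))"
proof (induct n)
  case 0
  then show ?case by simp
next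
  case (Suc n)
  define S where "S = (\<lambda>(x :: 'a bop) n. x ^ n /\<^sub>R fact n)"
  have times_S: "x * S x n = real (Suc n) *\<^sub>R S x (Suc n)" for x n
    unfolding S_def by (simp del: mult_Suc)
  have S_comm: "y * S x n = S x n * y" for n
    using power_commuting_commutes[OF comm, of n] by (simp add: S_def)
  have "real (Suc n) *\<^sub>R S (x + y) (Suc n) = (x + y) * (\<Sum>i\<le>n. S x i * S y (n - i))"
    using Suc times_S[of "x + y" n] by (simp add: S_def)
  also have "\<dots> = (\<Sum>i\<le>n. (x * S x i) * S y (n - i)) + (\<Sum>i\<le>n. S x i * (y * S y (n - i)))"
    by (simp add: distrib_right sum_distrib_left sum.distrib S_comm flip: mult.assoc)
  also have "\<dots> = (\<Sum>i\<le>n. real (Suc i) *\<^sub>R (S x (Suc i) * S y (n - i)))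
                + (\<Sum>i\<le>n. real (Suc n - i) *\<^sub>R (S x i * S y (Suc n - i)))"
    by (simp add: times_S Suc_diff_le)
  also have "(\<Sum>i\<le>n. real (Suc i) *\<^sub>R (S x (Suc i) * S y (n - i)))
           = (\<Sum>i\<le>Suc n. real i *\<^sub>R (S x i * S y (Suc n - i)))"
    by (subst sum.atMost_Suc_shift) simp
  also have "(\<Sum>i\<le>n. real (Suc n - i) *\<^sub>R (S x i * S y (Suc n - i)))
           = (\<Sum>i\<le>Suc n. real (Suc n - i) *\<^sub>R (S x i * S y (Suc n - i)))"
    by simp
  also have "(\<Sum>i\<le>Suc n. real i *\<^sub>R (S x i * S y (Suc n - i)))
           + (\<Sum>i\<le>Suc n. real (Suc n - i) *\<^sub>R (S x i * S y (Suc n - i)))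
           = (\<Sum>i\<le>Suc n. real (Suc n) *\<^sub>R (S x i * S y (Suc n - i)))"
    by (simp flip: sum.distrib scaleR_add_left of_nat_add)
  also have "\<dots> = real (Suc n) *\<^sub>R (\<Sum>i\<le>Suc n. S x i * S y (Suc n - i))"
    by (simp only: scaleR_right.sum)
  finally have "S (x + y) (Suc n) = (\<Sum>i\<le>Suc n. S x i * S y (Suc n - i))"
    by (simp del: sum.cl_ivl_Suc)
  then show ?case unfolding S_def .
qed

lemma bexp_add: "x * y = y * x \<Longrightarrow> bexp (x + y) = bexp x * bexp y"
  unfolding bexp_def
  by (simp only: Cauchy_product[OF summable_norm_bexp summable_norm_bexp] bexp_series_add)

lemma bexp_zero: "bexp 0 = 1"
proof -
  have "(\<lambda>n. (0 :: 'a bop) ^ n /\<^sub>R fact n) sums (\<Sum>n\<in>{0}. (0 :: 'a bop) ^ n /\<^sub>R fact n)"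
    by (rule sums_finite) (auto simp: gr0_conv_Suc)
  then show ?thesis using sums_unique2[OF bexp_sums[of 0]] by simp
qed

lemma bexp_commute: "x * y = y * x \<Longrightarrow> bexp x * y = y * bexp x"
proof -
  assume "x * y = y * x"
  then have *: "x ^ n * y = y * x ^ n" for n by (simp add: power_commuting_commutes)
  have "(\<lambda>n. (x ^ n /\<^sub>R fact n) * y) sums (bexp x * y)"
    by (rule sums_mult2[OF bexp_sums])
  moreover have "(\<lambda>n. y * (x ^ n /\<^sub>R fact n)) sums (y * bexp x)"
    by (rule sums_mult[OF bexp_sums])
  ultimately show ?thesis by (simp add: * sums_unique2)
qed

lemma adj_bexp: "adj (bexp S) = bexp (adj S)"
  using bounded_linear.sums[OF bounded_linear_adj bexp_sums[of S]] bexp_sums[of "adj S"]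
  by (simp add: adj_simps sums_unique2)

lemma norm_bexp_skew: "adj K = - K \<Longrightarrow> norm (bexp K) \<le> 1"
proof -
  assume K: "adj K = - K"
  have "bexp (- K) * bexp K = bexp (- K + K)" by (rule bexp_add[symmetric]) simp
  then have "adj (bexp K) * bexp K = 1" by (simp add: adj_bexp K bexp_zero)
  then have "(norm (bexp K))\<^sup>2 \<le> 1" using norm_adj_mult[of "bexp K"] norm_one_bop_le by metis
  then show ?thesis by (simp add: power_le_one_iff)
qed

lemma scaleC_power_bop: "(c *\<^sub>C (S :: 'a::hilbert_space bop)) ^ n = c ^ n *\<^sub>C S ^ n"
  by (induction n) (auto simp: scaleC_mult_left scaleC_mult_right scaleC_scaleC mult.commute)

text \<open>By Liouville's theorem the function is constant, so its derivative at \<open>0\<close> vanishes.\<close>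

lemma entire_bounded_coeff_1:
  fixes c :: "nat \<Rightarrow> complex"
  assumes "\<And>z. (\<lambda>k. c k * z ^ k) sums F z" "\<And>z. cmod (F z) \<le> B"
  shows "c 1 = 0"
proof -
  have F: "F = (\<lambda>z. \<Sum>k. c k * z ^ k)" using assms(1) sums_unique by blast
  have D: "(F has_field_derivative (\<Sum>n. diffs c n * z ^ n)) (at z)" for z
    unfolding F by (rule termdiffs_strong_converges_everywhere) (use assms(1) sums_summable in blast)
  then have "F holomorphic_on UNIV"
    by (intro holomorphic_onI) (metis DERIV_subset field_differentiable_def subset_UNIV)
  moreover have "bounded (range F)" using assms(2) by (auto simp: bounded_iff)
  ultimately have "F constant_on UNIV" by (rule Liouville_theorem)
  then obtain a where "F = (\<lambda>_. a)" by (auto simp: constant_on_def)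
  then have "(F has_field_derivative 0) (at 0)" by simp
  then have "(\<Sum>n. diffs c n * 0 ^ n) = 0" using D[of 0] DERIV_unique by blast
  then show ?thesis by (simp add: powser_zero diffs_def)
qed

text \<open>Fuglede's theorem by Rosenblum's argument: the entire function
  \<open>e\<^bsup>z N*\<^esup> M e\<^bsup>-z N*\<^esup>\<close> is bounded, because \<open>M\<close> may be conjugated by \<open>e\<^bsup>-cnj z N\<^esup>\<close> first, and
  the combined exponentials are unitary.  Its linear coefficient is the commutator.\<close>

theorem Fuglede:
  fixes N M :: "'a::hilbert_space bop"
  assumes N: "normal_op N" and NM: "N * M = M * N"
  shows "adj N * M = M * adj N"
proof -
  define S where "S = adj N"
  have SN: "S * N = N * S" using N by (simp add: normal_op_def S_def)
  define s where "s k = S ^ k /\<^sub>R fact k" for k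
  define c where "c k = (\<Sum>i\<le>k. s i * M * ((- 1) ^ (k - i) *\<^sub>C s (k - i)))" for k
  define F where "F z = bexp (z *\<^sub>C S) * M * bexp (- z *\<^sub>C S)" for z
  have sz: "(z *\<^sub>C S) ^ k /\<^sub>R fact k = z ^ k *\<^sub>C s k" for z k
    by (simp add: s_def scaleC_power_bop scaleR_eq_scaleC scaleC_scaleC mult.commute)
  have Fsums: "(\<lambda>k. z ^ k *\<^sub>C c k) sums F z" for z
  proof -
    have a: "summable (\<lambda>k. norm ((z ^ k *\<^sub>C s k) * M))"
    proof (rule summable_comparison_test'[where N = 0])
      show "summable (\<lambda>k. norm (z ^ k *\<^sub>C s k) * norm M)"
        using summable_mult2[OF summable_norm_bexp[of "z *\<^sub>C S"], of "norm M"] by (simp only: sz)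
      show "norm (norm ((z ^ k *\<^sub>C s k) * M)) \<le> norm (z ^ k *\<^sub>C s k) * norm M" for k
        by (simp add: norm_mult_ineq)
    qed
    have b: "summable (\<lambda>k. norm ((- z) ^ k *\<^sub>C s k))"
      using summable_norm_bexp[of "(- z) *\<^sub>C S"] by (simp only: sz)
    have A: "(\<Sum>k. (z ^ k *\<^sub>C s k) * M) = bexp (z *\<^sub>C S) * M"
      using sums_mult2[OF bexp_sums[of "z *\<^sub>C S"], of M] unfolding sz by (rule sums_unique[symmetric])
    have B: "(\<Sum>k. (- z) ^ k *\<^sub>C s k) = bexp (- z *\<^sub>C S)"
      using bexp_sums[of "(- z) *\<^sub>C S"] unfolding sz by (rule sums_unique[symmetric])
    have coeff: "(\<Sum>i\<le>k. ((z ^ i *\<^sub>C s i) * M) * ((- z) ^ (k - i) *\<^sub>C s (k - i))) = z ^ k *\<^sub>C c k" for k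
    proof -
      have "((z ^ i *\<^sub>C s i) * M) * ((- z) ^ (k - i) *\<^sub>C s (k - i))
          = z ^ k *\<^sub>C (s i * M * ((- 1) ^ (k - i) *\<^sub>C s (k - i)))" if "i \<le> k" for i
      proof -
        have "z ^ k = z ^ i * z ^ (k - i)" using that by (simp flip: power_add)
        then show ?thesis
          by (simp add: scaleC_mult_left scaleC_mult_right scaleC_scaleC power_minus[of z] mult_ac)
      qed
      then show ?thesis by (simp add: c_def scaleC_sum_right)
    qed
    show ?thesis
      using Cauchy_product_sums[OF a b] unfolding coeff A B F_def .
  qed
  have Fbound: "norm (F z) \<le> norm M" for z
  proof -
    define G where "G = bexp ((- cnj z) *\<^sub>C N)"
    define G' where "G' = bexp (cnj z *\<^sub>C N)"
    define K where "K = z *\<^sub>C S + (- cnj z) *\<^sub>C N"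
    have GG: "G * G' = 1"
    proof -
      have "G * G' = bexp ((- cnj z) *\<^sub>C N + cnj z *\<^sub>C N)"
        unfolding G_def G'_def by (rule bexp_add[symmetric]) (simp add: scaleC_mult_left scaleC_mult_right scaleC_scaleC mult.commute)
      then show ?thesis by (simp add: scaleC_minus_left bexp_zero)
    qed
    have "G * M = M * G"
      unfolding G_def by (rule bexp_commute) (simp add: scaleC_mult_left scaleC_mult_right NM)
    then have "M = G * M * G'" using GG by (metis mult.assoc mult_1_right)
    then have "F z = (bexp (z *\<^sub>C S) * G) * M * (G' * bexp (- z *\<^sub>C S))"
      unfolding F_def by (metis mult.assoc)
    also have "bexp (z *\<^sub>C S) * G = bexp K"
      unfolding G_def K_def by (rule bexp_add[symmetric]) (simp add: scaleC_mult_left scaleC_mult_right scaleC_scaleC SN mult.commute)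
    also have "G' * bexp (- z *\<^sub>C S) = bexp (- K)"
    proof -
      have "G' * bexp (- z *\<^sub>C S) = bexp (cnj z *\<^sub>C N + (- z) *\<^sub>C S)"
        unfolding G'_def by (rule bexp_add[symmetric]) (simp add: scaleC_mult_left scaleC_mult_right scaleC_scaleC SN mult.commute)
      then show ?thesis by (simp add: K_def scaleC_minus_left)
    qed
    finally have FK: "F z = bexp K * M * bexp (- K)" .
    have aK: "adj K = - K" by (simp add: K_def adj_simps S_def scaleC_minus_left)
    have "norm (F z) \<le> norm (bexp K) * norm M * norm (bexp (- K))"
      unfolding FK by (meson mult_right_mono norm_ge_zero norm_mult_ineq order_trans)
    also have "\<dots> \<le> 1 * norm M * 1"
      by (intro mult_mono norm_bexp_skew) (auto simp: aK adj_uminus)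
    finally show ?thesis by simp
  qed
  have "app (c 1) x = 0" for x
  proof (rule cinner_eqI)
    fix y
    have bl: "bounded_linear (\<lambda>T :: 'a bop. cinner (app T x) y)"
    proof (rule bounded_linear_intro)
      fix T :: "'a bop"
      have "norm (cinner (app T x) y) \<le> norm (app T x) * norm y" by (rule cinner_Cauchy_Schwarz)
      also have "\<dots> \<le> (norm T * norm x) * norm y" by (intro mult_right_mono norm_app_le) simp
      finally show "norm (cinner (app T x) y) \<le> norm T * (norm x * norm y)" by (simp add: mult_ac)
    qed (auto simp: app_simps cinner_simps scaleR_conv_of_real)
    have "cinner (app (c 1) x) y = 0"
    proof (rule entire_bounded_coeff_1)
      show "(\<lambda>k. cinner (app (c k) x) y * z ^ k) sums cinner (app (F z) x) y" for z
        using bounded_linear.sums[OF bl Fsums[of z]] by (simp add: app_simps cinner_simps mult.commute)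
      show "cmod (cinner (app (F z) x) y) \<le> norm M * norm x * norm y" for z
      proof -
        have "cmod (cinner (app (F z) x) y) \<le> norm (app (F z) x) * norm y" by (rule cinner_Cauchy_Schwarz)
        also have "\<dots> \<le> norm (F z) * norm x * norm y" by (intro mult_right_mono norm_app_le) simp
        also have "\<dots> \<le> norm M * norm x * norm y" by (intro mult_right_mono Fbound) auto
        finally show ?thesis .
      qed
    qed
    then show "cinner (app (c 1) x) y = cinner 0 y" by simp
  qed
  then have "c 1 = 0" by (intro bop_eqI) (simp add: app_zero)
  moreover have "c 1 = S * M - M * S"
    by (simp add: c_def s_def scaleC_minus1 scaleC_minus_right scaleC_mult_right)
  ultimately show ?thesis by (simp add: S_def)
qed


section \<open>Polynomials in commuting normal contractions\<close>

lemma commute_prod_list: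
  "(\<And>x. x \<in> set xs \<Longrightarrow> C * x = x * C) \<Longrightarrow> C * prod_list xs = prod_list xs * (C :: 'a::monoid_mult)"
  by (induction xs) (simp, metis list.set_intros mult.assoc prod_list.Cons)

lemma op_monomial_commute:
  assumes "\<And>i. C * X i = X i * C"
  shows "C * op_monomial X k = op_monomial X k * C"
  unfolding op_monomial_def
  by (rule commute_prod_list) (auto simp: power_commuting_commutes[symmetric] assms intro: power_commuting_commutes)

lemma op_monomial_add:
  assumes X: "commuting X"
  shows "op_monomial X (\<lambda>i. k i + l i) = op_monomial X k * op_monomial X l"
proof -
  have "prod_list (map (\<lambda>i. X i ^ (k i + l i)) L)
      = prod_list (map (\<lambda>i. X i ^ k i) L) * prod_list (map (\<lambda>i. X i ^ l i) L)" for L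
  proof (induction L)
    case (Cons j L)
    have "X j ^ l j * prod_list (map (\<lambda>i. X i ^ k i) L) = prod_list (map (\<lambda>i. X i ^ k i) L) * X j ^ l j"
    proof (rule commute_prod_list)
      fix x assume "x \<in> set (map (\<lambda>i. X i ^ k i) L)"
      then obtain i where "x = X i ^ k i" by auto
      moreover have "X j ^ l j * X i = X i * X j ^ l j"
        using X by (intro power_commuting_commutes) (simp add: commuting_def)
      ultimately show "X j ^ l j * x = x * X j ^ l j"
        using power_commuting_commutes[of "X i" "X j ^ l j" "k i"] by simp
    qed
    then have "X j ^ k j * (X j ^ l j * prod_list (map (\<lambda>i. X i ^ k i) L)) * prod_list (map (\<lambda>i. X i ^ l i) L)
        = X j ^ k j * (prod_list (map (\<lambda>i. X i ^ k i) L) * X j ^ l j) * prod_list (map (\<lambda>i. X i ^ l i) L)"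
      by simp
    then show ?case using Cons by (simp add: power_add mult.assoc)
  qed simp
  then show ?thesis by (simp add: op_monomial_def)
qed

lemma op_monomial_zero: "op_monomial X (\<lambda>_. 0) = 1"
proof -
  have "prod_list (map (\<lambda>i. X i ^ 0) L) = 1" for L by (induction L) auto
  then show ?thesis by (simp add: op_monomial_def)
qed

lemma op_monomial_single: "op_monomial X (\<lambda>i. if i = j then m else 0) = X j ^ m"
proof -
  have "prod_list (map (\<lambda>i. X i ^ (if i = j then m else 0)) L) = (if j \<in> set L then X j ^ m else 1)"
    if "distinct L" for L using that by (induction L) auto
  then show ?thesis by (simp add: op_monomial_def)
qed

lemma norm_op_monomial_le:
  assumes "\<And>i. contraction (X i)"
  shows "norm (op_monomial X k) \<le> 1"
proof -
  have "norm (prod_list (map (\<lambda>i. X i ^ k i) L)) \<le> 1" for L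
  proof (induction L)
    case (Cons i L)
    have "norm (X i ^ k i) \<le> 1"
      using norm_power_bop_le[of "X i" "k i"] assms[of i] by (simp add: contraction_def) (meson norm_ge_zero order_trans power_le_one)
    then have "norm (X i ^ k i) * norm (prod_list (map (\<lambda>i. X i ^ k i) L)) \<le> 1 * 1"
      by (intro mult_mono Cons) auto
    then show ?case using norm_mult_ineq order_trans by fastforce
  qed (simp add: norm_one_bop_le)
  then show ?thesis by (simp add: op_monomial_def)
qed

text \<open>\<open>polyrel X d p P\<close>: \<open>p\<close> is a polynomial function of degree at most \<open>d\<close> in each variable, and
  \<open>P\<close> is the value of the same polynomial expression at the operators \<open>X\<close>.  As a relation it is
  closed under sums and products without any normal form for polynomials; that \<open>p\<close> determines \<open>P\<close>
  is a consequence of \<open>polyrel_coeff\<close> below.\<close>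

inductive polyrel :: "('n::{finite,linorder} \<Rightarrow> 'a::hilbert_space bop) \<Rightarrow> nat \<Rightarrow>
    (('n \<Rightarrow> complex) \<Rightarrow> complex) \<Rightarrow> 'a bop \<Rightarrow> bool" for X d where
  mono: "(\<And>i. k i \<le> d) \<Longrightarrow> polyrel X d (\<lambda>z. c * (\<Prod>i\<in>UNIV. z i ^ k i)) (c *\<^sub>C op_monomial X k)"
| add: "polyrel X d p P \<Longrightarrow> polyrel X d q Q \<Longrightarrow> polyrel X d (\<lambda>z. p z + q z) (P + Q)"

lemma polyrel_zero: "polyrel X d (\<lambda>z. 0) 0"
  using polyrel.mono[of "\<lambda>_. 0" d X 0] by simp

lemma polyrel_sum:
  assumes "finite F" "\<And>k i. k \<in> F \<Longrightarrow> k i \<le> d"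
  shows "polyrel X d (\<lambda>z. \<Sum>k\<in>F. c k * (\<Prod>i\<in>UNIV. z i ^ k i)) (\<Sum>k\<in>F. c k *\<^sub>C op_monomial X k)"
  using assms
proof (induction F rule: finite_induct)
  case empty
  then show ?case by (simp add: polyrel_zero)
next
  case (insert k F)
  have "polyrel X d (\<lambda>z. c k * (\<Prod>i\<in>UNIV. z i ^ k i)) (c k *\<^sub>C op_monomial X k)"
    by (rule polyrel.mono) (use insert in auto)
  from polyrel.add[OF this insert.IH] show ?case using insert by simp
qed

lemma polyrel_mult:
  assumes X: "commuting X" and p: "polyrel X d p P" and q: "polyrel X e q Q"
  shows "polyrel X (d + e) (\<lambda>z. p z * q z) (P * Q)"
  using p
proof (induction rule: polyrel.induct)
  case (mono k c)
  show ?case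
    using q
  proof (induction rule: polyrel.induct)
    case (mono l b)
    have "polyrel X (d + e) (\<lambda>z. (c * b) * (\<Prod>i\<in>UNIV. z i ^ (k i + l i))) ((c * b) *\<^sub>C op_monomial X (\<lambda>i. k i + l i))"
      by (rule polyrel.mono) (use mono \<open>\<And>i. k i \<le> d\<close> in \<open>auto intro: add_mono\<close>)
    then show ?case
      by (simp add: op_monomial_add[OF X] power_add prod.distrib scaleC_mult_left scaleC_mult_right scaleC_scaleC mult_ac)
  next
    case (add q Q q' Q')
    from polyrel.add[OF add.IH] show ?case by (simp add: distrib_left)
  qed
next
  case (add p P p' P')
  from polyrel.add[OF add.IH] show ?case by (simp add: distrib_right)
qed

lemma polyrel_const: "polyrel X 0 (\<lambda>z. c) (c *\<^sub>C 1)"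
  using polyrel.mono[of "\<lambda>_. 0" 0 X c] by (simp add: op_monomial_zero)

lemma polyrel_monomial:
  "(\<And>i. k i \<le> d) \<Longrightarrow> polyrel X d (\<lambda>z. \<Prod>i\<in>UNIV. z i ^ k i) (op_monomial X k)"
  using polyrel.mono[of k d X 1] by simp

lemma polyrel_power:
  assumes X: "commuting X" and p: "polyrel X d p P"
  shows "polyrel X (m * d) (\<lambda>z. p z ^ m) (P ^ m)"
proof (induction m)
  case 0
  then show ?case using polyrel_const[of X 1] by simp
next
  case (Suc m)
  from polyrel_mult[OF X p this] show ?case by simp
qed

lemma polyrel_commute:
  assumes "polyrel X d p P" "\<And>i. C * X i = X i * C"
  shows "C * P = P * C"
  using assms
  by (induction rule: polyrel.induct)
    (auto simp: scaleC_mult_left scaleC_mult_right op_monomial_commute algebra_simps)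

text \<open>The coefficients of a polynomial are recovered from its values at roots of unity.\<close>

definition unity_root :: "nat \<Rightarrow> nat \<Rightarrow> complex" where
  "unity_root M l = cis (2 * pi * real l / real M)"

lemma unity_root_orthogonal:
  assumes "j < M" "k < M"
  shows "(\<Sum>l<M. unity_root M l ^ j * cnj (unity_root M l) ^ k) = (if j = k then of_nat M else 0)"
proof -
  define q where "q = cis (2 * pi * (real j - real k) / real M)"
  have eq: "unity_root M l ^ j * cnj (unity_root M l) ^ k = q ^ l" for l
    using assms by (simp add: unity_root_def q_def cis_cnj Complex.DeMoivre cis_mult field_simps)
  show ?thesis
  proof (cases "j = k")
    case True
    then show ?thesis unfolding eq by (simp add: q_def)
  next
    case False
    have "q \<noteq> 1"
    proof
      assume "q = 1"
      then have "cos (2 * pi * (real j - real k) / real M) = 1" by (simp add: q_def complex_eq_iff)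
      then obtain n :: int where "2 * pi * (real j - real k) / real M = of_int n * 2 * pi"
        using cos_one_2pi_int by blast
      then have "2 * pi * ((real j - real k) / real M) = 2 * pi * of_int n" by (simp add: mult_ac)
      then have "(real j - real k) / real M = of_int n" by (subst (asm) mult_cancel_left) simp
      then have "real j - real k = of_int n * real M" using assms by (simp add: field_simps)
      then have "of_int (int j - int k) = (of_int (n * int M) :: real)" by simp
      then have "int j - int k = n * int M" by (subst (asm) of_int_eq_iff)
      moreover have "\<bar>int j - int k\<bar> < int M" using assms by auto
      moreover have "n \<noteq> 0" using False calculation(1) by auto
      ultimately show False
        by (metis abs_mult abs_of_nat linorder_not_less mult_le_cancel_right1 of_nat_0_le_iff zero_less_abs_iff int_one_le_iff_zero_less)
    qed
    moreover have "q ^ M = 1"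
    proof -
      have "q ^ M = cis (2 * pi * (real j - real k))" using assms by (simp add: q_def Complex.DeMoivre)
      also have "\<dots> = cis (2 * pi * real j) * cnj (cis (2 * pi * real k))"
        by (simp add: cis_cnj cis_mult algebra_simps)
      finally show ?thesis by (simp add: cis_multiple_2pi)
    qed
    ultimately show ?thesis using False by (simp add: eq geometric_sum)
  qed
qed

text \<open>The discrete Fourier coefficient of \<open>p\<close> over the \<open>M\<close>-th roots of unity in each variable.\<close>

definition polycoeff :: "nat \<Rightarrow> (('n::finite \<Rightarrow> complex) \<Rightarrow> complex) \<Rightarrow> ('n \<Rightarrow> nat) \<Rightarrow> complex" where
  "polycoeff M p k = (\<Sum>w\<in>PiE UNIV (\<lambda>_. {..<M}). p (\<lambda>i. unity_root M (w i)) *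
      (\<Prod>i\<in>UNIV. cnj (unity_root M (w i)) ^ k i)) / of_nat M ^ CARD('n)"

lemma polycoeff_monomial:
  fixes k l :: "'n::finite \<Rightarrow> nat"
  assumes "\<And>i. k i < M" "\<And>i. l i < M"
  shows "polycoeff M (\<lambda>z. c * (\<Prod>i\<in>UNIV. z i ^ l i)) k = (if l = k then c else 0)"
proof -
  have "(\<Sum>w\<in>PiE UNIV (\<lambda>_. {..<M}). c * (\<Prod>i\<in>UNIV. unity_root M (w i) ^ l i) *
      (\<Prod>i\<in>UNIV. cnj (unity_root M (w i)) ^ k i))
    = c * (\<Sum>w\<in>PiE UNIV (\<lambda>_. {..<M}). \<Prod>i\<in>UNIV. unity_root M (w i) ^ l i * cnj (unity_root M (w i)) ^ k i)"
    by (simp add: sum_distrib_left prod.distrib mult.assoc)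
  also have "\<dots> = c * (\<Prod>i\<in>UNIV. \<Sum>r<M. unity_root M r ^ l i * cnj (unity_root M r) ^ k i)"
    by (subst prod_sum_PiE) auto
  also have "\<dots> = c * (\<Prod>i\<in>(UNIV :: 'n set). if l i = k i then of_nat M else 0)"
    by (simp add: unity_root_orthogonal assms)
  also have "\<dots> = (if l = k then c * of_nat M ^ CARD('n) else 0)"
    by (auto simp: fun_eq_iff)
  finally show ?thesis using assms(1)[of undefined] by (simp add: polycoeff_def)
qed

lemma polyrel_coeff:
  fixes X :: "'n::{finite,linorder} \<Rightarrow> 'a::hilbert_space bop"
  assumes "polyrel X d p P"
  shows "P = (\<Sum>k\<in>PiE UNIV (\<lambda>_. {..d}). polycoeff (Suc d) p k *\<^sub>C op_monomial X k)"
  using assms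
proof (induction rule: polyrel.induct)
  case (mono l c)
  have "(\<Sum>k\<in>PiE UNIV (\<lambda>_. {..d}). polycoeff (Suc d) (\<lambda>z. c * (\<Prod>i\<in>UNIV. z i ^ l i)) k *\<^sub>C op_monomial X k)
      = (\<Sum>k\<in>PiE UNIV (\<lambda>_. {..d}). if k = l then c *\<^sub>C op_monomial X l else 0)"
  proof (rule sum.cong[OF refl])
    fix k :: "'n \<Rightarrow> nat" assume "k \<in> PiE UNIV (\<lambda>_. {..d})"
    then have "polycoeff (Suc d) (\<lambda>z. c * (\<Prod>i\<in>UNIV. z i ^ l i)) k = (if l = k then c else 0)"
      by (intro polycoeff_monomial) (use mono in \<open>auto simp: less_Suc_eq_le\<close>)
    then show "polycoeff (Suc d) (\<lambda>z. c * (\<Prod>i\<in>UNIV. z i ^ l i)) k *\<^sub>C op_monomial X k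
        = (if k = l then c *\<^sub>C op_monomial X l else 0)" by auto
  qed
  then show ?case using mono by (simp add: finite_PiE PiE_iff)
next
  case (add p P q Q)
  have "polycoeff (Suc d) (\<lambda>z. p z + q z) k = polycoeff (Suc d) p k + polycoeff (Suc d) q k" for k
    by (simp add: polycoeff_def distrib_right sum.distrib add_divide_distrib)
  then show ?case by (subst add.IH(1), subst add.IH(2)) (simp add: scaleC_add_left sum.distrib)
qed

text \<open>By the Fourier formula each of the \<open>(d + 1)\<^bsup>n\<^esup>\<close> coefficients is at most the supremum of \<open>p\<close> on the
  torus, and every monomial in contractions has norm at most \<open>1\<close>.\<close>

lemma polyrel_norm_crude:
  fixes X :: "'n::{finite,linorder} \<Rightarrow> 'a::hilbert_space bop"
  assumes p: "polyrel X d p P" and X: "\<And>i. contraction (X i)"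
    and s: "\<And>z. (\<And>i. cmod (z i) = 1) \<Longrightarrow> cmod (p z) \<le> s"
  shows "norm P \<le> real (Suc d) ^ CARD('n) * s"
proof -
  have coeff: "cmod (polycoeff (Suc d) p k) \<le> s" for k
  proof -
    have "cmod (\<Sum>w\<in>PiE UNIV (\<lambda>_. {..<Suc d}). p (\<lambda>i. unity_root (Suc d) (w i)) *
        (\<Prod>i\<in>UNIV. cnj (unity_root (Suc d) (w i)) ^ k i))
      \<le> (\<Sum>w\<in>PiE (UNIV :: 'n set) (\<lambda>_. {..<Suc d}). s)"
      by (rule order_trans[OF norm_sum sum_mono])
        (auto simp: norm_mult norm_power unity_root_def simp flip: prod_norm intro!: s)
    also have "\<dots> = real (Suc d) ^ CARD('n) * s" by (simp add: card_PiE)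
    finally show ?thesis by (simp add: polycoeff_def norm_divide norm_power field_simps del: of_nat_Suc)
  qed
  have "norm P \<le> (\<Sum>k\<in>PiE (UNIV :: 'n set) (\<lambda>_. {..d}). s)"
  proof (subst polyrel_coeff[OF p], rule order_trans[OF norm_sum sum_mono])
    fix k
    have "norm (polycoeff (Suc d) p k *\<^sub>C op_monomial X k) \<le> s * 1"
      unfolding norm_scaleC_bop by (intro mult_mono coeff norm_op_monomial_le X) (use coeff norm_ge_zero order_trans in blast)+
    then show "norm (polycoeff (Suc d) p k *\<^sub>C op_monomial X k) \<le> s" by simp
  qed
  then show ?thesis by (simp add: card_PiE)
qed

text \<open>Squaring: \<open>\<parallel>T\<^sup>2\<parallel>\<^sup>2 = \<parallel>(T\<^sup>2)\<^sup>* T\<^sup>2\<parallel> = \<parallel>(T\<^sup>* T)\<^sup>2\<parallel> = \<parallel>T\<^sup>* T\<parallel>\<^sup>2 = \<parallel>T\<parallel>\<^sup>4\<close> by normality and the C*-identity.\<close>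

lemma norm_normal_power:
  assumes "normal_op T"
  shows "norm (T ^ 2 ^ r) = norm T ^ 2 ^ r"
  using assms
proof (induction r arbitrary: T)
  case (Suc r)
  have n: "adj T * T = T * adj T" using Suc.prems by (simp add: normal_op_def)
  have 1: "adj (T * T) * (T * T) = (adj T * T) * (adj T * T)"
    by (simp add: adj_mult) (metis n mult.assoc)
  have 2: "adj (adj T * T) = adj T * T" by (simp add: adj_mult)
  have "(norm (T * T))\<^sup>2 = norm (adj (T * T) * (T * T))" by (rule norm_adj_mult[symmetric])
  also have "\<dots> = norm (adj (adj T * T) * (adj T * T))" by (simp only: 1 2)
  also have "\<dots> = (norm (adj T * T))\<^sup>2" by (rule norm_adj_mult)
  finally have "(norm (T * T))\<^sup>2 = (norm (adj T * T))\<^sup>2" .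
  then have TT: "norm (T * T) = (norm T)\<^sup>2"
    by (metis norm_adj_mult norm_ge_zero power2_eq_imp_eq)
  have "(T * T) * adj (T * T) = T * (T * adj T) * adj T" by (simp add: adj_mult mult.assoc)
  also have "\<dots> = T * (adj T * T) * adj T" by (simp only: n)
  also have "\<dots> = (T * adj T) * (T * adj T)" by (simp only: mult.assoc)
  also have "\<dots> = (adj T * T) * (adj T * T)" by (simp only: n)
  finally have "normal_op (T * T)" unfolding normal_op_def 1 by simp
  then have "norm ((T * T) ^ 2 ^ r) = norm (T * T) ^ 2 ^ r" by (rule Suc.IH)
  moreover have "T ^ 2 ^ Suc r = (T * T) ^ 2 ^ r" by (simp add: power_mult power2_eq_square)
  moreover have "norm T ^ 2 ^ Suc r = ((norm T)\<^sup>2) ^ 2 ^ r" by (simp add: power_mult)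
  ultimately show ?case by (simp only: TT)
qed simp

text \<open>By Fuglede's theorem every adjoint \<open>adj (X j)\<close> commutes with all \<open>X i\<close>, hence with \<open>P\<close>.\<close>

lemma polyrel_normal:
  assumes p: "polyrel X d p P" and X: "commuting X" "\<And>i. normal_op (X i)"
  shows "normal_op P"
proof -
  have "adj (X j) * X i = X i * adj (X j)" for i j
    by (rule Fuglede[OF X(2)]) (use X(1) in \<open>simp add: commuting_def\<close>)
  then have "adj (X j) * P = P * adj (X j)" for j by (rule polyrel_commute[OF p])
  then have "adj (adj (X j) * P) = adj (P * adj (X j))" for j by simp
  then have "adj P * X j = X j * adj P" for j by (simp add: adj_mult)
  then show ?thesis unfolding normal_op_def by (rule polyrel_commute[OF p])
qed

text \<open>Von Neumann's inequality for commuting normal contractions.  The crude bound by the sum of the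
  coefficients costs a factor polynomial in the degree, which disappears when it is applied to the
  powers \<open>P\<^bsup>m\<^esup>\<close>, because \<open>norm (P\<^bsup>m\<^esup>) = (norm P)\<^bsup>m\<^esup>\<close> for a normal \<open>P\<close>.\<close>

theorem polyrel_norm_le:
  fixes X :: "'n::{finite,linorder} \<Rightarrow> 'a::hilbert_space bop"
  assumes p: "polyrel X d p P"
    and X: "commuting X" "\<And>i. normal_op (X i)" "\<And>i. contraction (X i)"
    and s: "\<And>z. (\<And>i. cmod (z i) = 1) \<Longrightarrow> cmod (p z) \<le> s"
  shows "norm P \<le> s"
proof (rule ccontr)
  assume "\<not> norm P \<le> s"
  then have less: "s < norm P" by simp
  have s0: "0 \<le> s" using s[of "\<lambda>_. 1"] norm_ge_zero order_trans by (metis norm_one)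
  have bound: "norm P ^ 2 ^ r \<le> real (Suc (2 ^ r * d)) ^ CARD('n) * s ^ 2 ^ r" for r
  proof -
    have "norm (P ^ 2 ^ r) \<le> real (Suc (2 ^ r * d)) ^ CARD('n) * s ^ 2 ^ r"
      by (rule polyrel_norm_crude[OF polyrel_power[OF X(1) p] X(3)])
        (auto simp: norm_power intro!: power_mono s)
    then show ?thesis by (simp add: norm_normal_power[OF polyrel_normal[OF p X(1,2)]])
  qed
  show False
  proof (cases "s = 0")
    case True
    then show ?thesis using bound[of 0] less by simp
  next
    case False
    then have s1: "s > 0" using s0 by simp
    define n where "n = CARD('n)"
    have n0: "n > 0" by (simp add: n_def)
    \<comment> \<open>an \<open>n\<close>-th root turns the bound into \<open>q ^ 2 ^ r \<le> (d + 1) * 2 ^ r\<close>, absurd for large \<open>r\<close> since \<open>q > 1\<close>\<close>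
    define q where "q = root n (norm P / s)"
    have q1: "q > 1" using less s1 n0 by (simp add: q_def)
    have qn: "q ^ n = norm P / s" using n0 s1 by (simp add: q_def)
    have qb: "q ^ 2 ^ r \<le> real (d + 1) * real (2 ^ r)" for r
    proof -
      have "(q ^ 2 ^ r) ^ n = norm P ^ 2 ^ r / s ^ 2 ^ r"
        by (metis qn power_divide power_mult mult.commute)
      also have "\<dots> \<le> real (Suc (2 ^ r * d)) ^ n"
        using bound[of r] s1 by (simp add: divide_simps n_def)
      also have "\<dots> \<le> (real (d + 1) * real (2 ^ r)) ^ n"
        by (rule power_mono) (auto simp: algebra_simps)
      finally show ?thesis using n0 q1 by (subst (asm) power_mono_iff) auto
    qed
    have "(\<lambda>m. real m * inverse q ^ m) \<longlonglongrightarrow> 0"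
      using powser_times_n_limit_0[of "inverse q"] q1 by (simp add: inverse_less_1_iff)
    then have "(\<lambda>r. real (2 ^ r) * inverse q ^ (2 ^ r)) \<longlonglongrightarrow> 0"
      by (rule filterlim_compose) (rule filterlim_subseq, simp add: strict_mono_def)
    then have "\<forall>\<^sub>F r in sequentially. real (2 ^ r) * inverse q ^ (2 ^ r) < 1 / real (d + 1)"
      by (rule order_tendstoD) simp
    then obtain r where r: "real (2 ^ r) * inverse q ^ (2 ^ r) < 1 / real (d + 1)"
      using eventually_happens by force
    define Q where "Q = q ^ 2 ^ r"
    have Q: "Q > 0" using q1 by (simp add: Q_def)
    have "real (2 ^ r) * inverse Q < 1 / real (d + 1)"
      using r by (simp add: Q_def power_inverse)
    then have "real (d + 1) * real (2 ^ r) < Q"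
      using Q by (simp add: field_simps)
    then show False using qb[of r] by (simp add: Q_def)
  qed
qed

section \<open>Von Neumann inequalities\<close>

text \<open>Dilations are formulated for words in the operators, not for monomials.\<close>

lemma op_monomial_word:
  "op_monomial X k = prod_list (map X (concat (map (\<lambda>i. replicate (k i) i) (sorted_list_of_set UNIV))))"
proof -
  have rep: "prod_list (map X (replicate m i)) = X i ^ m" for m i by (induction m) auto
  have "prod_list (map (\<lambda>i. X i ^ k i) L) = prod_list (map X (concat (map (\<lambda>i. replicate (k i) i) L)))" for L
    by (induction L) (simp_all add: rep del: map_replicate)
  then show ?thesis by (simp add: op_monomial_def)
qed

lemma orth_proj_works:
  fixes J :: "'a::hilbert_space \<Rightarrow> 'b::hilbert_space"
  assumes J: "isometric_embedding J"
  shows "orth_proj (range J) v \<in> range J \<and> (\<forall>s\<in>range J. cinner (v - orth_proj (range J) v) s = 0)"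
  unfolding orth_proj_def
proof (rule theI')
  have add: "J (x + y) = J x + J y" and scale: "J (c *\<^sub>C x) = c *\<^sub>C J x" and nrm: "norm (J x) = norm x" for x y c
    using J by (auto simp: isometric_embedding_def)
  have diff: "J (x - y) = J x - J y" for x y
    using add[of x "(-1) *\<^sub>C y"] scale[of "-1" y] by (simp add: scaleC_minus1)
  have closed: "closed (range J)"
    unfolding closed_sequential_limits
  proof (intro allI impI, elim conjE)
    fix f l assume f: "\<forall>n. f n \<in> range J" "f \<longlonglongrightarrow> l"
    then have "\<forall>n. \<exists>x. f n = J x" by blast
    then obtain x where x: "\<And>n. f n = J (x n)" by metis
    have "Cauchy f" using f(2) LIMSEQ_imp_Cauchy by blast
    then have "Cauchy x" by (simp add: Cauchy_def dist_norm x nrm flip: diff)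
    then obtain y where y: "x \<longlonglongrightarrow> y" by (auto simp: Cauchy_convergent_iff convergent_def)
    have "f \<longlonglongrightarrow> J y"
      using y by (simp add: LIMSEQ_iff x nrm flip: diff)
    then show "l \<in> range J" using f(2) LIMSEQ_unique by blast
  qed
  have "\<exists>p\<in>range J. \<forall>s\<in>range J. cinner (v - p) s = 0"
  proof (rule projection_theorem[OF closed])
    show "0 \<in> range J" using scale[of 0 0] by (metis rangeI scaleC_zero_left)
  qed (auto simp flip: add scale)
  then obtain p where p: "p \<in> range J" "\<And>s. s \<in> range J \<Longrightarrow> cinner (v - p) s = 0" by blast
  show "\<exists>!p. p \<in> range J \<and> (\<forall>s\<in>range J. cinner (v - p) s = 0)"
  proof (rule ex1I[of _ p])
    fix q assume q: "q \<in> range J \<and> (\<forall>s\<in>range J. cinner (v - q) s = 0)"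
    have mem: "q - p \<in> range J" using q p(1) by (auto simp flip: diff)
    have "cinner (q - p) (q - p) = cinner (v - p) (q - p) - cinner (v - q) (q - p)"
      by (simp flip: cinner_diff_left)
    then have "cinner (q - p) (q - p) = 0" using p(2) q mem by simp
    then show "q = p" by (simp add: cinner_self)
  qed (use p in blast)
qed

text \<open>Up to the embedding \<open>J\<close>, the polynomial \<open>P\<close> in \<open>X\<close> is the compression of the same polynomial \<open>Q\<close> in
  the commuting normal contractions \<open>U\<close>, and compressing does not increase the norm.\<close>

theorem von_Neumann_inequality_dilatable:
  fixes X :: "'n::{finite,linorder} \<Rightarrow> 'h::hilbert_space bop"
  assumes dil: "admits_normal_dilation TYPE('k::hilbert_space) X" and F: "finite F"
    and s: "\<And>z. (\<And>i. cmod (z i) = 1) \<Longrightarrow> cmod (\<Sum>k\<in>F. c k * (\<Prod>i\<in>UNIV. z i ^ k i)) \<le> s"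
  shows "norm (\<Sum>k\<in>F. c k *\<^sub>C op_monomial X k) \<le> s"
proof -
  obtain J :: "'h \<Rightarrow> 'k" and U :: "'n \<Rightarrow> 'k bop" where
    J: "isometric_embedding J" and U: "commuting U" "\<And>i. normal_op (U i)" "\<And>i. contraction (U i)"
    and JU: "\<And>js x. J (app (prod_list (map X js)) x) = orth_proj (range J) (app (prod_list (map U js)) (J x))"
    using dil unfolding admits_normal_dilation_def by blast
  have add: "J (x + y) = J x + J y" and scale: "J (c *\<^sub>C x) = c *\<^sub>C J x" and nrm: "norm (J x) = norm x" for x y c
    using J by (auto simp: isometric_embedding_def)
  have sumJ: "J (\<Sum>k\<in>F. g k) = (\<Sum>k\<in>F. J (g k))" for g
  proof (induction F rule: infinite_finite_induct)
    have "J 0 = 0" using scale[of 0 0] by simp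
    then show "J (sum g {}) = (\<Sum>k\<in>{}. J (g k))" "\<And>A. infinite A \<Longrightarrow> J (sum g A) = (\<Sum>k\<in>A. J (g k))"
      by simp_all
  qed (simp add: add)
  obtain d where d: "\<And>k i. k \<in> F \<Longrightarrow> k i \<le> d"
  proof
    fix k i assume "k \<in> F"
    then show "k i \<le> Max ((\<lambda>(k, i). k i) ` (F \<times> UNIV))"
      using F by (intro Max_ge) (auto intro!: image_eqI[of _ _ "(k, i)"])
  qed
  define P where "P = (\<Sum>k\<in>F. c k *\<^sub>C op_monomial X k)"
  define Q where "Q = (\<Sum>k\<in>F. c k *\<^sub>C op_monomial U k)"
  have "polyrel U d (\<lambda>z. \<Sum>k\<in>F. c k * (\<Prod>i\<in>UNIV. z i ^ k i)) Q"
    unfolding Q_def by (rule polyrel_sum) (use F d in auto)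
  then have Q: "norm Q \<le> s" by (rule polyrel_norm_le[OF _ U s])
  then have s0: "0 \<le> s" using norm_ge_zero order_trans by blast
  have "norm (app P x) \<le> s * norm x" for x
  proof -
    define y where "y = J (app P x)"
    have "cinner (app Q (J x) - y) t = 0" if t: "t \<in> range J" for t
    proof -
      have "app Q (J x) - y = (\<Sum>k\<in>F. c k *\<^sub>C (app (op_monomial U k) (J x) - J (app (op_monomial X k) x)))"
        by (simp add: Q_def P_def y_def app_sum app_scaleC sumJ scale scaleC_diff_right sum_subtractf)
      moreover have "cinner (app (op_monomial U k) (J x) - J (app (op_monomial X k) x)) t = 0" for k
        unfolding op_monomial_word JU using orth_proj_works[OF J] t by blast
      ultimately show ?thesis by (simp add: cinner_sum_left cinner_scaleC_left)
    qed
    then have "cinner (app Q (J x) - y) y = 0" by (simp add: y_def)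
    then have "cinner (app Q (J x)) y = cinner y y" by (simp add: cinner_diff_left)
    then have "norm y * norm y \<le> norm (app Q (J x)) * norm y"
      using cinner_Cauchy_Schwarz[of "app Q (J x)" y] by (simp add: cinner_self power2_eq_square norm_mult)
    then have "norm y \<le> norm (app Q (J x))" by (cases "norm y = 0") auto
    also have "\<dots> \<le> norm Q * norm (J x)" by (rule norm_app_le)
    also have "\<dots> \<le> s * norm x" by (simp add: nrm mult_right_mono Q)
    finally show ?thesis by (simp add: y_def nrm)
  qed
  then show ?thesis unfolding P_def[symmetric] by (rule norm_bop_le[OF s0])
qed

text \<open>For self-adjoint contractions the supremum over the cube suffices: \<open>A i\<close> is the real part of
  the unitary \<open>U i = A i + \<i> (1 - A i\<^sup>2)\<^bsup>1/2\<^esup>\<close>, and multiplication by a unitary monomial turns the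
  Laurent polynomial \<open>p (Re z)\<close> into a polynomial in \<open>U\<close> without changing norms.\<close>

theorem von_Neumann_inequality_selfadjoint:
  fixes A :: "'n::{finite,linorder} \<Rightarrow> 'h::hilbert_space bop"
  assumes A: "commuting A" "\<And>i. contraction (A i)" "\<And>i. self_adjoint (A i)" and F: "finite F"
    and s: "\<And>x. (\<And>i. \<bar>x i\<bar> \<le> 1) \<Longrightarrow> cmod (\<Sum>k\<in>F. c k * of_real (\<Prod>i\<in>UNIV. x i ^ k i)) \<le> s"
  shows "norm (\<Sum>k\<in>F. c k *\<^sub>C op_monomial A k) \<le> s"
proof -
  have aA: "adj (A i) = A i" for i using A(3) by (simp add: self_adjoint_def)
  have cA: "A i * A j = A j * A i" for i j using A(1) by (simp add: commuting_def)
  have "positive_op (1 - A i * A i)" for i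
  proof -
    have "Re (cinner (app (A i * A i) x) x) \<le> (norm x)\<^sup>2" for x
    proof -
      have "Re (cinner (app (A i * A i) x) x) = (norm (app (A i) x))\<^sup>2" by (simp add: norm_power2_app aA)
      also have "\<dots> \<le> (norm x)\<^sup>2"
        using norm_app_le[of "A i" x] A(2)[of i] mult_right_mono[of "norm (A i)" 1 "norm x"]
        by (intro power_mono) (auto simp: contraction_def)
      finally show ?thesis .
    qed
    then show ?thesis by (simp add: positive_op_iff adj_simps aA app_minus app_one cinner_diff_left cinner_self)
  qed
  then have "\<exists>R. positive_op R \<and> R * R = 1 - A i * A i \<and>
      (\<forall>C. C * (1 - A i * A i) = (1 - A i * A i) * C \<longrightarrow> C * R = R * C)" for i
    by (rule positive_op_sqrt_exists)
  then obtain R where R: "\<And>i. positive_op (R i)" "\<And>i. R i * R i = 1 - A i * A i"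
      "\<And>i C. C * (1 - A i * A i) = (1 - A i * A i) * C \<Longrightarrow> C * R i = R i * C" by metis
  have aR: "adj (R i) = R i" for i using R(1) positive_opD by blast
  have cSq: "C * (1 - A i * A i) = (1 - A i * A i) * C" if "C * A i = A i * C" for C i
  proof -
    have "C * (A i * A i) = (A i * A i) * C" by (metis that mult.assoc)
    then show ?thesis by (simp add: algebra_simps)
  qed
  have cAR: "A j * R i = R i * A j" for i j by (rule R(3)[OF cSq[OF cA]])
  have cRR: "R j * R i = R i * R j" for i j by (rule R(3)[OF cSq[OF cAR[symmetric]]])
  define U where "U i = A i + \<i> *\<^sub>C R i" for i
  define U' where "U' i = A i - \<i> *\<^sub>C R i" for i
  have aU: "adj (U i) = U' i" for i
    by (simp add: U_def U'_def adj_simps aA aR scaleC_minus_left)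
  have UU': "U i * U' i = 1" and U'U: "U' i * U i = 1" for i
    using R(2)[of i] by (simp_all add: U_def U'_def algebra_simps scaleC_mult_left scaleC_mult_right
        cAR scaleC_scaleC scaleC_minus1 scaleC_minus_left scaleC_diff_right scaleC_add_right)
  have commU: "commuting U"
    by (simp add: commuting_def U_def algebra_simps scaleC_mult_left scaleC_mult_right cA cAR cRR scaleC_scaleC scaleC_add_right)
  have normalU: "normal_op (U i)" for i by (simp add: normal_op_def aU UU' U'U)
  have contrU: "contraction (U i)" for i
  proof -
    have "(norm (U i))\<^sup>2 \<le> 1" using norm_adj_mult[of "U i"] norm_one_bop_le[where 'a = 'h] by (simp add: aU U'U)
    then show ?thesis by (simp add: contraction_def power_le_one_iff)
  qed
  have cUA: "A j * U i = U i * A j" for i j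
    by (simp add: U_def algebra_simps scaleC_mult_left scaleC_mult_right cA cAR)
  define W where "W = op_monomial U (\<lambda>_. 1)"
  define w where "w z = (\<Prod>i\<in>(UNIV :: 'n set). z i)" for z :: "'n \<Rightarrow> complex"
  have cWA: "A j * W = W * A j" for j unfolding W_def by (rule op_monomial_commute) (rule cUA)
  \<comment> \<open>\<open>p (Re z)\<close> times the \<open>m\<close>-th power of \<open>w z = \<Prod>z i\<close> agrees on the torus with a polynomial \<open>q\<close>, whose value at \<open>U\<close> is \<open>W ^ m * P\<close>\<close>
  define good where "good = (\<lambda>m (p :: ('n \<Rightarrow> complex) \<Rightarrow> complex) P. \<exists>e q. polyrel U e q (W ^ m * P) \<and> P * W = W * P \<and>
      (\<forall>z. (\<forall>i. cmod (z i) = 1) \<longrightarrow> q z = w z ^ m * p (\<lambda>i. of_real (Re (z i)))))"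
  have polW: "polyrel U 1 (\<lambda>z. w z) W"
    using polyrel_monomial[of "\<lambda>_. 1" 1 U] by (simp add: w_def W_def)
  have good_const: "good 0 (\<lambda>z. c) (c *\<^sub>C 1)" for c
    unfolding good_def using polyrel_const[of U c]
    by (intro exI[of _ 0] exI[of _ "\<lambda>z. c"]) (auto simp: scaleC_mult_left scaleC_mult_right)
  have good_mult: "good (m + m') (\<lambda>z. p z * p' z) (P * P')" if "good m p P" "good m' p' P'" for m m' p p' P P'
  proof -
    from that obtain e q e' q' where *: "polyrel U e q (W ^ m * P)" "P * W = W * P" "polyrel U e' q' (W ^ m' * P')" "P' * W = W * P'"
        "\<And>z. (\<And>i. cmod (z i) = 1) \<Longrightarrow> q z = w z ^ m * p (\<lambda>i. of_real (Re (z i)))"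
        "\<And>z. (\<And>i. cmod (z i) = 1) \<Longrightarrow> q' z = w z ^ m' * p' (\<lambda>i. of_real (Re (z i)))"
      unfolding good_def by metis
    have "(W ^ m * P) * (W ^ m' * P') = W ^ (m + m') * (P * P')"
    proof -
      have "P * W ^ m' = W ^ m' * P" using *(2) by (metis power_commuting_commutes)
      then have "W ^ m * (P * W ^ m') * P' = W ^ m * (W ^ m' * P) * P'" by simp
      then show ?thesis by (simp add: power_add mult.assoc)
    qed
    moreover have "(P * P') * W = W * (P * P')"
    proof -
      have "(P * P') * W = P * (W * P')" by (simp add: mult.assoc *(4))
      also have "\<dots> = (P * W) * P'" by (simp add: mult.assoc)
      finally show ?thesis by (simp add: *(2) mult.assoc)
    qed
    ultimately show ?thesis
      unfolding good_def using polyrel_mult[OF commU *(1,3)]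
      by (intro exI[of _ "e + e'"] exI[of _ "\<lambda>z. q z * q' z"]) (auto simp: *(5,6) power_add mult_ac)
  qed
  have good_var: "good 1 (\<lambda>z. z j) (A j)" for j
  proof -
    have half: "A j = (1/2) *\<^sub>C (U j + U' j)"
      by (simp add: U_def U'_def scaleC_add_right scaleC_add_left[symmetric])
    define Wj where "Wj = op_monomial U (\<lambda>i. if i = j then 0 else 1)"
    have "W = op_monomial U (\<lambda>i. (if i = j then 0 else 1) + (if i = j then 1 else 0))"
      unfolding W_def by (rule arg_cong[of _ _ "op_monomial U"]) auto
    then have WWj: "W = Wj * U j"
      unfolding op_monomial_add[OF commU] Wj_def by (simp add: op_monomial_single)
    have "W * A j = (1/2) *\<^sub>C (W * U j + Wj)"
      by (simp add: half scaleC_mult_right distrib_left) (simp add: WWj mult.assoc UU')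
    then have WA: "W ^ 1 * A j = (1/2) *\<^sub>C 1 * (op_monomial U (\<lambda>i. if i = j then 2 else 1) + Wj)"
    proof -
      have "op_monomial U (\<lambda>i. if i = j then 2 else 1) = op_monomial U (\<lambda>i. 1 + (if i = j then 1 else 0))"
        by (rule arg_cong[of _ _ "op_monomial U"]) auto
      also have "\<dots> = W * U j" unfolding op_monomial_add[OF commU] W_def by (simp add: op_monomial_single)
      finally show ?thesis using \<open>W * A j = _\<close> by (simp add: scaleC_mult_left)
    qed
    define q where "q z = (1/2) * ((\<Prod>i\<in>UNIV. z i ^ (if i = j then 2 else 1)) + (\<Prod>i\<in>UNIV. z i ^ (if i = j then 0 else 1)))"
      for z :: "'n \<Rightarrow> complex"
    have "polyrel U (0 + 2) q (W ^ 1 * A j)"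
      unfolding WA Wj_def q_def
      by (intro polyrel_mult commU polyrel_const polyrel.add polyrel_monomial) auto
    moreover have "q z = w z ^ 1 * of_real (Re (z j))" if z: "\<forall>i. cmod (z i) = 1" for z
    proof -
      define r where "r = (\<Prod>i\<in>UNIV - {j}. z i)"
      have 1: "(\<Prod>i\<in>UNIV. z i ^ (if i = j then 2 else 1)) = (z j)\<^sup>2 * r"
        unfolding r_def by (subst prod.remove[of _ j]) (auto intro!: prod.cong)
      have 2: "(\<Prod>i\<in>UNIV. z i ^ (if i = j then 0 else 1)) = r"
        unfolding r_def by (subst prod.remove[of _ j]) (auto intro!: prod.cong)
      have 3: "w z = z j * r" unfolding r_def w_def by (subst prod.remove[of _ j]) auto
      have zz: "z j * cnj (z j) = 1" using z[rule_format, of j] by (metis complex_norm_square of_real_1 power_one)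
      have re: "of_real (Re (z j)) = (1/2) * (z j + cnj (z j))" by (simp add: complex_add_cnj)
      have "w z * of_real (Re (z j)) = (1/2) * ((z j)\<^sup>2 * r + (z j * cnj (z j)) * r)"
        unfolding 3 re by (simp add: power2_eq_square algebra_simps)
      then show ?thesis by (simp add: q_def 1 2 zz)
    qed
    ultimately show ?thesis unfolding good_def using cWA by blast
  qed
  have good_power: "\<exists>m. good m (\<lambda>z. z j ^ n) (A j ^ n)" for j n
  proof (induction n)
    case 0
    then show ?case using good_const[of 1] by auto
  next
    case (Suc n)
    then obtain m where "good m (\<lambda>z. z j ^ n) (A j ^ n)" by blast
    from good_mult[OF good_var this, of j] show ?case by auto
  qed
  have good_list: "\<exists>m. good m (\<lambda>z. prod_list (map (\<lambda>i. z i ^ k i) L)) (prod_list (map (\<lambda>i. A i ^ k i) L))" for k L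
  proof (induction L)
    case Nil
    then show ?case using good_const[of 1] by auto
  next
    case (Cons j L)
    then obtain m where m: "good m (\<lambda>z. prod_list (map (\<lambda>i. z i ^ k i) L)) (prod_list (map (\<lambda>i. A i ^ k i) L))" by blast
    obtain n where n: "good n (\<lambda>z. z j ^ k j) (A j ^ k j)" using good_power by blast
    from good_mult[OF n m] show ?case by auto
  qed
  have good_mono: "\<exists>m. good m (\<lambda>z. c * (\<Prod>i\<in>UNIV. z i ^ k i)) (c *\<^sub>C op_monomial A k)" for c k
  proof -
    obtain m where m: "good m (\<lambda>z. prod_list (map (\<lambda>i. z i ^ k i) (sorted_list_of_set UNIV))) (op_monomial A k)"
      using good_list unfolding op_monomial_def by blast
    have "prod_list (map (\<lambda>i. z i ^ k i) (sorted_list_of_set UNIV)) = (\<Prod>i\<in>UNIV. z i ^ k i)" for z :: "'n \<Rightarrow> complex"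
      using prod.distinct_set_conv_list[of "sorted_list_of_set (UNIV :: 'n set)" "\<lambda>i. z i ^ k i"] by simp
    with good_mult[OF good_const m, of c] show ?thesis by (auto simp: scaleC_mult_left)
  qed
  have good_Suc: "good (Suc m) p P" if "good m p P" for m p P
  proof -
    from that obtain e q where *: "polyrel U e q (W ^ m * P)" "P * W = W * P"
        "\<And>z. (\<And>i. cmod (z i) = 1) \<Longrightarrow> q z = w z ^ m * p (\<lambda>i. of_real (Re (z i)))"
      unfolding good_def by metis
    show ?thesis unfolding good_def using polyrel_mult[OF commU polW *(1)] *(2)
      by (intro exI[of _ "1 + e"] exI[of _ "\<lambda>z. w z * q z"]) (auto simp: *(3) mult_ac)
  qed
  have good_le: "good m' p P" if "good m p P" "m \<le> m'" for m m' p P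
    using that(2,1) by (induction rule: dec_induct) (auto intro: good_Suc)
  have good_add: "\<exists>m. good m (\<lambda>z. p z + p' z) (P + P')" if "good m p P" "good m' p' P'" for m m' p p' P P'
  proof -
    have "good (max m m') p P" "good (max m m') p' P'" using that by (auto intro: good_le)
    then obtain e q e' q' where *: "polyrel U e q (W ^ max m m' * P)" "P * W = W * P" "polyrel U e' q' (W ^ max m m' * P')" "P' * W = W * P'"
        "\<And>z. (\<And>i. cmod (z i) = 1) \<Longrightarrow> q z = w z ^ max m m' * p (\<lambda>i. of_real (Re (z i)))"
        "\<And>z. (\<And>i. cmod (z i) = 1) \<Longrightarrow> q' z = w z ^ max m m' * p' (\<lambda>i. of_real (Re (z i)))"
      unfolding good_def by metis
    have mon: "polyrel U b f T \<Longrightarrow> b \<le> b' \<Longrightarrow> polyrel U b' f T" for b b' f T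
      by (induction rule: polyrel.induct) (auto intro!: polyrel.intros intro: order_trans)
    have "polyrel U (max e e') (\<lambda>z. q z + q' z) (W ^ max m m' * P + W ^ max m m' * P')"
      by (intro polyrel.add mon[OF *(1)] mon[OF *(3)]) auto
    then show ?thesis
      unfolding good_def
      by (intro exI[of _ "max m m'"] exI[of _ "max e e'"] exI[of _ "\<lambda>z. q z + q' z"])
        (auto simp: *(2,4,5,6) distrib_left distrib_right)
  qed
  have "\<exists>m. good m (\<lambda>z. \<Sum>k\<in>F. c k * (\<Prod>i\<in>UNIV. z i ^ k i)) (\<Sum>k\<in>F. c k *\<^sub>C op_monomial A k)"
    using F
  proof (induction F rule: finite_induct)
    case empty
    then show ?case using good_const[of 0] by auto
  next
    case (insert k F)
    then obtain m where m: "good m (\<lambda>z. \<Sum>k\<in>F. c k * (\<Prod>i\<in>UNIV. z i ^ k i)) (\<Sum>k\<in>F. c k *\<^sub>C op_monomial A k)" by blast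
    obtain n where n: "good n (\<lambda>z. c k * (\<Prod>i\<in>UNIV. z i ^ k i)) (c k *\<^sub>C op_monomial A k)" using good_mono by blast
    from good_add[OF n m] show ?case using insert by simp
  qed
  then obtain m where m: "good m (\<lambda>z. \<Sum>k\<in>F. c k * (\<Prod>i\<in>UNIV. z i ^ k i)) (\<Sum>k\<in>F. c k *\<^sub>C op_monomial A k)" by blast
  define P where "P = (\<Sum>k\<in>F. c k *\<^sub>C op_monomial A k)"
  from m obtain e q where q: "polyrel U e q (W ^ m * P)"
      "\<And>z. (\<And>i. cmod (z i) = 1) \<Longrightarrow> q z = w z ^ m * (\<Sum>k\<in>F. c k * (\<Prod>i\<in>UNIV. of_real (Re (z i)) ^ k i))"
    unfolding good_def P_def[symmetric] by blast
  have "norm (W ^ m * P) \<le> s"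
  proof (rule polyrel_norm_le[OF q(1) commU normalU contrU])
    fix z :: "'n \<Rightarrow> complex" assume z: "\<And>i. cmod (z i) = 1"
    have "cmod (w z) = 1" by (simp add: w_def z flip: prod_norm)
    moreover have "cmod (\<Sum>k\<in>F. c k * of_real (\<Prod>i\<in>UNIV. Re (z i) ^ k i)) \<le> s"
      by (rule s) (metis abs_Re_le_cmod z)
    ultimately show "cmod (q z) \<le> s" by (simp add: q(2)[OF z] norm_mult norm_power)
  qed
  moreover have "norm P \<le> norm (W ^ m * P)"
  proof -
    have "adj W * W = 1"
    proof -
      have "adj (prod_list (map (\<lambda>i. U i ^ 1) L)) * prod_list (map (\<lambda>i. U i ^ 1) L) = 1" for L
      proof (induction L)
        case (Cons i L)
        define D where "D = prod_list (map (\<lambda>i. U i ^ 1) L)"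
        have "adj (U i * D) * (U i * D) = adj D * (U' i * U i) * D" by (simp add: adj_mult aU mult.assoc)
        then show ?case using Cons by (simp add: U'U D_def)
      qed simp
      then show ?thesis unfolding W_def op_monomial_def by blast
    qed
    then have Wm: "adj W ^ m * W ^ m = 1"
    proof (induction m)
      case (Suc m)
      have "adj W ^ Suc m * W ^ Suc m = adj W ^ m * (adj W * W) * W ^ m"
        by (simp only: power_Suc2[of "adj W"] power_Suc[of W] mult.assoc)
      then show ?case using Suc by simp
    qed simp
    have cw: "norm (adj W ^ m) \<le> 1"
    proof -
      have "norm W \<le> 1" unfolding W_def by (rule norm_op_monomial_le[OF contrU])
      then have "norm (adj W) ^ m \<le> 1" by (simp add: power_le_one)
      then show ?thesis using norm_power_bop_le order_trans by blast
    qed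
    have "P = adj W ^ m * (W ^ m * P)" by (simp add: Wm flip: mult.assoc)
    then have "norm P \<le> norm (adj W ^ m) * norm (W ^ m * P)" by (metis norm_mult_ineq)
    also have "\<dots> \<le> 1 * norm (W ^ m * P)" by (intro mult_right_mono cw) simp
    finally show ?thesis by simp
  qed
  ultimately show ?thesis by (simp add: P_def)
qed

section \<open>Positive traces on normed ideals\<close>

locale traced_ideal =
  fixes I :: "'h::hilbert_space bop set" and nrm :: "'h bop \<Rightarrow> real" and \<tau> :: "'h bop \<Rightarrow> complex"
  assumes ideal: "normed_ideal I nrm" and trace: "trace_on I \<tau>"
    and positive: "positive_on I \<tau>" and bounded: "\<exists>M. bounded_by I nrm \<tau> M"
begin

lemma I_zero: "0 \<in> I" and I_add: "X \<in> I \<Longrightarrow> Y \<in> I \<Longrightarrow> X + Y \<in> I"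
  and I_mult_left: "X \<in> I \<Longrightarrow> A * X \<in> I" and I_mult_right: "X \<in> I \<Longrightarrow> X * A \<in> I"
  using ideal by (auto simp: normed_ideal_def op_ideal_def)

lemma I_scaleC: "X \<in> I \<Longrightarrow> c *\<^sub>C X \<in> I"
  using I_mult_left[of X "c *\<^sub>C 1"] by (simp add: scaleC_mult_left)

lemma I_scaleR: "X \<in> I \<Longrightarrow> c *\<^sub>R X \<in> I"
  by (simp add: scaleR_eq_scaleC I_scaleC)

lemma I_diff: "X \<in> I \<Longrightarrow> Y \<in> I \<Longrightarrow> X - Y \<in> I"
  using I_add[of X "(-1) *\<^sub>C Y"] I_scaleC[of Y "-1"] by (simp add: scaleC_minus1)

lemma I_sum: "(\<And>k. k \<in> F \<Longrightarrow> f k \<in> I) \<Longrightarrow> sum f F \<in> I"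
  by (induction F rule: infinite_finite_induct) (auto intro: I_add I_zero)

lemma \<tau>_add: "X \<in> I \<Longrightarrow> Y \<in> I \<Longrightarrow> \<tau> (X + Y) = \<tau> X + \<tau> Y"
  and \<tau>_scaleC: "X \<in> I \<Longrightarrow> \<tau> (c *\<^sub>C X) = c * \<tau> X"
  and \<tau>_commute: "X \<in> I \<Longrightarrow> \<tau> (A * X) = \<tau> (X * A)"
  using trace by (auto simp: trace_on_def)

lemma \<tau>_zero: "\<tau> 0 = 0"
  using \<tau>_scaleC[OF I_zero, of 0] by simp

lemma \<tau>_scaleR: "X \<in> I \<Longrightarrow> \<tau> (r *\<^sub>R X) = of_real r * \<tau> X"
  by (simp add: scaleR_eq_scaleC \<tau>_scaleC)

lemma \<tau>_diff: "X \<in> I \<Longrightarrow> Y \<in> I \<Longrightarrow> \<tau> (X - Y) = \<tau> X - \<tau> Y"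
  using \<tau>_add[of X "(-1) *\<^sub>C Y"] \<tau>_scaleC[of Y "-1"] I_scaleC[of Y "-1"] by (simp add: scaleC_minus1)

lemma \<tau>_sum: "(\<And>k. k \<in> F \<Longrightarrow> f k \<in> I) \<Longrightarrow> \<tau> (sum f F) = (\<Sum>k\<in>F. \<tau> (f k))"
  by (induction F rule: infinite_finite_induct) (auto simp: \<tau>_zero \<tau>_add I_sum)

lemma \<tau>_positive: "X \<in> I \<Longrightarrow> positive_op X \<Longrightarrow> 0 \<le> Re (\<tau> X) \<and> Im (\<tau> X) = 0"
  using positive by (auto simp: positive_on_def complex_nonneg_Reals_iff)

lemma nrm_nonneg: "X \<in> I \<Longrightarrow> 0 \<le> nrm X"
  and nrm_eq_0: "X \<in> I \<Longrightarrow> nrm X = 0 \<longleftrightarrow> X = 0"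
  and nrm_scaleC: "X \<in> I \<Longrightarrow> nrm (c *\<^sub>C X) = cmod c * nrm X"
  and nrm_triangle: "X \<in> I \<Longrightarrow> Y \<in> I \<Longrightarrow> nrm (X + Y) \<le> nrm X + nrm Y"
  and nrm_mult3: "X \<in> I \<Longrightarrow> nrm (A * X * C) \<le> norm A * nrm X * norm C"
  and norm_le_nrm: "\<exists>K>0. \<forall>B\<in>I. norm B \<le> K * nrm B"
  using ideal unfolding normed_ideal_def by blast+

lemma nrm_zero: "nrm 0 = 0"
  using nrm_eq_0[OF I_zero] by simp

lemma nrm_minus: "X \<in> I \<Longrightarrow> nrm (- X) = nrm X"
  using nrm_scaleC[of X "-1"] by (simp add: scaleC_minus1)

lemma nrm_sum: "(\<And>k. k \<in> F \<Longrightarrow> f k \<in> I) \<Longrightarrow> nrm (sum f F) \<le> (\<Sum>k\<in>F. nrm (f k))"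
proof (induction F rule: infinite_finite_induct)
  case (insert k F)
  have "nrm (f k + sum f F) \<le> nrm (f k) + nrm (sum f F)"
    by (rule nrm_triangle) (use insert in \<open>auto intro: I_sum\<close>)
  then show ?case using insert by fastforce
qed (simp_all add: nrm_zero)

lemma dual_norm_nonneg: "0 \<le> dual_norm I nrm \<tau>"
  unfolding dual_norm_def using bounded by (intro cInf_greatest) (auto simp: bounded_by_def)

lemma \<tau>_dual_norm: "X \<in> I \<Longrightarrow> cmod (\<tau> X) \<le> dual_norm I nrm \<tau> * nrm X"
proof (cases "nrm X = 0")
  case True
  assume "X \<in> I"
  then have "X = 0" using True nrm_eq_0 by blast
  then show ?thesis by (simp add: \<tau>_zero nrm_zero)
next
  case False
  assume X: "X \<in> I"
  then have pos: "nrm X > 0" using nrm_nonneg[OF X] False by simp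
  have "cmod (\<tau> X) / nrm X \<le> dual_norm I nrm \<tau>"
    unfolding dual_norm_def
    by (rule cInf_greatest) (use bounded X pos in \<open>auto simp: bounded_by_def divide_le_eq\<close>)
  then show ?thesis using pos by (simp add: divide_le_eq)
qed

lemma I_adj: "X \<in> I \<Longrightarrow> adj X \<in> I" and I_abs_op: "X \<in> I \<Longrightarrow> abs_op X \<in> I"
proof -
  assume X: "X \<in> I"
  obtain U where U: "X = U * abs_op X" "abs_op X = adj U * X" by (rule polar_decomposition)
  show abs: "abs_op X \<in> I" using I_mult_left[OF X, of "adj U"] unfolding U(2)[symmetric] .
  have "adj X = abs_op X * adj U"
    using arg_cong[OF U(1), of adj] abs_op_works[of X] by (simp add: adj_mult positive_opD)
  then show "adj X \<in> I" using I_mult_right[OF abs] by simp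
qed

lemma I_Re_op: "X \<in> I \<Longrightarrow> Re_op X \<in> I" and I_Im_op: "X \<in> I \<Longrightarrow> Im_op X \<in> I"
  by (auto simp: Re_op_def Im_op_def intro!: I_scaleC I_add I_diff I_adj)

context
  fixes P
  assumes P: "P \<in> I" "positive_op P"
begin

lemma trace_form_diagonal: "0 \<le> Re (\<tau> (X * P * adj X)) \<and> Im (\<tau> (X * P * adj X)) = 0"
  using positive_op_conj[OF P(2), of "adj X"] P(1) by (intro \<tau>_positive) (auto intro: I_mult_left I_mult_right)

lemma trace_form_sesquilinear:
  "\<tau> ((X + Y) * P * adj Z) = \<tau> (X * P * adj Z) + \<tau> (Y * P * adj Z)"
  "\<tau> (X * P * adj (Y + Z)) = \<tau> (X * P * adj Y) + \<tau> (X * P * adj Z)"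
  "\<tau> ((c *\<^sub>C X) * P * adj Y) = c * \<tau> (X * P * adj Y)"
  "\<tau> (X * P * adj (c *\<^sub>C Y)) = cnj c * \<tau> (X * P * adj Y)"
proof -
  have mem: "X * P * Y \<in> I" for X Y using P by (intro I_mult_left I_mult_right)
  show "\<tau> ((X + Y) * P * adj Z) = \<tau> (X * P * adj Z) + \<tau> (Y * P * adj Z)"
    by (simp only: distrib_right \<tau>_add mem)
  show "\<tau> (X * P * adj (Y + Z)) = \<tau> (X * P * adj Y) + \<tau> (X * P * adj Z)"
    by (simp only: adj_plus distrib_left \<tau>_add mem)
  show "\<tau> ((c *\<^sub>C X) * P * adj Y) = c * \<tau> (X * P * adj Y)"
    by (simp only: scaleC_mult_left \<tau>_scaleC mem)
  show "\<tau> (X * P * adj (c *\<^sub>C Y)) = cnj c * \<tau> (X * P * adj Y)"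
    by (simp only: adj_scaleC scaleC_mult_right \<tau>_scaleC mem)
qed

lemma trace_form_hermitian: "\<tau> (X * P * adj Y) = cnj (\<tau> (Y * P * adj X))"
  by (rule sesquilinear_real_diagonal_hermitian[where s = "\<lambda>X Y. \<tau> (X * P * adj Y)"])
    (simp_all only: trace_form_sesquilinear trace_form_diagonal)

text \<open>Cauchy-Schwarz for \<open>\<tau> (X P Y\<^sup>*)\<close> bounds \<open>\<tau> (T P)\<close> by \<open>\<tau> (T P T\<^sup>*)\<close>, and
  \<open>c - T\<^sup>* T\<close> with \<open>c = (norm T)\<^sup>2\<close> has a square root \<open>R\<close>, so that \<open>\<tau> ((c - T\<^sup>* T) P) = \<tau> (R P R) \<ge> 0\<close>.\<close>

lemma trace_mult_positive_bound: "cmod (\<tau> (T * P)) \<le> norm T * Re (\<tau> P)"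
proof -
  have CS: "(cmod (\<tau> (T * P * adj 1)))\<^sup>2 \<le> Re (\<tau> (T * P * adj T)) * Re (\<tau> (1 * P * adj 1))"
    by (rule semidefinite_Cauchy_Schwarz[where s = "\<lambda>X Y. \<tau> (X * P * adj Y)"])
      (simp_all only: trace_form_sesquilinear trace_form_diagonal, rule trace_form_hermitian)
  define c where "c = (norm T)\<^sup>2"
  define Q where "Q = c *\<^sub>R 1 - adj T * T"
  have "(norm (app T x))\<^sup>2 \<le> c * (norm x)\<^sup>2" for x
    unfolding c_def power_mult_distrib[symmetric] by (intro power_mono norm_app_le) simp
  then have "positive_op Q"
    by (simp add: Q_def positive_op_iff adj_simps app_minus app_scaleR app_one cinner_diff_left
        cinner_scaleR_left cinner_self norm_power2_app)
  then obtain R where R: "positive_op R" "R * R = Q" using positive_op_sqrt_exists by blast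
  have "0 \<le> Re (\<tau> (R * P * adj R))" using trace_form_diagonal by blast
  also have "R * P * adj R = R * (P * R)" using R(1) by (simp add: positive_opD mult.assoc)
  also have "\<tau> (R * (P * R)) = \<tau> (P * Q)"
    by (subst \<tau>_commute) (auto simp: I_mult_right P R(2) mult.assoc)
  also have "P * Q = c *\<^sub>R P - (P * adj T) * T" by (simp add: Q_def algebra_simps mult.assoc)
  also have "\<tau> (c *\<^sub>R P - (P * adj T) * T) = c * \<tau> P - \<tau> (T * (P * adj T))"
    by (simp add: \<tau>_diff \<tau>_scaleR \<tau>_commute[of "P * adj T" T] I_scaleR I_mult_right P)
  finally have "Re (\<tau> (T * P * adj T)) \<le> c * Re (\<tau> P)" by (simp add: mult.assoc)
  moreover have pos: "0 \<le> Re (\<tau> P)" using \<tau>_positive P by blast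
  ultimately have "Re (\<tau> (T * P * adj T)) * Re (\<tau> P) \<le> (c * Re (\<tau> P)) * Re (\<tau> P)"
    by (intro mult_right_mono)
  then have "(cmod (\<tau> (T * P)))\<^sup>2 \<le> (norm T * Re (\<tau> P))\<^sup>2"
    using CS by (simp add: c_def power2_eq_square mult_ac)
  then show ?thesis by (rule power2_le_imp_le) (use pos in simp)
qed

end

text \<open>The two factors of the polar decomposition reduce this to the hermitian form of \<open>abs_op X\<close>.\<close>

lemma trace_adj: "X \<in> I \<Longrightarrow> \<tau> (adj X) = cnj (\<tau> X)"
proof -
  assume X: "X \<in> I"
  obtain U where U: "X = U * abs_op X" "abs_op X = adj U * X" by (rule polar_decomposition)
  have "adj X = abs_op X * adj U"
    using arg_cong[OF U(1), of adj] abs_op_works[of X] by (simp add: adj_mult positive_opD)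
  moreover have "\<tau> (1 * abs_op X * adj U) = cnj (\<tau> (U * abs_op X * adj 1))"
    using trace_form_hermitian abs_op_works I_abs_op[OF X] by blast
  ultimately show ?thesis using U(1) by simp
qed

lemma trace_mult_abs_bound:
  assumes S: "S \<in> I"
  shows "cmod (\<tau> (T * S)) \<le> norm T * Re (\<tau> (abs_op S))"
proof -
  obtain U where U: "S = U * abs_op S" "norm U \<le> 1" by (rule polar_decomposition)
  have pos: "0 \<le> Re (\<tau> (abs_op S))" using \<tau>_positive I_abs_op[OF S] abs_op_works by blast
  have "\<tau> (T * S) = \<tau> ((T * U) * abs_op S)" using U(1) by (simp add: mult.assoc)
  then have "cmod (\<tau> (T * S)) \<le> norm (T * U) * Re (\<tau> (abs_op S))"
    using trace_mult_positive_bound[OF I_abs_op[OF S]] abs_op_works by metis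
  also have "\<dots> \<le> norm T * Re (\<tau> (abs_op S))"
    using norm_mult_ineq[of T U] mult_left_mono[OF U(2), of "norm T"] pos by (intro mult_right_mono) auto
  finally show ?thesis .
qed

text \<open>The bound required of the measure belonging to \<open>W\<close>.\<close>

definition mass :: "'h bop \<Rightarrow> real" where
  "mass W = min (dual_norm I nrm \<tau> * nrm W) (Re (\<tau> (abs_op (Re_op W) + abs_op (Im_op W))))"

text \<open>The first bound is the ideal property of the norm, the second is \<open>trace_mult_abs_bound\<close> for the
  real and imaginary parts of \<open>W\<close>.\<close>

lemma trace_mult_mass:
  assumes W: "W \<in> I"
  shows "cmod (\<tau> (T * W)) \<le> norm T * mass W" "0 \<le> mass W"
proof -
  have d: "cmod (\<tau> (T * W)) \<le> norm T * (dual_norm I nrm \<tau> * nrm W)"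
  proof -
    have "nrm (T * W * 1) \<le> norm T * nrm W * norm (1 :: 'h bop)" by (rule nrm_mult3[OF W])
    also have "\<dots> \<le> norm T * nrm W * 1"
      by (intro mult_left_mono norm_one_bop_le mult_nonneg_nonneg nrm_nonneg W) simp
    finally have "nrm (T * W) \<le> norm T * nrm W" by simp
    then have "dual_norm I nrm \<tau> * nrm (T * W) \<le> dual_norm I nrm \<tau> * (norm T * nrm W)"
      by (intro mult_left_mono dual_norm_nonneg)
    then show ?thesis using \<tau>_dual_norm[OF I_mult_left[OF W], of T] by (simp add: mult_ac)
  qed
  have RI: "Re_op W \<in> I" "Im_op W \<in> I" using W by (auto intro: I_Re_op I_Im_op)
  have sum: "Re (\<tau> (abs_op (Re_op W) + abs_op (Im_op W))) = Re (\<tau> (abs_op (Re_op W))) + Re (\<tau> (abs_op (Im_op W)))"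
    by (simp add: \<tau>_add I_abs_op RI)
  have "W = Re_op W + \<i> *\<^sub>C Im_op W"
    by (simp add: Re_op_def Im_op_def scaleC_scaleC flip: scaleC_add_right)
      (simp add: scaleC_add_left[symmetric] flip: scaleR_2 scaleC_of_real, simp add: scaleC_scaleC)
  then have "T * W = T * Re_op W + \<i> *\<^sub>C (T * Im_op W)"
    by (metis distrib_left scaleC_mult_right)
  then have "\<tau> (T * W) = \<tau> (T * Re_op W) + \<i> * \<tau> (T * Im_op W)"
    by (simp add: \<tau>_add \<tau>_scaleC I_scaleC I_mult_left RI)
  then have "cmod (\<tau> (T * W)) \<le> cmod (\<tau> (T * Re_op W)) + cmod (\<tau> (T * Im_op W))"
    using norm_triangle_ineq[of "\<tau> (T * Re_op W)" "\<i> * \<tau> (T * Im_op W)"] by (simp add: norm_mult)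
  also have "\<dots> \<le> norm T * Re (\<tau> (abs_op (Re_op W))) + norm T * Re (\<tau> (abs_op (Im_op W)))"
    by (intro add_mono trace_mult_abs_bound RI)
  finally have e: "cmod (\<tau> (T * W)) \<le> norm T * Re (\<tau> (abs_op (Re_op W) + abs_op (Im_op W)))"
    by (simp add: sum distrib_left)
  show "cmod (\<tau> (T * W)) \<le> norm T * mass W" using d e by (simp add: mass_def min_def)
  have "0 \<le> Re (\<tau> (abs_op (Re_op W)))" "0 \<le> Re (\<tau> (abs_op (Im_op W)))"
    using \<tau>_positive I_abs_op RI abs_op_works by blast+
  then show "0 \<le> mass W" by (simp add: mass_def sum dual_norm_nonneg nrm_nonneg W)
qed

lemma bounded_linear_trace_mult:
  assumes W: "W \<in> I"
  shows "bounded_linear (\<lambda>T. \<tau> (T * W))"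
  by (rule bounded_linear_intro[of _ "mass W"])
    (auto simp: distrib_right \<tau>_add \<tau>_scaleR I_mult_left W trace_mult_mass scaleR_conv_of_real)

end

section \<open>The Hahn-Banach theorem and the variation of a functional\<close>

text \<open>Partial functionals are represented by their graphs, so that extension is inclusion and Zorn's lemma
  applies to the linear subspaces of \<open>'a \<times> real\<close> dominated by \<open>C * norm x\<close>.  A dominated subspace
  is automatically single-valued, and a maximal one is total by the usual one-dimensional step: any
  value \<open>a\<close> between the two families of bounds is admissible at a new point \<open>x0\<close>.\<close>

theorem Hahn_Banach_graph:
  fixes G :: "('a::real_normed_vector \<times> real) set"
  assumes G: "subspace G" "\<And>x r. (x, r) \<in> G \<Longrightarrow> r \<le> C * norm x" and C: "0 \<le> C"
  obtains R where "linear R" "\<And>x r. (x, r) \<in> G \<Longrightarrow> R x = r" "\<And>x. R x \<le> C * norm x"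
proof -
  define \<A> where "\<A> = {H. G \<subseteq> H \<and> subspace H \<and> (\<forall>(x, r)\<in>H. r \<le> C * norm x)}"
  have "G \<in> \<A>" using G by (auto simp: \<A>_def)
  then have "\<A> \<noteq> {}" by blast
  moreover have "\<Union>\<C> \<in> \<A>" if c: "\<C> \<noteq> {}" "subset.chain \<A> \<C>" for \<C>
  proof -
    have sub: "\<And>X. X \<in> \<C> \<Longrightarrow> G \<subseteq> X \<and> subspace X \<and> (\<forall>(x, r)\<in>X. r \<le> C * norm x)"
      using c(2) by (auto simp: \<A>_def subset.chain_def)
    have "subspace (\<Union>\<C>)"
      unfolding subspace_def
    proof (intro conjI ballI allI)
      show "0 \<in> \<Union>\<C>" using c(1) sub subspace_0 by blast
      show "r *\<^sub>R x \<in> \<Union>\<C>" if "x \<in> \<Union>\<C>" for r x using that sub subspace_scale by blast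
      show "x + y \<in> \<Union>\<C>" if xy: "x \<in> \<Union>\<C>" "y \<in> \<Union>\<C>" for x y
      proof -
        obtain X Y where XY: "X \<in> \<C>" "Y \<in> \<C>" "x \<in> X" "y \<in> Y" using xy by blast
        then have "X \<subseteq> Y \<or> Y \<subseteq> X" using c(2) by (auto simp: subset.chain_def)
        then show ?thesis using XY sub subspace_add by (metis UnionI subsetD)
      qed
    qed
    then show ?thesis using sub c(1) by (auto simp: \<A>_def)
  qed
  ultimately obtain H where H: "H \<in> \<A>" "\<And>X. X \<in> \<A> \<Longrightarrow> H \<subseteq> X \<Longrightarrow> X = H"
    using subset_Zorn_nonempty[of \<A>] by blast
  have GH: "G \<subseteq> H" and sH: "subspace H" and bH: "\<And>x r. (x, r) \<in> H \<Longrightarrow> r \<le> C * norm x"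
    using H(1) by (auto simp: \<A>_def)
  have total: "\<exists>r. (x0, r) \<in> H" for x0
  proof (rule ccontr)
    assume no: "\<nexists>r. (x0, r) \<in> H"
    have key: "t - C * norm (z - x0) \<le> C * norm (y + x0) - r" if "(y, r) \<in> H" "(z, t) \<in> H" for y r z t
    proof -
      have "(y + z, r + t) \<in> H" using subspace_add[OF sH that] by simp
      then have "r + t \<le> C * norm ((y + x0) + (z - x0))" using bH by force
      also have "\<dots> \<le> C * norm (y + x0) + C * norm (z - x0)"
        using mult_left_mono[OF norm_triangle_ineq[of "y + x0" "z - x0"] C] by (simp add: distrib_left)
      finally show ?thesis by simp
    qed
    define a where "a = (SUP (z, t)\<in>H. t - C * norm (z - x0))"
    have H0: "(0, 0) \<in> H" using subspace_0[OF sH] by (simp add: zero_prod_def)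
    have bdd: "bdd_above ((\<lambda>(z, t). t - C * norm (z - x0)) ` H)"
      using key[OF H0] by (intro bdd_aboveI2[of _ _ "C * norm (0 + x0) - 0"]) auto
    have a1: "t - C * norm (z - x0) \<le> a" if "(z, t) \<in> H" for z t
      unfolding a_def using cSUP_upper[OF that bdd] by simp
    have a2: "a \<le> C * norm (y + x0) - r" if "(y, r) \<in> H" for y r
      unfolding a_def using H0 key[OF that] by (intro cSUP_least) auto
    define H' where "H' = span (insert (x0, a) H)"
    have spanH: "span H = H" using sH by (rule span_eq_iff[THEN iffD2])
    have "r \<le> C * norm x" if xr: "(x, r) \<in> H'" for x r
    proof -
      obtain k where k: "(x - k *\<^sub>R x0, r - k * a) \<in> H"
        using xr unfolding H'_def span_insert spanH by auto
      have sc: "(c *\<^sub>R (x - k *\<^sub>R x0), c * (r - k * a)) \<in> H" for c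
        using subspace_scale[OF sH k, of c] by simp
      consider "k = 0" | "k > 0" | "k < 0" by linarith
      then show ?thesis
      proof cases
        case 1
        then show ?thesis using bH[OF k] by simp
      next
        case 2
        have "a \<le> C * norm ((1/k) *\<^sub>R (x - k *\<^sub>R x0) + x0) - (1/k) * (r - k * a)" by (rule a2[OF sc])
        also have "(1/k) *\<^sub>R (x - k *\<^sub>R x0) + x0 = (1/k) *\<^sub>R x" using 2 by (simp add: algebra_simps)
        finally show ?thesis using 2 by (simp add: field_simps)
      next
        case 3
        have "(-1/k) * (r - k * a) - C * norm ((-1/k) *\<^sub>R (x - k *\<^sub>R x0) - x0) \<le> a" by (rule a1[OF sc])
        also have "(-1/k) *\<^sub>R (x - k *\<^sub>R x0) - x0 = (-1/k) *\<^sub>R x" using 3 by (simp add: algebra_simps)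
        finally show ?thesis using 3 by (simp add: field_simps)
      qed
    qed
    moreover have HH': "H \<subseteq> H'" unfolding H'_def using span_superset by blast
    ultimately have "H' \<in> \<A>" using GH by (auto simp: \<A>_def H'_def)
    then have "H' = H" using H(2) HH' by blast
    moreover have "(x0, a) \<in> H'" unfolding H'_def by (rule span_base) simp
    ultimately show False using no by blast
  qed
  have uniq: "r = r'" if "(x, r) \<in> H" "(x, r') \<in> H" for x r r'
    using bH[of 0 "r - r'"] bH[of 0 "r' - r"] subspace_diff[OF sH that] subspace_diff[OF sH that(2,1)] by simp
  obtain R where R: "\<And>x. (x, R x) \<in> H" using total by metis
  have "linear R"
  proof (rule linearI)
    show "R (x + y) = R x + R y" for x y
      using uniq[OF R] subspace_add[OF sH R[of x] R[of y]] by simp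
    show "R (c *\<^sub>R x) = c *\<^sub>R R x" for c x
      using uniq[OF R] subspace_scale[OF sH R[of x], of c] by simp
  qed
  then show ?thesis using that[of R] R uniq GH bH by blast
qed

definition bseq :: "(nat \<Rightarrow> complex) \<Rightarrow> nat \<Rightarrow>\<^sub>C complex" where "bseq f = Bcontfun f"

lemma apply_bseq: "(\<And>i. cmod (f i) \<le> b) \<Longrightarrow> apply_bcontfun (bseq f) i = f i"
  unfolding bseq_def by (subst Bcontfun_inverse) (auto intro!: bcontfun_normI)

text \<open>The value \<open>u\<close> on \<open>E\<close> and \<open>0\<close> elsewhere.\<close>

definition bseq_on :: "complex \<Rightarrow> nat set \<Rightarrow> nat \<Rightarrow>\<^sub>C complex" where
  "bseq_on u E = bseq (\<lambda>i. if i \<in> E then u else 0)"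

lemma apply_bseq_on: "apply_bcontfun (bseq_on u E) i = (if i \<in> E then u else 0)"
  unfolding bseq_on_def by (rule apply_bseq[of _ "cmod u"]) simp

lemma bseq_on_union: "E \<inter> F = {} \<Longrightarrow> bseq_on u (E \<union> F) = bseq_on u E + bseq_on u F"
  by (rule bcontfun_eqI) (auto simp: apply_bseq_on)

text \<open>A functional on bounded sequences is a finitely additive set function on the subsets of
  \<open>nat\<close>; \<open>v E\<close> is the norm of its restriction to sequences supported in \<open>E\<close>.  The norm is additive
  over disjoint supports because the supremum norm of a sum of disjointly supported sequences is the
  maximum of the norms.\<close>

lemma functional_variation:
  assumes R: "linear R" "\<And>x :: nat \<Rightarrow>\<^sub>C complex. R x \<le> C * norm x" and C: "0 \<le> C"
  obtains v :: "nat set \<Rightarrow> real" where "\<And>E F. E \<inter> F = {} \<Longrightarrow> v (E \<union> F) = v E + v F"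
    "\<And>u E. cmod u = 1 \<Longrightarrow> R (bseq_on u E) \<le> v E" "v UNIV \<le> C" "\<And>E. 0 \<le> v E"
proof -
  define D where "D E = {f :: nat \<Rightarrow>\<^sub>C complex. norm f \<le> 1 \<and> (\<forall>i. i \<notin> E \<longrightarrow> apply_bcontfun f i = 0)}" for E
  define v where "v E = (SUP f\<in>D E. R f)" for E
  have ne: "0 \<in> D E" for E by (simp add: D_def)
  have le: "R f \<le> C" if "f \<in> D E" for f E
    using R(2)[of f] that mult_left_mono[of "norm f" 1 C] C by (auto simp: D_def)
  have bdd: "bdd_above (R ` D E)" for E by (rule bdd_aboveI2[OF le])
  have upper: "R f \<le> v E" if "f \<in> D E" for f E unfolding v_def by (rule cSUP_upper[OF that bdd])
  have least: "v E \<le> b" if "\<And>f. f \<in> D E \<Longrightarrow> R f \<le> b" for E b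
    unfolding v_def using ne that by (intro cSUP_least) auto
  have nrm: "cmod (apply_bcontfun f i) \<le> 1" if "f \<in> D E" for f i E
    using norm_bounded[of f i] that by (auto simp: D_def)
  have add: "v (E \<union> F) = v E + v F" if EF: "E \<inter> F = {}" for E F
  proof (rule antisym)
    show "v (E \<union> F) \<le> v E + v F"
    proof (rule least)
      fix f assume f: "f \<in> D (E \<union> F)"
      define g where "g A = bseq (\<lambda>i. if i \<in> A then apply_bcontfun f i else 0)" for A
      have g: "apply_bcontfun (g A) i = (if i \<in> A then apply_bcontfun f i else 0)" for A i
        unfolding g_def by (rule apply_bseq[of _ 1]) (simp add: nrm[OF f])
      have gD: "g A \<in> D A" for A
        by (auto simp: D_def g nrm[OF f] intro!: norm_bound)
      have "f = g E + g F"
        using f EF by (intro bcontfun_eqI) (auto simp: g D_def)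
      then have "R f = R (g E) + R (g F)" using R(1) linear_add by metis
      then show "R f \<le> v E + v F" using upper[OF gD, of E] upper[OF gD, of F] by simp
    qed
    have "v F \<le> v (E \<union> F) - v E"
    proof (rule least)
      fix g assume g: "g \<in> D F"
      have "v E \<le> v (E \<union> F) - R g"
      proof (rule least)
        fix f assume f: "f \<in> D E"
        have "cmod (apply_bcontfun (f + g) i) \<le> 1" for i
          using nrm[OF f, of i] nrm[OF g, of i] f g EF by (cases "i \<in> E") (auto simp: D_def)
        then have "f + g \<in> D (E \<union> F)" using f g by (auto simp: D_def intro!: norm_bound)
        then have "R (f + g) \<le> v (E \<union> F)" by (rule upper)
        then show "R f \<le> v (E \<union> F) - R g" by (simp add: linear_add[OF R(1)])
      qed
      then show "R g \<le> v (E \<union> F) - v E" by simp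
    qed
    then show "v E + v F \<le> v (E \<union> F)" by simp
  qed
  have u: "R (bseq_on u E) \<le> v E" if "cmod u = 1" for u E
    by (rule upper) (auto simp: D_def apply_bseq_on that intro!: norm_bound)
  have nonneg: "0 \<le> v E" for E using upper[OF ne, of E] linear_0[OF R(1)] by simp
  show ?thesis by (rule that[OF add u least[OF le] nonneg])
qed

section \<open>Measures on Cantor space\<close>

definition cantor_space :: "(nat \<Rightarrow> bool) measure" where
  "cantor_space = PiM UNIV (\<lambda>_. count_space UNIV)"

definition cylinder :: "bool list \<Rightarrow> (nat \<Rightarrow> bool) set" where
  "cylinder s = {y. \<forall>k<length s. y k = s ! k}"

lemma space_cantor_space [simp]: "space cantor_space = UNIV"
  by (simp add: cantor_space_def space_PiM)

lemma measurable_cantor_component [measurable]: "(\<lambda>y. y k) \<in> measurable cantor_space (count_space UNIV)"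
  unfolding cantor_space_def by (rule measurable_component_singleton) simp

lemma sets_cylinder [measurable]: "cylinder s \<in> sets cantor_space"
proof -
  have "{y \<in> space cantor_space. \<forall>k\<in>{..<length s}. y k = s ! k} \<in> sets cantor_space"
    by measurable
  then show ?thesis by (simp add: cylinder_def lessThan_def)
qed

lemma cylinder_Nil: "cylinder [] = UNIV" by (simp add: cylinder_def)

lemma cylinder_eq: "cylinder s = {y. map y [0..<length s] = s}"
proof (intro set_eqI iffI)
  fix y assume "y \<in> cylinder s"
  then have "map y [0..<length s] = s" by (intro nth_equalityI) (auto simp: cylinder_def)
  then show "y \<in> {y. map y [0..<length s] = s}" by blast
next
  fix y assume "y \<in> {y. map y [0..<length s] = s}"
  then have *: "map y [0..<length s] = s" by blast
  have "y k = s ! k" if "k < length s" for k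
  proof -
    have "map y [0..<length s] ! k = y k" using that by simp
    then show ?thesis unfolding * by (rule sym)
  qed
  then show "y \<in> cylinder s" by (simp add: cylinder_def)
qed

lemma cylinder_snoc: "cylinder (s @ [b]) = {y \<in> cylinder s. y (length s) = b}"
  by (auto simp: cylinder_eq)

lemma finite_bool_lists: "finite {s :: bool list. length s = n}"
  using finite_lists_length_eq[of "UNIV :: bool set" n] by simp

lemma sets_cantor_space: "sets cantor_space = sigma_sets UNIV (insert {} (range cylinder))"
proof
  show "sigma_sets UNIV (insert {} (range cylinder)) \<subseteq> sets cantor_space"
    using sets.sigma_sets_subset[of "insert {} (range cylinder)" cantor_space] sets_cylinder
    by (simp add: image_subset_iff)
  have "sets cantor_space = sigma_sets UNIV {{f. f i \<in> A} |i A. True}"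
    unfolding cantor_space_def by (subst sets_PiM_single) simp
  also have "\<dots> \<subseteq> sigma_sets UNIV (insert {} (range cylinder))"
  proof (rule sigma_sets_mono, safe)
    fix i :: nat and A :: "bool set"
    have "{f. f i \<in> A} = (\<Union>s\<in>{s. length s = Suc i \<and> s ! i \<in> A}. cylinder s)"
    proof (intro set_eqI iffI)
      fix f assume "f \<in> {f. f i \<in> A}"
      then show "f \<in> (\<Union>s\<in>{s. length s = Suc i \<and> s ! i \<in> A}. cylinder s)"
        by (intro UN_I[of "map f [0..<Suc i]"]) (auto simp: cylinder_eq nth_append simp del: upt_Suc)
    qed (auto simp: cylinder_def)
    moreover have "(\<Union>s\<in>{s. length s = Suc i \<and> s ! i \<in> A}. cylinder s) \<in> sigma_sets UNIV (insert {} (range cylinder))"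
    proof -
      interpret sigma_algebra UNIV "sigma_sets UNIV (insert {} (range cylinder))"
        by (rule sigma_algebra_sigma_sets) auto
      show ?thesis
        by (intro finite_UN finite_subset[OF _ finite_bool_lists[of "Suc i"]]) (auto intro: sigma_sets.Basic)
    qed
    ultimately show "{f. f i \<in> A} \<in> sigma_sets UNIV (insert {} (range cylinder))" by simp
  qed
  finally show "sets cantor_space \<subseteq> sigma_sets UNIV (insert {} (range cylinder))" .
qed

lemma Int_stable_cylinder: "Int_stable (insert {} (range cylinder))"
proof -
  have *: "cylinder s \<inter> cylinder t \<in> insert {} (range cylinder)" if "length s \<le> length t" for s t
  proof (cases "take (length s) t = s")
    case True
    have "s ! k = t ! k" if "k < length s" for k using True that by (metis nth_take)
    then have "cylinder s \<inter> cylinder t = cylinder t" using that by (auto simp: cylinder_def)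
    then show ?thesis by simp
  next
    case False
    have "cylinder s \<inter> cylinder t = {}"
    proof (rule ccontr)
      assume "cylinder s \<inter> cylinder t \<noteq> {}"
      then obtain y where "\<forall>k<length s. y k = s ! k" "\<forall>k<length t. y k = t ! k"
        by (auto simp: cylinder_def)
      then have "take (length s) t = s" using that by (intro nth_equalityI) auto
      then show False using False by simp
    qed
    then show ?thesis by simp
  qed
  show ?thesis
    unfolding Int_stable_def
  proof (intro ballI)
    fix a b assume ab: "a \<in> insert {} (range cylinder)" "b \<in> insert {} (range cylinder)"
    show "a \<inter> b \<in> insert {} (range cylinder)"
    proof (cases "a = {} \<or> b = {}")
      case False
      then obtain s t where st: "a = cylinder s" "b = cylinder t" using ab by blast
      show ?thesis
      proof (cases "length s \<le> length t")
        case True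
        then show ?thesis unfolding st by (rule *)
      next
        case False
        then have "cylinder t \<inter> cylinder s \<in> insert {} (range cylinder)" by (intro *) simp
        then show ?thesis unfolding st by (simp only: Int_commute)
      qed
    qed auto
  qed
qed

text \<open>Linear relations between finite measures propagate from the cylinders, which are stable under
  intersection, to the generated \<open>\<sigma>\<close>-algebra.\<close>

lemma cantor_measures_linear:
  assumes M: "\<And>q. q \<in> Q \<Longrightarrow> finite_measure (M q) \<and> sets (M q) = sets cantor_space"
    and cyl: "\<And>s. (\<Sum>q\<in>Q. c q * measure (M q) (cylinder s)) = 0"
    and E: "E \<in> sets cantor_space"
  shows "(\<Sum>q\<in>Q. c q * measure (M q) E) = 0"
proof -
  have closed: "insert {} (range cylinder) \<subseteq> Pow UNIV" by simp
  have "E \<in> sigma_sets UNIV (insert {} (range cylinder))" using E sets_cantor_space by simp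
  from Int_stable_cylinder closed this show ?thesis
  proof (induction rule: sigma_sets_induct_disjoint)
    case (basic A)
    then show ?case using cyl by auto
  next
    case empty
    then show ?case by simp
  next
    case (compl A)
    have "measure (M q) (UNIV - A) = measure (M q) (cylinder []) - measure (M q) A" if "q \<in> Q" for q
    proof -
      interpret finite_measure "M q" using M[OF that] by blast
      have "space (M q) = UNIV" using M[OF that] sets_eq_imp_space_eq by fastforce
      moreover have "A \<in> sets (M q)" using compl M[OF that] sets_cantor_space by simp
      ultimately show ?thesis using finite_measure_compl[of A] by (simp add: cylinder_Nil)
    qed
    then show ?case using cyl[of "[]"] compl by (simp add: right_diff_distrib sum_subtractf)
  next
    case (union A)
    have "(\<lambda>i. measure (M q) (A i)) sums measure (M q) (\<Union>i. A i)" if "q \<in> Q" for q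
    proof -
      interpret finite_measure "M q" using M[OF that] by blast
      show ?thesis
        by (rule finite_measure_UNION) (use union M[OF that] sets_cantor_space in auto)
    qed
    then have "(\<lambda>i. \<Sum>q\<in>Q. c q * measure (M q) (A i)) sums (\<Sum>q\<in>Q. c q * measure (M q) (\<Union>i. A i))"
      by (intro sums_sum sums_mult)
    then show ?case using union by (simp add: sums_iff)
  qed
qed

text \<open>The binary tree of cylinders is laid out on the interval from \<open>0\<close> to \<open>v UNIV\<close>, the cylinder \<open>s\<close>
  getting a half-open interval of length \<open>v (cylinder s)\<close>; the image of Lebesgue measure under the map
  that sends a point to its branch is the wanted measure.  Countable additivity comes for free.\<close>

theorem cantor_measure_exists:
  fixes v :: "(nat \<Rightarrow> bool) set \<Rightarrow> real"
  assumes add: "\<And>E F. E \<inter> F = {} \<Longrightarrow> v (E \<union> F) = v E + v F" and pos: "\<And>E. 0 \<le> v E"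
  obtains M where "finite_measure M" "sets M = sets cantor_space"
    "\<And>s. measure M (cylinder s) = v (cylinder s)"
proof -
  \<comment> \<open>\<open>w s\<close> is the length and \<open>l s\<close> the left end point of the interval of \<open>s\<close>; \<open>T u\<close> is the branch of the point \<open>u\<close>\<close>
  define w where "w s = v (cylinder s)" for s
  have wsplit: "w s = w (s @ [False]) + w (s @ [True])" for s
  proof -
    have "cylinder s = cylinder (s @ [False]) \<union> cylinder (s @ [True])"
      "cylinder (s @ [False]) \<inter> cylinder (s @ [True]) = {}" by (auto simp: cylinder_snoc)
    then show ?thesis using add unfolding w_def by metis
  qed
  have w0: "0 \<le> w s" for s by (simp add: w_def pos)
  define W where "W = w []"
  define l where "l s = (\<Sum>k<length s. if s ! k then w (take k s @ [False]) else 0)" for s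
  have l0: "l [] = 0" by (simp add: l_def)
  have lsnoc: "l (s @ [b]) = l s + (if b then w (s @ [False]) else 0)" for s b
  proof -
    have "(\<Sum>k<length s. if (s @ [b]) ! k then w (take k (s @ [b]) @ [False]) else 0) = l s"
      unfolding l_def by (rule sum.cong) (auto simp: nth_append)
    then show ?thesis by (simp add: l_def)
  qed
  have l_bounds: "0 \<le> l s \<and> l s + w s \<le> W" for s
  proof (induction s rule: rev_induct)
    case (snoc b s)
    then show ?case using wsplit[of s] w0[of "s @ [False]"] w0[of "s @ [True]"] by (auto simp: lsnoc)
  qed (simp add: l0 W_def)
  define pre where "pre u = rec_nat [] (\<lambda>_ s. s @ [l s + w (s @ [False]) \<le> u])" for u
  have pre0: "pre u 0 = []" and preS: "pre u (Suc n) = pre u n @ [l (pre u n) + w (pre u n @ [False]) \<le> u]" for u n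
    by (simp_all add: pre_def)
  have len: "length (pre u n) = n" for u n by (induction n) (auto simp: pre0 preS)
  define T where "T u n = (l (pre u n) + w (pre u n @ [False]) \<le> u)" for u n
  have preT: "pre u n = map (T u) [0..<n]" for u n
    by (induction n) (auto simp: pre0 preS T_def)
  have T_cyl: "T u \<in> cylinder s \<longleftrightarrow> pre u (length s) = s" for u s
    by (simp add: cylinder_eq preT)
  have T_int: "T u \<in> cylinder s \<longleftrightarrow> u \<in> {l s..<l s + w s}" if u: "u \<in> {0..<W}" for u s
  proof (induction s rule: rev_induct)
    case Nil
    then show ?case using u by (simp add: cylinder_Nil l0 W_def)
  next
    case (snoc b s)
    have "T u \<in> cylinder (s @ [b]) \<longleftrightarrow> pre u (length s) = s \<and> (l s + w (s @ [False]) \<le> u) = b"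
      unfolding T_cyl by (auto simp: preS)
    also have "\<dots> \<longleftrightarrow> u \<in> {l s..<l s + w s} \<and> (l s + w (s @ [False]) \<le> u) = b"
      using snoc T_cyl by simp
    also have "\<dots> \<longleftrightarrow> u \<in> {l (s @ [b])..<l (s @ [b]) + w (s @ [b])}"
      using wsplit[of s] w0[of "s @ [False]"] w0[of "s @ [True]"] by (cases b) (auto simp: lsnoc)
    finally show ?case .
  qed
  define L where "L = restrict_space lborel {0..<W}"
  have spL: "space L = {0..<W}" by (simp add: L_def space_restrict_space)
  have setsL: "A \<in> sets L" if "A \<subseteq> {0..<W}" "A \<in> sets borel" for A
    using that by (auto simp: L_def sets_restrict_space_iff)
  have Tn: "(\<lambda>u. T u n) \<in> measurable L (count_space UNIV)" for n
  proof -
    have "{u \<in> space L. T u n} = (\<Union>s\<in>{s. length s = Suc n \<and> s ! n}. {l s..<l s + w s})"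
    proof (intro set_eqI iffI)
      fix u assume u: "u \<in> {u \<in> space L. T u n}"
      then have "T u \<in> cylinder (pre u (Suc n))" "pre u (Suc n) ! n"
        by (auto simp: T_cyl len preT nth_append simp del: upt_Suc)
      then show "u \<in> (\<Union>s\<in>{s. length s = Suc n \<and> s ! n}. {l s..<l s + w s})"
        using T_int[of u "pre u (Suc n)"] u len spL by auto
    next
      fix u assume "u \<in> (\<Union>s\<in>{s. length s = Suc n \<and> s ! n}. {l s..<l s + w s})"
      then obtain s where s: "length s = Suc n" "s ! n" "u \<in> {l s..<l s + w s}" by blast
      then have uW: "u \<in> {0..<W}" using l_bounds[of s] by auto
      then have "T u \<in> cylinder s" using T_int s(3) by simp
      then show "u \<in> {u \<in> space L. T u n}" using s uW spL by (auto simp: cylinder_def)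
    qed
    also have "\<dots> \<in> sets L"
      by (intro sets.finite_UN finite_subset[OF _ finite_bool_lists[of "Suc n"]])
        (auto intro!: setsL dest: order_trans[OF conjunct1[OF l_bounds]] less_le_trans[OF _ conjunct2[OF l_bounds]])
    finally show ?thesis by (simp add: pred_def)
  qed
  have Tm: "T \<in> measurable L cantor_space"
    unfolding cantor_space_def by (rule measurable_PiM_single') (auto intro: Tn)
  define M where "M = distr L cantor_space T"
  have em: "emeasure M (cylinder s) = ennreal (w s)" for s
  proof -
    have "emeasure M (cylinder s) = emeasure L (T -` cylinder s \<inter> space L)"
      unfolding M_def by (rule emeasure_distr[OF Tm sets_cylinder])
    also have "T -` cylinder s \<inter> space L = {l s..<l s + w s}"
      using T_int[of _ s] l_bounds[of s] by (auto simp: spL)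
    also have "emeasure L {l s..<l s + w s} = emeasure lborel {l s..<l s + w s}"
      unfolding L_def by (rule emeasure_restrict_space) (use l_bounds[of s] in auto)
    also have "\<dots> = ennreal (w s)" using w0[of s] by simp
    finally show ?thesis .
  qed
  show ?thesis
  proof (rule that[of M])
    show "sets M = sets cantor_space" by (simp add: M_def)
    have "space M = cylinder []" by (simp add: M_def cylinder_Nil)
    then show "finite_measure M" by (intro finite_measureI) (simp add: em)
    show "measure M (cylinder s) = v (cylinder s)" for s
      using em[of s] w0[of s] by (simp add: measure_def w_def)
  qed
qed

section \<open>The Riesz representation theorem on compact sets\<close>

text \<open>A function of the first \<open>N\<close> bits only is a finite combination of indicators of cylinders.\<close>

lemma cylinder_partition_integral:
  fixes h :: "(nat \<Rightarrow> bool) \<Rightarrow> complex"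
  assumes M: "finite_measure M" "sets M = sets cantor_space"
    and h: "\<And>y y'. (\<And>k. k < N \<Longrightarrow> y k = y' k) \<Longrightarrow> h y = h y'"
  shows "(\<integral>y. h y \<partial>M) = (\<Sum>s\<in>{s. length s = N}. of_real (measure M (cylinder s)) * h ((!) s))"
proof -
  interpret finite_measure M by (rule M)
  have cs: "cylinder s \<in> sets M" for s by (simp add: M(2) sets_cylinder)
  have "h y = (\<Sum>s\<in>{s. length s = N}. indicator (cylinder s) y *\<^sub>R h ((!) s))" for y
  proof -
    have "(\<Sum>s\<in>{s. length s = N}. indicator (cylinder s) y *\<^sub>R h ((!) s))
        = (\<Sum>s\<in>{map y [0..<N]}. indicator (cylinder s) y *\<^sub>R h ((!) s))"
      by (rule sum.mono_neutral_right) (auto simp: finite_bool_lists indicator_def cylinder_eq)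
    also have "\<dots> = h ((!) (map y [0..<N]))" by (simp add: cylinder_eq)
    also have "\<dots> = h y" by (rule h) simp
    finally show ?thesis by simp
  qed
  then have "(\<integral>y. h y \<partial>M) = (\<integral>y. (\<Sum>s\<in>{s. length s = N}. indicator (cylinder s) y *\<^sub>R h ((!) s)) \<partial>M)"
    by (rule Bochner_Integration.integral_cong[OF refl])
  also have "\<dots> = (\<Sum>s\<in>{s. length s = N}. \<integral>y. indicator (cylinder s) y *\<^sub>R h ((!) s) \<partial>M)"
    by (rule Bochner_Integration.integral_sum) (auto intro!: integrable_scaleR_left integrable_real_indicator cs simp: emeasure_eq_measure)
  also have "\<dots> = (\<Sum>s\<in>{s. length s = N}. of_real (measure M (cylinder s)) * h ((!) s))"
  proof (rule sum.cong[OF refl])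
    fix s
    have "(\<integral>y. indicator (cylinder s) y *\<^sub>R h ((!) s) \<partial>M) = (\<integral>y. indicator (cylinder s) y \<partial>M) *\<^sub>R h ((!) s)"
      by (rule integral_scaleR_left) (auto intro!: integrable_real_indicator cs simp: emeasure_eq_measure)
    also have "(\<integral>y. indicator (cylinder s) y \<partial>M) = measure M (cylinder s)"
      using sets.sets_into_space[OF cs[of s]] by (simp add: Int_absorb2)
    finally show "(\<integral>y. indicator (cylinder s) y *\<^sub>R h ((!) s) \<partial>M) = of_real (measure M (cylinder s)) * h ((!) s)"
      by (simp add: scaleR_conv_of_real)
  qed
  finally show ?thesis .
qed

text \<open>Sampling along a dense sequence \<open>d\<close> embeds the continuous functions isometrically into the bounded
  sequences, where the functional extends to some \<open>R\<close> by Hahn-Banach.  On indicators, \<open>R\<close> is a finitely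
  additive set function on \<open>nat\<close>.  To make it countably additive, encode each index \<open>i\<close> by the bits
  \<open>b i\<close> telling in which of the balls with radii \<open>1 / (m + 1)\<close> around the points of \<open>d\<close> the point
  \<open>d i\<close> lies: on Cantor space a nonnegative finitely additive set function always agrees with a measure on the cylinders.  By compactness finitely many bits
  determine \<open>d i\<close> up to a small error, so that a branch \<open>y\<close> has a limit point \<open>\<gamma> y\<close> in \<open>K\<close>, and \<open>g\<close> is
  the uniform limit of functions of finitely many bits.  The representing measures are images under
  \<open>\<gamma>\<close>.

  The set \<open>G\<close> is the graph of the functional.  The variation \<open>v\<close> of \<open>R\<close> gives \<open>m0\<close>; adding to it the
  values of \<open>R\<close> on the sequences with the constant value \<open>1\<close>, resp. \<open>\<i>\<close>, on a set yields the nonnegative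
  set functions of \<open>m1\<close> and \<open>m2\<close>, which therefore enter the conclusion as differences to \<open>m0\<close>.\<close>

theorem Riesz_measures:
  fixes K :: "'y::euclidean_space set" and G :: "(('y \<Rightarrow> complex) \<times> complex) set"
  assumes K: "compact K" "K \<noteq> {}" and C: "0 \<le> C"
    and cont: "\<And>g c. (g, c) \<in> G \<Longrightarrow> continuous_on K g"
    and G0: "(\<lambda>_. 0, 0) \<in> G"
    and Gadd: "\<And>g c h d. (g, c) \<in> G \<Longrightarrow> (h, d) \<in> G \<Longrightarrow> (\<lambda>x. g x + h x, c + d) \<in> G"
    and Gscale: "\<And>a g c. (g, c) \<in> G \<Longrightarrow> (\<lambda>x. a * g x, a * c) \<in> G"
    and bound: "\<And>g c s. (g, c) \<in> G \<Longrightarrow> (\<And>x. x \<in> K \<Longrightarrow> cmod (g x) \<le> s) \<Longrightarrow> cmod c \<le> C * s"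
  obtains m0 m1 m2 :: "'y measure" where
    "finite_measure m0" "finite_measure m1" "finite_measure m2"
    "sets m0 = sets (borel_on K)" "sets m1 = sets (borel_on K)" "sets m2 = sets (borel_on K)"
    "measure m0 K \<le> C"
    "\<And>E. E \<in> sets (borel_on K) \<Longrightarrow>
       cmod (Complex (measure m1 E - measure m0 E) (measure m0 E - measure m2 E)) \<le> measure m0 E"
    "\<And>g c. (g, c) \<in> G \<Longrightarrow> c = ((\<integral>x. g x \<partial>m1) - (\<integral>x. g x \<partial>m0)) + \<i> * ((\<integral>x. g x \<partial>m0) - (\<integral>x. g x \<partial>m2))"
proof -
  obtain D where D: "countable D" "D \<subseteq> K" "K \<subseteq> closure D" by (rule separable)
  have Dne: "D \<noteq> {}" using D(3) K(2) by auto
  define d where "d = from_nat_into D"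
  have rd: "range d = D" using D(1) Dne by (simp add: d_def range_from_nat_into)
  have dK: "d i \<in> K" for i using rd D(2) by auto
  have clK: "closure (range d) = K"
    using D(3) closure_minimal[OF D(2) compact_imp_closed[OF K(1)]] by (simp add: rd)
  have gb: "\<exists>B. \<forall>x\<in>K. cmod (g x) \<le> B" if "(g, c) \<in> G" for g c
    using compact_imp_bounded[OF compact_continuous_image[OF cont[OF that] K(1)]] by (auto simp: bounded_iff)
  define sq where "sq g = bseq (\<lambda>i. g (d i))" for g :: "'y \<Rightarrow> complex"
  have sq: "apply_bcontfun (sq g) i = g (d i)" if gc: "(g, c) \<in> G" for g c i
  proof -
    obtain B where "\<forall>x\<in>K. cmod (g x) \<le> B" using gb[OF gc] by blast
    then show ?thesis unfolding sq_def by (intro apply_bseq[of _ B]) (simp add: dK)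
  qed
  have "subspace {(sq g, Re c) |g c. (g, c) \<in> G}"
    unfolding subspace_def
  proof (intro conjI ballI allI)
    have "sq (\<lambda>_. 0) = 0" by (rule bcontfun_eqI) (simp add: sq[OF G0])
    then show "0 \<in> {(sq g, Re c) |g c. (g, c) \<in> G}" using G0 by (force simp: zero_prod_def)
  next
    fix p q assume "p \<in> {(sq g, Re c) |g c. (g, c) \<in> G}" "q \<in> {(sq g, Re c) |g c. (g, c) \<in> G}"
    then obtain g c h e where gc: "p = (sq g, Re c)" "(g, c) \<in> G" "q = (sq h, Re e)" "(h, e) \<in> G" by blast
    have "sq (\<lambda>x. g x + h x) = sq g + sq h"
      by (rule bcontfun_eqI) (simp add: sq[OF Gadd[OF gc(2,4)]] sq[OF gc(2)] sq[OF gc(4)])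
    then have "p + q = (sq (\<lambda>x. g x + h x), Re (c + e))" by (simp add: gc)
    then show "p + q \<in> {(sq g, Re c) |g c. (g, c) \<in> G}" using Gadd[OF gc(2,4)] by blast
  next
    fix a :: real and p assume "p \<in> {(sq g, Re c) |g c. (g, c) \<in> G}"
    then obtain g c where gc: "p = (sq g, Re c)" "(g, c) \<in> G" by blast
    have "sq (\<lambda>x. of_real a * g x) = a *\<^sub>R sq g"
      by (rule bcontfun_eqI) (simp add: sq[OF Gscale[OF gc(2)]] sq[OF gc(2)] scaleR_conv_of_real)
    then have "a *\<^sub>R p = (sq (\<lambda>x. of_real a * g x), Re (of_real a * c))" by (simp add: gc)
    then show "a *\<^sub>R p \<in> {(sq g, Re c) |g c. (g, c) \<in> G}" using Gscale[OF gc(2)] by blast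
  qed
  moreover have "r \<le> C * norm x" if xr: "(x, r) \<in> {(sq g, Re c) |g c. (g, c) \<in> G}" for x r
  proof -
    obtain g c where gc: "x = sq g" "r = Re c" "(g, c) \<in> G" using xr by blast
    have "cmod (g y) \<le> norm (sq g)" if y: "y \<in> K" for y
    proof (rule continuous_on_closure_norm_le[of "range d"])
      show "continuous_on (closure (range d)) g" by (simp add: clK cont[OF gc(3)])
      show "\<forall>y\<in>range d. cmod (g y) \<le> norm (sq g)"
        using norm_bounded[of "sq g"] by (auto simp: sq[OF gc(3)])
      show "y \<in> closure (range d)" by (simp add: clK y)
    qed
    then have "cmod c \<le> C * norm (sq g)" by (rule bound[OF gc(3)])
    then show ?thesis using complex_Re_le_cmod[of c] by (simp add: gc)
  qed
  ultimately obtain R where R: "linear R" "\<And>g c. (g, c) \<in> G \<Longrightarrow> R (sq g) = Re c" "\<And>x. R x \<le> C * norm x"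
    using Hahn_Banach_graph[of "{(sq g, Re c) |g c. (g, c) \<in> G}" C] C
    by (smt (verit, ccfv_threshold) mem_Collect_eq)
  have Rabs: "\<bar>R x\<bar> \<le> C * norm x" for x
    using R(3)[of x] R(3)[of "- x"] by (simp add: linear_neg[OF R(1)] abs_le_iff)
  obtain v where v: "\<And>E F. E \<inter> F = {} \<Longrightarrow> v (E \<union> F) = v E + v F"
    "\<And>u E. cmod u = 1 \<Longrightarrow> R (bseq_on u E) \<le> v E" "v UNIV \<le> C" "\<And>E. 0 \<le> v E"
    using functional_variation[OF R(1,3) C] by metis
  define b where "b i k \<longleftrightarrow> dist (d i) (d (fst (prod_decode k))) < 1 / Suc (snd (prod_decode k))" for i k
  have sep: "\<exists>N. \<forall>i j. (\<forall>k<N. b i k = b j k) \<longrightarrow> dist (d i) (d j) < e" if e: "e > 0" for e :: real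
  proof -
    obtain m where m: "2 / real (Suc m) < e"
      using reals_Archimedean[of "e / 2"] e by (auto simp: field_simps)
    have "K \<subseteq> (\<Union>i\<in>UNIV. ball (d i) (1 / Suc m))"
    proof
      fix x assume "x \<in> K"
      then have "x \<in> closure (range d)" by (simp add: clK)
      then obtain i where "dist (d i) x < 1 / Suc m"
        unfolding closure_approachable by (metis imageE of_nat_0_less_iff zero_less_Suc zero_less_divide_1_iff)
      then show "x \<in> (\<Union>i\<in>UNIV. ball (d i) (1 / Suc m))" by auto
    qed
    then obtain F where F: "finite F" "K \<subseteq> (\<Union>i\<in>F. ball (d i) (1 / Suc m))"
      using compactE_image[OF K(1), of UNIV "\<lambda>i. ball (d i) (1 / Suc m)"] by auto
    obtain N where N: "\<And>i. i \<in> F \<Longrightarrow> prod_encode (i, m) < N"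
      using finite_nat_set_iff_bounded[of "(\<lambda>i. prod_encode (i, m)) ` F"] F(1) by auto
    have "dist (d i) (d j) < e" if eq: "\<forall>k<N. b i k = b j k" for i j
    proof -
      obtain f where f: "f \<in> F" "dist (d f) (d i) < 1 / Suc m" using F(2) dK[of i] by auto
      then have "b i (prod_encode (f, m))" by (simp add: b_def dist_commute)
      then have "b j (prod_encode (f, m))" using eq N[OF f(1)] by blast
      then have "dist (d j) (d f) < 1 / Suc m" by (simp add: b_def)
      then have "dist (d i) (d j) < 1 / Suc m + 1 / Suc m"
        using f(2) dist_triangle[of "d i" "d j" "d f"] by (simp add: dist_commute)
      then show ?thesis using m by simp
    qed
    then show ?thesis by blast
  qed
  \<comment> \<open>\<open>idx y N\<close> is an index compatible with the first \<open>N\<close> bits of \<open>y\<close>, or the last one found if there is none\<close>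
  define cell where "cell y N = {i. \<forall>k<N. b i k = y k}" for y N
  define idx where "idx y = rec_nat 0 (\<lambda>N p. if \<exists>i. i \<in> cell y (Suc N) then LEAST i. i \<in> cell y (Suc N) else p)" for y
  have idx0: "idx y 0 = 0"
    and idxS: "idx y (Suc N) = (if \<exists>i. i \<in> cell y (Suc N) then LEAST i. i \<in> cell y (Suc N) else idx y N)" for y N
    by (simp_all add: idx_def)
  have cell_mono: "cell y N' \<subseteq> cell y N" if "N \<le> N'" for y N N' using that by (auto simp: cell_def)
  have idx_cell: "idx y N' \<in> cell y N" if ne: "cell y N \<noteq> {}" and le: "N \<le> N'" for y N N'
    using le
  proof (induction rule: dec_induct)
    case base
    show ?case
    proof (cases N)
      case (Suc n)
      then show ?thesis using ne by (auto simp: idxS intro: LeastI)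
    qed (simp add: cell_def)
  next
    case (step n)
    have "(LEAST i. i \<in> cell y (Suc n)) \<in> cell y N" if "\<exists>i. i \<in> cell y (Suc n)"
      using LeastI_ex[OF that] cell_mono[of N "Suc n" y] step(1) by auto
    then show ?case using step by (auto simp: idxS)
  qed
  have idx_cong: "idx y N = idx y' N" if "\<And>k. k < N \<Longrightarrow> y k = y' k" for y y' N
    using that
  proof (induction N)
    case (Suc N)
    have "cell y (Suc N) = cell y' (Suc N)" using Suc.prems by (auto simp: cell_def)
    moreover have "idx y N = idx y' N" using Suc by simp
    ultimately show ?case by (simp add: idxS)
  qed (simp add: idx0)
  have cauchy: "Cauchy (\<lambda>N. d (idx y N))" for y
  proof (rule metric_CauchyI)
    fix e :: real assume "0 < e"
    then obtain N where N: "\<And>i j. (\<forall>k<N. b i k = b j k) \<Longrightarrow> dist (d i) (d j) < e" using sep by blast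
    have "dist (d (idx y m)) (d (idx y n)) < e" if "m \<ge> N" "n \<ge> N" for m n
    proof (cases "cell y N = {}")
      case True
      have const: "idx y m = idx y N" if "m \<ge> N" for m
        using that
      proof (induction rule: dec_induct)
        case (step n)
        have "cell y (Suc n) = {}" using cell_mono[of N "Suc n" y] step(1) True by auto
        then show ?case using step by (simp add: idxS)
      qed simp
      show ?thesis unfolding const[OF that(1)] const[OF that(2)] using \<open>0 < e\<close> by simp
    next
      case False
      then show ?thesis
        using idx_cell[OF False that(1)] idx_cell[OF False that(2)] by (intro N) (auto simp: cell_def)
    qed
    then show "\<exists>M. \<forall>m\<ge>M. \<forall>n\<ge>M. dist (d (idx y m)) (d (idx y n)) < e" by blast
  qed
  then have "\<exists>x. (\<lambda>N. d (idx y N)) \<longlonglongrightarrow> x" for y by (simp add: Cauchy_convergent_iff convergent_def)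
  then obtain \<gamma> where \<gamma>: "\<And>y. (\<lambda>N. d (idx y N)) \<longlonglongrightarrow> \<gamma> y" by metis
  have \<gamma>K: "\<gamma> y \<in> K" for y
    using closed_sequentially[OF compact_imp_closed[OF K(1)] _ \<gamma>] dK by blast
  have idx_meas: "(\<lambda>y. idx y N) \<in> measurable cantor_space (count_space UNIV)" for N
  proof (induction N)
    case (Suc N)
    note [measurable] = this
    show ?case unfolding idxS cell_def mem_Collect_eq by measurable
  qed (simp add: idx0)
  have gd_meas: "(\<lambda>y. g (d (idx y N))) \<in> borel_measurable cantor_space" for g :: "'y \<Rightarrow> 'z::topological_space" and N
    by (rule measurable_compose[OF idx_meas]) simp
  have \<gamma>_borel: "\<gamma> \<in> borel_measurable cantor_space"
    by (rule borel_measurable_LIMSEQ_metric[OF gd_meas[of "\<lambda>x. x"]]) (use \<gamma> in auto)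
  have \<gamma>_meas: "\<gamma> \<in> measurable cantor_space (borel_on K)"
    unfolding borel_on_def by (rule measurable_restrict_space2) (use \<gamma>K \<gamma>_borel in auto)
  \<comment> \<open>transport of set functions from \<open>nat\<close> to Cantor space along \<open>b\<close>\<close>
  define pb where "pb E = {i. b i \<in> E}" for E
  define r where "r u E = R (bseq_on u (pb E))" for u E
  have r_add: "r u (E \<union> F) = r u E + r u F" if "E \<inter> F = {}" for u E F
  proof -
    have "pb (E \<union> F) = pb E \<union> pb F" "pb E \<inter> pb F = {}" using that by (auto simp: pb_def)
    then show ?thesis by (simp add: r_def bseq_on_union linear_add[OF R(1)])
  qed
  have v_add: "v (pb (E \<union> F)) = v (pb E) + v (pb F)" if "E \<inter> F = {}" for E F
  proof -
    have "pb (E \<union> F) = pb E \<union> pb F" "pb E \<inter> pb F = {}" using that by (auto simp: pb_def)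
    then show ?thesis by (simp add: v(1))
  qed
  have r_neg: "r (- u) E = - r u E" for u E
  proof -
    have "bseq_on (- u) (pb E) = - bseq_on u (pb E)" by (rule bcontfun_eqI) (simp add: apply_bseq_on)
    then show ?thesis by (simp add: r_def linear_neg[OF R(1)])
  qed
  have r_lin: "r u E = Re u * r 1 E + Im u * r \<i> E" for u E
  proof -
    have "bseq_on u (pb E) = Re u *\<^sub>R bseq_on 1 (pb E) + Im u *\<^sub>R bseq_on \<i> (pb E)"
      by (rule bcontfun_eqI) (simp add: apply_bseq_on complex_eq_iff)
    then show ?thesis by (simp add: r_def linear_add[OF R(1)] linear_scale[OF R(1)])
  qed
  have r_le: "r u E \<le> v (pb E)" if "cmod u = 1" for u E unfolding r_def by (rule v(2)[OF that])
  have ex: "\<exists>M. finite_measure M \<and> sets M = sets cantor_space \<and> (\<forall>s. measure M (cylinder s) = v (pb (cylinder s)) - r u (cylinder s))"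
    if u: "cmod u = 1" for u
  proof -
    obtain M where "finite_measure M" "sets M = sets cantor_space" "\<And>s. measure M (cylinder s) = v (pb (cylinder s)) - r u (cylinder s)"
      by (rule cantor_measure_exists[of "\<lambda>E. v (pb E) - r u E"])
        (use v_add r_add r_le[OF u] in \<open>auto simp: algebra_simps\<close>)
    then show ?thesis by blast
  qed
  obtain M0 where M0: "finite_measure M0" "sets M0 = sets cantor_space" "\<And>s. measure M0 (cylinder s) = v (pb (cylinder s))"
    by (rule cantor_measure_exists[of "\<lambda>E. v (pb E)"]) (use v_add v(4) in auto)
  obtain M1 where M1: "finite_measure M1" "sets M1 = sets cantor_space"
    "\<And>s. measure M1 (cylinder s) = v (pb (cylinder s)) + r 1 (cylinder s)"
    using ex[of "- 1"] by (auto simp: r_neg)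
  obtain M2 where M2: "finite_measure M2" "sets M2 = sets cantor_space"
    "\<And>s. measure M2 (cylinder s) = v (pb (cylinder s)) + r \<i> (cylinder s)"
    using ex[of "- \<i>"] by (auto simp: r_neg)
  define \<mu> where "\<mu> E = Complex (measure M1 E - measure M0 E) (measure M0 E - measure M2 E)" for E
  \<comment> \<open>rotating \<open>\<mu> E\<close> to the positive axis by \<open>u\<close>: \<open>v - r u\<close> is nonnegative on cylinders, hence so is the corresponding combination of measures on \<open>E\<close>\<close>
  have \<mu>_le: "cmod (\<mu> E) \<le> measure M0 E" if E: "E \<in> sets cantor_space" for E
  proof -
    obtain u where u: "cmod u = 1" "u * \<mu> E = of_real (cmod (\<mu> E))"
    proof (cases "\<mu> E = 0")
      case True
      then show ?thesis using that[of 1] by simp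
    next
      case False
      have "cnj (\<mu> E) * \<mu> E = of_real (cmod (\<mu> E)) * of_real (cmod (\<mu> E))"
        by (simp add: mult.commute[of "cnj _"] complex_norm_square[symmetric] power2_eq_square)
      then show ?thesis using that[of "cnj (\<mu> E) / of_real (cmod (\<mu> E))"] False by (simp add: norm_divide)
    qed
    obtain M3 where M3: "finite_measure M3" "sets M3 = sets cantor_space"
      "\<And>s. measure M3 (cylinder s) = v (pb (cylinder s)) - r u (cylinder s)"
      using ex[OF u(1)] by blast
    define M where "M q = [M0, M1, M2, M3] ! q" for q
    define c where "c q = [Re u + Im u + 1, - Re u, - Im u, -1] ! q" for q
    have "(\<Sum>q\<in>{0,1,2,3::nat}. c q * measure (M q) E) = 0"
    proof (rule cantor_measures_linear[OF _ _ E])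
      show "(\<Sum>q\<in>{0,1,2,3::nat}. c q * measure (M q) (cylinder s)) = 0" for s
        by (simp add: c_def M_def M0 M1 M2 M3 r_lin[of u] algebra_simps numeral_2_eq_2 numeral_3_eq_3)
    qed (use M0 M1 M2 M3 in \<open>auto simp: M_def numeral_2_eq_2 numeral_3_eq_3\<close>)
    then have "measure M3 E = measure M0 E - (Re u * (measure M1 E - measure M0 E) + Im u * (measure M2 E - measure M0 E))"
      by (simp add: c_def M_def algebra_simps numeral_2_eq_2 numeral_3_eq_3)
    also have "Re u * (measure M1 E - measure M0 E) + Im u * (measure M2 E - measure M0 E) = Re (u * \<mu> E)"
      by (simp add: \<mu>_def algebra_simps)
    also have "\<dots> = cmod (\<mu> E)" by (simp add: u(2))
    finally show ?thesis using measure_nonneg[of M3 E] by simp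
  qed
  define S where "S g = ((\<integral>y. g (\<gamma> y) \<partial>M1) - (\<integral>y. g (\<gamma> y) \<partial>M0)) + \<i> * ((\<integral>y. g (\<gamma> y) \<partial>M0) - (\<integral>y. g (\<gamma> y) \<partial>M2))" for g :: "'y \<Rightarrow> complex"
  have g_meas: "(\<lambda>y. g (\<gamma> y)) \<in> borel_measurable cantor_space" if "(g, c) \<in> G" for g c
    by (rule measurable_compose[OF \<gamma>_meas]) (simp add: borel_on_def borel_measurable_continuous_on_restrict[OF cont[OF that]])
  have lim: "(\<lambda>N. \<integral>y. g (d (idx y N)) \<partial>M) \<longlonglongrightarrow> (\<integral>y. g (\<gamma> y) \<partial>M)"
    if M: "finite_measure M" "sets M = sets cantor_space" and g: "(g, c) \<in> G" for M g c
  proof -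
    interpret finite_measure M by (rule M)
    have meq: "borel_measurable M = borel_measurable cantor_space" by (rule measurable_cong_sets[OF M(2) refl])
    obtain B where B: "\<forall>x\<in>K. cmod (g x) \<le> B" using gb[OF g] by blast
    show ?thesis
    proof (rule integral_dominated_convergence[where w = "\<lambda>_. B"])
      show "(\<lambda>y. g (\<gamma> y)) \<in> borel_measurable M" unfolding meq by (rule g_meas[OF g])
      show "(\<lambda>y. g (d (idx y N))) \<in> borel_measurable M" for N unfolding meq by (rule gd_meas)
      show "AE y in M. (\<lambda>N. g (d (idx y N))) \<longlonglongrightarrow> g (\<gamma> y)"
        using continuous_on_tendsto_compose[OF cont[OF g] \<gamma> \<gamma>K] dK by auto
      show "AE y in M. cmod (g (d (idx y N))) \<le> B" for N using B dK by auto
    qed simp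
  qed
  have Re_S: "Re c = Re (S g)" if g: "(g, c) \<in> G" for g c
  proof -
    define a where "a N s = g (d (idx ((!) s) N))" for N s
    \<comment> \<open>\<open>f N\<close> is the sequence \<open>i \<mapsto> g (d (idx (b i) N))\<close>, a sum over cylinders, which approximates \<open>sq g\<close>\<close>
    define f where "f N = (\<Sum>s\<in>{s. length s = N}. Re (a N s) *\<^sub>R bseq_on 1 (pb (cylinder s)) + Im (a N s) *\<^sub>R bseq_on \<i> (pb (cylinder s)))" for N
    define SN where "SN N = ((\<integral>y. g (d (idx y N)) \<partial>M1) - (\<integral>y. g (d (idx y N)) \<partial>M0)) + \<i> * ((\<integral>y. g (d (idx y N)) \<partial>M0) - (\<integral>y. g (d (idx y N)) \<partial>M2))" for N
    have int: "(\<integral>y. g (d (idx y N)) \<partial>M) = (\<Sum>s\<in>{s. length s = N}. of_real (measure M (cylinder s)) * a N s)"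
      if "finite_measure M" "sets M = sets cantor_space" for M N
      unfolding a_def by (rule cylinder_partition_integral[OF that]) (metis idx_cong)
    have "Re (SN N) = R (f N)" for N
    proof -
      have "SN N = (\<Sum>s\<in>{s. length s = N}. (of_real (r 1 (cylinder s)) - \<i> * of_real (r \<i> (cylinder s))) * a N s)"
        unfolding SN_def int[OF M0(1,2)] int[OF M1(1,2)] int[OF M2(1,2)] M0 M1 M2
        by (simp add: sum_distrib_left algebra_simps flip: sum_subtractf sum.distrib)
      moreover have "Re ((of_real (r 1 (cylinder s)) - \<i> * of_real (r \<i> (cylinder s))) * a N s)
          = Re (a N s) * r 1 (cylinder s) + Im (a N s) * r \<i> (cylinder s)" for s
        by (simp add: algebra_simps)
      ultimately show ?thesis
        by (simp add: f_def linear_sum[OF R(1)] linear_add[OF R(1)] linear_scale[OF R(1)] r_def mult.commute)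
    qed
    moreover have "(\<lambda>N. R (f N)) \<longlonglongrightarrow> Re c"
    proof (rule LIMSEQ_I)
      fix e :: real assume e: "0 < e"
      define e' where "e' = e / (C + 1)"
      have e': "e' > 0" using e C by (simp add: e'_def)
      have "uniformly_continuous_on K g" using compact_uniformly_continuous[OF cont[OF g] K(1)] .
      then obtain \<delta> where \<delta>: "\<delta> > 0" "\<And>x x'. x \<in> K \<Longrightarrow> x' \<in> K \<Longrightarrow> dist x' x < \<delta> \<Longrightarrow> dist (g x') (g x) < e'"
        unfolding uniformly_continuous_on_def using e' by metis
      obtain N0 where N0: "\<And>i j. (\<forall>k<N0. b i k = b j k) \<Longrightarrow> dist (d i) (d j) < \<delta>" using sep[OF \<delta>(1)] by blast
      have "norm (R (f N) - Re c) < e" if N: "N \<ge> N0" for N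
      proof -
        have "norm (f N - sq g) \<le> e'"
        proof (rule norm_bound)
          fix i
          define s0 where "s0 = map (b i) [0..<N]"
          have bcyl: "b i \<in> cylinder s \<longleftrightarrow> s = s0" if "length s = N" for s
            using that by (auto simp: cylinder_eq s0_def)
          have fs: "apply_bcontfun (\<Sum>s\<in>A. F s) i = (\<Sum>s\<in>A. apply_bcontfun (F s) i)" for A and F :: "bool list \<Rightarrow> nat \<Rightarrow>\<^sub>C complex"
            by (induction A rule: infinite_finite_induct) auto
          have "apply_bcontfun (f N) i = (\<Sum>s\<in>{s. length s = N}. if b i \<in> cylinder s then a N s else 0)"
            unfolding f_def fs by (rule sum.cong) (auto simp: apply_bseq_on pb_def complex_eq_iff)
          also have "\<dots> = (\<Sum>s\<in>{s. length s = N}. if s = s0 then a N s else 0)"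
            by (rule sum.cong) (auto simp: bcyl)
          also have "\<dots> = a N s0" by (simp add: finite_bool_lists) (simp add: s0_def)
          also have "\<dots> = g (d (idx (b i) N))"
            unfolding a_def by (rule arg_cong[of _ _ "\<lambda>i. g (d i)"], rule idx_cong) (simp add: s0_def)
          finally have "apply_bcontfun (f N - sq g) i = g (d (idx (b i) N)) - g (d i)" by (simp add: sq[OF g])
          moreover have "dist (g (d (idx (b i) N))) (g (d i)) < e'"
          proof (rule \<delta>(2)[OF dK dK], rule N0)
            have "i \<in> cell (b i) N" by (simp add: cell_def)
            then have "idx (b i) N \<in> cell (b i) N" using idx_cell by blast
            then show "\<forall>k<N0. b (idx (b i) N) k = b i k" using N by (simp add: cell_def)
          qed
          ultimately show "cmod (apply_bcontfun (f N - sq g) i) \<le> e'" by (simp add: dist_norm)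
        qed
        then have "C * norm (f N - sq g) \<le> C * e'" using C by (rule mult_left_mono)
        then have "\<bar>R (f N - sq g)\<bar> \<le> C * e'" using Rabs order_trans by blast
        also have "C * e' < e" using e C by (simp add: e'_def field_simps)
        finally show ?thesis by (simp add: linear_diff[OF R(1)] R(2)[OF g])
      qed
      then show "\<exists>no. \<forall>n\<ge>no. norm (R (f n) - Re c) < e" by blast
    qed
    moreover have "SN \<longlonglongrightarrow> S g"
      unfolding SN_def S_def
      by (intro tendsto_add tendsto_diff tendsto_mult tendsto_const lim[OF M0(1,2) g] lim[OF M1(1,2) g] lim[OF M2(1,2) g])
    then have "(\<lambda>N. Re (SN N)) \<longlonglongrightarrow> Re (S g)" by (rule tendsto_Re)
    ultimately show ?thesis using LIMSEQ_unique by simp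
  qed
  have cS: "c = S g" if g: "(g, c) \<in> G" for g c
  proof -
    have "S (\<lambda>x. - \<i> * g x) = - \<i> * S g" by (simp add: S_def algebra_simps)
    then have "Im c = Im (S g)" using Re_S[OF Gscale[OF g, of "- \<i>"]] by simp
    then show ?thesis using Re_S[OF g] by (simp add: complex_eq_iff)
  qed
  define m where "m M = distr M (borel_on K) \<gamma>" for M :: "(nat \<Rightarrow> bool) measure"
  have \<gamma>M: "\<gamma> \<in> measurable M (borel_on K)" if "sets M = sets cantor_space" for M
    using \<gamma>_meas measurable_cong_sets[OF that refl] by blast
  have meas: "measure (m M) E = measure M (\<gamma> -` E)" if "sets M = sets cantor_space" "E \<in> sets (borel_on K)" for M E
    using measure_distr[OF \<gamma>M[OF that(1)] that(2)] sets_eq_imp_space_eq[OF that(1)] by (simp add: m_def)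
  have vim: "\<gamma> -` E \<in> sets cantor_space" if "E \<in> sets (borel_on K)" for E
    using measurable_sets[OF \<gamma>_meas that] by simp
  have spK: "K \<in> sets (borel_on K)" by (simp add: borel_on_def sets_restrict_space_iff borel_compact[OF K(1)])
  have ints: "(\<integral>x. g x \<partial>m M) = (\<integral>y. g (\<gamma> y) \<partial>M)" if "sets M = sets cantor_space" "(g, c) \<in> G" for M g c
    unfolding m_def by (rule integral_distr[OF \<gamma>M[OF that(1)]])
      (simp add: borel_on_def borel_measurable_continuous_on_restrict[OF cont[OF that(2)]])
  show ?thesis
  proof (rule that[of "m M0" "m M1" "m M2"])
    show "finite_measure (m M0)" "finite_measure (m M1)" "finite_measure (m M2)"
      unfolding m_def by (rule finite_measure.finite_measure_distr; use M0 M1 M2 \<gamma>M in blast)+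
    show "sets (m M0) = sets (borel_on K)" "sets (m M1) = sets (borel_on K)" "sets (m M2) = sets (borel_on K)"
      by (simp_all add: m_def)
    have "\<gamma> -` K = cylinder []" using \<gamma>K by (auto simp: cylinder_Nil)
    then have "measure (m M0) K = v (pb (cylinder []))" using M0 spK by (simp add: meas)
    then show "measure (m M0) K \<le> C" using v(3) by (simp add: cylinder_Nil pb_def)
    show "cmod (Complex (measure (m M1) E - measure (m M0) E) (measure (m M0) E - measure (m M2) E)) \<le> measure (m M0) E"
      if "E \<in> sets (borel_on K)" for E
      using \<mu>_le[OF vim[OF that]] M0(2) M1(2) M2(2) that by (simp add: meas \<mu>_def)
    show "c = ((\<integral>x. g x \<partial>m M1) - (\<integral>x. g x \<partial>m M0)) + \<i> * ((\<integral>x. g x \<partial>m M0) - (\<integral>x. g x \<partial>m M2))"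
      if "(g, c) \<in> G" for g c
      using cS[OF that] M0(2) M1(2) M2(2) that by (simp add: ints S_def)
  qed
qed

section \<open>Complex measures and their integrals\<close>

lemma complex_measure_union:
  assumes \<mu>: "complex_measure M \<mu>" and AB: "A \<in> sets M" "B \<in> sets M" "A \<inter> B = {}"
  shows "\<mu> (A \<union> B) = \<mu> A + \<mu> B"
proof -
  define E :: "nat \<Rightarrow> _" where "E = (\<lambda>i. if i = 0 then A else if i = 1 then B else {})"
  have "range E \<subseteq> sets M" "disjoint_family E" using AB by (auto simp: E_def disjoint_family_on_def)
  then have "(\<lambda>i. \<mu> (E i)) sums \<mu> (\<Union>i. E i)" using \<mu> by (simp add: complex_measure_def)
  moreover have "(\<Union>i. E i) = A \<union> B" by (auto simp: E_def split: if_splits)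
  moreover have "(\<lambda>i. \<mu> (E i)) sums (\<Sum>i\<in>{0,1}. \<mu> (E i))"
    using \<mu> by (intro sums_finite) (auto simp: E_def complex_measure_def)
  ultimately have "\<mu> (A \<union> B) = (\<Sum>i\<in>{0,1}. \<mu> (E i))" using sums_unique2 by metis
  then show ?thesis by (simp add: E_def)
qed

text \<open>If \<open>\<mu>\<close> is unbounded on the subsets of \<open>E\<close>, then \<open>E\<close> splits off a set of measure larger than \<open>1\<close>
  in modulus and leaves a remainder of the same kind.  Iteration would give a divergent series.\<close>

theorem complex_measure_bounded:
  assumes \<mu>: "complex_measure M \<mu>"
  obtains B where "\<And>E. E \<in> sets M \<Longrightarrow> cmod (\<mu> E) \<le> B"
proof -
  define bad where "bad E \<longleftrightarrow> E \<in> sets M \<and> (\<forall>b. \<exists>F\<in>sets M. F \<subseteq> E \<and> cmod (\<mu> F) > b)" for E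
  have step: "\<exists>E'. bad E' \<and> E' \<subseteq> E \<and> cmod (\<mu> (E - E')) > 1" if E: "bad E" for E
  proof -
    obtain F where F: "F \<in> sets M" "F \<subseteq> E" "cmod (\<mu> F) > cmod (\<mu> E) + 1" using E unfolding bad_def by blast
    have EM: "E \<in> sets M" using E by (simp add: bad_def)
    have dM: "E - F \<in> sets M" using EM F(1) by blast
    have "E = F \<union> (E - F)" using F(2) by blast
    then have "\<mu> E = \<mu> F + \<mu> (E - F)" using complex_measure_union[OF \<mu> F(1) dM] by auto
    then have "cmod (\<mu> F) \<le> cmod (\<mu> E) + cmod (\<mu> (E - F))"
      using norm_triangle_ineq4[of "\<mu> E" "\<mu> (E - F)"] by simp
    then have big: "cmod (\<mu> (E - F)) > 1" "cmod (\<mu> F) > 1" using F(3) norm_ge_zero[of "\<mu> E"] by linarith+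
    have "bad F \<or> bad (E - F)"
    proof (rule ccontr)
      assume "\<not> (bad F \<or> bad (E - F))"
      then obtain b b' where b: "\<And>G. G \<in> sets M \<Longrightarrow> G \<subseteq> F \<Longrightarrow> cmod (\<mu> G) \<le> b"
        "\<And>G. G \<in> sets M \<Longrightarrow> G \<subseteq> E - F \<Longrightarrow> cmod (\<mu> G) \<le> b'"
        using F(1) dM unfolding bad_def by (meson not_le)
      have "cmod (\<mu> G) \<le> b + b'" if G: "G \<in> sets M" "G \<subseteq> E" for G
      proof -
        have "\<mu> ((G \<inter> F) \<union> (G - F)) = \<mu> (G \<inter> F) + \<mu> (G - F)"
          by (rule complex_measure_union[OF \<mu>]) (use G F(1) in auto)
        moreover have "(G \<inter> F) \<union> (G - F) = G" by blast
        ultimately have "cmod (\<mu> G) \<le> cmod (\<mu> (G \<inter> F)) + cmod (\<mu> (G - F))" by (metis norm_triangle_ineq)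
        also have "\<dots> \<le> b + b'" by (intro add_mono b) (use G F(1) in auto)
        finally show ?thesis .
      qed
      then show False using E unfolding bad_def by (meson not_le)
    qed
    then show ?thesis
    proof
      assume "bad F"
      then show ?thesis using big(1) F(2) by blast
    next
      assume "bad (E - F)"
      moreover have "E - (E - F) = F" using F(2) by blast
      ultimately show ?thesis using big(2) by (intro exI[of _ "E - F"]) auto
    qed
  qed
  have "\<not> bad (space M)"
  proof
    assume "bad (space M)"
    then obtain E where E: "\<And>n. bad (E n)" "\<And>n. E (Suc n) \<subseteq> E n \<and> cmod (\<mu> (E n - E (Suc n))) > 1"
      using dependent_nat_choice[of "\<lambda>_. bad" "\<lambda>_ E E'. E' \<subseteq> E \<and> cmod (\<mu> (E - E')) > 1"] step by metis
    define D where "D n = E n - E (Suc n)" for n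
    have "range D \<subseteq> sets M" using E(1) by (auto simp: D_def bad_def)
    moreover have "disjoint_family D"
      unfolding disjoint_family_on_def
    proof (intro ballI impI)
      have anti: "E n \<subseteq> E m" if "m \<le> n" for m n
        using that by (induction rule: dec_induct) (use E(2) in blast)+
      have "D m \<inter> D n = {}" if "m < n" for m n
        using anti[of "Suc m" n] that by (auto simp: D_def)
      then show "D m \<inter> D n = {}" if "m \<noteq> n" for m n
        using that by (metis Int_commute linorder_neqE_nat)
    qed
    ultimately have "(\<lambda>n. \<mu> (D n)) sums \<mu> (\<Union>n. D n)" using \<mu> by (simp add: complex_measure_def)
    then have "(\<lambda>n. \<mu> (D n)) \<longlonglongrightarrow> 0" using summable_LIMSEQ_zero sums_summable by blast
    then have "\<forall>\<^sub>F n in sequentially. cmod (\<mu> (D n)) < 1"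
      using order_tendstoD(2)[OF tendsto_norm_zero, of _ _ 1] by simp
    then obtain n where "cmod (\<mu> (D n)) < 1" using eventually_happens by force
    then show False using E(2)[of n] by (simp add: D_def)
  qed
  then obtain b where "\<And>F. F \<in> sets M \<Longrightarrow> cmod (\<mu> F) \<le> b"
    unfolding bad_def by (meson not_le sets.sets_into_space sets.top)
  then show ?thesis by (rule that)
qed

context
  fixes M :: "'a measure" and \<nu> :: "'a set \<Rightarrow> real" and B :: real
  assumes empty: "\<nu> {} = 0"
    and sums: "\<And>E :: nat \<Rightarrow> 'a set. range E \<subseteq> sets M \<Longrightarrow> disjoint_family E \<Longrightarrow> (\<lambda>i. \<nu> (E i)) sums \<nu> (\<Union>i. E i)"
    and B: "\<And>E. E \<in> sets M \<Longrightarrow> \<bar>\<nu> E\<bar> \<le> B"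
begin

lemma signed_union: "A \<in> sets M \<Longrightarrow> A' \<in> sets M \<Longrightarrow> A \<inter> A' = {} \<Longrightarrow> \<nu> (A \<union> A') = \<nu> A + \<nu> A'"
proof -
  assume A: "A \<in> sets M" "A' \<in> sets M" "A \<inter> A' = {}"
  have "complex_measure M (\<lambda>E. complex_of_real (\<nu> E))"
    using sums empty by (auto simp: complex_measure_def intro!: sums_of_real)
  from complex_measure_union[OF this A] show ?thesis by (simp flip: of_real_add)
qed

definition "upper_variation E = (SUP F\<in>{F \<in> sets M. F \<subseteq> E}. \<nu> F)"

lemma upper_variation_ge: "F \<in> sets M \<Longrightarrow> F \<subseteq> E \<Longrightarrow> \<nu> F \<le> upper_variation E"
  unfolding upper_variation_def using B by (intro cSUP_upper bdd_aboveI2[of _ _ B]) (auto simp: abs_le_iff)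

lemma upper_variation_le: "(\<And>F. F \<in> sets M \<Longrightarrow> F \<subseteq> E \<Longrightarrow> \<nu> F \<le> b) \<Longrightarrow> upper_variation E \<le> b"
  unfolding upper_variation_def by (intro cSUP_least) auto

lemma upper_variation_nonneg: "0 \<le> upper_variation E"
  using upper_variation_ge[of "{}" E] empty by simp

lemma upper_variation_mono: "E \<subseteq> E' \<Longrightarrow> upper_variation E \<le> upper_variation E'"
  by (rule upper_variation_le) (auto intro: upper_variation_ge)

lemma upper_variation_superadditive:
  assumes "A \<inter> A' = {}"
  shows "upper_variation A + upper_variation A' \<le> upper_variation (A \<union> A')"
proof -
  have "upper_variation A' \<le> upper_variation (A \<union> A') - upper_variation A"
  proof (rule upper_variation_le)
    fix G assume G: "G \<in> sets M" "G \<subseteq> A'"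
    have "upper_variation A \<le> upper_variation (A \<union> A') - \<nu> G"
    proof (rule upper_variation_le)
      fix F assume F: "F \<in> sets M" "F \<subseteq> A"
      have "F \<inter> G = {}" using F(2) G(2) assms by blast
      then have "\<nu> F + \<nu> G = \<nu> (F \<union> G)" using signed_union F G by simp
      also have "\<dots> \<le> upper_variation (A \<union> A')" by (rule upper_variation_ge) (use F G in auto)
      finally show "\<nu> F \<le> upper_variation (A \<union> A') - \<nu> G" by simp
    qed
    then show "\<nu> G \<le> upper_variation (A \<union> A') - upper_variation A" by simp
  qed
  then show ?thesis by simp
qed

lemma upper_variation_sums:
  fixes E :: "nat \<Rightarrow> 'a set"
  assumes E: "range E \<subseteq> sets M" "disjoint_family E"
  shows "(\<lambda>i. upper_variation (E i)) sums upper_variation (\<Union>i. E i)"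
proof -
  have fin: "(\<Sum>i<n. upper_variation (E i)) \<le> upper_variation (\<Union>i<n. E i)" for n
  proof (induction n)
    case (Suc n)
    have "E i \<inter> E n = {}" if "i < n" for i using disjoint_family_onD[OF E(2), of i n] that by simp
    then have "(\<Union>i<n. E i) \<inter> E n = {}" by blast
    from upper_variation_superadditive[OF this] show ?case using Suc by (simp add: lessThan_Suc Un_commute)
  qed (simp add: upper_variation_nonneg)
  have le: "(\<Sum>i<n. upper_variation (E i)) \<le> upper_variation (\<Union>i. E i)" for n
    using fin[of n] upper_variation_mono[of "\<Union>i<n. E i" "\<Union>i. E i"] by fastforce
  have summ: "summable (\<lambda>i. upper_variation (E i))"
    by (rule summableI_nonneg_bounded[OF upper_variation_nonneg le])
  have "upper_variation (\<Union>i. E i) \<le> (\<Sum>i. upper_variation (E i))"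
  proof (rule upper_variation_le)
    fix F assume F: "F \<in> sets M" "F \<subseteq> (\<Union>i. E i)"
    have "(\<lambda>i. \<nu> (F \<inter> E i)) sums \<nu> (\<Union>i. F \<inter> E i)"
      by (rule sums) (use E F in \<open>auto simp: disjoint_family_on_def\<close>)
    moreover have "(\<Union>i. F \<inter> E i) = F" using F by blast
    ultimately have "\<nu> F = (\<Sum>i. \<nu> (F \<inter> E i))" "summable (\<lambda>i. \<nu> (F \<inter> E i))" by (auto simp: sums_iff)
    moreover have "\<nu> (F \<inter> E i) \<le> upper_variation (E i)" for i
      by (rule upper_variation_ge) (use E F in auto)
    ultimately show "\<nu> F \<le> (\<Sum>i. upper_variation (E i))" by (metis suminf_le summ)
  qed
  moreover have "(\<Sum>i. upper_variation (E i)) \<le> upper_variation (\<Union>i. E i)"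
    by (rule suminf_le_const[OF summ le])
  ultimately show ?thesis using summ by (simp add: sums_iff)
qed

text \<open>The supremum over subsets is countably additive by the previous lemmas.  It is finite because \<open>\<nu>\<close> is
  bounded.\<close>

lemma positive_part_measure:
  "sets (positive_part M \<nu>) = sets M" "finite_measure (positive_part M \<nu>)"
  "E \<in> sets M \<Longrightarrow> measure (positive_part M \<nu>) E = upper_variation E"
proof -
  show s: "sets (positive_part M \<nu>) = sets M"
    by (simp add: positive_part_def sets.sets_measure_of_eq)
  have sup: "(SUP F\<in>{F \<in> sets M. F \<subseteq> E}. ennreal (\<nu> F)) = ennreal (upper_variation E)" for E
  proof (rule antisym)
    show "(SUP F\<in>{F \<in> sets M. F \<subseteq> E}. ennreal (\<nu> F)) \<le> ennreal (upper_variation E)"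
      by (rule SUP_least) (auto intro!: ennreal_leI upper_variation_ge)
    show "ennreal (upper_variation E) \<le> (SUP F\<in>{F \<in> sets M. F \<subseteq> E}. ennreal (\<nu> F))"
    proof (cases "(SUP F\<in>{F \<in> sets M. F \<subseteq> E}. ennreal (\<nu> F))")
      case (real x)
      have "\<nu> F \<le> x" if "F \<in> sets M" "F \<subseteq> E" for F
      proof -
        have "ennreal (\<nu> F) \<le> ennreal x" unfolding real(2)[symmetric] by (rule SUP_upper) (use that in auto)
        then show ?thesis using real(1) by (simp add: ennreal_le_iff)
      qed
      then have "upper_variation E \<le> x" by (rule upper_variation_le)
      then show ?thesis unfolding real(2) by (rule ennreal_leI)
    next
      case top
      show ?thesis unfolding top by (rule top_greatest)
    qed
  qed
  have em: "emeasure (positive_part M \<nu>) E = ennreal (upper_variation E)" if "E \<in> sets M" for E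
    unfolding positive_part_def
  proof (subst emeasure_measure_of_sigma)
    show "sigma_algebra (space M) (sets M)" by (rule sets.sigma_algebra_axioms)
    have "upper_variation {} = 0"
      using upper_variation_le[of "{}" 0] upper_variation_nonneg[of "{}"] empty by auto
    then show "positive (sets M) (\<lambda>E. SUP F\<in>{F \<in> sets M. F \<subseteq> E}. ennreal (\<nu> F))"
      by (simp only: sup positive_def ennreal_0)
    show "countably_additive (sets M) (\<lambda>E. SUP F\<in>{F \<in> sets M. F \<subseteq> E}. ennreal (\<nu> F))"
      unfolding sup
    proof (rule countably_additiveI)
      fix A :: "nat \<Rightarrow> 'a set" assume "range A \<subseteq> sets M" "disjoint_family A"
      from upper_variation_sums[OF this]
      show "(\<Sum>i. ennreal (upper_variation (A i))) = ennreal (upper_variation (\<Union>i. A i))"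
        by (intro suminf_ennreal_eq upper_variation_nonneg)
    qed
  qed (use that sup in auto)
  have "space (positive_part M \<nu>) = space M" using s by (rule sets_eq_imp_space_eq)
  then show "finite_measure (positive_part M \<nu>)" by (intro finite_measureI) (simp add: em)
  show "E \<in> sets M \<Longrightarrow> measure (positive_part M \<nu>) E = upper_variation E"
    by (simp add: measure_def em upper_variation_nonneg)
qed

end

text \<open>For \<open>F \<subseteq> E\<close> one has \<open>\<nu> F = \<nu> E + (- \<nu>) (E - F)\<close>; take suprema over \<open>F\<close>.\<close>

lemma Jordan_decomposition:
  fixes M :: "'a measure" and \<nu> :: "'a set \<Rightarrow> real"
  assumes empty: "\<nu> {} = 0"
    and sums: "\<And>E :: nat \<Rightarrow> 'a set. range E \<subseteq> sets M \<Longrightarrow> disjoint_family E \<Longrightarrow> (\<lambda>i. \<nu> (E i)) sums \<nu> (\<Union>i. E i)"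
    and B: "\<And>E. E \<in> sets M \<Longrightarrow> \<bar>\<nu> E\<bar> \<le> B" and E: "E \<in> sets M"
  shows "measure (positive_part M \<nu>) E - measure (positive_part M (\<lambda>E. - \<nu> E)) E = \<nu> E"
proof -
  have neg: "- \<nu> {} = 0" "\<And>E :: nat \<Rightarrow> 'a set. range E \<subseteq> sets M \<Longrightarrow> disjoint_family E \<Longrightarrow> (\<lambda>i. - \<nu> (E i)) sums (- \<nu> (\<Union>i. E i))"
    "\<And>E. E \<in> sets M \<Longrightarrow> \<bar>- \<nu> E\<bar> \<le> B"
    using empty sums B by (auto intro: sums_minus)
  note p = upper_variation_le[OF empty sums B] upper_variation_ge[OF empty sums B]
  note n = upper_variation_le[OF neg] upper_variation_ge[OF neg]
  have split: "\<nu> E = \<nu> F + \<nu> (E - F)" if "F \<in> sets M" "F \<subseteq> E" for F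
  proof -
    have "\<nu> (F \<union> (E - F)) = \<nu> F + \<nu> (E - F)"
      by (rule signed_union[OF empty sums B]) (use that E in auto)
    moreover have "F \<union> (E - F) = E" using that by blast
    ultimately show ?thesis by simp
  qed
  have "upper_variation M \<nu> E \<le> \<nu> E + upper_variation M (\<lambda>E. - \<nu> E) E"
  proof (rule p(1))
    fix F assume F: "F \<in> sets M" "F \<subseteq> E"
    have "- \<nu> (E - F) \<le> upper_variation M (\<lambda>E. - \<nu> E) E" by (rule n(2)) (use F E in auto)
    then show "\<nu> F \<le> \<nu> E + upper_variation M (\<lambda>E. - \<nu> E) E" using split[OF F] by simp
  qed
  moreover have "upper_variation M (\<lambda>E. - \<nu> E) E \<le> upper_variation M \<nu> E - \<nu> E"
  proof (rule n(1))
    fix F assume F: "F \<in> sets M" "F \<subseteq> E"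
    have "\<nu> (E - F) \<le> upper_variation M \<nu> E" by (rule p(2)) (use F E in auto)
    then show "- \<nu> F \<le> upper_variation M \<nu> E - \<nu> E" using split[OF F] by simp
  qed
  ultimately show ?thesis
    using positive_part_measure(3)[OF empty sums B E] positive_part_measure(3)[OF neg E] by simp
qed

definition cm_bounded :: "'a measure \<Rightarrow> ('a \<Rightarrow> complex) \<Rightarrow> bool" where
  "cm_bounded M f \<longleftrightarrow> f \<in> borel_measurable M \<and> (\<exists>s. \<forall>x\<in>space M. cmod (f x) \<le> s)"

lemma cm_boundedI: "f \<in> borel_measurable M \<Longrightarrow> (\<And>x. x \<in> space M \<Longrightarrow> cmod (f x) \<le> s) \<Longrightarrow> cm_bounded M f"
  by (auto simp: cm_bounded_def)

lemma cm_bounded_integrable: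
  assumes "cm_bounded M f" "finite_measure p" "sets p = sets M"
  shows "integrable p f"
proof -
  obtain s where s: "\<forall>x\<in>space M. cmod (f x) \<le> s" using assms(1) by (auto simp: cm_bounded_def)
  have "f \<in> borel_measurable p"
    using assms(1) measurable_cong_sets[OF assms(3) refl] unfolding cm_bounded_def by blast
  then show ?thesis
    by (rule finite_measure.integrable_const_bound[OF assms(2), of _ s, rotated])
      (use s sets_eq_imp_space_eq[OF assms(3)] in auto)
qed

lemma cm_bounded_const: "cm_bounded M (\<lambda>_. c)"
  by (rule cm_boundedI[of _ _ "cmod c"]) auto

lemma cm_bounded_add: "cm_bounded M f \<Longrightarrow> cm_bounded M g \<Longrightarrow> cm_bounded M (\<lambda>x. f x + g x)"
  unfolding cm_bounded_def by (auto intro: norm_triangle_le add_mono intro!: exI)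

lemma cm_bounded_scale: "cm_bounded M f \<Longrightarrow> cm_bounded M (\<lambda>x. a * f x)"
proof -
  assume f: "cm_bounded M f"
  then obtain s where "\<forall>x\<in>space M. cmod (f x) \<le> s" by (auto simp: cm_bounded_def)
  then have "\<forall>x\<in>space M. cmod (a * f x) \<le> cmod a * s" by (auto simp: norm_mult intro: mult_left_mono)
  then show ?thesis using f by (auto simp: cm_bounded_def)
qed

lemma cm_bounded_sum: "(\<And>k. k \<in> F \<Longrightarrow> cm_bounded M (f k)) \<Longrightarrow> cm_bounded M (\<lambda>x. \<Sum>k\<in>F. f k x)"
  by (induction F rule: infinite_finite_induct) (auto simp: cm_bounded_const cm_bounded_add)

lemma cm_bounded_continuous:
  fixes K :: "'y::t2_space set"
  assumes "continuous_on K f" "compact K"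
  shows "cm_bounded (borel_on K) f"
proof -
  obtain s where "\<forall>x\<in>K. cmod (f x) \<le> s"
    using compact_imp_bounded[OF compact_continuous_image[OF assms]] by (auto simp: bounded_iff)
  then show ?thesis
    using borel_measurable_continuous_on_restrict[OF assms(1)]
    by (auto simp: cm_bounded_def borel_on_def space_restrict_space)
qed

text \<open>The equation passes from sets to nonnegative functions by monotone-class induction, to bounded real
  functions by adding a constant, and to complex functions by parts.\<close>

lemma integral_balance:
  fixes f :: "'a \<Rightarrow> complex"
  assumes fin: "finite_measure a" "finite_measure b" "finite_measure c" "finite_measure d"
    and sets: "sets a = sets M" "sets b = sets M" "sets c = sets M" "sets d = sets M"
    and eq: "\<And>E. E \<in> sets M \<Longrightarrow> measure a E + measure b E = measure c E + measure d E"
    and f: "cm_bounded M f"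
  shows "(\<integral>x. f x \<partial>a) + (\<integral>x. f x \<partial>b) = (\<integral>x. f x \<partial>c) + (\<integral>x. f x \<partial>d)"
proof -
  have fm: "f \<in> borel_measurable M" using f by (simp add: cm_bounded_def)
  obtain s where s: "\<And>x. x \<in> space M \<Longrightarrow> cmod (f x) \<le> s" using f by (auto simp: cm_bounded_def)
  have bm: "f \<in> borel_measurable a" if "sets a = sets M" "f \<in> borel_measurable M"
    for a and f :: "'a \<Rightarrow> 'z::topological_space"
    using that(2) measurable_cong_sets[OF that(1) refl] by blast
  have sp: "space a = space M" if "sets a = sets M" for a by (rule sets_eq_imp_space_eq[OF that])
  have nn: "(\<integral>\<^sup>+x. h x \<partial>a) + (\<integral>\<^sup>+x. h x \<partial>b) = (\<integral>\<^sup>+x. h x \<partial>c) + (\<integral>\<^sup>+x. h x \<partial>d)"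
    if h: "h \<in> borel_measurable M" for h :: "'a \<Rightarrow> ennreal"
    using h
  proof (induction rule: borel_measurable_induct)
    case (cong f g)
    have "(\<integral>\<^sup>+x. f x \<partial>a) = (\<integral>\<^sup>+x. g x \<partial>a)" if "sets a = sets M" for a
      by (rule nn_integral_cong) (use cong sp[OF that] in auto)
    then show ?case using cong sets by simp
  next
    case (set E)
    have e: "emeasure a E = ennreal (measure a E)" if "finite_measure a" for a
      using finite_measure.emeasure_eq_measure[OF that] .
    show ?case using set sets eq[OF set] by (simp add: e fin flip: ennreal_plus)
  next
    case (mult u k)
    have *: "(\<integral>\<^sup>+x. k * u x \<partial>a) = k * (\<integral>\<^sup>+x. u x \<partial>a)" if "sets a = sets M" for a
      by (rule nn_integral_cmult[OF bm[OF that]]) (use mult in blast)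
    show ?case unfolding *[OF sets(1)] *[OF sets(2)] *[OF sets(3)] *[OF sets(4)]
      using mult.IH by (simp flip: distrib_left)
  next
    case (add u v)
    have *: "(\<integral>\<^sup>+x. v x + u x \<partial>a) = (\<integral>\<^sup>+x. v x \<partial>a) + (\<integral>\<^sup>+x. u x \<partial>a)" if "sets a = sets M" for a
      by (rule nn_integral_add[OF bm[OF that] bm[OF that]]) (use add in blast)+
    have "(v1 + u1) + (v2 + u2) = (v1 + v2) + (u1 + u2)" for v1 v2 u1 u2 :: ennreal
      by (simp add: ac_simps)
    note swap = this
    have "((\<integral>\<^sup>+x. v x \<partial>a) + (\<integral>\<^sup>+x. u x \<partial>a)) + ((\<integral>\<^sup>+x. v x \<partial>b) + (\<integral>\<^sup>+x. u x \<partial>b))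
        = ((\<integral>\<^sup>+x. v x \<partial>a) + (\<integral>\<^sup>+x. v x \<partial>b)) + ((\<integral>\<^sup>+x. u x \<partial>a) + (\<integral>\<^sup>+x. u x \<partial>b))" by (rule swap)
    also have "\<dots> = ((\<integral>\<^sup>+x. v x \<partial>c) + (\<integral>\<^sup>+x. v x \<partial>d)) + ((\<integral>\<^sup>+x. u x \<partial>c) + (\<integral>\<^sup>+x. u x \<partial>d))"
      by (simp only: add.IH)
    also have "\<dots> = ((\<integral>\<^sup>+x. v x \<partial>c) + (\<integral>\<^sup>+x. u x \<partial>c)) + ((\<integral>\<^sup>+x. v x \<partial>d) + (\<integral>\<^sup>+x. u x \<partial>d))" by (rule swap)
    finally show ?case unfolding *[OF sets(1)] *[OF sets(2)] *[OF sets(3)] *[OF sets(4)] .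
  next
    case (seq U)
    have lim: "(\<lambda>i. \<integral>\<^sup>+x. U i x \<partial>a) \<longlonglongrightarrow> (\<integral>\<^sup>+x. (SUP i. U i) x \<partial>a)" if "sets a = sets M" for a
    proof -
      have "(\<integral>\<^sup>+x. (SUP i. U i) x \<partial>a) = (SUP i. \<integral>\<^sup>+x. U i x \<partial>a)"
        unfolding SUP_apply by (rule nn_integral_monotone_convergence_SUP) (use seq bm[OF that] in blast)+
      moreover have "incseq (\<lambda>i. \<integral>\<^sup>+x. U i x \<partial>a)"
        using seq by (auto simp: mono_def le_fun_def intro!: nn_integral_mono)
      ultimately show ?thesis using LIMSEQ_SUP by metis
    qed
    have "(\<lambda>i. (\<integral>\<^sup>+x. U i x \<partial>a) + (\<integral>\<^sup>+x. U i x \<partial>b)) \<longlonglongrightarrow> (\<integral>\<^sup>+x. (SUP i. U i) x \<partial>a) + (\<integral>\<^sup>+x. (SUP i. U i) x \<partial>b)"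
      "(\<lambda>i. (\<integral>\<^sup>+x. U i x \<partial>c) + (\<integral>\<^sup>+x. U i x \<partial>d)) \<longlonglongrightarrow> (\<integral>\<^sup>+x. (SUP i. U i) x \<partial>c) + (\<integral>\<^sup>+x. (SUP i. U i) x \<partial>d)"
      by (intro tendsto_add lim sets)+
    then show ?case using seq.IH LIMSEQ_unique by simp
  qed
  have real: "(\<integral>x. g x \<partial>a) + (\<integral>x. g x \<partial>b) = (\<integral>x. g x \<partial>c) + (\<integral>x. g x \<partial>d)"
    if g: "g \<in> borel_measurable M" "\<And>x. x \<in> space M \<Longrightarrow> \<bar>g x\<bar> \<le> s" for g :: "'a \<Rightarrow> real"
  proof -
    have shift: "ennreal ((\<integral>x. g x \<partial>a) + s * measure a (space M)) = (\<integral>\<^sup>+x. ennreal (g x + s) \<partial>a)"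
      "0 \<le> (\<integral>x. g x \<partial>a) + s * measure a (space M)"
      if a: "finite_measure a" "sets a = sets M" for a
    proof -
      interpret finite_measure a by (rule a)
      have gi: "integrable a g"
        by (rule integrable_const_bound[of _ s]) (use g bm[OF a(2) g(1)] sp[OF a(2)] in auto)
      have "(\<integral>x. g x + s \<partial>a) = (\<integral>x. g x \<partial>a) + s * measure a (space M)"
        using gi by (simp add: sp[OF a(2)])
      moreover have pos: "AE x in a. 0 \<le> g x + s"
        using g(2) sp[OF a(2)] by (intro AE_I2) (fastforce simp: abs_le_iff)
      then have "(\<integral>\<^sup>+x. ennreal (g x + s) \<partial>a) = ennreal (\<integral>x. g x + s \<partial>a)"
        by (intro nn_integral_eq_integral) (use gi in auto)
      moreover have "0 \<le> (\<integral>x. g x + s \<partial>a)" using pos by (rule integral_nonneg_AE)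
      ultimately show "ennreal ((\<integral>x. g x \<partial>a) + s * measure a (space M)) = (\<integral>\<^sup>+x. ennreal (g x + s) \<partial>a)"
        "0 \<le> (\<integral>x. g x \<partial>a) + s * measure a (space M)" by simp_all
    qed
    have "(\<lambda>x. ennreal (g x + s)) \<in> borel_measurable M" using g by measurable
    note eqn = nn[OF this]
    define J where "J m = (\<integral>x. g x \<partial>m) + s * measure m (space M)" for m
    have sh: "(\<integral>\<^sup>+x. ennreal (g x + s) \<partial>m) = ennreal (J m)" "0 \<le> J m"
      if "finite_measure m" "sets m = sets M" for m
      using shift[OF that] by (simp_all add: J_def)
    note shs = sh[OF fin(1) sets(1)] sh[OF fin(2) sets(2)] sh[OF fin(3) sets(3)] sh[OF fin(4) sets(4)]
    have "ennreal (J a + J b) = ennreal (J c + J d)"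
      using eqn shs by (simp add: ennreal_plus)
    then have "J a + J b = J c + J d" using shs by (subst (asm) ennreal_inj) auto
    moreover have "s * measure a (space M) + s * measure b (space M) = s * measure c (space M) + s * measure d (space M)"
      using eq[of "space M"] by (simp flip: distrib_left)
    ultimately show ?thesis unfolding J_def by linarith
  qed
  have int: "integrable a f" if "finite_measure a" "sets a = sets M" for a
    by (rule cm_bounded_integrable[OF f that])
  have "(\<integral>x. Re (f x) \<partial>a) + (\<integral>x. Re (f x) \<partial>b) = (\<integral>x. Re (f x) \<partial>c) + (\<integral>x. Re (f x) \<partial>d)"
    by (rule real) (use fm in \<open>auto intro: order_trans[OF abs_Re_le_cmod s]\<close>)
  moreover have "(\<integral>x. Im (f x) \<partial>a) + (\<integral>x. Im (f x) \<partial>b) = (\<integral>x. Im (f x) \<partial>c) + (\<integral>x. Im (f x) \<partial>d)"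
    by (rule real) (use fm in \<open>auto intro: order_trans[OF abs_Im_le_cmod s]\<close>)
  ultimately show ?thesis
    by (simp add: complex_eq_iff int fin sets flip: integral_Re integral_Im)
qed

text \<open>A complex measure written as \<open>(a - b) + \<i> (c - d)\<close> with finite measures \<open>a, b, c, d\<close>, not
  necessarily mutually singular.\<close>

definition decomposes ::
    "'a measure \<Rightarrow> ('a set \<Rightarrow> complex) \<Rightarrow> 'a measure \<Rightarrow> 'a measure \<Rightarrow> 'a measure \<Rightarrow> 'a measure \<Rightarrow> bool" where
  "decomposes M \<mu> a b c d \<longleftrightarrow> (\<forall>p\<in>{a, b, c, d}. finite_measure p \<and> sets p = sets M) \<and>
     (\<forall>E\<in>sets M. \<mu> E = Complex (measure a E - measure b E) (measure c E - measure d E))"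

lemma positive_parts_decompose:
  assumes \<mu>: "complex_measure M \<mu>"
  shows "decomposes M \<mu> (positive_part M (\<lambda>E. Re (\<mu> E))) (positive_part M (\<lambda>E. - Re (\<mu> E)))
    (positive_part M (\<lambda>E. Im (\<mu> E))) (positive_part M (\<lambda>E. - Im (\<mu> E)))"
proof -
  obtain B where B: "\<And>E. E \<in> sets M \<Longrightarrow> cmod (\<mu> E) \<le> B" using complex_measure_bounded[OF \<mu>] by blast
  have part: "sets (positive_part M \<nu>) = sets M \<and> finite_measure (positive_part M \<nu>) \<and>
      sets (positive_part M (\<lambda>E. - \<nu> E)) = sets M \<and> finite_measure (positive_part M (\<lambda>E. - \<nu> E)) \<and>
      (\<forall>E\<in>sets M. \<nu> E = measure (positive_part M \<nu>) E - measure (positive_part M (\<lambda>E. - \<nu> E)) E)"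
    if \<nu>: "bounded_linear h" "\<And>z. \<bar>h z\<bar> \<le> cmod z" "\<nu> = (\<lambda>E. h (\<mu> E))" for h \<nu>
  proof -
    have p: "\<nu> {} = 0" "\<And>E. E \<in> sets M \<Longrightarrow> \<bar>\<nu> E\<bar> \<le> B"
      "\<And>E :: nat \<Rightarrow> 'a set. range E \<subseteq> sets M \<Longrightarrow> disjoint_family E \<Longrightarrow> (\<lambda>i. \<nu> (E i)) sums \<nu> (\<Union>i. E i)"
      using \<mu> \<nu>(3) order_trans[OF \<nu>(2) B] bounded_linear.sums[OF \<nu>(1)] linear_0[OF bounded_linear.linear[OF \<nu>(1)]]
      by (auto simp: complex_measure_def)
    then have n: "- \<nu> {} = 0" "\<And>E. E \<in> sets M \<Longrightarrow> \<bar>- \<nu> E\<bar> \<le> B"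
      "\<And>E :: nat \<Rightarrow> 'a set. range E \<subseteq> sets M \<Longrightarrow> disjoint_family E \<Longrightarrow> (\<lambda>i. - \<nu> (E i)) sums (- \<nu> (\<Union>i. E i))"
      by (auto intro: sums_minus)
    show ?thesis
      using positive_part_measure(1,2)[OF p(1,3,2)] positive_part_measure(1,2)[OF n(1,3,2)]
        Jordan_decomposition[OF p(1,3,2)] by simp
  qed
  show ?thesis
    unfolding decomposes_def
    using part[OF bounded_linear_Re abs_Re_le_cmod refl] part[OF bounded_linear_Im abs_Im_le_cmod refl]
    by (simp add: complex_eq_iff)
qed

text \<open>Two decompositions differ by a relation \<open>a + m2 = m1 + b\<close> between positive measures, which
  integrals respect; so \<open>cm_integral\<close>, defined by the minimal decomposition, may be computed from any
  other one.\<close>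

theorem cm_integral_decomposes:
  assumes \<mu>: "complex_measure M \<mu>" and dec: "decomposes M \<mu> m1 m2 m3 m4" and f: "cm_bounded M f"
  shows "cm_integral M \<mu> f = (\<integral>x. f x \<partial>m1) - (\<integral>x. f x \<partial>m2) + \<i> * ((\<integral>x. f x \<partial>m3) - (\<integral>x. f x \<partial>m4))"
proof -
  define a where "a = positive_part M (\<lambda>E. Re (\<mu> E))"
  define b where "b = positive_part M (\<lambda>E. - Re (\<mu> E))"
  define c where "c = positive_part M (\<lambda>E. Im (\<mu> E))"
  define d where "d = positive_part M (\<lambda>E. - Im (\<mu> E))"
  have par: "decomposes M \<mu> a b c d" unfolding a_def b_def c_def d_def by (rule positive_parts_decompose[OF \<mu>])
  have eq: "measure a E - measure b E = measure m1 E - measure m2 E \<and> measure c E - measure d E = measure m3 E - measure m4 E"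
    if "E \<in> sets M" for E
    using dec par that unfolding decomposes_def by (metis complex.inject)
  have "(\<integral>x. f x \<partial>a) + (\<integral>x. f x \<partial>m2) = (\<integral>x. f x \<partial>m1) + (\<integral>x. f x \<partial>b)"
    by (rule integral_balance[where M = M]) (use dec par f eq in \<open>auto simp: decomposes_def algebra_simps\<close>)
  moreover have "(\<integral>x. f x \<partial>c) + (\<integral>x. f x \<partial>m4) = (\<integral>x. f x \<partial>m3) + (\<integral>x. f x \<partial>d)"
    by (rule integral_balance[where M = M]) (use dec par f eq in \<open>auto simp: decomposes_def algebra_simps\<close>)
  ultimately have "(\<integral>x. f x \<partial>a) - (\<integral>x. f x \<partial>b) = (\<integral>x. f x \<partial>m1) - (\<integral>x. f x \<partial>m2)"
    "(\<integral>x. f x \<partial>c) - (\<integral>x. f x \<partial>d) = (\<integral>x. f x \<partial>m3) - (\<integral>x. f x \<partial>m4)"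
    by (simp_all add: algebra_simps)
  then show ?thesis by (simp add: cm_integral_def a_def b_def c_def d_def)
qed

lemma norm_integral_finite_measure_le:
  fixes f :: "'a \<Rightarrow> complex"
  assumes p: "finite_measure p" and f: "f \<in> borel_measurable p" "\<And>x. x \<in> space p \<Longrightarrow> cmod (f x) \<le> s"
  shows "cmod (\<integral>x. f x \<partial>p) \<le> s * measure p (space p)"
proof -
  interpret finite_measure p by (rule p)
  have "integrable p f" by (rule integrable_const_bound[of _ s]) (use f in auto)
  then have "cmod (\<integral>x. f x \<partial>p) \<le> (\<integral>x. s \<partial>p)"
    by (intro order_trans[OF integral_norm_bound integral_mono]) (use f in auto)
  then show ?thesis by (simp add: mult.commute)
qed

context
  fixes M :: "'a measure" and \<mu> :: "'a set \<Rightarrow> complex"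
  assumes \<mu>: "complex_measure M \<mu>"
begin

lemma cm_integral_add:
  assumes "cm_bounded M f" "cm_bounded M g"
  shows "cm_integral M \<mu> (\<lambda>x. f x + g x) = cm_integral M \<mu> f + cm_integral M \<mu> g"
  using positive_parts_decompose[OF \<mu>] unfolding decomposes_def cm_integral_def
  by (simp add: Bochner_Integration.integral_add cm_bounded_integrable[OF assms(1)]
      cm_bounded_integrable[OF assms(2)] algebra_simps)

lemma cm_integral_scale: "cm_integral M \<mu> (\<lambda>x. a * f x) = a * cm_integral M \<mu> f"
  by (simp add: cm_integral_def algebra_simps)

lemma cm_integral_zero: "cm_integral M \<mu> (\<lambda>x. 0) = 0"
  by (simp add: cm_integral_def)

lemma cm_integral_sum:
  assumes "finite F" "\<And>k. k \<in> F \<Longrightarrow> cm_bounded M (f k)"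
  shows "cm_integral M \<mu> (\<lambda>x. \<Sum>k\<in>F. f k x) = (\<Sum>k\<in>F. cm_integral M \<mu> (f k))"
  using assms
proof (induction F rule: finite_induct)
  case (insert k F)
  have "cm_integral M \<mu> (\<lambda>x. f k x + (\<Sum>k\<in>F. f k x)) = cm_integral M \<mu> (f k) + cm_integral M \<mu> (\<lambda>x. \<Sum>k\<in>F. f k x)"
    by (rule cm_integral_add) (use insert in \<open>auto intro: cm_bounded_sum\<close>)
  then show ?case using insert by simp
qed (simp add: cm_integral_zero)

lemma cm_integral_norm_le:
  obtains B where "0 \<le> B"
    "\<And>f s. f \<in> borel_measurable M \<Longrightarrow> (\<And>x. x \<in> space M \<Longrightarrow> cmod (f x) \<le> s) \<Longrightarrow> cmod (cm_integral M \<mu> f) \<le> B * s"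
proof -
  obtain a b c d where dec: "decomposes M \<mu> a b c d" using positive_parts_decompose[OF \<mu>] by blast
  define B where "B = measure a (space M) + measure b (space M) + measure c (space M) + measure d (space M)"
  show ?thesis
  proof (rule that[of B])
    fix f s assume f: "f \<in> borel_measurable M" "\<And>x. x \<in> space M \<Longrightarrow> cmod (f x) \<le> s"
    have le: "cmod (\<integral>x. f x \<partial>p) \<le> s * measure p (space M)" if p: "p \<in> {a, b, c, d}" for p
    proof -
      have fin: "finite_measure p" and sets: "sets p = sets M" using dec p unfolding decomposes_def by blast+
      have sp: "space p = space M" using sets by (rule sets_eq_imp_space_eq)
      have "f \<in> borel_measurable p" using f(1) measurable_cong_sets[OF sets refl] by blast
      then show ?thesis using norm_integral_finite_measure_le[OF fin, of f s] f(2) unfolding sp by blast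
    qed
    have "cm_integral M \<mu> f = (\<integral>x. f x \<partial>a) - (\<integral>x. f x \<partial>b) + \<i> * ((\<integral>x. f x \<partial>c) - (\<integral>x. f x \<partial>d))"
      by (rule cm_integral_decomposes[OF \<mu> dec cm_boundedI[OF f]])
    also have "cmod \<dots> \<le> (cmod (\<integral>x. f x \<partial>a) + cmod (\<integral>x. f x \<partial>b)) + 1 * (cmod (\<integral>x. f x \<partial>c) + cmod (\<integral>x. f x \<partial>d))"
      by (intro norm_triangle_le add_mono norm_triangle_ineq4) (simp add: norm_mult norm_triangle_ineq4)
    also have "\<dots> \<le> B * s" using le[of a] le[of b] le[of c] le[of d] by (simp add: B_def algebra_simps)
    finally show "cmod (cm_integral M \<mu> f) \<le> B * s" .
  qed (simp add: B_def)
qed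

text \<open>The integral is continuous for uniform convergence, and a summable majorant makes the finite partial
  sums converge uniformly.\<close>

lemma cm_integral_has_sum:
  assumes f: "\<And>k. f k \<in> borel_measurable M" "\<And>k x. x \<in> space M \<Longrightarrow> cmod (f k x) \<le> a k"
    and a: "a summable_on UNIV" and g: "g \<in> borel_measurable M" "\<And>x. x \<in> space M \<Longrightarrow> g x = (\<Sum>\<^sub>\<infinity>k. f k x)"
  shows "((\<lambda>k. cm_integral M \<mu> (f k)) has_sum cm_integral M \<mu> g) UNIV"
proof -
  obtain B where B: "0 \<le> B" "\<And>f s. f \<in> borel_measurable M \<Longrightarrow> (\<And>x. x \<in> space M \<Longrightarrow> cmod (f x) \<le> s) \<Longrightarrow> cmod (cm_integral M \<mu> f) \<le> B * s"
    using cm_integral_norm_le by blast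
  have bounded: "cm_bounded M (f k)" for k using f by (auto simp: cm_bounded_def)
  have summable: "(\<lambda>k. cmod (f k x)) summable_on UNIV" if "x \<in> space M" for x
    by (rule summable_on_comparison_test[OF a]) (use f that in auto)
  have tail: "cmod (g x - (\<Sum>k\<in>F. f k x)) \<le> infsum a UNIV - sum a F" if x: "x \<in> space M" and F: "finite F" for x F
  proof -
    have s: "(\<lambda>k. f k x) summable_on A" for A
      using abs_summable_summable[OF summable[OF x]] summable_on_subset_banach by blast
    have sa: "a summable_on A" for A using a summable_on_subset_banach by blast
    have "g x = (\<Sum>\<^sub>\<infinity>k\<in>F \<union> (UNIV - F). f k x)" using g(2)[OF x] by simp
    also have "\<dots> = (\<Sum>k\<in>F. f k x) + (\<Sum>\<^sub>\<infinity>k\<in>UNIV - F. f k x)"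
      using F s by (subst infsum_Un_disjoint) auto
    finally have 1: "g x - (\<Sum>k\<in>F. f k x) = (\<Sum>\<^sub>\<infinity>k\<in>UNIV - F. f k x)" by simp
    have "infsum a UNIV = infsum a (F \<union> (UNIV - F))" by simp
    also have "\<dots> = sum a F + infsum a (UNIV - F)"
      using F sa by (subst infsum_Un_disjoint) auto
    finally have 2: "infsum a UNIV - sum a F = infsum a (UNIV - F)" by simp
    have sn: "(\<lambda>k. cmod (f k x)) summable_on (UNIV - F)" using summable[OF x] summable_on_subset_banach by blast
    have "cmod (\<Sum>\<^sub>\<infinity>k\<in>UNIV - F. f k x) \<le> (\<Sum>\<^sub>\<infinity>k\<in>UNIV - F. cmod (f k x))"
      by (rule norm_infsum_bound) (use sn in simp)
    also have "\<dots> \<le> infsum a (UNIV - F)" by (rule infsum_mono[OF sn sa]) (use f(2)[OF x] in auto)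
    finally show ?thesis unfolding 1 2 .
  qed
  have "cm_bounded M g"
    using g(1) tail[of _ "{}"] by (auto simp: cm_bounded_def)
  have bound: "cmod ((\<Sum>k\<in>F. cm_integral M \<mu> (f k)) - cm_integral M \<mu> g) \<le> B * (infsum a UNIV - sum a F)" if F: "finite F" for F
  proof -
    have "cm_integral M \<mu> (\<lambda>x. g x + (- 1) * (\<Sum>k\<in>F. f k x)) = cm_integral M \<mu> g + (- 1) * (\<Sum>k\<in>F. cm_integral M \<mu> (f k))"
      using cm_integral_add[OF \<open>cm_bounded M g\<close> cm_bounded_scale[OF cm_bounded_sum[of F M f, OF bounded], of "- 1"]]
      unfolding cm_integral_scale cm_integral_sum[OF F bounded] .
    moreover have "cmod (cm_integral M \<mu> (\<lambda>x. g x + (- 1) * (\<Sum>k\<in>F. f k x))) \<le> B * (infsum a UNIV - sum a F)"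
      by (rule B(2)) (use g(1) f(1) tail[OF _ F] in auto)
    ultimately show ?thesis by (simp add: norm_minus_commute)
  qed
  have "(sum a \<longlongrightarrow> infsum a UNIV) (finite_subsets_at_top UNIV)"
    using has_sum_infsum[OF a] by (simp add: has_sum_def)
  then have "((\<lambda>F. B * (infsum a UNIV - sum a F)) \<longlongrightarrow> B * (infsum a UNIV - infsum a UNIV)) (finite_subsets_at_top UNIV)"
    by (intro tendsto_intros)
  then have lim: "((\<lambda>F. B * (infsum a UNIV - sum a F)) \<longlongrightarrow> 0) (finite_subsets_at_top UNIV)" by simp
  have "((\<lambda>F. (\<Sum>k\<in>F. cm_integral M \<mu> (f k)) - cm_integral M \<mu> g) \<longlongrightarrow> 0) (finite_subsets_at_top UNIV)"
    by (rule Lim_null_comparison[OF _ lim]) (use bound in \<open>auto simp: eventually_finite_subsets_at_top\<close>)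
  then show ?thesis unfolding has_sum_def by (rule LIM_zero_cancel)
qed

lemma cm_integral_one: "cm_integral M \<mu> (\<lambda>_. 1) = \<mu> (space M)"
proof -
  obtain a b c d where dec: "decomposes M \<mu> a b c d" using positive_parts_decompose[OF \<mu>] by blast
  then have "space p = space M" if "p \<in> {a, b, c, d}" for p
    using that unfolding decomposes_def by (intro sets_eq_imp_space_eq) blast
  then show ?thesis
    using dec cm_integral_decomposes[OF \<mu> dec cm_bounded_const[of M 1]] by (simp add: decomposes_def complex_eq_iff)
qed

end

text \<open>The three measures of \<open>Riesz_measures\<close> assembled into one complex measure, whose modulus is
  dominated by \<open>m0\<close>.\<close>

theorem Riesz_complex_measure:
  fixes K :: "'y::euclidean_space set" and G :: "(('y \<Rightarrow> complex) \<times> complex) set"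
  assumes K: "compact K" "K \<noteq> {}" and C: "0 \<le> C"
    and cont: "\<And>g c. (g, c) \<in> G \<Longrightarrow> continuous_on K g"
    and G0: "(\<lambda>_. 0, 0) \<in> G"
    and Gadd: "\<And>g c h d. (g, c) \<in> G \<Longrightarrow> (h, d) \<in> G \<Longrightarrow> (\<lambda>x. g x + h x, c + d) \<in> G"
    and Gscale: "\<And>a g c. (g, c) \<in> G \<Longrightarrow> (\<lambda>x. a * g x, a * c) \<in> G"
    and bound: "\<And>g c s. (g, c) \<in> G \<Longrightarrow> (\<And>x. x \<in> K \<Longrightarrow> cmod (g x) \<le> s) \<Longrightarrow> cmod c \<le> C * s"
  obtains \<mu> where "complex_measure (borel_on K) \<mu>" "total_variation (borel_on K) \<mu> \<le> ennreal C"
    "\<And>g c. (g, c) \<in> G \<Longrightarrow> cm_integral (borel_on K) \<mu> g = c"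
proof (rule Riesz_measures[OF K C cont G0 Gadd Gscale bound])
  fix m0 m1 m2 :: "'y measure"
  assume fin: "finite_measure m0" "finite_measure m1" "finite_measure m2"
    and st: "sets m0 = sets (borel_on K)" "sets m1 = sets (borel_on K)" "sets m2 = sets (borel_on K)"
    and mK: "measure m0 K \<le> C"
    and dom: "\<And>E. E \<in> sets (borel_on K) \<Longrightarrow>
       cmod (Complex (measure m1 E - measure m0 E) (measure m0 E - measure m2 E)) \<le> measure m0 E"
    and rep: "\<And>g c. (g, c) \<in> G \<Longrightarrow> c = ((\<integral>x. g x \<partial>m1) - (\<integral>x. g x \<partial>m0)) + \<i> * ((\<integral>x. g x \<partial>m0) - (\<integral>x. g x \<partial>m2))"
  define \<mu> where "\<mu> E = Complex (measure m1 E - measure m0 E) (measure m0 E - measure m2 E)" for E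
  have sp: "space (borel_on K) = K" by (simp add: borel_on_def space_restrict_space)
  have cm: "complex_measure (borel_on K) \<mu>"
    unfolding complex_measure_def
  proof (intro conjI allI impI)
    show "\<mu> {} = 0" by (simp add: \<mu>_def complex_eq_iff)
    fix E :: "nat \<Rightarrow> 'y set" assume E: "range E \<subseteq> sets (borel_on K) \<and> disjoint_family E"
    have "(\<lambda>i. measure m (E i)) sums measure m (\<Union>i. E i)" if "finite_measure m" "sets m = sets (borel_on K)" for m
      by (rule finite_measure.finite_measure_UNION[OF that(1)]) (use E that(2) in auto)
    then show "(\<lambda>i. \<mu> (E i)) sums \<mu> (\<Union>i. E i)"
      unfolding sums_complex_iff \<mu>_def complex.sel using fin st by (intro conjI sums_diff) auto
  qed
  have tv: "total_variation (borel_on K) \<mu> \<le> ennreal C"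
    unfolding total_variation_def
  proof (rule SUP_least)
    fix P assume "P \<in> {P. finite P \<and> P \<subseteq> sets (borel_on K) \<and> partition_on (space (borel_on K)) P}"
    then have P: "finite P" "P \<subseteq> sets (borel_on K)" "\<Union>P = K" "disjoint P"
      unfolding sp by (auto simp: partition_on_def)
    have "(\<Sum>E\<in>P. ennreal (cmod (\<mu> E))) \<le> (\<Sum>E\<in>P. ennreal (measure m0 E))"
      by (intro sum_mono ennreal_leI) (use dom P(2) in \<open>auto simp: \<mu>_def\<close>)
    also have "\<dots> = ennreal (\<Sum>E\<in>P. measure m0 E)" by (simp add: sum_ennreal)
    also have "(\<Sum>E\<in>P. measure m0 E) = measure m0 (\<Union>E\<in>P. E)"
      by (rule finite_measure.finite_measure_finite_Union[OF fin(1) P(1), symmetric])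
        (use P st(1) in \<open>auto simp: disjoint_family_on_def disjoint_def\<close>)
    also have "ennreal \<dots> \<le> ennreal C" using mK P(3) by (intro ennreal_leI) simp
    finally show "(\<Sum>E\<in>P. ennreal (cmod (\<mu> E))) \<le> ennreal C" .
  qed
  have dec: "decomposes (borel_on K) \<mu> m1 m0 m0 m2" using fin st by (simp add: decomposes_def \<mu>_def)
  have int: "cm_integral (borel_on K) \<mu> g = c" if g: "(g, c) \<in> G" for g c
    using cm_integral_decomposes[OF cm dec cm_bounded_continuous[OF cont[OF g] K(1)]] rep[OF g] by simp
  show ?thesis by (rule that[OF cm tv int])
qed

lemma real_part_measure:
  assumes \<mu>: "complex_measure M \<mu>"
  shows "complex_measure M (\<lambda>E. of_real (Re (\<mu> E)))"
    "total_variation M (\<lambda>E. of_real (Re (\<mu> E))) \<le> total_variation M \<mu>"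
    "cm_bounded M f \<Longrightarrow> (\<And>x. x \<in> space M \<Longrightarrow> Im (f x) = 0) \<Longrightarrow>
       cm_integral M (\<lambda>E. of_real (Re (\<mu> E))) f = of_real (Re (cm_integral M \<mu> f))"
proof -
  show cm: "complex_measure M (\<lambda>E. of_real (Re (\<mu> E)))"
    using \<mu> by (auto simp: complex_measure_def intro!: sums_of_real sums_Re)
  show "total_variation M (\<lambda>E. of_real (Re (\<mu> E))) \<le> total_variation M \<mu>"
    unfolding total_variation_def by (intro SUP_mono' sum_mono ennreal_leI) (simp add: abs_Re_le_cmod)
  assume f: "cm_bounded M f" "\<And>x. x \<in> space M \<Longrightarrow> Im (f x) = 0"
  obtain a b c d where dec: "decomposes M \<mu> a b c d" using positive_parts_decompose[OF \<mu>] by blast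
  then have dec': "decomposes M (\<lambda>E. of_real (Re (\<mu> E))) a b a a"
    by (auto simp: decomposes_def complex_eq_iff)
  have "Im (\<integral>x. f x \<partial>p) = 0" if "p \<in> {a, b, c, d}" for p
  proof -
    have p: "finite_measure p" "sets p = sets M" using dec that unfolding decomposes_def by blast+
    have "Im (\<integral>x. f x \<partial>p) = (\<integral>x. Im (f x) \<partial>p)"
      by (rule integral_Im[symmetric, OF cm_bounded_integrable[OF f(1) p]])
    also have "\<dots> = (\<integral>x. 0 \<partial>p)"
      by (rule Bochner_Integration.integral_cong) (use f(2) sets_eq_imp_space_eq[OF p(2)] in auto)
    finally show ?thesis by simp
  qed
  then show "cm_integral M (\<lambda>E. of_real (Re (\<mu> E))) f = of_real (Re (cm_integral M \<mu> f))"
    unfolding cm_integral_decomposes[OF cm dec' f(1)] cm_integral_decomposes[OF \<mu> dec f(1)]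
    by (simp add: complex_eq_iff)
qed

text \<open>The images of the parts of \<open>\<nu>\<close> under the inclusion \<open>S \<subseteq> T\<close> decompose the extension.\<close>

lemma cm_integral_extend_by_zero:
  fixes S T :: "'y::topological_space set"
  assumes \<nu>: "complex_measure (borel_on S) \<nu>" and S: "S \<subseteq> T" "S \<in> sets borel"
    and f: "cm_bounded (borel_on T) f"
  shows "complex_measure (borel_on T) (extend_by_zero S \<nu>)"
    "cm_integral (borel_on T) (extend_by_zero S \<nu>) f = cm_integral (borel_on S) \<nu> f"
proof -
  have int: "E \<inter> S \<in> sets (borel_on S)" if ET: "E \<in> sets (borel_on T)" for E
  proof -
    obtain F where "F \<in> sets borel" "E = T \<inter> F" using ET by (auto simp: borel_on_def sets_restrict_space)
    then have "E \<inter> S = S \<inter> F" using S(1) by blast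
    then show ?thesis using \<open>F \<in> sets borel\<close> by (auto simp: borel_on_def sets_restrict_space)
  qed
  show cm: "complex_measure (borel_on T) (extend_by_zero S \<nu>)"
    unfolding complex_measure_def extend_by_zero_def
  proof (intro conjI allI impI)
    show "\<nu> ({} \<inter> S) = 0" using \<nu> by (simp add: complex_measure_def)
    fix E :: "nat \<Rightarrow> 'y set" assume E: "range E \<subseteq> sets (borel_on T) \<and> disjoint_family E"
    have "range (\<lambda>i. E i \<inter> S) \<subseteq> sets (borel_on S)" using int E by auto
    moreover have "disjoint_family (\<lambda>i. E i \<inter> S)" using E unfolding disjoint_family_on_def by blast
    ultimately have "(\<lambda>i. \<nu> (E i \<inter> S)) sums \<nu> (\<Union>i. E i \<inter> S)"
      using \<nu> unfolding complex_measure_def by blast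
    then show "(\<lambda>i. \<nu> (E i \<inter> S)) sums \<nu> ((\<Union>i. E i) \<inter> S)" by simp
  qed
  have id: "(\<lambda>x. x) \<in> measurable p (borel_on T)" if p: "sets p = sets (borel_on S)" for p
  proof -
    have "(\<lambda>x. x) \<in> measurable (borel_on S) (borel_on T)"
      unfolding borel_on_def
      by (rule measurable_restrict_space2) (use S(1) in \<open>auto simp: space_restrict_space measurable_restrict_space1\<close>)
    then show ?thesis using measurable_cong_sets[OF p refl] by blast
  qed
  obtain a b c d where dec: "decomposes (borel_on S) \<nu> a b c d" using positive_parts_decompose[OF \<nu>] by blast
  define e where "e p = distr p (borel_on T) (\<lambda>x. x)" for p :: "'y measure"
  have e: "finite_measure (e p) \<and> sets (e p) = sets (borel_on T) \<and> (\<integral>x. f x \<partial>e p) = (\<integral>x. f x \<partial>p) \<and>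
      (\<forall>E\<in>sets (borel_on T). measure (e p) E = measure p (E \<inter> S))" if "p \<in> {a, b, c, d}" for p
  proof -
    have p: "finite_measure p" "sets p = sets (borel_on S)" using dec that unfolding decomposes_def by blast+
    have sp: "space p = S" using sets_eq_imp_space_eq[OF p(2)] by (simp add: borel_on_def space_restrict_space)
    have fm: "f \<in> borel_measurable (borel_on T)" using f by (simp add: cm_bounded_def)
    show ?thesis
      using finite_measure.finite_measure_distr[OF p(1) id[OF p(2)]] integral_distr[OF id[OF p(2)] fm]
        measure_distr[OF id[OF p(2)]] by (simp add: e_def sp vimage_def)
  qed
  have "decomposes (borel_on T) (extend_by_zero S \<nu>) (e a) (e b) (e c) (e d)"
    using e[of a] e[of b] e[of c] e[of d] dec int unfolding decomposes_def extend_by_zero_def by simp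
  from cm_integral_decomposes[OF cm this f]
  have "cm_integral (borel_on T) (extend_by_zero S \<nu>) f = (\<integral>x. f x \<partial>a) - (\<integral>x. f x \<partial>b) + \<i> * ((\<integral>x. f x \<partial>c) - (\<integral>x. f x \<partial>d))"
    using e[of a] e[of b] e[of c] e[of d] by simp
  also have "\<dots> = cm_integral (borel_on S) \<nu> f"
  proof (rule cm_integral_decomposes[OF \<nu> dec, symmetric])
    obtain s where s: "\<And>x. x \<in> T \<Longrightarrow> cmod (f x) \<le> s" using f by (auto simp: cm_bounded_def borel_on_def space_restrict_space)
    have "f \<in> borel_measurable (borel_on S)"
      using f unfolding cm_bounded_def by (blast intro: measurable_compose[OF id[OF refl]])
    then show "cm_bounded (borel_on S) f"
      by (rule cm_boundedI) (use s S(1) in \<open>auto simp: borel_on_def space_restrict_space\<close>)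
  qed
  finally show "cm_integral (borel_on T) (extend_by_zero S \<nu>) f = cm_integral (borel_on S) \<nu> f" .
qed

lemma cm_integral_cong:
  assumes "\<And>x. x \<in> space M \<Longrightarrow> f x = g x"
  shows "cm_integral M \<mu> f = cm_integral M \<mu> g"
proof -
  have sp: "space (positive_part M \<nu>) = space M" for \<nu>
    unfolding positive_part_def by (rule space_measure_of) (rule sets.space_closed)
  have "(\<integral>x. f x \<partial>positive_part M \<nu>) = (\<integral>x. g x \<partial>positive_part M \<nu>)" for \<nu>
    by (rule Bochner_Integration.integral_cong) (auto simp: sp assms)
  then show ?thesis by (simp add: cm_integral_def)
qed

lemma cm_integral_infsum:
  fixes f :: "'k \<Rightarrow> 'y::topological_space \<Rightarrow> complex"
  assumes \<mu>: "complex_measure (borel_on K) \<mu>" and f: "\<And>k. continuous_on K (f k)"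
    and a: "\<And>k x. x \<in> K \<Longrightarrow> cmod (f k x) \<le> a k" "a summable_on UNIV"
    and g: "\<And>x. x \<in> K \<Longrightarrow> g x = (\<Sum>\<^sub>\<infinity>k. f k x)"
  shows "((\<lambda>k. cm_integral (borel_on K) \<mu> (f k)) has_sum cm_integral (borel_on K) \<mu> g) UNIV"
proof -
  have sp: "space (borel_on K) = K" by (simp add: borel_on_def space_restrict_space)
  have bm: "h \<in> borel_measurable (borel_on K)" if "continuous_on K h" for h :: "'y \<Rightarrow> complex"
    unfolding borel_on_def by (rule borel_measurable_continuous_on_restrict[OF that])
  have "uniform_limit K (\<lambda>F x. \<Sum>k\<in>F. f k x) (\<lambda>x. \<Sum>\<^sub>\<infinity>k. f k x) (finite_subsets_at_top UNIV)"
    by (rule Weierstrass_m_test_general[OF _ a(2)]) (use a(1) in blast)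
  then have "continuous_on K (\<lambda>x. \<Sum>\<^sub>\<infinity>k. f k x)"
    by (rule uniform_limit_theorem[rotated]) (auto intro!: always_eventually continuous_on_sum f)
  then have "((\<lambda>k. cm_integral (borel_on K) \<mu> (f k)) has_sum cm_integral (borel_on K) \<mu> (\<lambda>x. \<Sum>\<^sub>\<infinity>k. f k x)) UNIV"
    by (intro cm_integral_has_sum[OF \<mu> bm[OF f] _ a(2) bm]) (auto simp: sp a)
  then show ?thesis using cm_integral_cong[of "borel_on K" g] g sp by fastforce
qed

section \<open>The trace of a monomial along a segment of commuting contractions\<close>

lemma prod_list_eq_op_monomial:
  assumes X: "commuting X"
  shows "prod_list (map X js) = op_monomial X (count_list js)"
proof (induction js)
  case Nil
  have "count_list ([] :: 'n list) = (\<lambda>_. 0)" by auto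
  then show ?case by (simp add: op_monomial_zero)
next
  case (Cons j js)
  have "count_list (j # js) = (\<lambda>i. (if i = j then 1 else 0) + count_list js i)" by auto
  then show ?case by (simp add: Cons op_monomial_add[OF X] op_monomial_single)
qed

lemma count_list_surj: "\<exists>js. count_list js = (k :: 'n::{finite,linorder} \<Rightarrow> nat)"
proof -
  have app: "count_list (xs @ ys) x = count_list xs x + count_list ys x" for xs ys and x :: 'n
    by (induction xs) auto
  have rep: "count_list (replicate m j) i = (if i = j then m else 0)" for m and i j :: 'n
    by (induction m) auto
  have "count_list (concat (map (\<lambda>i. replicate (k i) i) L)) j = (if j \<in> set L then k j else 0)"
    if "distinct L" for L j
    using that by (induction L) (auto simp: app rep)
  then have "count_list (concat (map (\<lambda>i. replicate (k i) i) (sorted_list_of_set UNIV))) = k" by auto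
  then show ?thesis by blast
qed

lemma sum_positions:
  fixes g :: "'n::finite \<Rightarrow> 'b::real_vector"
  shows "(\<Sum>i<length js. g (js ! i)) = (\<Sum>j\<in>UNIV. real (count_list js j) *\<^sub>R g j)"
proof (induction js)
  case (Cons a js)
  have "(\<Sum>i<length (a # js). g ((a # js) ! i)) = g a + (\<Sum>j\<in>UNIV. real (count_list js j) *\<^sub>R g j)"
    by (simp only: length_Cons sum.lessThan_Suc_shift) (simp add: Cons)
  also have "g a = (\<Sum>j\<in>UNIV. if a = j then g j else 0)" by simp
  also have "(\<Sum>j\<in>UNIV. if a = j then g j else 0) + (\<Sum>j\<in>UNIV. real (count_list js j) *\<^sub>R g j)
      = (\<Sum>j\<in>UNIV. real (count_list (a # js) j) *\<^sub>R g j)"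
    unfolding sum.distrib[symmetric] by (rule sum.cong) (auto simp: algebra_simps)
  finally show ?case .
qed simp

text \<open>The words with an initial part in \<open>X\<close> and the rest in \<open>Y\<close> interpolate between the two products.\<close>

lemma prod_list_telescope:
  fixes X Y :: "'n \<Rightarrow> 'a::hilbert_space bop"
  shows "prod_list (map Y js) - prod_list (map X js) =
    (\<Sum>i<length js. prod_list (map X (take i js)) * (Y (js ! i) - X (js ! i)) * prod_list (map Y (drop (Suc i) js)))"
proof (induction js)
  case (Cons j js)
  have "prod_list (map Y (j # js)) - prod_list (map X (j # js))
      = (Y j - X j) * prod_list (map Y js) + X j * (prod_list (map Y js) - prod_list (map X js))"
    by (simp add: algebra_simps)
  also have "\<dots> = (\<Sum>i<length (j # js). prod_list (map X (take i (j # js))) * (Y ((j # js) ! i) - X ((j # js) ! i)) * prod_list (map Y (drop (Suc i) (j # js))))"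
    by (simp only: length_Cons sum.lessThan_Suc_shift) (simp add: Cons sum_distrib_left mult.assoc)
  finally show ?case .
qed simp

lemma norm_prod_list_le_1:
  assumes "\<And>i. contraction (X i)"
  shows "norm (prod_list (map X js)) \<le> 1"
proof (induction js)
  case (Cons j js)
  have "norm (X j) * norm (prod_list (map X js)) \<le> 1 * 1"
    by (intro mult_mono Cons) (use assms in \<open>auto simp: contraction_def\<close>)
  then show ?case using norm_mult_ineq order_trans by fastforce
qed (simp add: norm_one_bop_le)

lemma continuous_on_prod_list:
  assumes "\<And>i. continuous_on S (\<lambda>t. X t i :: 'a::hilbert_space bop)"
  shows "continuous_on S (\<lambda>t. prod_list (map (X t) js))"
  by (induction js) (auto intro!: continuous_intros assms)

locale contractive_segment = traced_ideal I nrm \<tau>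
  for I :: "'h::hilbert_space bop set" and nrm :: "'h bop \<Rightarrow> real" and \<tau> :: "'h bop \<Rightarrow> complex" +
  fixes A B :: "'n::{finite,linorder} \<Rightarrow> 'h bop"
  assumes segment_commuting: "\<And>t. t \<in> {0..1} \<Longrightarrow> commuting (\<lambda>j. A j + t *\<^sub>R (B j - A j))"
    and segment_contraction: "\<And>t j. t \<in> {0..1} \<Longrightarrow> contraction (A j + t *\<^sub>R (B j - A j))"
    and diff_in_I: "\<And>j. B j - A j \<in> I"
begin

definition seg :: "real \<Rightarrow> 'n \<Rightarrow> 'h bop" where "seg t j = A j + t *\<^sub>R (B j - A j)"

lemma seg_0: "seg 0 = A" and seg_1: "seg 1 = B" by (auto simp: seg_def)

lemma seg_commuting: "t \<in> {0..1} \<Longrightarrow> commuting (seg t)"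
  using segment_commuting unfolding seg_def[abs_def] by blast

lemma seg_contraction: "t \<in> {0..1} \<Longrightarrow> contraction (seg t j)"
  using segment_contraction unfolding seg_def by blast

lemma seg_diff: "seg s j - seg t j = (s - t) *\<^sub>R (B j - A j)"
  by (simp add: seg_def algebra_simps)

lemma continuous_on_seg: "continuous_on S (\<lambda>t. seg t j)"
  unfolding seg_def by (intro continuous_intros)

lemma continuous_on_monomial_seg: "continuous_on S (\<lambda>t. op_monomial (seg t) k)"
  unfolding op_monomial_word by (rule continuous_on_prod_list[OF continuous_on_seg])

lemma continuous_on_trace_mult:
  assumes "W \<in> I" "continuous_on S T"
  shows "continuous_on S (\<lambda>t. \<tau> (T t * W))"
  using bounded_linear.continuous_on[OF bounded_linear_trace_mult[OF assms(1)] assms(2)] by simp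

text \<open>What the integral of the monomial \<open>k\<close> with respect to the \<open>j\<close>-th measure has to be.\<close>

definition moment :: "'n \<Rightarrow> ('n \<Rightarrow> nat) \<Rightarrow> complex" where
  "moment j k = integral {0..1} (\<lambda>t. \<tau> (op_monomial (seg t) k * (B j - A j)))"

lemma moment_has_integral:
  "((\<lambda>t. \<tau> (op_monomial (seg t) k * (B j - A j))) has_integral moment j k) {0..1}"
  unfolding moment_def
  by (intro integrable_integral integrable_continuous_real continuous_on_trace_mult diff_in_I continuous_on_monomial_seg)

lemma moment_zero: "moment j (\<lambda>_. 0) = \<tau> (B j - A j)"
  by (simp add: moment_def op_monomial_zero)

text \<open>The bound by \<open>mass\<close> survives averaging over the segment, so it only remains to compare the operator
  norm of a polynomial in \<open>seg t\<close> with its supremum, which is a von Neumann inequality.\<close>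

lemma moment_polynomial_bound:
  assumes F: "finite F"
    and s: "\<And>t. t \<in> {0..1} \<Longrightarrow> norm (\<Sum>k\<in>F. c k *\<^sub>C op_monomial (seg t) k) \<le> s"
  shows "cmod (\<Sum>k\<in>F. c k * moment j k) \<le> mass (B j - A j) * s"
proof -
  define f where "f t = (\<Sum>k\<in>F. c k * \<tau> (op_monomial (seg t) k * (B j - A j)))" for t
  have f: "f t = \<tau> ((\<Sum>k\<in>F. c k *\<^sub>C op_monomial (seg t) k) * (B j - A j))" for t
    by (simp add: f_def sum_distrib_right \<tau>_sum I_scaleC I_mult_left diff_in_I scaleC_mult_left \<tau>_scaleC)
  have int: "(f has_integral (\<Sum>k\<in>F. c k * moment j k)) {0..1}"
    unfolding f_def by (intro has_integral_sum F has_integral_mult_right moment_has_integral)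
  have "cmod (f t) \<le> mass (B j - A j) * s" if t: "t \<in> {0..1}" for t
  proof -
    have "cmod (f t) \<le> norm (\<Sum>k\<in>F. c k *\<^sub>C op_monomial (seg t) k) * mass (B j - A j)"
      unfolding f by (rule trace_mult_mass(1)[OF diff_in_I])
    also have "\<dots> \<le> s * mass (B j - A j)"
      by (intro mult_right_mono s t trace_mult_mass(2) diff_in_I)
    finally show ?thesis by (simp add: mult.commute)
  qed
  moreover have nonneg: "0 \<le> mass (B j - A j) * s"
    using order_trans[OF norm_ge_zero s[of 0]] by (intro mult_nonneg_nonneg trace_mult_mass(2) diff_in_I) auto
  ultimately have "cmod (\<Sum>k\<in>F. c k * moment j k) \<le> mass (B j - A j) * s * measure lborel {0..1::real}"
    using has_integral_bound_real[OF nonneg finite.emptyI int] by simp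
  then show ?thesis by simp
qed

text \<open>Each summand of the telescoped difference contains one factor \<open>B j - A j\<close> between contractions.\<close>

lemma monomial_diff_in_I: "op_monomial B k - op_monomial A k \<in> I"
  and monomial_diff_nrm: "nrm (op_monomial B k - op_monomial A k) \<le> real (\<Sum>i\<in>UNIV. k i) * (\<Sum>j\<in>UNIV. nrm (B j - A j))"
proof -
  obtain js where js: "count_list js = k" using count_list_surj by blast
  have c: "commuting A" "commuting B" "\<And>j. contraction (A j)" "\<And>j. contraction (B j)"
    using seg_commuting[of 0] seg_commuting[of 1] seg_contraction[of 0] seg_contraction[of 1]
    by (simp_all add: seg_0 seg_1)
  define T where "T i = prod_list (map A (take i js)) * (B (js ! i) - A (js ! i)) * prod_list (map B (drop (Suc i) js))" for i
  have eq: "op_monomial B k - op_monomial A k = (\<Sum>i<length js. T i)"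
    using prod_list_telescope[of B js A] c by (simp add: prod_list_eq_op_monomial js T_def)
  have TI: "T i \<in> I" for i unfolding T_def by (intro I_mult_left I_mult_right diff_in_I)
  then show "op_monomial B k - op_monomial A k \<in> I" unfolding eq by (intro I_sum)
  have nV: "nrm (B j - A j) \<le> (\<Sum>j\<in>UNIV. nrm (B j - A j))" for j
    by (rule member_le_sum) (auto intro: nrm_nonneg diff_in_I)
  have "nrm (T i) \<le> nrm (B (js ! i) - A (js ! i))" for i
  proof -
    have "nrm (T i) \<le> norm (prod_list (map A (take i js))) * nrm (B (js ! i) - A (js ! i)) * norm (prod_list (map B (drop (Suc i) js)))"
      unfolding T_def by (rule nrm_mult3[OF diff_in_I])
    also have "\<dots> \<le> 1 * nrm (B (js ! i) - A (js ! i)) * 1"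
      by (intro mult_mono norm_prod_list_le_1 c mult_nonneg_nonneg nrm_nonneg diff_in_I) auto
    finally show ?thesis by simp
  qed
  then have "nrm (\<Sum>i<length js. T i) \<le> (\<Sum>i<length js. (\<Sum>j\<in>UNIV. nrm (B j - A j)))"
    by (intro order_trans[OF nrm_sum sum_mono] TI) (use nV order_trans in blast)
  moreover have "length js = (\<Sum>i\<in>UNIV. k i)"
  proof -
    have "real (length js) = (\<Sum>i<length js. (1::real))" by simp
    also have "\<dots> = (\<Sum>j\<in>UNIV. real (k j))" using sum_positions[of "\<lambda>_. 1::real" js] by (simp add: js)
    finally show ?thesis by (simp flip: of_nat_sum)
  qed
  ultimately show "nrm (op_monomial B k - op_monomial A k) \<le> real (\<Sum>i\<in>UNIV. k i) * (\<Sum>j\<in>UNIV. nrm (B j - A j))"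
    by (simp add: eq)
qed

text \<open>Along the segment, the difference quotient of a word is the sum over the positions of the words
  in which that factor is replaced by \<open>B j - A j\<close>.  Under the trace this factor may be moved to the
  end, and the other factors commute in the limit.\<close>

theorem trace_monomial_diff:
  "\<tau> (op_monomial B k - op_monomial A k) = (\<Sum>j\<in>UNIV. of_nat (k j) * moment j (\<lambda>i. if i = j then k i - 1 else k i))"
proof -
  obtain js where js: "count_list js = k" using count_list_surj by blast
  define W where "W t xs = prod_list (map (seg t) xs)" for t xs
  have Wc: "continuous_on S (\<lambda>t. W t xs)" for S xs
    unfolding W_def by (rule continuous_on_prod_list[OF continuous_on_seg])
  have tele: "W s js - W t js = (s - t) *\<^sub>R (\<Sum>i<length js. W t (take i js) * (B (js ! i) - A (js ! i)) * W s (drop (Suc i) js))" for s t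
    unfolding W_def prod_list_telescope[of "seg s" js "seg t"] seg_diff by (simp add: scaleR_sum_right)
  define Q where "Q t s = (\<Sum>i<length js. \<tau> ((W s (drop (Suc i) js) * W t (take i js)) * (B (js ! i) - A (js ! i))))" for t s
  have mem: "W t (take i js) * (B (js ! i) - A (js ! i)) * W s (drop (Suc i) js) \<in> I" for i s t
    by (intro I_mult_left I_mult_right diff_in_I)
  have diffI: "W s js - W t js \<in> I" for s t
    unfolding tele by (intro I_scaleR I_sum mem)
  have \<tau>diff: "\<tau> (W s js - W t js) = of_real (s - t) * Q t s" for s t
  proof -
    have "\<tau> (W t (take i js) * (B (js ! i) - A (js ! i)) * W s (drop (Suc i) js))
        = \<tau> ((W s (drop (Suc i) js) * W t (take i js)) * (B (js ! i) - A (js ! i)))" for i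
      using \<tau>_commute[of "W t (take i js) * (B (js ! i) - A (js ! i))" "W s (drop (Suc i) js)"]
      by (simp add: I_mult_left diff_in_I mult.assoc)
    then show ?thesis unfolding tele Q_def by (simp add: \<tau>_scaleR \<tau>_sum I_sum mem)
  qed
  define F where "F t = \<tau> (W t js - W 0 js)" for t
  have Fdiff: "F s - F t = of_real (s - t) * Q t s" for s t
  proof -
    have "F s - F t = \<tau> ((W s js - W 0 js) - (W t js - W 0 js))" unfolding F_def by (rule \<tau>_diff[symmetric]) (rule diffI)+
    then show ?thesis using \<tau>diff[of s t] by simp
  qed
  have Qcont: "continuous_on S (Q t)" for S t
    unfolding Q_def by (intro continuous_on_sum continuous_on_trace_mult diff_in_I continuous_on_mult Wc continuous_on_const)
  have deriv: "(F has_vector_derivative Q t t) (at t within {0..1})" for t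
  proof -
    have lim: "(Q t \<longlongrightarrow> Q t t) (at t within {0..1})"
      using Qcont[of UNIV t] by (simp add: continuous_on_eq_continuous_at isCont_def Lim_at_imp_Lim_at_within)
    have q: "(Re (F s) - Re (F t)) / (s - t) = Re (Q t s)" "(Im (F s) - Im (F t)) / (s - t) = Im (Q t s)" if "s \<noteq> t" for s
      using arg_cong[OF Fdiff[of s t], of Re] arg_cong[OF Fdiff[of s t], of Im] that by simp_all
    have "((\<lambda>s. (Re (F s) - Re (F t)) / (s - t)) \<longlongrightarrow> Re (Q t t)) (at t within {0..1})"
      by (rule Lim_transform_eventually[OF tendsto_Re[OF lim]]) (auto simp: eventually_at_filter q)
    moreover have "((\<lambda>s. (Im (F s) - Im (F t)) / (s - t)) \<longlongrightarrow> Im (Q t t)) (at t within {0..1})"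
      by (rule Lim_transform_eventually[OF tendsto_Im[OF lim]]) (auto simp: eventually_at_filter q)
    ultimately show ?thesis
      unfolding has_vector_derivative_complex_iff has_field_derivative_iff by blast
  qed
  have "((\<lambda>t. Q t t) has_integral (F 1 - F 0)) {0..1}"
    by (rule fundamental_theorem_of_calculus) (auto intro: deriv)
  moreover have "F 0 = 0" by (simp add: F_def \<tau>_zero)
  moreover have "F 1 = \<tau> (op_monomial B k - op_monomial A k)"
    using seg_commuting[of 0] seg_commuting[of 1]
    by (simp add: F_def W_def seg_0 seg_1 prod_list_eq_op_monomial js)
  ultimately have int: "((\<lambda>t. Q t t) has_integral \<tau> (op_monomial B k - op_monomial A k)) {0..1}" by simp
  define e where "e j = (\<lambda>i. if i = j then k i - 1 else k i)" for j
  have Qt: "Q t t = (\<Sum>j\<in>UNIV. of_nat (k j) * \<tau> (op_monomial (seg t) (e j) * (B j - A j)))" if t: "t \<in> {0..1}" for t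
  proof -
    have "W t (drop (Suc i) js) * W t (take i js) = op_monomial (seg t) (e (js ! i))" if i: "i < length js" for i
    proof -
      have "W t (drop (Suc i) js) * W t (take i js) = W t (drop (Suc i) js @ take i js)" by (simp add: W_def)
      also have "\<dots> = op_monomial (seg t) (count_list (drop (Suc i) js @ take i js))"
        unfolding W_def by (rule prod_list_eq_op_monomial[OF seg_commuting[OF t]])
      also have "count_list (drop (Suc i) js @ take i js) = e (js ! i)"
      proof
        fix j
        have app: "count_list (xs @ ys) x = count_list xs x + count_list ys x" for xs ys and x :: 'n
          by (induction xs) auto
        have "k j = count_list (take i js @ js ! i # drop (Suc i) js) j"
          using i by (simp add: js id_take_nth_drop[symmetric])
        then show "count_list (drop (Suc i) js @ take i js) j = e (js ! i) j"
          by (cases "js ! i = j") (auto simp: app e_def)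
      qed
      finally show ?thesis .
    qed
    then have "Q t t = (\<Sum>i<length js. \<tau> (op_monomial (seg t) (e (js ! i)) * (B (js ! i) - A (js ! i))))"
      unfolding Q_def by (intro sum.cong) auto
    also have "\<dots> = (\<Sum>j\<in>UNIV. real (k j) *\<^sub>R \<tau> (op_monomial (seg t) (e j) * (B j - A j)))"
      using sum_positions[of "\<lambda>j. \<tau> (op_monomial (seg t) (e j) * (B j - A j))" js] by (simp add: js)
    finally show ?thesis by (simp add: scaleR_conv_of_real)
  qed
  have "((\<lambda>t. \<Sum>j\<in>UNIV. of_nat (k j) * \<tau> (op_monomial (seg t) (e j) * (B j - A j))) has_integral
      (\<Sum>j\<in>UNIV. of_nat (k j) * moment j (e j))) {0..1}"
    by (intro has_integral_sum has_integral_mult_right moment_has_integral) auto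
  then have "((\<lambda>t. Q t t) has_integral (\<Sum>j\<in>UNIV. of_nat (k j) * moment j (e j))) {0..1}"
    by (rule has_integral_eq[rotated]) (simp add: Qt)
  then show ?thesis using int has_integral_unique unfolding e_def by blast
qed

text \<open>The trace formula for the monomials in a single variable.\<close>

lemma moment_power: "of_nat (Suc m) * moment j (\<lambda>i. if i = j then m else 0) = \<tau> (B j ^ Suc m - A j ^ Suc m)"
proof -
  define k where "k = (\<lambda>i. if i = j then Suc m else 0)"
  have "\<tau> (op_monomial B k - op_monomial A k) = (\<Sum>j'\<in>UNIV. of_nat (k j') * moment j' (\<lambda>i. if i = j' then k i - 1 else k i))"
    by (rule trace_monomial_diff)
  also have "\<dots> = (\<Sum>j'\<in>{j}. of_nat (k j') * moment j' (\<lambda>i. if i = j' then k i - 1 else k i))"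
    by (rule sum.mono_neutral_right) (auto simp: k_def)
  also have "\<dots> = of_nat (Suc m) * moment j (\<lambda>i. if i = j then m else 0)"
  proof -
    have "(\<lambda>i. if i = j then k i - 1 else k i) = (\<lambda>i. if i = j then m else 0)" by (auto simp: k_def)
    then show ?thesis by (simp add: k_def)
  qed
  finally show ?thesis by (simp add: k_def op_monomial_single)
qed

text \<open>Reversing a word in commuting operators does not change it, so \<open>\<tau> (g (seg t) V)\<close> is invariant under
  complex conjugation by cyclicity.\<close>

lemma moment_real:
  assumes "\<And>j. self_adjoint (A j)" "\<And>j. self_adjoint (B j)"
  shows "Im (moment j k) = 0"
proof -
  have adjseg: "adj (seg t i) = seg t i" for t i
    using assms by (simp add: seg_def adj_simps self_adjoint_def)
  have real: "Im (\<tau> (op_monomial (seg t) k * (B j - A j))) = 0" if t: "t \<in> {0..1}" for t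
  proof -
    have rev: "adj (prod_list (map (seg t) xs)) = prod_list (map (seg t) (rev xs))" for xs
      by (induction xs) (auto simp: adj_mult adjseg)
    have "adj (op_monomial (seg t) k) = op_monomial (seg t) k"
    proof -
      obtain js where js: "count_list js = k" using count_list_surj by blast
      have "count_list (rev js) = k" using js by (auto simp: fun_eq_iff)
      then show ?thesis
        using rev[of js] prod_list_eq_op_monomial[OF seg_commuting[OF t]] js by metis
    qed
    then have "adj (op_monomial (seg t) k * (B j - A j)) = (B j - A j) * op_monomial (seg t) k"
      using assms by (simp add: adj_simps self_adjoint_def)
    then have "cnj (\<tau> (op_monomial (seg t) k * (B j - A j))) = \<tau> ((B j - A j) * op_monomial (seg t) k)"
      using trace_adj[of "op_monomial (seg t) k * (B j - A j)"] by (simp add: I_mult_left diff_in_I)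
    also have "\<dots> = \<tau> (op_monomial (seg t) k * (B j - A j))"
      by (rule \<tau>_commute[OF diff_in_I, symmetric])
    finally show ?thesis by (metis cnj.simps(2) equal_neg_zero)
  qed
  have "((\<lambda>t. Im (\<tau> (op_monomial (seg t) k * (B j - A j)))) has_integral Im (moment j k)) {0..1}"
    using has_integral_linear[OF moment_has_integral bounded_linear_Im] by (simp add: o_def)
  then have "((\<lambda>t :: real. 0 :: real) has_integral Im (moment j k)) {0..1}"
    by (rule has_integral_eq[rotated]) (simp add: real)
  then show ?thesis using has_integral_unique has_integral_0 by blast
qed

end

section \<open>Power series\<close>

lemma has_sum_diff_complex:
  fixes f g :: "'a \<Rightarrow> 'b::real_normed_vector"
  assumes "(f has_sum a) A" "(g has_sum b) A"
  shows "((\<lambda>x. f x - g x) has_sum (a - b)) A"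
  using has_sum_add[OF assms(1), of "\<lambda>x. - g x" "- b"] assms(2) by (simp add: has_sum_uminus)

lemma has_sum_sum_finite:
  fixes f :: "'j \<Rightarrow> 'a \<Rightarrow> 'b::real_normed_vector"
  assumes "\<And>j. j \<in> J \<Longrightarrow> (f j has_sum S j) A"
  shows "((\<lambda>x. \<Sum>j\<in>J. f j x) has_sum (\<Sum>j\<in>J. S j)) A"
  using assms by (induction J rule: infinite_finite_induct) (auto intro: has_sum_add)

lemma nat_le_power_div:
  fixes \<delta> :: real
  assumes "\<delta> > 0"
  shows "real m \<le> (1 + \<delta>) ^ m / \<delta>"
proof -
  have "1 + real m * \<delta> \<le> (1 + \<delta>) ^ m" using assms by (intro Bernoulli_inequality) simp
  then show ?thesis using assms by (simp add: field_simps)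
qed

text \<open>Convergence at the point with all coordinates \<open>(1 + \<delta>)\<^sup>3 < 1 + \<epsilon>\<close> leaves two factors
  \<open>(1 + \<delta>)\<^bsup>m\<^esup> \<ge> m \<delta>\<close> to pay for a weight \<open>m\<^sup>2\<close>, where \<open>m\<close> is the total degree, and one to spare.\<close>

lemma taylor_polydisc_weights:
  fixes c :: "('n::finite \<Rightarrow> nat) \<Rightarrow> complex"
  assumes f: "taylor_polydisc (1 + \<epsilon>) c f" and \<epsilon>: "\<epsilon> > 0"
  obtains \<delta> where "\<delta> > 0" "\<delta> < \<epsilon>" "(\<lambda>k. cmod (c k)) summable_on UNIV"
    "(\<lambda>k. cmod (c k) * real (\<Sum>i\<in>UNIV. k i)) summable_on UNIV"
    "(\<lambda>k. cmod (c k) * (real (\<Sum>i\<in>UNIV. k i))\<^sup>2 * (1 + \<delta>) ^ (\<Sum>i\<in>UNIV. k i)) summable_on UNIV"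
proof -
  define \<delta> where "\<delta> = min 1 (\<epsilon> / 8)"
  have \<delta>: "\<delta> > 0" "\<delta> \<le> 1" "\<delta> < \<epsilon>" using \<epsilon> by (auto simp: \<delta>_def)
  have "\<delta> ^ 2 \<le> \<delta>" "\<delta> ^ 3 \<le> \<delta>"
    using \<delta> power_decreasing[of 1 2 \<delta>] power_decreasing[of 1 3 \<delta>] by auto
  moreover have "(1 + \<delta>) ^ 3 = 1 + 3 * \<delta> + 3 * \<delta> ^ 2 + \<delta> ^ 3" by (simp add: power2_eq_square power3_eq_cube algebra_simps)
  ultimately have r: "(1 + \<delta>) ^ 3 < 1 + \<epsilon>" using \<epsilon> by (auto simp: \<delta>_def min_def)
  define N where "N k = (\<Sum>i\<in>UNIV. k i)" for k :: "'n \<Rightarrow> nat"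
  define \<rho> where "\<rho> = (1 + \<delta>) ^ 3"
  have \<rho>0: "0 \<le> \<rho>" using \<delta> by (simp add: \<rho>_def)
  define \<zeta> :: "complex ^ 'n" where "\<zeta> = (\<chi> i. complex_of_real \<rho>)"
  have "\<forall>i. cmod (\<zeta> $ i) < 1 + \<epsilon>" using r[folded \<rho>_def] \<rho>0 by (simp add: \<zeta>_def)
  then have "(\<lambda>k. norm (c k * (\<Prod>i\<in>UNIV. \<zeta> $ i ^ k i))) summable_on UNIV"
    using f unfolding taylor_polydisc_def by blast
  moreover have "norm (c k * (\<Prod>i\<in>UNIV. \<zeta> $ i ^ k i)) = cmod (c k) * \<rho> ^ N k" for k
    using \<rho>0 by (simp add: norm_mult norm_power N_def \<zeta>_def power_sum flip: prod_norm)
  ultimately have base: "(\<lambda>k. cmod (c k) * \<rho> ^ N k) summable_on UNIV" by simp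
  have p1: "1 \<le> (1 + \<delta>) ^ m" for m using \<delta> by simp
  have \<rho>N: "\<rho> ^ m = (1 + \<delta>) ^ m * (1 + \<delta>) ^ m * (1 + \<delta>) ^ m" for m
    by (simp add: \<rho>_def power3_eq_cube power_mult_distrib)
  have nb: "real m \<le> (1 + \<delta>) ^ m / \<delta>" for m by (rule nat_le_power_div[OF \<delta>(1)])
  show ?thesis
  proof (rule that[OF \<delta>(1,3)])
    show "(\<lambda>k. cmod (c k)) summable_on UNIV"
    proof (rule summable_on_comparison_test[OF base])
      show "cmod (c k) \<le> cmod (c k) * \<rho> ^ N k" for k
        using \<delta> by (simp add: \<rho>_def mult_le_cancel_left1)
    qed simp
    show "(\<lambda>k. cmod (c k) * real (\<Sum>i\<in>UNIV. k i)) summable_on UNIV"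
    proof (rule summable_on_comparison_test[OF summable_on_cmult_left[OF base, of "1 / \<delta>"]])
      fix k :: "'n \<Rightarrow> nat"
      have "real (N k) \<le> (1 + \<delta>) ^ N k / \<delta>" by (rule nb)
      also have "\<dots> \<le> \<rho> ^ N k / \<delta>"
        using \<delta> by (intro divide_right_mono power_mono) (auto simp: \<rho>_def self_le_power)
      finally have "cmod (c k) * real (N k) \<le> cmod (c k) * (\<rho> ^ N k / \<delta>)" by (rule mult_left_mono) simp
      then show "cmod (c k) * real (\<Sum>i\<in>UNIV. k i) \<le> cmod (c k) * \<rho> ^ N k * (1 / \<delta>)" by (simp add: N_def)
    qed (simp add: sum_nonneg)
    show "(\<lambda>k. cmod (c k) * (real (\<Sum>i\<in>UNIV. k i))\<^sup>2 * (1 + \<delta>) ^ (\<Sum>i\<in>UNIV. k i)) summable_on UNIV"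
    proof (rule summable_on_comparison_test[OF summable_on_cmult_left[OF base, of "1 / \<delta>\<^sup>2"]])
      fix k :: "'n \<Rightarrow> nat"
      have "(real (N k))\<^sup>2 \<le> ((1 + \<delta>) ^ N k / \<delta>)\<^sup>2" by (rule power_mono[OF nb]) simp
      then have "(real (N k))\<^sup>2 * (1 + \<delta>) ^ N k \<le> ((1 + \<delta>) ^ N k / \<delta>)\<^sup>2 * (1 + \<delta>) ^ N k"
        using \<delta> by (intro mult_right_mono) auto
      also have "\<dots> = \<rho> ^ N k * (1 / \<delta>\<^sup>2)" by (simp add: \<rho>N power2_eq_square)
      finally have "cmod (c k) * ((real (N k))\<^sup>2 * (1 + \<delta>) ^ N k) \<le> cmod (c k) * (\<rho> ^ N k * (1 / \<delta>\<^sup>2))"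
        by (rule mult_left_mono) simp
      then show "cmod (c k) * (real (\<Sum>i\<in>UNIV. k i))\<^sup>2 * (1 + \<delta>) ^ (\<Sum>i\<in>UNIV. k i) \<le> cmod (c k) * \<rho> ^ N k * (1 / \<delta>\<^sup>2)"
        by (simp add: N_def mult.assoc)
    qed (use \<delta> in simp)
  qed
qed

text \<open>Termwise differentiation: the error of the difference quotient of \<open>w\<^bsup>m\<^esup>\<close> is at most
  \<open>m\<^sup>2 (1 + \<delta>)\<^bsup>m\<^esup> \<bar>h\<bar>\<close> for \<open>\<bar>w\<bar>, \<bar>w + h\<bar> \<le> 1 + \<delta>\<close>, which is summable against the coefficients.\<close>

lemma taylor_polydisc_partial:
  fixes c :: "('n::finite \<Rightarrow> nat) \<Rightarrow> complex"
  assumes f: "taylor_polydisc (1 + \<epsilon>) c f" and \<epsilon>: "\<epsilon> > 0" and z: "\<And>i. cmod (z $ i) \<le> 1"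
  shows "((\<lambda>w. f (vec_upd z j w)) has_field_derivative
    (\<Sum>\<^sub>\<infinity>k. c k * (of_nat (k j) * (\<Prod>i\<in>UNIV. z $ i ^ (if i = j then k i - 1 else k i))))) (at (z $ j))"
proof -
  obtain \<delta> where \<delta>: "\<delta> > 0" "\<delta> < \<epsilon>"
    and s1: "(\<lambda>k. cmod (c k) * real (\<Sum>i\<in>UNIV. k i)) summable_on UNIV"
    and s2: "(\<lambda>k. cmod (c k) * (real (\<Sum>i\<in>UNIV. k i))\<^sup>2 * (1 + \<delta>) ^ (\<Sum>i\<in>UNIV. k i)) summable_on UNIV"
    by (rule taylor_polydisc_weights[OF f \<epsilon>])
  define N where "N k = (\<Sum>i\<in>UNIV. k i)" for k :: "'n \<Rightarrow> nat"
  define P where "P k = (\<Prod>i\<in>UNIV - {j}. z $ i ^ k i)" for k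
  have P1: "cmod (P k) \<le> 1" for k
  proof -
    have "cmod (P k) = (\<Prod>i\<in>UNIV - {j}. cmod (z $ i) ^ k i)" by (simp add: P_def norm_power flip: prod_norm)
    also have "\<dots> \<le> 1" by (intro prod_le_1) (auto intro: power_le_one z)
    finally show ?thesis .
  qed
  have kN: "k j \<le> N k" for k unfolding N_def by (rule member_le_sum) auto
  define w where "w = z $ j"
  define F where "F w = f (vec_upd z j w)" for w
  have Fsum: "((\<lambda>k. c k * (u ^ k j * P k)) has_sum F u) UNIV" if u: "cmod u < 1 + \<epsilon>" for u
  proof -
    have "cmod (z $ i) < 1 + \<epsilon>" for i using z[of i] \<epsilon> by linarith
    then have lt: "\<forall>i. cmod (vec_upd z j u $ i) < 1 + \<epsilon>" using u by (auto simp: vec_upd_def)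
    have mon: "(\<Prod>i\<in>UNIV. vec_upd z j u $ i ^ k i) = u ^ k j * P k" for k
      unfolding P_def by (subst prod.remove[of _ j]) (auto simp: vec_upd_def intro!: prod.cong)
    have sums: "(\<lambda>k. norm (c k * (u ^ k j * P k))) summable_on UNIV" "F u = (\<Sum>\<^sub>\<infinity>k. c k * (u ^ k j * P k))"
      using f lt unfolding taylor_polydisc_def F_def mon[symmetric] by blast+
    from has_sum_infsum[OF abs_summable_summable[OF sums(1)]] show ?thesis unfolding sums(2) .
  qed
  define L where "L = (\<Sum>\<^sub>\<infinity>k. c k * (of_nat (k j) * (w ^ (k j - 1) * P k)))"
  have Lsum: "((\<lambda>k. c k * (of_nat (k j) * (w ^ (k j - 1) * P k))) has_sum L) UNIV"
  proof -
    have "(\<lambda>k. cmod (c k * (of_nat (k j) * (w ^ (k j - 1) * P k)))) summable_on UNIV"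
    proof (rule summable_on_comparison_test[OF s1])
      fix k :: "'n \<Rightarrow> nat"
      have "cmod (w ^ (k j - 1) * P k) \<le> 1 * 1"
        unfolding norm_mult norm_power by (intro mult_mono P1 power_le_one) (auto simp: w_def z)
      then have "real (k j) * cmod (w ^ (k j - 1) * P k) \<le> real (N k) * 1"
        using kN[of k] by (intro mult_mono) auto
      then have "cmod (c k) * (real (k j) * cmod (w ^ (k j - 1) * P k)) \<le> cmod (c k) * real (N k)"
        by (intro mult_left_mono) auto
      then show "cmod (c k * (of_nat (k j) * (w ^ (k j - 1) * P k))) \<le> cmod (c k) * real (\<Sum>i\<in>UNIV. k i)"
        by (simp add: norm_mult N_def)
    qed simp
    from has_sum_infsum[OF abs_summable_summable[OF this]] show ?thesis unfolding L_def .
  qed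
  define S where "S = (\<Sum>\<^sub>\<infinity>k. cmod (c k) * (real (\<Sum>i\<in>UNIV. k i))\<^sup>2 * (1 + \<delta>) ^ (\<Sum>i\<in>UNIV. k i))"
  have bound: "cmod ((F (w + h) - F w) / h - L) \<le> S * cmod h" if h: "h \<noteq> 0" "cmod h < \<delta>" for h
  proof -
    have wh: "cmod (w + h) \<le> 1 + \<delta>" "cmod w \<le> 1 + \<delta>"
      using z[of j] h \<delta> norm_triangle_ineq[of w h] by (auto simp: w_def)
    define q where "q k = ((w + h) ^ k j - w ^ k j) / h - of_nat (k j) * w ^ (k j - 1)" for k
    have "((\<lambda>k. (1 / h) * (c k * ((w + h) ^ k j * P k) - c k * (w ^ k j * P k)) - c k * (of_nat (k j) * (w ^ (k j - 1) * P k)))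
        has_sum ((1 / h) * (F (w + h) - F w) - L)) UNIV"
      by (intro has_sum_diff_complex has_sum_cmult_right Fsum Lsum) (use wh \<delta> in auto)
    moreover have "(1 / h) * (c k * ((w + h) ^ k j * P k) - c k * (w ^ k j * P k)) - c k * (of_nat (k j) * (w ^ (k j - 1) * P k))
        = c k * (P k * q k)" for k
      by (simp add: q_def algebra_simps diff_divide_distrib)
    ultimately have qs: "((\<lambda>k. c k * (P k * q k)) has_sum ((F (w + h) - F w) / h - L)) UNIV" by simp
    have le: "cmod (c k * (P k * q k)) \<le> (cmod (c k) * (real (N k))\<^sup>2 * (1 + \<delta>) ^ N k) * cmod h" for k
    proof -
      have "cmod (q k) \<le> real (k j) * real (k j - Suc 0) * (1 + \<delta>) ^ (k j - 2) * cmod h"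
        unfolding q_def using lemma_termdiff3[OF h(1) wh(2,1), of "k j"] by simp
      also have "\<dots> \<le> real (N k) * real (N k) * (1 + \<delta>) ^ N k * cmod h"
        using kN[of k] \<delta> by (intro mult_right_mono mult_mono power_increasing) auto
      finally have "cmod (P k) * cmod (q k) \<le> 1 * (real (N k) * real (N k) * (1 + \<delta>) ^ N k * cmod h)"
        by (intro mult_mono P1) auto
      then have "cmod (c k) * (cmod (P k) * cmod (q k)) \<le> cmod (c k) * (real (N k) * real (N k) * (1 + \<delta>) ^ N k * cmod h)"
        by (intro mult_left_mono) auto
      then show ?thesis by (simp add: norm_mult power2_eq_square mult_ac)
    qed
    have sh: "(\<lambda>k. (cmod (c k) * (real (N k))\<^sup>2 * (1 + \<delta>) ^ N k) * cmod h) summable_on UNIV"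
      unfolding N_def by (rule summable_on_cmult_left[OF s2])
    have sn: "(\<lambda>k. cmod (c k * (P k * q k))) summable_on UNIV"
      by (rule summable_on_comparison_test[OF sh le]) simp
    have "cmod ((F (w + h) - F w) / h - L) = cmod (\<Sum>\<^sub>\<infinity>k. c k * (P k * q k))" using infsumI[OF qs] by simp
    also have "\<dots> \<le> (\<Sum>\<^sub>\<infinity>k. cmod (c k * (P k * q k)))" by (rule norm_infsum_bound) (use sn in simp)
    also have "\<dots> \<le> (\<Sum>\<^sub>\<infinity>k. (cmod (c k) * (real (N k))\<^sup>2 * (1 + \<delta>) ^ N k) * cmod h)"
      by (rule infsum_mono[OF sn sh le])
    also have "\<dots> = S * cmod h" unfolding S_def N_def by (rule infsum_cmult_left) (use s2 in blast)
    finally show ?thesis .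
  qed
  have "(\<lambda>h. (F (w + h) - F w) / h - L) \<midarrow>0\<rightarrow> 0"
  proof (rule Lim_null_comparison)
    show "\<forall>\<^sub>F h in at 0. norm ((F (w + h) - F w) / h - L) \<le> S * cmod h"
      unfolding eventually_at using \<delta>(1) bound by (auto simp: dist_norm)
    have "((\<lambda>h. S * cmod h) \<longlongrightarrow> S * cmod 0) (at 0)" by (intro tendsto_intros)
    then show "(\<lambda>h. S * cmod h) \<midarrow>0\<rightarrow> 0" by simp
  qed
  then have "(F has_field_derivative L) (at w)" unfolding DERIV_def by (rule LIM_zero_cancel)
  moreover have "w ^ (k j - 1) * P k = (\<Prod>i\<in>UNIV. z $ i ^ (if i = j then k i - 1 else k i))" for k
    unfolding P_def w_def by (subst prod.remove[of UNIV j]) (auto intro!: prod.cong)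
  ultimately show ?thesis unfolding L_def F_def w_def by simp
qed

text \<open>Absolute convergence at a polyradius inside the real cube is absolute convergence on the torus of that
  polyradius.\<close>

lemma taylor_cube_extend:
  fixes c :: "('n::finite \<Rightarrow> nat) \<Rightarrow> complex"
  assumes "taylor_cube r c f"
  shows "taylor_polydisc r c (\<lambda>z. \<Sum>\<^sub>\<infinity>k. c k * (\<Prod>i\<in>UNIV. z $ i ^ k i))"
  unfolding taylor_polydisc_def
proof (intro allI impI conjI)
  fix z :: "complex ^ 'n" assume z: "\<forall>i. cmod (z $ i) < r"
  have "(\<lambda>k. norm (c k * of_real (\<Prod>i\<in>UNIV. (\<chi> i. cmod (z $ i)) $ i ^ k i))) summable_on UNIV"
    using assms[unfolded taylor_cube_def, rule_format, of "\<chi> i. cmod (z $ i)"] z by simp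
  then show "(\<lambda>k. norm (c k * (\<Prod>i\<in>UNIV. z $ i ^ k i))) summable_on UNIV"
    by (simp add: norm_mult abs_prod norm_power flip: prod_norm)
qed simp

text \<open>The partial derivative of the holomorphic extension, restricted to the real cube.\<close>

lemma rpartial_taylor_cube:
  fixes c :: "('n::finite \<Rightarrow> nat) \<Rightarrow> complex"
  assumes f: "taylor_cube (1 + \<epsilon>) c f" and \<epsilon>: "\<epsilon> > 0" and x: "\<And>i. \<bar>x $ i\<bar> \<le> 1"
  shows "rpartial j f x = (\<Sum>\<^sub>\<infinity>k. c k * (of_nat (k j) * (\<Prod>i\<in>UNIV. of_real (x $ i) ^ (if i = j then k i - 1 else k i))))"
proof -
  define z where "z = (\<chi> i. complex_of_real (x $ i))"
  define D where "D = (\<Sum>\<^sub>\<infinity>k. c k * (of_nat (k j) * (\<Prod>i\<in>UNIV. z $ i ^ (if i = j then k i - 1 else k i))))"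
  define g where "g = (\<lambda>z :: complex ^ 'n. \<Sum>\<^sub>\<infinity>k. c k * (\<Prod>i\<in>UNIV. z $ i ^ k i))"
  have "((\<lambda>w. g (vec_upd z j w)) has_field_derivative D) (at (z $ j))"
    unfolding D_def g_def
    by (rule taylor_polydisc_partial[OF taylor_cube_extend[OF f] \<epsilon>]) (simp add: z_def x)
  then have "((\<lambda>w. g (vec_upd z j w)) has_field_derivative D) (at (complex_of_real (x $ j)))"
    by (simp add: z_def)
  then have "((\<lambda>t. g (vec_upd z j (of_real t))) has_vector_derivative D) (at (x $ j))"
    by (rule has_vector_derivative_real_field)
  then have "((\<lambda>t. f (vec_upd x j t)) has_vector_derivative D) (at (x $ j))"
  proof (rule has_vector_derivative_transform_within_open[where S = "{- (1 + \<epsilon>)<..<1 + \<epsilon>}"])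
    show "x $ j \<in> {- (1 + \<epsilon>)<..<1 + \<epsilon>}" using x[of j] \<epsilon> by auto
    fix t assume t: "t \<in> {- (1 + \<epsilon>)<..<1 + \<epsilon>}"
    have "\<bar>x $ i\<bar> < 1 + \<epsilon>" for i using x[of i] \<epsilon> by linarith
    then have "\<forall>i. \<bar>vec_upd x j t $ i\<bar> < 1 + \<epsilon>" using t by (auto simp: vec_upd_def)
    then have "f (vec_upd x j t) = (\<Sum>\<^sub>\<infinity>k. c k * of_real (\<Prod>i\<in>UNIV. vec_upd x j t $ i ^ k i))"
      using f unfolding taylor_cube_def by blast
    also have "\<dots> = g (vec_upd z j (of_real t))"
      unfolding g_def by (intro infsum_cong) (auto simp: vec_upd_def z_def intro!: prod.cong)
    finally show "g (vec_upd z j (of_real t)) = f (vec_upd x j t)" by simp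
  qed simp
  then show ?thesis unfolding rpartial_def by (simp add: vector_derivative_at D_def z_def)
qed

context traced_ideal
begin

text \<open>Completeness of the ideal speaks of sequences, whereas the sum runs over an arbitrary index set: choose
  finite sets \<open>X m\<close> exhausting the sum of the majorant up to \<open>1 / (m + 1)\<close>, and compare with those.\<close>

lemma complete_ideal_summable:
  assumes complete: "complete_ideal I nrm" and D: "\<And>k. D k \<in> I"
    and a: "\<And>k. nrm (D k) \<le> a k" "a summable_on UNIV"
  shows "\<exists>T\<in>I. ((\<lambda>F. nrm (T - (\<Sum>k\<in>F. D k))) \<longlongrightarrow> 0) (finite_subsets_at_top UNIV)"
proof -
  have a0: "0 \<le> a k" for k using a(1) nrm_nonneg[OF D] order_trans by blast
  define s where "s = infsum a UNIV"
  have as: "(a has_sum s) UNIV" unfolding s_def by (rule has_sum_infsum[OF a(2)])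
  have sum_le: "sum a F \<le> s" if "finite F" for F
    unfolding s_def by (rule finite_sum_le_infsum[OF a(2) that]) (auto intro: a0)
  have "\<exists>F. finite F \<and> s - 1 / Suc m < sum a F" for m
  proof -
    obtain F where "finite F" "dist (sum a F) s \<le> 1 / (2 * Suc m)"
      using has_sum_finite_approximation[OF as, of "1 / (2 * Suc m)"] by auto
    moreover have "1 / (2 * real (Suc m)) < 1 / real (Suc m)" by (simp add: field_simps)
    ultimately show ?thesis by (intro exI[of _ F]) (auto simp: dist_real_def)
  qed
  then obtain E where E: "\<And>m. finite (E m)" "\<And>m. s - 1 / Suc m < sum a (E m)" by metis
  define X where "X m = (\<Union>i\<le>m. E i)" for m
  have X: "finite (X m)" "E m \<subseteq> X m" "mono X" for m
  proof -
    show "finite (X m)" "E m \<subseteq> X m" using E(1) by (auto simp: X_def)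
    show "mono X" unfolding X_def by (intro monoI UN_mono) auto
  qed
  have Xs: "s - 1 / Suc m < sum a (X m)" for m
    using E(2)[of m] sum_mono2[OF X(1) X(2), of m a] a0 by fastforce
  have close: "nrm ((\<Sum>k\<in>F. D k) - (\<Sum>k\<in>X m. D k)) \<le> 1 / Suc m" if F: "finite F" "X m \<subseteq> F" for F m
  proof -
    have "(\<Sum>k\<in>F. D k) - (\<Sum>k\<in>X m. D k) = (\<Sum>k\<in>F - X m. D k)"
      using sum.subset_diff[OF F(2,1), of D] by simp
    then have "nrm ((\<Sum>k\<in>F. D k) - (\<Sum>k\<in>X m. D k)) \<le> (\<Sum>k\<in>F - X m. nrm (D k))"
      using nrm_sum[of "F - X m" D] D by simp
    also have "\<dots> \<le> (\<Sum>k\<in>F - X m. a k)" by (intro sum_mono a)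
    also have "\<dots> = sum a F - sum a (X m)" using sum.subset_diff[OF F(2,1), of a] by simp
    also have "\<dots> \<le> 1 / Suc m" using sum_le[OF F(1)] Xs[of m] by simp
    finally show ?thesis .
  qed
  have DI: "(\<Sum>k\<in>F. D k) \<in> I" for F by (rule I_sum[OF D])
  have close2: "nrm ((\<Sum>k\<in>F. D k) - (\<Sum>k\<in>G. D k)) \<le> 2 / Suc m" if F: "finite F" "X m \<subseteq> F" and G: "finite G" "X m \<subseteq> G" for F G m
  proof -
    have "(\<Sum>k\<in>F. D k) - (\<Sum>k\<in>G. D k) = ((\<Sum>k\<in>F. D k) - (\<Sum>k\<in>X m. D k)) + - ((\<Sum>k\<in>G. D k) - (\<Sum>k\<in>X m. D k))" by simp
    then have "nrm ((\<Sum>k\<in>F. D k) - (\<Sum>k\<in>G. D k)) \<le> nrm ((\<Sum>k\<in>F. D k) - (\<Sum>k\<in>X m. D k)) + nrm (- ((\<Sum>k\<in>G. D k) - (\<Sum>k\<in>X m. D k)))"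
      using nrm_triangle[OF I_diff[OF DI DI] I_diff[OF DI DI], of F "X m" "X m" G] by simp
    also have "nrm (- ((\<Sum>k\<in>G. D k) - (\<Sum>k\<in>X m. D k))) = nrm ((\<Sum>k\<in>G. D k) - (\<Sum>k\<in>X m. D k))"
      by (rule nrm_minus[OF I_diff[OF DI DI]])
    also have "nrm ((\<Sum>k\<in>F. D k) - (\<Sum>k\<in>X m. D k)) + \<dots> \<le> 1 / Suc m + 1 / Suc m" by (intro add_mono close F G)
    finally show ?thesis by simp
  qed
  have small: "\<exists>m. 2 / real (Suc m) < e" if "e > 0" for e :: real
    using reals_Archimedean[of "e / 2"] that by (auto simp: field_simps)
  have "\<exists>T\<in>I. (\<lambda>m. nrm ((\<Sum>k\<in>X m. D k) - T)) \<longlonglongrightarrow> 0"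
  proof (rule complete[unfolded complete_ideal_def, rule_format], intro conjI allI impI)
    show "(\<Sum>k\<in>X m. D k) \<in> I" for m by (rule DI)
    fix e :: real assume "0 < e"
    then obtain m where m: "2 / real (Suc m) < e" using small by blast
    have "nrm ((\<Sum>k\<in>X p. D k) - (\<Sum>k\<in>X q. D k)) < e" if "p \<ge> m" "q \<ge> m" for p q
      using close2[OF X(1) monoD[OF X(3) that(1)] X(1) monoD[OF X(3) that(2)]] m by simp
    then show "\<exists>N. \<forall>p\<ge>N. \<forall>q\<ge>N. nrm ((\<Sum>k\<in>X p. D k) - (\<Sum>k\<in>X q. D k)) < e" by blast
  qed
  then obtain T where T: "T \<in> I" "(\<lambda>m. nrm ((\<Sum>k\<in>X m. D k) - T)) \<longlonglongrightarrow> 0" by blast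
  have "((\<lambda>F. nrm (T - (\<Sum>k\<in>F. D k))) \<longlongrightarrow> 0) (finite_subsets_at_top UNIV)"
  proof (rule tendstoI)
    fix e :: real assume e: "0 < e"
    then obtain m where m: "2 / real (Suc m) < e / 2" using small[of "e / 2"] by auto
    have "\<forall>\<^sub>F p in sequentially. nrm ((\<Sum>k\<in>X p. D k) - T) < e / 2"
      using order_tendstoD(2)[OF T(2), of "e / 2"] e by simp
    then obtain p0 where "\<And>p. p \<ge> p0 \<Longrightarrow> nrm ((\<Sum>k\<in>X p. D k) - T) < e / 2"
      unfolding eventually_sequentially by blast
    then obtain p where p: "p \<ge> m" "nrm ((\<Sum>k\<in>X p. D k) - T) < e / 2"
      by (metis max.cobounded1 max.cobounded2)
    have "nrm (T - (\<Sum>k\<in>F. D k)) < e" if F: "finite F" "X m \<subseteq> F" for F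
    proof -
      have "T - (\<Sum>k\<in>F. D k) = - ((\<Sum>k\<in>X p. D k) - T) + ((\<Sum>k\<in>X p. D k) - (\<Sum>k\<in>F. D k))" by simp
      also have "nrm \<dots> \<le> nrm (- ((\<Sum>k\<in>X p. D k) - T)) + nrm ((\<Sum>k\<in>X p. D k) - (\<Sum>k\<in>F. D k))"
        using I_scaleC[OF I_diff[OF DI T(1)], of "-1" "X p"]
        by (intro nrm_triangle I_diff DI) (simp add: scaleC_minus1)
      also have "nrm (- ((\<Sum>k\<in>X p. D k) - T)) = nrm ((\<Sum>k\<in>X p. D k) - T)"
        by (rule nrm_minus[OF I_diff[OF DI T(1)]])
      also have "\<dots> + nrm ((\<Sum>k\<in>X p. D k) - (\<Sum>k\<in>F. D k)) < e / 2 + e / 2"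
        using p(2) close2[OF X(1) monoD[OF X(3) p(1)] F] m by (intro add_strict_mono) auto
      finally show ?thesis by simp
    qed
    moreover have "0 \<le> nrm (T - (\<Sum>k\<in>F. D k))" for F by (rule nrm_nonneg[OF I_diff[OF T(1) DI]])
    ultimately show "\<forall>\<^sub>F F in finite_subsets_at_top UNIV. dist (nrm (T - (\<Sum>k\<in>F. D k))) 0 < e"
      unfolding eventually_finite_subsets_at_top by (intro exI[of _ "X m"]) (auto simp: X(1))
  qed
  then show ?thesis using T(1) by blast
qed

text \<open>The sum in the norm of the ideal agrees with the sum in operator norm, and the trace is
  continuous for the former.\<close>

lemma trace_has_sum:
  assumes D: "\<And>k. D k \<in> I" and T: "T \<in> I"
    and lim: "((\<lambda>F. nrm (T - (\<Sum>k\<in>F. D k))) \<longlongrightarrow> 0) (finite_subsets_at_top UNIV)"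
    and S: "(D has_sum S) UNIV"
  shows "((\<lambda>k. \<tau> (D k)) has_sum \<tau> S) UNIV"
proof -
  obtain K where K: "K > 0" "\<And>X. X \<in> I \<Longrightarrow> norm X \<le> K * nrm X" using norm_le_nrm by blast
  have DI: "(\<Sum>k\<in>F. D k) \<in> I" for F by (rule I_sum[OF D])
  have "((\<lambda>F. T - (\<Sum>k\<in>F. D k)) \<longlongrightarrow> 0) (finite_subsets_at_top UNIV)"
  proof (rule Lim_null_comparison)
    show "\<forall>\<^sub>F F in finite_subsets_at_top UNIV. norm (T - (\<Sum>k\<in>F. D k)) \<le> K * nrm (T - (\<Sum>k\<in>F. D k))"
      by (rule always_eventually) (use K(2) I_diff[OF T DI] in blast)
    show "((\<lambda>F. K * nrm (T - (\<Sum>k\<in>F. D k))) \<longlongrightarrow> 0) (finite_subsets_at_top UNIV)"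
      by (rule tendsto_mult_right_zero[OF lim])
  qed
  moreover have "((\<lambda>F. T - (\<Sum>k\<in>F. D k)) \<longlongrightarrow> T - S) (finite_subsets_at_top UNIV)"
    using S unfolding has_sum_def by (intro tendsto_diff tendsto_const)
  ultimately have "T - S = 0"
    using tendsto_unique finite_subsets_at_top_neq_bot by blast
  then have TS: "T = S" by simp
  have "((\<lambda>F. \<tau> (T - (\<Sum>k\<in>F. D k))) \<longlongrightarrow> 0) (finite_subsets_at_top UNIV)"
  proof (rule Lim_null_comparison)
    show "\<forall>\<^sub>F F in finite_subsets_at_top UNIV. norm (\<tau> (T - (\<Sum>k\<in>F. D k))) \<le> dual_norm I nrm \<tau> * nrm (T - (\<Sum>k\<in>F. D k))"
      by (rule always_eventually) (use \<tau>_dual_norm[OF I_diff[OF T DI]] in blast)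
    show "((\<lambda>F. dual_norm I nrm \<tau> * nrm (T - (\<Sum>k\<in>F. D k))) \<longlongrightarrow> 0) (finite_subsets_at_top UNIV)"
      by (rule tendsto_mult_right_zero[OF lim])
  qed
  then have "((\<lambda>F. \<tau> T - (\<Sum>k\<in>F. \<tau> (D k))) \<longlongrightarrow> 0) (finite_subsets_at_top UNIV)"
    by (simp add: \<tau>_diff T DI \<tau>_sum D)
  then have "((\<lambda>F. \<tau> T - (\<tau> T - (\<Sum>k\<in>F. \<tau> (D k)))) \<longlongrightarrow> \<tau> T - 0) (finite_subsets_at_top UNIV)"
    by (intro tendsto_diff tendsto_const)
  then show ?thesis by (simp add: has_sum_def TS)
qed

end

context contractive_segment
begin

text \<open>In a complete ideal the sum converges in the norm of the ideal, since \<open>nrm\<close> of a difference of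
  monomials grows at most linearly in the degree; otherwise this is the hypothesis
  \<open>trace_applicable\<close>.\<close>

lemma trace_op_series:
  assumes c: "(\<lambda>k. cmod (c k)) summable_on UNIV" "(\<lambda>k. cmod (c k) * real (\<Sum>i\<in>UNIV. k i)) summable_on UNIV"
    and app: "trace_applicable I nrm (\<lambda>k. c k *\<^sub>C (op_monomial B k - op_monomial A k))"
  shows "((\<lambda>k. c k * \<tau> (op_monomial B k - op_monomial A k)) has_sum
    \<tau> (op_series c (op_monomial B) - op_series c (op_monomial A))) UNIV"
proof -
  define D where "D k = c k *\<^sub>C (op_monomial B k - op_monomial A k)" for k
  have DI: "D k \<in> I" for k unfolding D_def by (rule I_scaleC[OF monomial_diff_in_I])
  have "\<exists>T\<in>I. ((\<lambda>F. nrm (T - (\<Sum>k\<in>F. D k))) \<longlongrightarrow> 0) (finite_subsets_at_top UNIV)"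
  proof (cases "complete_ideal I nrm")
    case True
    show ?thesis
    proof (rule complete_ideal_summable[OF True DI])
      show "nrm (D k) \<le> cmod (c k) * real (\<Sum>i\<in>UNIV. k i) * (\<Sum>j\<in>UNIV. nrm (B j - A j))" for k
        unfolding D_def nrm_scaleC[OF monomial_diff_in_I] mult.assoc by (intro mult_left_mono monomial_diff_nrm) simp
      show "(\<lambda>k. cmod (c k) * real (\<Sum>i\<in>UNIV. k i) * (\<Sum>j\<in>UNIV. nrm (B j - A j))) summable_on UNIV"
        by (rule summable_on_cmult_left[OF c(2)])
    qed
  next
    case False
    then show ?thesis using app unfolding trace_applicable_def D_def by blast
  qed
  then obtain T where T: "T \<in> I" "((\<lambda>F. nrm (T - (\<Sum>k\<in>F. D k))) \<longlongrightarrow> 0) (finite_subsets_at_top UNIV)" by blast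
  have ser: "((\<lambda>k. c k *\<^sub>C op_monomial X k) has_sum op_series c (op_monomial X)) UNIV" if X: "\<And>i. contraction (X i)" for X
  proof -
    have "(\<lambda>k. norm (c k *\<^sub>C op_monomial X k)) summable_on UNIV"
      by (rule summable_on_comparison_test[OF c(1)])
        (use norm_op_monomial_le[of X, OF X] in \<open>auto simp: norm_scaleC_bop mult_left_le\<close>)
    from has_sum_infsum[OF abs_summable_summable[OF this]] show ?thesis unfolding op_series_def .
  qed
  have "contraction (A j)" "contraction (B j)" for j
    using seg_contraction[of 0 j] seg_contraction[of 1 j] by (simp_all add: seg_0 seg_1)
  then have "(D has_sum (op_series c (op_monomial B) - op_series c (op_monomial A))) UNIV"
    unfolding D_def scaleC_diff_right by (intro has_sum_diff_complex ser)
  from trace_has_sum[OF DI T this] show ?thesis by (simp add: D_def \<tau>_scaleC monomial_diff_in_I)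
qed

context
  fixes K :: "'y::euclidean_space set" and e :: "'n \<Rightarrow> 'y \<Rightarrow> complex"
  assumes K: "compact K" "K \<noteq> {}"
    and e_cont: "\<And>i. continuous_on K (e i)" and e_le: "\<And>i x. x \<in> K \<Longrightarrow> cmod (e i x) \<le> 1"
begin

definition mon :: "('n \<Rightarrow> nat) \<Rightarrow> 'y \<Rightarrow> complex" where "mon k x = (\<Prod>i\<in>UNIV. e i x ^ k i)"

lemma mon_cont: "continuous_on K (mon k)"
  unfolding mon_def by (intro continuous_intros e_cont)

lemma mon_le: "x \<in> K \<Longrightarrow> cmod (mon k x) \<le> 1"
  unfolding mon_def by (simp add: norm_power flip: prod_norm) (auto intro!: prod_le_1 power_le_one e_le)

lemma mon_single: "mon (\<lambda>i. if i = j then m else 0) x = e j x ^ m"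
proof -
  have "mon (\<lambda>i. if i = j then m else 0) x = (\<Prod>i\<in>UNIV. if i = j then e i x ^ m else 1)"
    unfolding mon_def by (rule prod.cong) auto
  then show ?thesis by simp
qed

text \<open>A von Neumann inequality on the compact set \<open>K\<close>, on which the variables are represented by the
  functions \<open>e i\<close>, makes the moments a functional on polynomials bounded by \<open>mass (B j - A j)\<close>.  The
  graph \<open>G\<close> of this functional is what the Riesz theorem is applied to.\<close>

lemma moment_measure_exists:
  assumes vN: "\<And>F c s t. finite F \<Longrightarrow> t \<in> {0..1} \<Longrightarrow> (\<And>x. x \<in> K \<Longrightarrow> cmod (\<Sum>k\<in>F. c k * mon k x) \<le> s) \<Longrightarrow>
      norm (\<Sum>k\<in>F. c k *\<^sub>C op_monomial (seg t) k) \<le> s"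
  obtains \<mu> where "complex_measure (borel_on K) \<mu>"
    "total_variation (borel_on K) \<mu> \<le> ennreal (mass (B j - A j))"
    "\<And>k. cm_integral (borel_on K) \<mu> (mon k) = moment j k"
proof -
  define G where "G = {(\<lambda>x. \<Sum>k\<in>F. c k * mon k x, \<Sum>k\<in>F. c k * moment j k) |F c. finite F}"
  show ?thesis
  proof (rule Riesz_complex_measure[OF K trace_mult_mass(2)[OF diff_in_I], of G j])
    show "continuous_on K g" if "(g, d) \<in> G" for g d
      using that unfolding G_def by (auto intro!: continuous_intros mon_cont)
    show "(\<lambda>_. 0, 0) \<in> G" unfolding G_def by (auto intro!: exI[of _ "{}"])
    show "(\<lambda>x. g x + h x, d + d') \<in> G" if "(g, d) \<in> G" "(h, d') \<in> G" for g d h d'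
    proof -
      obtain F c F' c' where *: "finite F" "finite F'"
        "g = (\<lambda>x. \<Sum>k\<in>F. c k * mon k x)" "d = (\<Sum>k\<in>F. c k * moment j k)"
        "h = (\<lambda>x. \<Sum>k\<in>F'. c' k * mon k x)" "d' = (\<Sum>k\<in>F'. c' k * moment j k)"
        using \<open>(g, d) \<in> G\<close> \<open>(h, d') \<in> G\<close> unfolding G_def by blast
      have ext: "(\<Sum>k\<in>E. b k * y k) = (\<Sum>k\<in>F \<union> F'. (if k \<in> E then b k else 0) * y k)" if "E \<subseteq> F \<union> F'"
        for E b and y :: "('n \<Rightarrow> nat) \<Rightarrow> complex"
      proof -
        have "(\<Sum>k\<in>F \<union> F'. (if k \<in> E then b k else 0) * y k) = (\<Sum>k\<in>E. (if k \<in> E then b k else 0) * y k)"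
          by (rule sum.mono_neutral_right) (use *(1,2) that in auto)
        then show ?thesis by simp
      qed
      define b where "b k = (if k \<in> F then c k else 0) + (if k \<in> F' then c' k else 0)" for k
      have comb: "(\<Sum>k\<in>F. c k * y k) + (\<Sum>k\<in>F'. c' k * y k) = (\<Sum>k\<in>F \<union> F'. b k * y k)" for y :: "('n \<Rightarrow> nat) \<Rightarrow> complex"
        unfolding ext[of F c, OF Un_upper1] ext[of F' c', OF Un_upper2] b_def by (simp add: distrib_right sum.distrib)
      show ?thesis unfolding *(3-6) comb G_def using *(1,2) by blast
    qed
    show "(\<lambda>x. a * g x, a * d) \<in> G" if "(g, d) \<in> G" for a g d
    proof -
      obtain F c where *: "finite F" "g = (\<lambda>x. \<Sum>k\<in>F. c k * mon k x)" "d = (\<Sum>k\<in>F. c k * moment j k)"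
        using \<open>(g, d) \<in> G\<close> unfolding G_def by blast
      have comb: "a * (\<Sum>k\<in>F. c k * y k) = (\<Sum>k\<in>F. (a * c k) * y k)" for y :: "('n \<Rightarrow> nat) \<Rightarrow> complex"
        by (simp add: sum_distrib_left mult.assoc)
      show ?thesis unfolding *(2,3) comb G_def
        by (intro CollectI exI[of _ F] exI[of _ "\<lambda>k. a * c k"]) (use *(1) in simp)
    qed
    show "cmod d \<le> mass (B j - A j) * s" if "(g, d) \<in> G" "\<And>x. x \<in> K \<Longrightarrow> cmod (g x) \<le> s" for g d s
    proof -
      obtain F c where *: "finite F" "g = (\<lambda>x. \<Sum>k\<in>F. c k * mon k x)" "d = (\<Sum>k\<in>F. c k * moment j k)"
        using \<open>(g, d) \<in> G\<close> unfolding G_def by blast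
      show ?thesis unfolding *(3)
        by (rule moment_polynomial_bound[OF *(1) vN[OF *(1)]]) (use that(2) *(2) in auto)
    qed
  next
    fix \<mu> assume \<mu>: "complex_measure (borel_on K) \<mu>" "total_variation (borel_on K) \<mu> \<le> ennreal (mass (B j - A j))"
      "\<And>g c. (g, c) \<in> G \<Longrightarrow> cm_integral (borel_on K) \<mu> g = c"
    have "(mon k, moment j k) \<in> G" for k
      unfolding G_def by (intro CollectI exI[of _ "{k}"] exI[of _ "\<lambda>_. 1"]) simp
    then show ?thesis using that[OF \<mu>(1,2)] \<mu>(3) by blast
  qed
qed

context
  fixes \<mu> :: "'n \<Rightarrow> 'y set \<Rightarrow> complex"
  assumes \<mu>: "\<And>j. complex_measure (borel_on K) (\<mu> j)"
    and moments: "\<And>j k. cm_integral (borel_on K) (\<mu> j) (mon k) = moment j k"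
begin

lemma total_mass: "\<mu> j K = \<tau> (B j - A j)"
proof -
  have "mon (\<lambda>_. 0) = (\<lambda>_. 1)" by (rule ext) (simp add: mon_def)
  then have "cm_integral (borel_on K) (\<mu> j) (\<lambda>_. 1) = \<tau> (B j - A j)"
    using moments[of j "\<lambda>_. 0"] by (simp add: moment_zero)
  then show ?thesis using cm_integral_one[OF \<mu>] by (simp add: borel_on_def space_restrict_space)
qed

text \<open>Both sides are sums of the formula for monomials.\<close>

lemma trace_formula:
  assumes c: "(\<lambda>k. cmod (c k)) summable_on UNIV" "(\<lambda>k. cmod (c k) * real (\<Sum>i\<in>UNIV. k i)) summable_on UNIV"
    and app: "trace_applicable I nrm (\<lambda>k. c k *\<^sub>C (op_monomial B k - op_monomial A k))"
    and g: "\<And>j x. x \<in> K \<Longrightarrow> g j x = (\<Sum>\<^sub>\<infinity>k. c k * (of_nat (k j) * mon (\<lambda>i. if i = j then k i - 1 else k i) x))"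
  shows "\<tau> (op_series c (op_monomial B) - op_series c (op_monomial A)) = (\<Sum>j\<in>UNIV. cm_integral (borel_on K) (\<mu> j) (g j))"
proof -
  define d where "d j k = (\<lambda>i. if i = j then k i - 1 else k i)" for j :: 'n and k :: "'n \<Rightarrow> nat"
  have "((\<lambda>k. c k * (of_nat (k j) * moment j (d j k))) has_sum cm_integral (borel_on K) (\<mu> j) (g j)) UNIV" for j
  proof -
    have "((\<lambda>k. cm_integral (borel_on K) (\<mu> j) (\<lambda>x. c k * (of_nat (k j) * mon (d j k) x))) has_sum
        cm_integral (borel_on K) (\<mu> j) (g j)) UNIV"
    proof (rule cm_integral_infsum[OF \<mu> _ _ c(2)])
      show "continuous_on K (\<lambda>x. c k * (of_nat (k j) * mon (d j k) x))" for k by (intro continuous_intros mon_cont)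
      show "g j x = (\<Sum>\<^sub>\<infinity>k. c k * (of_nat (k j) * mon (d j k) x))" if "x \<in> K" for x unfolding d_def by (rule g[OF that])
      fix k x assume x: "x \<in> K"
      have "real (k j) \<le> real (\<Sum>i\<in>UNIV. k i)" unfolding of_nat_le_iff by (rule member_le_sum) auto
      then have "real (k j) * cmod (mon (d j k) x) \<le> real (\<Sum>i\<in>UNIV. k i) * 1" by (intro mult_mono mon_le x) auto
      then have "cmod (c k) * (real (k j) * cmod (mon (d j k) x)) \<le> cmod (c k) * real (\<Sum>i\<in>UNIV. k i)"
        by (intro mult_left_mono) auto
      then show "cmod (c k * (of_nat (k j) * mon (d j k) x)) \<le> cmod (c k) * real (\<Sum>i\<in>UNIV. k i)" by (simp add: norm_mult)
    qed
    then show ?thesis by (simp add: cm_integral_scale[OF \<mu>] moments)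
  qed
  then have "((\<lambda>k. \<Sum>j\<in>UNIV. c k * (of_nat (k j) * moment j (d j k))) has_sum (\<Sum>j\<in>UNIV. cm_integral (borel_on K) (\<mu> j) (g j))) UNIV"
    by (intro has_sum_sum_finite) auto
  moreover have "(\<Sum>j\<in>UNIV. c k * (of_nat (k j) * moment j (d j k))) = c k * \<tau> (op_monomial B k - op_monomial A k)" for k
    unfolding trace_monomial_diff d_def by (simp add: sum_distrib_left)
  ultimately show ?thesis using has_sum_unique[OF trace_op_series[OF c app]] by simp
qed

lemma one_variable_integral:
  assumes b: "(\<lambda>m. cmod (b m)) summable_on UNIV"
    and g: "\<And>x. x \<in> K \<Longrightarrow> g x = (\<Sum>\<^sub>\<infinity>m. b m * e j x ^ m)"
  shows "((\<lambda>m. b m * moment j (\<lambda>i. if i = j then m else 0)) has_sum cm_integral (borel_on K) (\<mu> j) g) UNIV"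
proof -
  have "((\<lambda>m. cm_integral (borel_on K) (\<mu> j) (\<lambda>x. b m * mon (\<lambda>i. if i = j then m else 0) x)) has_sum cm_integral (borel_on K) (\<mu> j) g) UNIV"
  proof (rule cm_integral_infsum[OF \<mu> _ _ b])
    show "continuous_on K (\<lambda>x. b m * mon (\<lambda>i. if i = j then m else 0) x)" for m by (intro continuous_intros mon_cont)
    show "cmod (b m * mon (\<lambda>i. if i = j then m else 0) x) \<le> cmod (b m)" if "x \<in> K" for m x
      using mon_le[OF that] by (simp add: norm_mult mult_left_le)
    show "g x = (\<Sum>\<^sub>\<infinity>m. b m * mon (\<lambda>i. if i = j then m else 0) x)" if "x \<in> K" for x
      using g[OF that] by (simp add: mon_single)
  qed
  then show ?thesis by (simp add: cm_integral_scale[OF \<mu>] moments)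
qed

end

end

end

section \<open>The one-variable measures\<close>

lemma Neumann_inverse:
  fixes T :: "'a::hilbert_space bop"
  assumes "norm T < 1"
  shows "\<exists>S. (1 - T) * S = 1 \<and> S * (1 - T) = 1"
proof -
  have sn: "summable (\<lambda>n. norm (T ^ n))"
    by (rule summable_comparison_test'[OF summable_geometric[of "norm T"], of 0])
      (use assms in \<open>auto simp: norm_power_bop_le\<close>)
  then have s: "summable (\<lambda>n. T ^ n)" by (rule summable_norm_cancel)
  define S where "S = (\<Sum>n. T ^ n)"
  have sh: "(\<Sum>n. T ^ Suc n) = S - 1" unfolding S_def using suminf_split_head[OF s] by simp
  have "T * S = S - 1" unfolding S_def[symmetric] sh[symmetric] by (simp add: S_def suminf_mult[OF s])
  moreover have "S * T = S - 1"
    unfolding sh[symmetric] by (simp only: S_def suminf_mult2[OF s] power_Suc2)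
  ultimately show ?thesis by (intro exI[of _ S]) (simp add: algebra_simps)
qed

lemma spectrum_contraction:
  fixes A :: "'a::hilbert_space bop"
  assumes A: "contraction A" and z: "z \<in> spectrum_op A"
  shows "cmod z \<le> 1"
proof (rule ccontr)
  assume "\<not> cmod z \<le> 1"
  then have z1: "cmod z > 1" and z0: "z \<noteq> 0" by auto
  have "norm (inverse z *\<^sub>C A) < 1"
  proof -
    have "norm A < cmod z" using A z1 by (simp add: contraction_def)
    moreover have "0 < cmod z" using z0 by simp
    ultimately show ?thesis by (simp add: norm_scaleC_bop norm_inverse norm_divide field_simps)
  qed
  then obtain S where S: "(1 - inverse z *\<^sub>C A) * S = 1" "S * (1 - inverse z *\<^sub>C A) = 1"
    using Neumann_inverse by blast
  have "A - z *\<^sub>C 1 = (- z) *\<^sub>C (1 - inverse z *\<^sub>C A)"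
    using z0 by (simp add: scaleC_diff_right scaleC_scaleC scaleC_minus_left)
  then have "(A - z *\<^sub>C 1) * ((- inverse z) *\<^sub>C S) = 1" "((- inverse z) *\<^sub>C S) * (A - z *\<^sub>C 1) = 1"
    using S z0 by (simp_all add: scaleC_mult_left scaleC_mult_right scaleC_scaleC)
  then show False using z unfolding spectrum_op_def by blast
qed

lemma spectral_hull_contraction:
  assumes "contraction A" "contraction B"
  shows "spectral_hull A B \<subseteq> {-1..1}"
  unfolding spectral_hull_def
proof (rule hull_minimal)
  show "{x. complex_of_real x \<in> spectrum_op A \<union> spectrum_op B} \<subseteq> {-1..1}"
    using spectrum_contraction[OF assms(1)] spectrum_contraction[OF assms(2)] by fastforce
qed simp

text \<open>If \<open>T - r\<close> and \<open>T + r\<close>, with \<open>r = norm T\<close>, were both invertible, then so would be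
  \<open>P = r\<^sup>2 - T\<^sup>2 \<ge> 0\<close>, and \<open>(norm x)\<^sup>2 \<le> c \<langle>P x, x\<rangle> = c (r\<^sup>2 (norm x)\<^sup>2 - (norm (T x))\<^sup>2)\<close> would keep the norm
  of \<open>T\<close> away from \<open>r\<close>.\<close>

lemma norm_in_spectrum:
  fixes T :: "'a::hilbert_space bop"
  assumes T: "adj T = T" and nontrivial: "\<exists>x :: 'a. x \<noteq> 0"
  shows "of_real (norm T) \<in> spectrum_op T \<or> of_real (- norm T) \<in> spectrum_op T"
proof (rule ccontr)
  define r where "r = norm T"
  assume "\<not> ?thesis"
  then obtain B1 B2 where B: "(T - of_real r *\<^sub>C 1) * B1 = 1" "B1 * (T - of_real r *\<^sub>C 1) = 1"
    "(T - of_real (- r) *\<^sub>C 1) * B2 = 1" "B2 * (T - of_real (- r) *\<^sub>C 1) = 1"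
    unfolding spectrum_op_def r_def by auto
  define P where "P = r\<^sup>2 *\<^sub>R 1 - T * T"
  have Pfact: "- P = (T - of_real (- r) *\<^sub>C 1) * (T - of_real r *\<^sub>C 1)"
    by (simp add: P_def scaleC_of_real scaleC_minus_left algebra_simps power2_eq_square)
  have BP: "B1 * B2 * (- P) = 1"
  proof -
    have "B1 * B2 * (- P) = B1 * (B2 * (T - of_real (- r) *\<^sub>C 1)) * (T - of_real r *\<^sub>C 1)"
      unfolding Pfact by (simp only: mult.assoc)
    then show ?thesis using B by simp
  qed
  define C where "C = - (B1 * B2)"
  have CP: "C * P = 1" using BP by (simp add: C_def)
  have Pin: "Re (cinner (app P x) x) = r\<^sup>2 * (norm x)\<^sup>2 - (norm (app T x))\<^sup>2" for x
    by (simp add: P_def app_minus app_scaleR app_one cinner_diff_left cinner_scaleR_left cinner_self norm_power2_app T)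
  have nT: "(norm (app T x))\<^sup>2 \<le> r\<^sup>2 * (norm x)\<^sup>2" for x
    unfolding r_def power_mult_distrib[symmetric] by (intro power_mono norm_app_le) simp
  have posP: "positive_op P"
    using nT Pin by (simp add: positive_op_iff) (simp add: P_def adj_simps T)
  define c where "c = (norm C)\<^sup>2 * norm P"
  have key: "(norm x)\<^sup>2 \<le> c * (r\<^sup>2 * (norm x)\<^sup>2 - (norm (app T x))\<^sup>2)" for x
  proof -
    define y where "y = app P x"
    have "((norm y)\<^sup>2)\<^sup>2 = (cmod (cinner (app P x) y))\<^sup>2" by (simp add: y_def cinner_self norm_power)
    also have "\<dots> \<le> Re (cinner (app P x) x) * Re (cinner (app P y) y)" by (rule positive_op_Cauchy_Schwarz[OF posP])
    also have "\<dots> \<le> Re (cinner (app P x) x) * (norm P * (norm y)\<^sup>2)"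
      by (intro mult_left_mono Re_cinner_app_le positive_opD posP)
    finally have ineq: "(norm y)\<^sup>2 * (norm y)\<^sup>2 \<le> (norm P * Re (cinner (app P x) x)) * (norm y)\<^sup>2"
      by (simp add: power2_eq_square mult_ac)
    have y: "(norm y)\<^sup>2 \<le> norm P * Re (cinner (app P x) x)"
    proof (cases "norm y = 0")
      case False
      then show ?thesis using mult_right_le_imp_le[OF ineq] by simp
    qed (use positive_opD(2)[OF posP, of x] in simp)
    have "x = app C y" unfolding y_def app_times[symmetric] CP by (simp add: app_one)
    then have "(norm x)\<^sup>2 \<le> (norm C * norm y)\<^sup>2" by (intro power_mono) (use norm_app_le[of C y] in auto)
    also have "\<dots> \<le> (norm C)\<^sup>2 * (norm P * Re (cinner (app P x) x))"
      unfolding power_mult_distrib by (intro mult_left_mono y) simp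
    finally show ?thesis by (simp add: c_def Pin mult_ac)
  qed
  obtain x0 :: 'a where x0: "x0 \<noteq> 0" using nontrivial by blast
  have c0: "c > 0"
  proof (rule ccontr)
    assume "\<not> c > 0"
    moreover have "0 \<le> c" by (simp add: c_def)
    ultimately have "c = 0" by linarith
    then show False using key[of x0] x0 by simp
  qed
  have le: "(norm (app T x))\<^sup>2 \<le> (r\<^sup>2 - 1 / c) * (norm x)\<^sup>2" for x
    using key[of x] c0 by (simp add: field_simps)
  have "0 \<le> (r\<^sup>2 - 1 / c) * (norm x0)\<^sup>2" using le[of x0] by (meson order_trans zero_le_power2)
  then have d0: "0 \<le> r\<^sup>2 - 1 / c" using x0 by (simp add: zero_le_mult_iff)
  have "norm T \<le> sqrt (r\<^sup>2 - 1 / c)"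
  proof (rule norm_bop_le)
    fix x
    have "(norm (app T x))\<^sup>2 \<le> (sqrt (r\<^sup>2 - 1 / c) * norm x)\<^sup>2" using le[of x] d0 by (simp add: power_mult_distrib)
    then show "norm (app T x) \<le> sqrt (r\<^sup>2 - 1 / c) * norm x" by (rule power2_le_imp_le) (intro mult_nonneg_nonneg real_sqrt_ge_zero d0 norm_ge_zero)
  qed (rule real_sqrt_ge_zero[OF d0])
  then have "r\<^sup>2 \<le> (sqrt (r\<^sup>2 - 1 / c))\<^sup>2" unfolding r_def[symmetric] by (intro power_mono) (auto simp: r_def)
  then have "r\<^sup>2 \<le> r\<^sup>2 - 1 / c" using d0 by simp
  then show False using c0 by simp
qed

lemma op_poly_extend: "degree p \<le> N \<Longrightarrow> op_poly p H = (\<Sum>k\<le>N. coeff p k *\<^sub>C H ^ k)"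
  unfolding op_poly_def by (rule sum.mono_neutral_left) (auto simp: coeff_eq_0)

lemma op_poly_0 [simp]: "op_poly 0 H = 0"
  by (simp add: op_poly_def)

lemma op_poly_pCons: "op_poly (pCons a p) H = a *\<^sub>C 1 + H * op_poly p H"
proof -
  have "op_poly (pCons a p) H = (\<Sum>k\<le>Suc (degree p). coeff (pCons a p) k *\<^sub>C H ^ k)"
    by (rule op_poly_extend) (rule degree_pCons_le)
  also have "\<dots> = a *\<^sub>C 1 + (\<Sum>k\<le>degree p. coeff p k *\<^sub>C (H * H ^ k))"
    by (subst sum.atMost_Suc_shift) simp
  also have "\<dots> = a *\<^sub>C 1 + H * op_poly p H"
    by (simp add: op_poly_def sum_distrib_left scaleC_mult_right)
  finally show ?thesis .
qed

lemma op_poly_add: "op_poly (p + q) H = op_poly p H + op_poly q H"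
proof -
  have "degree (p + q) \<le> max (degree p) (degree q)" by (rule degree_add_le_max)
  then show ?thesis
    by (simp add: op_poly_extend[of _ "max (degree p) (degree q)"] scaleC_add_left sum.distrib)
qed

lemma op_poly_smult: "op_poly (smult a p) H = a *\<^sub>C op_poly p H"
  by (simp add: op_poly_extend[of "smult a p" "degree p"] degree_smult_le op_poly_def scaleC_sum_right scaleC_scaleC)

lemma op_poly_diff: "op_poly (p - q) H = op_poly p H - op_poly q H"
proof -
  have "p - q = p + smult (- 1) q" by simp
  then show ?thesis by (simp only: op_poly_add op_poly_smult scaleC_minus1) simp
qed

lemma op_poly_mult: "op_poly (p * q) H = op_poly p H * op_poly q H"
proof (induction p)
  case (pCons a p)
  then show ?case
    by (simp add: mult_pCons_left op_poly_add op_poly_smult op_poly_pCons scaleC_mult_left algebra_simps)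
qed simp

lemma op_poly_pcompose: "op_poly (pcompose p q) H = op_poly p (op_poly q H)"
  by (induction p) (simp_all add: pcompose_pCons op_poly_add op_poly_mult op_poly_pCons)

lemma pcompose_constant: "pcompose p [:c:] = [:poly p c:]"
  by (induction p) (simp_all add: pcompose_pCons mult.commute)

lemma op_poly_monom: "op_poly (monom a n) H = a *\<^sub>C H ^ n"
proof -
  have "op_poly (monom a n) H = (\<Sum>k\<le>n. (if n = k then a else 0) *\<^sub>C H ^ k)"
    by (simp add: op_poly_extend[OF degree_monom_le])
  also have "\<dots> = (\<Sum>k\<le>n. if n = k then a *\<^sub>C H ^ n else 0)" by (rule sum.cong) auto
  finally show ?thesis by simp
qed

text \<open>The von Neumann inequality for a single variable.\<close>

lemma op_poly_norm_le_contraction: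
  fixes T :: "'a::hilbert_space bop"
  assumes T: "self_adjoint T" "contraction T" and s: "\<And>x. \<bar>x\<bar> \<le> 1 \<Longrightarrow> cmod (poly p (of_real x)) \<le> s"
  shows "norm (op_poly p T) \<le> s"
proof -
  define F :: "(unit \<Rightarrow> nat) set" where "F = (\<lambda>i _. i) ` {..degree p}"
  have inj: "inj_on (\<lambda>i _ :: unit. i :: nat) {..degree p}" by (auto simp: inj_on_def fun_eq_iff)
  have "norm (\<Sum>k\<in>F. coeff p (k ()) *\<^sub>C op_monomial (\<lambda>_. T) k) \<le> s"
  proof (rule von_Neumann_inequality_selfadjoint)
    fix x :: "unit \<Rightarrow> real" assume "\<And>i. \<bar>x i\<bar> \<le> 1"
    then have "cmod (poly p (of_real (x ()))) \<le> s" by (rule s)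
    also have "poly p (of_real (x ())) = (\<Sum>k\<in>F. coeff p (k ()) * of_real (\<Prod>i\<in>UNIV. x i ^ k i))"
      unfolding F_def sum.reindex[OF inj] by (simp add: poly_altdef UNIV_unit)
    finally show "cmod (\<Sum>k\<in>F. coeff p (k ()) * of_real (\<Prod>i\<in>UNIV. x i ^ k i)) \<le> s" .
  qed (use T in \<open>auto simp: commuting_def F_def\<close>)
  also have "(\<Sum>k\<in>F. coeff p (k ()) *\<^sub>C op_monomial (\<lambda>_. T) k) = op_poly p T"
    unfolding F_def sum.reindex[OF inj] by (simp add: op_poly_def op_monomial_def UNIV_unit)
  finally show ?thesis .
qed

text \<open>After the affine change of variable taking the hull to \<open>[-1, 1]\<close> the operator is a self-adjoint
  contraction, because its norm is attained on the spectrum.\<close>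

lemma op_poly_norm_le_spectral_hull:
  fixes H H0 :: "'a::hilbert_space bop"
  assumes nontrivial: "\<exists>x :: 'a. x \<noteq> 0" and H: "self_adjoint H" "spectrum_op H \<subseteq> spectrum_op H0 \<union> spectrum_op H'"
    and bdd: "spectral_hull H0 H' \<subseteq> {-1..1}"
    and s: "\<And>x. x \<in> spectral_hull H0 H' \<Longrightarrow> cmod (poly p (of_real x)) \<le> s"
  shows "norm (op_poly p H) \<le> s"
proof -
  define S where "S = spectral_hull H0 H'"
  have conv: "convex S" unfolding S_def spectral_hull_def by (rule convex_convex_hull)
  have aH: "adj H = H" using H(1) by (simp add: self_adjoint_def)
  have bS: "bdd_above S" "bdd_below S"
    using bdd unfolding S_def by (auto intro: bdd_above_mono[OF bdd_above_Icc] bdd_below_mono[OF bdd_below_Icc])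
  define a where "a = Inf S"
  define b where "b = Sup S"
  define m where "m = (a + b) / 2"
  define T where "T = H - of_real m *\<^sub>C 1"
  have aT: "adj T = T" by (simp add: T_def adj_simps aH)
  have shift: "m + t \<in> S" if "of_real t \<in> spectrum_op T" for t
  proof -
    have "T - of_real t *\<^sub>C 1 = H - of_real (m + t) *\<^sub>C 1" by (simp add: T_def scaleC_add_left algebra_simps)
    then have "of_real (m + t) \<in> spectrum_op H" using that unfolding spectrum_op_def by simp
    then have "complex_of_real (m + t) \<in> spectrum_op H0 \<union> spectrum_op H'" using H(2) by blast
    then show ?thesis unfolding S_def spectral_hull_def by (intro hull_inc) blast
  qed
  have "m + norm T \<in> S \<or> m + - norm T \<in> S"
    using norm_in_spectrum[OF aT nontrivial] shift[of "norm T"] shift[of "- norm T"] by blast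
  then have ne: "S \<noteq> {}" and "m + norm T \<le> b \<or> a \<le> m + - norm T"
    using cSup_upper[OF _ bS(1)] cInf_lower[OF _ bS(2)] by (auto simp: a_def b_def)
  then have nT: "norm T \<le> (b - a) / 2" by (auto simp: m_def field_simps)
  have ab: "a \<le> b" using order_trans[OF norm_ge_zero nT] by simp
  have cl: "{a..b} \<subseteq> closure S"
  proof -
    have "closed_segment a b \<subseteq> closure S"
      using convex_closure[OF conv] closure_contains_Inf[OF ne bS(2)] closure_contains_Sup[OF ne bS(1)]
      unfolding a_def b_def convex_contains_segment by blast
    then show ?thesis using ab by (simp add: closed_segment_eq_real_ivl)
  qed
  have sab: "cmod (poly p (of_real x)) \<le> s" if "x \<in> {a..b}" for x
  proof (rule continuous_on_closure_norm_le[of S "\<lambda>x. poly p (complex_of_real x)"])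
    show "x \<in> closure S" using that cl by blast
  qed (auto intro!: continuous_intros s simp: S_def)
  show ?thesis
  proof (cases "a = b")
    case True
    then have "T = 0" using nT by simp
    then have "H = op_poly [:of_real m:] H" by (simp add: T_def op_poly_pCons)
    then have "op_poly p H = op_poly (pcompose p [:of_real m:]) H" by (simp add: op_poly_pcompose)
    also have "\<dots> = poly p (of_real m) *\<^sub>C 1" by (simp add: pcompose_constant op_poly_pCons)
    also have "norm \<dots> \<le> s * 1"
      unfolding norm_scaleC_bop
      by (intro mult_mono sab norm_one_bop_le order_trans[OF norm_ge_zero sab]) (use True in \<open>auto simp: m_def\<close>)
    finally show ?thesis by simp
  next
    case False
    define \<rho> where "\<rho> = (b - a) / 2"
    have \<rho>: "\<rho> > 0" using False ab by (simp add: \<rho>_def)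
    define T' where "T' = of_real (1 / \<rho>) *\<^sub>C T"
    have "contraction T'" using nT \<rho> by (simp add: contraction_def T'_def norm_scaleC_bop norm_divide \<rho>_def[symmetric])
    moreover have "self_adjoint T'" by (simp add: self_adjoint_def T'_def adj_simps aT)
    moreover have "H = op_poly [:of_real m, of_real \<rho>:] T'"
      using \<rho> by (simp add: op_poly_pCons T'_def T_def scaleC_mult_left scaleC_mult_right scaleC_scaleC flip: of_real_mult)
    then have "op_poly p H = op_poly (pcompose p [:of_real m, of_real \<rho>:]) T'" by (simp add: op_poly_pcompose)
    moreover have "cmod (poly (pcompose p [:of_real m, of_real \<rho>:]) (of_real x)) \<le> s" if x: "\<bar>x\<bar> \<le> 1" for x
    proof -
      have "\<bar>x * \<rho>\<bar> \<le> 1 * \<rho>" unfolding abs_mult using x \<rho> by (intro mult_mono) auto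
      then have "m + x * \<rho> \<in> {a..b}" by (auto simp: m_def \<rho>_def abs_le_iff field_simps)
      from sab[OF this] show ?thesis by (simp add: poly_pcompose mult.commute)
    qed
    ultimately show ?thesis using op_poly_norm_le_contraction by metis
  qed
qed

text \<open>By the norm bound above, polynomials converging uniformly on the spectral hull converge in norm at
  \<open>H\<close>.  On the zero space all operators coincide.\<close>

lemma fun_calculus_poly:
  fixes H H0 :: "'a::hilbert_space bop"
  assumes H: "self_adjoint H" "spectrum_op H \<subseteq> spectrum_op H0 \<union> spectrum_op H'"
    and bdd: "spectral_hull H0 H' \<subseteq> {-1..1}"
  shows "fun_calculus (spectral_hull H0 H') (\<lambda>x. poly p (of_real x)) H = op_poly p H"
proof (cases "\<exists>x :: 'a. x \<noteq> 0")
  case False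
  then have all: "X = Y" for X Y :: "'a bop" by (intro bop_eqI) metis
  show ?thesis by (rule all)
next
  case True
  show ?thesis
    unfolding fun_calculus_def
  proof (rule the_equality)
    show "\<forall>q. uniform_limit (spectral_hull H0 H') (\<lambda>m x. poly (q m) (of_real x)) (\<lambda>x. poly p (of_real x)) sequentially \<longrightarrow>
        (\<lambda>m. op_poly (q m) H) \<longlonglongrightarrow> op_poly p H"
    proof (intro allI impI)
      fix q assume q: "uniform_limit (spectral_hull H0 H') (\<lambda>m x. poly (q m) (of_real x)) (\<lambda>x. poly p (of_real x)) sequentially"
      show "(\<lambda>m. op_poly (q m) H) \<longlonglongrightarrow> op_poly p H"
      proof (rule metric_LIMSEQ_I)
        fix e :: real assume e: "0 < e"
        then have "\<forall>\<^sub>F m in sequentially. \<forall>x\<in>spectral_hull H0 H'. dist (poly (q m) (of_real x)) (poly p (of_real x)) < e / 2"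
          using q unfolding uniform_limit_iff by (meson half_gt_zero)
        then obtain N where N: "\<And>m x. m \<ge> N \<Longrightarrow> x \<in> spectral_hull H0 H' \<Longrightarrow> dist (poly (q m) (of_real x)) (poly p (of_real x)) < e / 2"
          unfolding eventually_sequentially by blast
        have "dist (op_poly (q m) H) (op_poly p H) < e" if m: "m \<ge> N" for m
        proof -
          have "norm (op_poly (q m - p) H) \<le> e / 2"
          proof (rule op_poly_norm_le_spectral_hull[OF True H bdd])
            show "cmod (poly (q m - p) (of_real x)) \<le> e / 2" if "x \<in> spectral_hull H0 H'" for x
              using N[OF m that] by (simp add: dist_norm)
          qed
          then show ?thesis using e by (simp add: op_poly_diff dist_norm)
        qed
        then show "\<exists>N. \<forall>m\<ge>N. dist (op_poly (q m) H) (op_poly p H) < e" by blast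
      qed
    qed
    fix T assume T: "\<forall>q. uniform_limit (spectral_hull H0 H') (\<lambda>m x. poly (q m) (of_real x)) (\<lambda>x. poly p (of_real x)) sequentially \<longrightarrow>
        (\<lambda>m. op_poly (q m) H) \<longlonglongrightarrow> T"
    have "uniform_limit (spectral_hull H0 H') (\<lambda>(m::nat) x. poly p (complex_of_real x)) (\<lambda>x. poly p (of_real x)) sequentially"
      by (rule uniform_limit_const)
    then have "(\<lambda>m::nat. op_poly p H) \<longlonglongrightarrow> T" using T[rule_format, of "\<lambda>_. p"] by blast
    then show "T = op_poly p H" using LIMSEQ_unique tendsto_const by blast
  qed
qed

lemma real_analytic_power: "real_analytic_on (\<lambda>x. of_real (x ^ n)) S"
  unfolding real_analytic_on_def
proof (intro ballI exI[of _ "1::real"] conjI)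
  fix x0 :: real
  have "(\<lambda>k. (of_nat (n choose k) * of_real (x0 ^ (n - k))) * of_real ((x - x0) ^ k)) sums complex_of_real (x ^ n)" for x
  proof -
    have "(\<lambda>k. (of_nat (n choose k) * of_real (x0 ^ (n - k))) * of_real ((x - x0) ^ k)) sums
        (\<Sum>k\<le>n. (of_nat (n choose k) * of_real (x0 ^ (n - k))) * complex_of_real ((x - x0) ^ k))"
      by (rule sums_finite) (auto simp: binomial_eq_0)
    also have "(\<Sum>k\<le>n. (of_nat (n choose k) * of_real (x0 ^ (n - k))) * complex_of_real ((x - x0) ^ k))
        = of_real (((x - x0) + x0) ^ n)"
      unfolding binomial_ring of_real_sum by (rule sum.cong) (simp_all add: mult_ac)
    finally show ?thesis by simp
  qed
  then show "\<exists>a. \<forall>x. \<bar>x - x0\<bar> < 1 \<longrightarrow> (\<lambda>k. a k * of_real ((x - x0) ^ k)) sums complex_of_real (x ^ n)"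
    by (intro exI[of _ "\<lambda>k. of_nat (n choose k) * of_real (x0 ^ (n - k))"]) simp
qed simp

context traced_ideal
begin

text \<open>The defining formula of the one-variable measure at \<open>h z = z\<^bsup>m + 1\<^esup>\<close>, a polynomial, for which the trace
  is applicable in every normed ideal.\<close>

lemma circle_measure_power:
  assumes \<nu>: "one_var_measure_circle I nrm \<tau> H0 H \<nu>" and diff: "\<And>m. H ^ m - H0 ^ m \<in> I"
  shows "of_nat (Suc m) * cm_integral (borel_on (sphere 0 1)) \<nu> (\<lambda>z. z ^ m) = \<tau> (H ^ Suc m - H0 ^ Suc m)"
proof -
  define a where "a k = (if k = Suc m then 1 else 0 :: complex)" for k
  define h where "h = (\<lambda>z :: complex. z ^ Suc m)"
  have one: "((\<lambda>k. a k * z ^ k) has_sum h z) UNIV" for z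
    by (rule has_sum_finite_neutralI[of "{Suc m}"]) (auto simp: a_def h_def)
  have td: "taylor_disc (1 + 1) a h"
    unfolding taylor_disc_def
  proof (intro allI impI conjI)
    fix z :: complex
    have "((\<lambda>k. norm (a k * z ^ k)) has_sum norm (z ^ Suc m)) UNIV"
      by (rule has_sum_finite_neutralI[of "{Suc m}"]) (auto simp: a_def)
    then show "(\<lambda>k. norm (a k * z ^ k)) summable_on UNIV" by (auto simp: summable_on_def)
    show "h z = (\<Sum>\<^sub>\<infinity>k. a k * z ^ k)" using infsumI[OF one] by simp
  qed
  have app: "trace_applicable I nrm (\<lambda>k. a k *\<^sub>C (H ^ k - H0 ^ k))"
    unfolding trace_applicable_def
  proof (intro disjI2 bexI[of _ "H ^ Suc m - H0 ^ Suc m"] diff)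
    have "nrm (H ^ Suc m - H0 ^ Suc m - (\<Sum>k\<in>F. a k *\<^sub>C (H ^ k - H0 ^ k))) = 0" if "finite F" "{Suc m} \<subseteq> F" for F
    proof -
      have "(\<Sum>k\<in>F. a k *\<^sub>C (H ^ k - H0 ^ k)) = (\<Sum>k\<in>{Suc m}. a k *\<^sub>C (H ^ k - H0 ^ k))"
        by (rule sum.mono_neutral_right) (use that in \<open>auto simp: a_def\<close>)
      then show ?thesis by (simp add: a_def nrm_zero)
    qed
    then have "\<forall>\<^sub>F F in finite_subsets_at_top UNIV. nrm (H ^ Suc m - H0 ^ Suc m - (\<Sum>k\<in>F. a k *\<^sub>C (H ^ k - H0 ^ k))) = 0"
      unfolding eventually_finite_subsets_at_top by (intro exI[of _ "{Suc m}"]) simp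
    then show "((\<lambda>F. nrm (H ^ Suc m - H0 ^ Suc m - (\<Sum>k\<in>F. a k *\<^sub>C (H ^ k - H0 ^ k)))) \<longlongrightarrow> 0) (finite_subsets_at_top UNIV)"
      by (rule tendsto_eventually)
  qed
  have ser: "op_series a (\<lambda>k. X ^ k) = X ^ Suc m" for X :: "'h bop"
    unfolding op_series_def
    by (rule infsumI, rule has_sum_finite_neutralI[of "{Suc m}"]) (auto simp: a_def)
  have "\<tau> (op_series a (\<lambda>k. H ^ k) - op_series a (\<lambda>k. H0 ^ k)) = cm_integral (borel_on (sphere 0 1)) \<nu> (deriv h)"
  proof -
    have "\<forall>\<epsilon>>0. \<forall>a h. taylor_disc (1 + \<epsilon>) a h \<and> trace_applicable I nrm (\<lambda>k. a k *\<^sub>C (H ^ k - H0 ^ k)) \<longrightarrow>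
        \<tau> (op_series a (\<lambda>k. H ^ k) - op_series a (\<lambda>k. H0 ^ k)) = cm_integral (borel_on (sphere 0 1)) \<nu> (deriv h)"
      using \<nu> unfolding one_var_measure_circle_def by (rule conjunct2[OF conjunct2])
    from this[rule_format, OF zero_less_one conjI[OF td app]] show ?thesis .
  qed
  moreover have "deriv h = (\<lambda>z. of_nat (Suc m) * z ^ m)"
    unfolding h_def using DERIV_power_Suc[OF DERIV_ident, where n = m] by (intro ext DERIV_imp_deriv) simp
  moreover have "complex_measure (borel_on (sphere 0 1)) \<nu>" using \<nu> by (simp add: one_var_measure_circle_def)
  ultimately show ?thesis unfolding ser by (simp add: cm_integral_scale)
qed

lemma interval_measure_power:
  assumes \<nu>: "one_var_measure_interval I nrm \<tau> H0 H \<nu>"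
    and H: "self_adjoint H0" "self_adjoint H" "contraction H0" "contraction H"
  shows "of_nat (Suc m) * cm_integral (borel_on (spectral_hull H0 H)) \<nu> (\<lambda>x. of_real x ^ m) = \<tau> (H ^ Suc m - H0 ^ Suc m)"
proof -
  define S where "S = spectral_hull H0 H"
  define h where "h = (\<lambda>x :: real. complex_of_real (x ^ Suc m))"
  have bdd: "spectral_hull H0 H \<subseteq> {-1..1}" by (rule spectral_hull_contraction[OF H(3,4)])
  have hp: "h = (\<lambda>x. poly (monom 1 (Suc m)) (complex_of_real x))" by (simp add: h_def poly_monom)
  have "\<tau> (fun_calculus S h H - fun_calculus S h H0) = cm_integral (borel_on S) \<nu> (\<lambda>x. vector_derivative h (at x))"
  proof -
    have "\<forall>h. real_analytic_on h S \<and> (complete_ideal I nrm \<or> (\<exists>p. \<forall>x. h x = poly p (of_real x))) \<longrightarrow>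
        \<tau> (fun_calculus S h H - fun_calculus S h H0) = cm_integral (borel_on S) \<nu> (\<lambda>x. vector_derivative h (at x))"
      using \<nu> unfolding one_var_measure_interval_def Let_def S_def by (rule conjunct2[OF conjunct2])
    moreover have "real_analytic_on h S" unfolding h_def by (rule real_analytic_power)
    moreover have "\<exists>p. \<forall>x. h x = poly p (of_real x)" using hp by auto
    ultimately show ?thesis by simp
  qed
  moreover have "fun_calculus S h H = H ^ Suc m" "fun_calculus S h H0 = H0 ^ Suc m"
    unfolding S_def hp using fun_calculus_poly[OF H(2) _ bdd, of "monom 1 (Suc m)"] fun_calculus_poly[OF H(1) _ bdd, of "monom 1 (Suc m)"]
    by (simp_all add: op_poly_monom)
  moreover have "vector_derivative h (at x) = of_nat (Suc m) * of_real x ^ m" for x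
  proof (rule vector_derivative_at)
    have "((\<lambda>z. z ^ Suc m) has_field_derivative of_nat (Suc m) * complex_of_real x ^ m) (at (complex_of_real x))"
      using DERIV_power_Suc[OF DERIV_ident, where n = m] by simp
    from has_vector_derivative_real_field[OF this]
    show "(h has_vector_derivative of_nat (Suc m) * complex_of_real x ^ m) (at x)" by (simp add: h_def)
  qed
  moreover have "complex_measure (borel_on S) \<nu>" using \<nu> by (simp add: one_var_measure_interval_def Let_def S_def)
  ultimately show ?thesis by (simp add: cm_integral_scale S_def[symmetric])
qed

end

lemma compact_vec_power:
  fixes S :: "'a::euclidean_space set"
  assumes S: "compact S"
  shows "compact (vec_power S :: ('a ^ 'n::finite) set)"
proof -
  have "closed (\<Inter>i. (\<lambda>z :: 'a ^ 'n. z $ i) -` S)"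
    by (intro closed_INT ballI closed_vimage compact_imp_closed[OF S] continuous_intros)
  moreover have "(\<Inter>i. (\<lambda>z :: 'a ^ 'n. z $ i) -` S) = vec_power S" by (auto simp: vec_power_def)
  moreover have "bounded (vec_power S :: ('a ^ 'n) set)"
  proof -
    obtain b where b: "\<And>x. x \<in> S \<Longrightarrow> norm x \<le> b" using compact_imp_bounded[OF S] by (auto simp: bounded_iff)
    have "norm z \<le> (\<Sum>i\<in>(UNIV :: 'n set). b)" if "z \<in> vec_power S" for z :: "'a ^ 'n"
    proof -
      have "norm z \<le> (\<Sum>i\<in>UNIV. norm (z $ i))" unfolding norm_vec_def by (rule L2_set_le_sum) simp
      also have "\<dots> \<le> (\<Sum>i\<in>(UNIV :: 'n set). b)" by (intro sum_mono b) (use that in \<open>auto simp: vec_power_def\<close>)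
      finally show ?thesis .
    qed
    then show ?thesis by (auto simp: bounded_iff)
  qed
  ultimately show ?thesis by (metis compact_eq_bounded_closed)
qed

lemma vec_power_nonempty: "x \<in> S \<Longrightarrow> vec_power S \<noteq> ({} :: ('a ^ 'n::finite) set)"
  by (auto simp: vec_power_def intro!: exI[of _ "\<chi> i. x"])

section \<open>The multivariate trace formula\<close>

theorem theorem3p9:
  fixes I :: "'h::hilbert_space bop set"
    and nrm :: "'h bop \<Rightarrow> real"
    and \<tau> :: "'h bop \<Rightarrow> complex"
    and A B V :: "'n::{finite,linorder} \<Rightarrow> 'h bop"
  assumes separable: "separable_space (euclidean :: 'h topology)"
    and ideal: "normed_ideal I nrm"
    and trace: "trace_on I \<tau>" "positive_on I \<tau>" "\<exists>M. bounded_by I nrm \<tau> M"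
    and A: "commuting A" "\<forall>j. contraction (A j)"
    and B: "commuting B" "\<forall>j. contraction (B j)"
    and V: "\<forall>j. V j = B j - A j" "\<forall>j. V j \<in> I" "\<forall>i j. i \<noteq> j \<longrightarrow> V i * V j = V j * V i"
    and dilation: "dilatable_segment TYPE('k::hilbert_space) A B"
  shows
    "(\<exists>\<mu> :: 'n \<Rightarrow> (complex ^ 'n::{finite,linorder}) set \<Rightarrow> complex.
        let \<Omega> = sphere (0::complex) 1; M = borel_on (vec_power \<Omega>) in
        (\<forall>j. complex_measure M (\<mu> j) \<and>
             total_variation M (\<mu> j) \<le>
               ennreal (min (dual_norm I nrm \<tau> * nrm (V j))
                            (Re (\<tau> (abs_op (Re_op (V j)) + abs_op (Im_op (V j)))))) \<and>
             \<mu> j (vec_power \<Omega>) = \<tau> (V j)) \<and>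
        (\<forall>\<epsilon>>0. \<forall>c f. taylor_polydisc (1 + \<epsilon>) c f \<and>
             trace_applicable I nrm (\<lambda>k. c k *\<^sub>C (op_monomial B k - op_monomial A k)) \<longrightarrow>
             \<tau> (op_series c (op_monomial B) - op_series c (op_monomial A)) =
               (\<Sum>j\<in>UNIV. cm_integral M (\<mu> j) (cpartial j f))) \<and>
        (\<forall>j \<nu>. one_var_measure_circle I nrm \<tau> (A j) (B j) \<nu> \<longrightarrow>
             (\<forall>\<epsilon>>0. \<forall>b g. taylor_disc (1 + \<epsilon>) b g \<longrightarrow>
                cm_integral M (\<mu> j) (\<lambda>z. g (z $ j)) = cm_integral (borel_on \<Omega>) \<nu> g)))
     \<and>
     ((\<forall>j. self_adjoint (A j) \<and> self_adjoint (B j)) \<longrightarrow>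
      (\<exists>\<mu> :: 'n \<Rightarrow> (real ^ 'n::{finite,linorder}) set \<Rightarrow> complex.
        let \<Omega> = {-1..1::real}; M = borel_on (vec_power \<Omega>) in
        (\<forall>j. complex_measure M (\<mu> j) \<and> real_valued_on M (\<mu> j) \<and>
             total_variation M (\<mu> j) \<le>
               ennreal (min (dual_norm I nrm \<tau> * nrm (V j))
                            (Re (\<tau> (abs_op (Re_op (V j)) + abs_op (Im_op (V j)))))) \<and>
             \<mu> j (vec_power \<Omega>) = \<tau> (V j)) \<and>
        (\<forall>\<epsilon>>0. \<forall>c f. taylor_cube (1 + \<epsilon>) c f \<and>
             trace_applicable I nrm (\<lambda>k. c k *\<^sub>C (op_monomial B k - op_monomial A k)) \<longrightarrow>
             \<tau> (op_series c (op_monomial B) - op_series c (op_monomial A)) =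
               (\<Sum>j\<in>UNIV. cm_integral M (\<mu> j) (rpartial j f))) \<and>
        (\<forall>j \<nu>. one_var_measure_interval I nrm \<tau> (A j) (B j) \<nu> \<longrightarrow>
             (\<forall>\<epsilon>>0. \<forall>b g. taylor_interval (1 + \<epsilon>) b g \<longrightarrow>
                cm_integral M (\<mu> j) (\<lambda>x. g (x $ j)) =
                cm_integral (borel_on \<Omega>) (extend_by_zero (spectral_hull (A j) (B j)) \<nu>) g))))"
proof -
  have VAB: "V = (\<lambda>j. B j - A j)" using V(1) by auto
  interpret traced_ideal I nrm \<tau>
    using ideal trace by unfold_locales
  have segment: "commuting (\<lambda>j. A j + t *\<^sub>R (B j - A j))" "contraction (A j + t *\<^sub>R (B j - A j))"
    "admits_normal_dilation TYPE('k) (\<lambda>j. A j + t *\<^sub>R (B j - A j))" if "t \<in> {0..1}" for t j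
    using dilation that unfolding dilatable_segment_def Let_def by blast+
  interpret contractive_segment I nrm \<tau> A B
    by unfold_locales (use segment V in auto)
  have seg_fun: "seg t = (\<lambda>j. A j + t *\<^sub>R (B j - A j))" for t by (auto simp: seg_def)
  have mass: "min (dual_norm I nrm \<tau> * nrm (V j)) (Re (\<tau> (abs_op (Re_op (V j)) + abs_op (Im_op (V j))))) = mass (B j - A j)" for j
    by (simp add: mass_def VAB)
  have power_diff: "B j ^ m - A j ^ m \<in> I" for j m
    using monomial_diff_in_I[of "\<lambda>i. if i = j then m else 0"] by (simp add: op_monomial_single)
  show ?thesis
  proof (intro conjI impI)
    let ?\<Omega> = "sphere (0::complex) 1"
    define K :: "(complex ^ 'n::{finite,linorder}) set" where "K = vec_power ?\<Omega>"
    define e :: "'n \<Rightarrow> complex ^ 'n::{finite,linorder} \<Rightarrow> complex" where "e i z = z $ i" for i z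
    have K: "compact K" "K \<noteq> {}"
      unfolding K_def by (rule compact_vec_power[OF compact_sphere]) (rule vec_power_nonempty[of 1], simp)
    have e: "continuous_on K (e i)" "x \<in> K \<Longrightarrow> cmod (e i x) \<le> 1" for i x
      unfolding e_def K_def by (auto intro!: continuous_intros simp: vec_power_def)
    have "\<exists>\<mu>. complex_measure (borel_on K) \<mu> \<and> total_variation (borel_on K) \<mu> \<le> ennreal (mass (B j - A j)) \<and>
        (\<forall>k. cm_integral (borel_on K) \<mu> (mon e k) = moment j k)" for j
    proof (rule moment_measure_exists[OF K e, where j = j])
      fix F and c :: "('n \<Rightarrow> nat) \<Rightarrow> complex" and s t :: real
      assume F: "finite F" and t: "t \<in> {0..1}" and s: "\<And>x. x \<in> K \<Longrightarrow> cmod (\<Sum>k\<in>F. c k * mon e k x) \<le> s"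
      show "norm (\<Sum>k\<in>F. c k *\<^sub>C op_monomial (seg t) k) \<le> s"
      proof (rule von_Neumann_inequality_dilatable[OF _ F])
        show "admits_normal_dilation TYPE('k) (seg t)" unfolding seg_fun by (rule segment(3)[OF t])
        fix z :: "'n \<Rightarrow> complex" assume "\<And>i. cmod (z i) = 1"
        then have "(\<chi> i. z i) \<in> K" by (simp add: K_def vec_power_def)
        from s[OF this] show "cmod (\<Sum>k\<in>F. c k * (\<Prod>i\<in>UNIV. z i ^ k i)) \<le> s"
          by (simp add: mon_def[OF K e] e_def)
      qed
    qed (assumption, intro exI conjI allI, assumption+)
    then obtain \<mu> where \<mu>: "\<And>j. complex_measure (borel_on K) (\<mu> j)"
      "\<And>j. total_variation (borel_on K) (\<mu> j) \<le> ennreal (mass (B j - A j))"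
      "\<And>j k. cm_integral (borel_on K) (\<mu> j) (mon e k) = moment j k" by metis
    have tf: "\<tau> (op_series c (op_monomial B) - op_series c (op_monomial A)) = (\<Sum>j\<in>UNIV. cm_integral (borel_on K) (\<mu> j) (cpartial j f))"
      if \<epsilon>: "\<epsilon> > 0" and f: "taylor_polydisc (1 + \<epsilon>) c f"
        and app: "trace_applicable I nrm (\<lambda>k. c k *\<^sub>C (op_monomial B k - op_monomial A k))" for \<epsilon> c f
    proof (rule taylor_polydisc_weights[OF f \<epsilon>])
      assume c: "(\<lambda>k. cmod (c k)) summable_on UNIV" "(\<lambda>k. cmod (c k) * real (\<Sum>i\<in>UNIV. k i)) summable_on UNIV"
      show ?thesis
      proof (rule trace_formula[OF K e \<mu>(1,3) c app])
        fix j x assume "x \<in> K"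
        then have "cmod (x $ i) \<le> 1" for i using e(2) by (simp add: e_def)
        from DERIV_imp_deriv[OF taylor_polydisc_partial[OF f \<epsilon> this, of j]]
        show "cpartial j f x = (\<Sum>\<^sub>\<infinity>k. c k * (of_nat (k j) * mon e (\<lambda>i. if i = j then k i - 1 else k i) x))"
          unfolding cpartial_def by (simp add: mon_def[OF K e] e_def)
      qed
    qed
    have ov: "cm_integral (borel_on K) (\<mu> j) (\<lambda>z. g (z $ j)) = cm_integral (borel_on ?\<Omega>) \<nu> g"
      if \<nu>: "one_var_measure_circle I nrm \<tau> (A j) (B j) \<nu>" and \<epsilon>: "\<epsilon> > 0" and g: "taylor_disc (1 + \<epsilon>) b g" for j \<nu> \<epsilon> b g
    proof (rule has_sum_unique)
      have gz: "(\<lambda>k. norm (b k * z ^ k)) summable_on UNIV" "g z = (\<Sum>\<^sub>\<infinity>k. b k * z ^ k)" if "cmod z = 1" for z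
        using g \<epsilon> that unfolding taylor_disc_def by auto
      have b: "(\<lambda>m. cmod (b m)) summable_on UNIV" using gz(1)[of 1] by simp
      show "((\<lambda>m. b m * moment j (\<lambda>i. if i = j then m else 0)) has_sum cm_integral (borel_on K) (\<mu> j) (\<lambda>z. g (z $ j))) UNIV"
        by (rule one_variable_integral[OF K e \<mu>(1,3) b]) (use gz(2) in \<open>auto simp: e_def K_def vec_power_def\<close>)
      have cm: "complex_measure (borel_on ?\<Omega>) \<nu>" using \<nu> by (simp add: one_var_measure_circle_def)
      have "((\<lambda>m. cm_integral (borel_on ?\<Omega>) \<nu> (\<lambda>z. b m * z ^ m)) has_sum cm_integral (borel_on ?\<Omega>) \<nu> g) UNIV"
        by (rule cm_integral_infsum[OF cm _ _ b]) (use gz(2) in \<open>auto intro!: continuous_intros simp: norm_mult norm_power\<close>)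
      moreover have "cm_integral (borel_on ?\<Omega>) \<nu> (\<lambda>z. z ^ m) = moment j (\<lambda>i. if i = j then m else 0)" for m
      proof -
        have "of_nat (Suc m) * cm_integral (borel_on ?\<Omega>) \<nu> (\<lambda>z. z ^ m) = of_nat (Suc m) * moment j (\<lambda>i. if i = j then m else 0)"
          unfolding circle_measure_power[OF \<nu> power_diff] moment_power ..
        then show ?thesis by (simp del: of_nat_Suc)
      qed
      ultimately show "((\<lambda>m. b m * moment j (\<lambda>i. if i = j then m else 0)) has_sum cm_integral (borel_on ?\<Omega>) \<nu> g) UNIV"
        by (simp add: cm_integral_scale[OF cm])
    qed
    have tm: "\<mu> j K = \<tau> (V j)" for j using total_mass[OF K e \<mu>(1,3)] by (simp add: VAB)
    show "\<exists>\<mu> :: 'n \<Rightarrow> (complex ^ 'n::{finite,linorder}) set \<Rightarrow> complex.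
        let \<Omega> = sphere (0::complex) 1; M = borel_on (vec_power \<Omega>) in
        (\<forall>j. complex_measure M (\<mu> j) \<and>
             total_variation M (\<mu> j) \<le>
               ennreal (min (dual_norm I nrm \<tau> * nrm (V j))
                            (Re (\<tau> (abs_op (Re_op (V j)) + abs_op (Im_op (V j)))))) \<and>
             \<mu> j (vec_power \<Omega>) = \<tau> (V j)) \<and>
        (\<forall>\<epsilon>>0. \<forall>c f. taylor_polydisc (1 + \<epsilon>) c f \<and>
             trace_applicable I nrm (\<lambda>k. c k *\<^sub>C (op_monomial B k - op_monomial A k)) \<longrightarrow>
             \<tau> (op_series c (op_monomial B) - op_series c (op_monomial A)) =
               (\<Sum>j\<in>UNIV. cm_integral M (\<mu> j) (cpartial j f))) \<and>
        (\<forall>j \<nu>. one_var_measure_circle I nrm \<tau> (A j) (B j) \<nu> \<longrightarrow>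
             (\<forall>\<epsilon>>0. \<forall>b g. taylor_disc (1 + \<epsilon>) b g \<longrightarrow>
                cm_integral M (\<mu> j) (\<lambda>z. g (z $ j)) = cm_integral (borel_on \<Omega>) \<nu> g))"
      unfolding Let_def K_def[symmetric] mass
      by (rule exI[of _ \<mu>]) (use \<mu>(1,2) tm tf ov in blast)
  next
    assume sa: "\<forall>j. self_adjoint (A j) \<and> self_adjoint (B j)"
    let ?\<Omega> = "{-1..1::real}"
    define K :: "(real ^ 'n::{finite,linorder}) set" where "K = vec_power ?\<Omega>"
    define e :: "'n \<Rightarrow> real ^ 'n::{finite,linorder} \<Rightarrow> complex" where "e i x = of_real (x $ i)" for i x
    have K: "compact K" "K \<noteq> {}"
      unfolding K_def by (rule compact_vec_power[OF compact_Icc]) (rule vec_power_nonempty[of 0], simp)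
    have e: "continuous_on K (e i)" "x \<in> K \<Longrightarrow> cmod (e i x) \<le> 1" for i x
      unfolding e_def K_def by (auto intro!: continuous_intros simp: vec_power_def abs_le_iff)
    have "\<exists>\<mu>. complex_measure (borel_on K) \<mu> \<and> total_variation (borel_on K) \<mu> \<le> ennreal (mass (B j - A j)) \<and>
        (\<forall>k. cm_integral (borel_on K) \<mu> (mon e k) = moment j k)" for j
    proof (rule moment_measure_exists[OF K e, where j = j])
      fix F and c :: "('n \<Rightarrow> nat) \<Rightarrow> complex" and s t :: real
      assume F: "finite F" and t: "t \<in> {0..1}" and s: "\<And>x. x \<in> K \<Longrightarrow> cmod (\<Sum>k\<in>F. c k * mon e k x) \<le> s"
      show "norm (\<Sum>k\<in>F. c k *\<^sub>C op_monomial (seg t) k) \<le> s"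
      proof (rule von_Neumann_inequality_selfadjoint[OF seg_commuting[OF t] seg_contraction[OF t] _ F])
        show "self_adjoint (seg t i)" for i
          using sa by (simp add: self_adjoint_def seg_def adj_simps)
        fix x :: "'n \<Rightarrow> real" assume "\<And>i. \<bar>x i\<bar> \<le> 1"
        then have "(\<chi> i. x i) \<in> K" by (auto simp: K_def vec_power_def abs_le_iff minus_le_iff)
        from s[OF this] show "cmod (\<Sum>k\<in>F. c k * of_real (\<Prod>i\<in>UNIV. x i ^ k i)) \<le> s"
          by (simp add: mon_def[OF K e] e_def)
      qed
    qed (assumption, intro exI conjI allI, assumption+)
    then obtain \<mu>' where \<mu>': "\<And>j. complex_measure (borel_on K) (\<mu>' j)"
      "\<And>j. total_variation (borel_on K) (\<mu>' j) \<le> ennreal (mass (B j - A j))"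
      "\<And>j k. cm_integral (borel_on K) (\<mu>' j) (mon e k) = moment j k" by metis
    \<comment> \<open>all moments are real, so that the real part of the measure has the same ones\<close>
    define \<mu> where "\<mu> j E = complex_of_real (Re (\<mu>' j E))" for j E
    have cm: "complex_measure (borel_on K) (\<mu> j)" for j
      unfolding \<mu>_def by (rule real_part_measure(1)[OF \<mu>'(1)])
    have tv: "total_variation (borel_on K) (\<mu> j) \<le> ennreal (mass (B j - A j))" for j
      unfolding \<mu>_def by (rule order_trans[OF real_part_measure(2)[OF \<mu>'(1)] \<mu>'(2)])
    have moments: "cm_integral (borel_on K) (\<mu> j) (mon e k) = moment j k" for j k
    proof -
      have "cm_bounded (borel_on K) (mon e k)" by (rule cm_bounded_continuous[OF mon_cont[OF K e] K(1)])
      then have "cm_integral (borel_on K) (\<mu> j) (mon e k) = of_real (Re (cm_integral (borel_on K) (\<mu>' j) (mon e k)))"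
        unfolding \<mu>_def by (rule real_part_measure(3)[OF \<mu>'(1)]) (simp add: mon_def[OF K e] e_def flip: of_real_power of_real_prod)
      also have "\<dots> = moment j k" using moment_real[of j k] sa by (simp add: \<mu>'(3) complex_eq_iff)
      finally show ?thesis .
    qed
    have tf: "\<tau> (op_series c (op_monomial B) - op_series c (op_monomial A)) = (\<Sum>j\<in>UNIV. cm_integral (borel_on K) (\<mu> j) (rpartial j f))"
      if \<epsilon>: "\<epsilon> > 0" and f: "taylor_cube (1 + \<epsilon>) c f"
        and app: "trace_applicable I nrm (\<lambda>k. c k *\<^sub>C (op_monomial B k - op_monomial A k))" for \<epsilon> c f
    proof (rule taylor_polydisc_weights[OF taylor_cube_extend[OF f] \<epsilon>])
      assume c: "(\<lambda>k. cmod (c k)) summable_on UNIV" "(\<lambda>k. cmod (c k) * real (\<Sum>i\<in>UNIV. k i)) summable_on UNIV"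
      show ?thesis
      proof (rule trace_formula[OF K e cm moments c app])
        fix j x assume "x \<in> K"
        then have "\<bar>x $ i\<bar> \<le> 1" for i using e(2)[of x i] by (simp add: e_def)
        from rpartial_taylor_cube[OF f \<epsilon> this, of j]
        show "rpartial j f x = (\<Sum>\<^sub>\<infinity>k. c k * (of_nat (k j) * mon e (\<lambda>i. if i = j then k i - 1 else k i) x))"
          by (simp add: mon_def[OF K e] e_def)
      qed
    qed
    have ov: "cm_integral (borel_on K) (\<mu> j) (\<lambda>x. g (x $ j)) =
        cm_integral (borel_on ?\<Omega>) (extend_by_zero (spectral_hull (A j) (B j)) \<nu>) g"
      if \<nu>: "one_var_measure_interval I nrm \<tau> (A j) (B j) \<nu>" and \<epsilon>: "\<epsilon> > 0" and g: "taylor_interval (1 + \<epsilon>) b g" for j \<nu> \<epsilon> b g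
    proof (rule has_sum_unique)
      define S where "S = spectral_hull (A j) (B j)"
      have S1: "S \<subseteq> {-1..1}" unfolding S_def by (rule spectral_hull_contraction) (use A B in auto)
      have "is_interval S" unfolding S_def spectral_hull_def by (simp add: is_interval_convex_1 convex_convex_hull)
      then have Sb: "S \<in> sets borel" by (rule real_interval_borel_measurable)
      have gx: "(\<lambda>k. norm (b k * of_real (x ^ k))) summable_on UNIV" "g x = (\<Sum>\<^sub>\<infinity>k. b k * of_real (x ^ k))" if "\<bar>x\<bar> \<le> 1" for x
        using g \<epsilon> that unfolding taylor_interval_def by auto
      have b: "(\<lambda>m. cmod (b m)) summable_on UNIV" using gx(1)[of 1] by simp
      show "((\<lambda>m. b m * moment j (\<lambda>i. if i = j then m else 0)) has_sum cm_integral (borel_on K) (\<mu> j) (\<lambda>x. g (x $ j))) UNIV"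
        by (rule one_variable_integral[OF K e cm moments b]) (use gx(2) e(2) in \<open>auto simp: e_def\<close>)
      have cm\<nu>: "complex_measure (borel_on S) \<nu>" using \<nu> by (simp add: one_var_measure_interval_def Let_def S_def)
      have le1: "cmod (b m * of_real x ^ m) \<le> cmod (b m)" if "\<bar>x\<bar> \<le> 1" for m and x :: real
        using that by (simp add: norm_mult norm_power mult_left_le power_le_one)
      have gsum: "((\<lambda>m. cm_integral (borel_on S) \<nu> (\<lambda>x. b m * of_real x ^ m)) has_sum cm_integral (borel_on S) \<nu> g) UNIV"
        by (rule cm_integral_infsum[OF cm\<nu> _ _ b]) (use gx(2) S1 le1 in \<open>force intro!: continuous_intros simp: abs_le_iff\<close>)+
      moreover have "cm_integral (borel_on S) \<nu> (\<lambda>x. of_real x ^ m) = moment j (\<lambda>i. if i = j then m else 0)" for m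
      proof -
        have "of_nat (Suc m) * cm_integral (borel_on S) \<nu> (\<lambda>x. of_real x ^ m) = of_nat (Suc m) * moment j (\<lambda>i. if i = j then m else 0)"
          unfolding S_def moment_power by (rule interval_measure_power[OF \<nu>]) (use sa A B in auto)
        then show ?thesis by (simp del: of_nat_Suc)
      qed
      ultimately have "((\<lambda>m. b m * moment j (\<lambda>i. if i = j then m else 0)) has_sum cm_integral (borel_on S) \<nu> g) UNIV"
        by (simp add: cm_integral_scale[OF cm\<nu>])
      moreover have "cm_integral (borel_on ?\<Omega>) (extend_by_zero S \<nu>) g = cm_integral (borel_on S) \<nu> g"
      proof (rule cm_integral_extend_by_zero(2)[OF cm\<nu> S1 Sb])
        have "uniform_limit ?\<Omega> (\<lambda>F x. \<Sum>m\<in>F. b m * complex_of_real x ^ m) (\<lambda>x. \<Sum>\<^sub>\<infinity>m. b m * complex_of_real x ^ m) (finite_subsets_at_top UNIV)"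
          by (rule Weierstrass_m_test_general[OF _ b]) (use le1 in auto)
        then have "continuous_on ?\<Omega> (\<lambda>x. \<Sum>\<^sub>\<infinity>m. b m * complex_of_real x ^ m)"
          by (rule uniform_limit_theorem[rotated]) (auto intro!: always_eventually continuous_intros)
        then have gc: "continuous_on ?\<Omega> g"
          by (rule continuous_on_eq) (use gx(2) in auto)
        then show "cm_bounded (borel_on ?\<Omega>) g" by (rule cm_bounded_continuous) (rule compact_Icc)
      qed
      ultimately show "((\<lambda>m. b m * moment j (\<lambda>i. if i = j then m else 0)) has_sum
          cm_integral (borel_on ?\<Omega>) (extend_by_zero (spectral_hull (A j) (B j)) \<nu>) g) UNIV"
        by (simp add: S_def)
    qed
    have tm: "\<mu> j K = \<tau> (V j)" for j using total_mass[OF K e cm moments] by (simp add: VAB)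
    have rv: "real_valued_on (borel_on K) (\<mu> j)" for j by (simp add: real_valued_on_def \<mu>_def)
    show "\<exists>\<mu> :: 'n \<Rightarrow> (real ^ 'n::{finite,linorder}) set \<Rightarrow> complex.
        let \<Omega> = {-1..1::real}; M = borel_on (vec_power \<Omega>) in
        (\<forall>j. complex_measure M (\<mu> j) \<and> real_valued_on M (\<mu> j) \<and>
             total_variation M (\<mu> j) \<le>
               ennreal (min (dual_norm I nrm \<tau> * nrm (V j))
                            (Re (\<tau> (abs_op (Re_op (V j)) + abs_op (Im_op (V j)))))) \<and>
             \<mu> j (vec_power \<Omega>) = \<tau> (V j)) \<and>
        (\<forall>\<epsilon>>0. \<forall>c f. taylor_cube (1 + \<epsilon>) c f \<and>
             trace_applicable I nrm (\<lambda>k. c k *\<^sub>C (op_monomial B k - op_monomial A k)) \<longrightarrow>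
             \<tau> (op_series c (op_monomial B) - op_series c (op_monomial A)) =
               (\<Sum>j\<in>UNIV. cm_integral M (\<mu> j) (rpartial j f))) \<and>
        (\<forall>j \<nu>. one_var_measure_interval I nrm \<tau> (A j) (B j) \<nu> \<longrightarrow>
             (\<forall>\<epsilon>>0. \<forall>b g. taylor_interval (1 + \<epsilon>) b g \<longrightarrow>
                cm_integral M (\<mu> j) (\<lambda>x. g (x $ j)) =
                cm_integral (borel_on \<Omega>) (extend_by_zero (spectral_hull (A j) (B j)) \<nu>) g))"
      unfolding Let_def K_def[symmetric] mass
      by (rule exI[of _ \<mu>]) (use cm tv rv tm tf ov in blast)
  qed
qed

end
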